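(* Let $A$ be a finite dimensional algebra over a field $K$, let $M$ be a finitely generated $A$-bimodule, and let $\Lambda=A\ltimes M$ be the trivial extension of $A$ by $M$. Let $(X,P)$ be a pair of finitely generated left $A$-modules. Then: (1) $(T(X),T(P))$ is a support $\tau$-tilting pair in $\Lambda\text{-}\mathrm{mod}$ if and only if $(X,P)$ is a support $\tau$-tilting pair in $A\text{-}\mathrm{mod}$, $\operatorname{Hom}_A(P,M\otimes_A X)=0$ and $\operatorname{Hom}_A(M\otimes_A X,\tau X)=0$. (2) $(Z(X),T(P))$ is a support $\tau$-tilting pair in $\Lambda\text{-}\mathrm{mod}$ if and only if $(X,P)$ is a support $\tau$-tilting pair in $A\text{-}\mathrm{mod}$ and $\operatorname{Hom}_A(Q,X)=0$, where $Q$ is a projective cover of $M\otimes_A X$.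
   Context: For a finite dimensional $K$-algebra $B$, $B\text{-}\mathrm{mod}$ denotes the category of finitely generated left $B$-modules, $\tau$ denotes the Auslander–Reiten translation in $B\text{-}\mathrm{mod}$ (so $\tau$ of a projective module is $0$), and $|N|$ denotes the number of pairwise non-isomorphic indecomposable direct summands of $N\in B\text{-}\mathrm{mod}$. Bimodules over $K$-algebras are assumed to have $K$ acting centrally. A module $N\in B\text{-}\mathrm{mod}$ is $\tau$-rigid if $\operatorname{Hom}_B(N,\tau N)=0$. A pair $(N,P)$ of modules in $B\text{-}\mathrm{mod}$ is a $\tau$-rigid pair if $N$ is $\tau$-rigid, $P$ is projective and $\operatorname{Hom}_B(P,N)=0$. It is a support $\tau$-tilting pair if it is a $\tau$-rigid pair and $|N|+|P|=|B|$. The trivial extension $A\ltimes M$ is the ring with additive group $A\times M$ and multiplication $(r,m)(r',m')=(rr',rm'+mr')$. A left $A\ltimes M$-module is identified with a pair $(X,\alpha)$, where $X$ is a left $A$-module and $\alpha\colon M\otimes_A X\to X$ is an $A$-module morphism such that $\alpha\circ(\mathrm{id}_M\otimes\alpha)=0\colon M\otimes_A M\otimes_A X\to X$. A morphism $(X,\alpha)\to(Y,\beta)$ is an $A$-module morphism $f\colon X\to Y$ with $f\alpha=\beta(\mathrm{id}_M\otimes f)$. Write $F=M\otimes_A-$. The functors $T,Z\colon A\text{-}\mathrm{mod}\to\Lambda\text{-}\mathrm{mod}$ are defined as follows. $T(N)=\bigl(N\oplus F(N),\begin{pmatrix}0&0\\1&0\end{pmatrix}\bigr)$, with structure map $\begin{pmatrix}0&0\\1&0\end{pmatrix}\colon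 F(N)\oplus F^2(N)\to N\oplus F(N)$, and $T(f)=\begin{pmatrix}f&0\\0&F(f)\end{pmatrix}$. $Z(N)=(N,0)$, with zero structure map $F(N)\to N$, and $Z(f)=f$. *)

theory Defs
  imports "HOL-Algebra.Module" "HOL-Algebra.AbelCoset" "HOL-Algebra.Free_Abelian_Groups"
begin

section \<open>Modules over a not necessarily commutative ring\<close>

text \<open>
  The library's \<open>module\<close> locale requires a commutative ring. Its record type is reused here; as in
  the library, the fields \<open>mult\<close> and \<open>one\<close> of a record that serves as a module carry no meaning.
  Right modules are treated as left modules over the opposite ring.
\<close>

locale left_module = R?: ring R + M?: abelian_group M
  for R :: "('r, 'c) ring_scheme" (structure) and M :: "('r, 'm, 'd) module_scheme" (structure) +
  assumes smult_closed:
      "\<lbrakk>a \<in> carrier R; x \<in> carrier M\<rbrakk> \<Longrightarrow> a \<odot>\<^bsub>M\<^esub> x \<in> carrier M"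
    and smult_l_distr:
      "\<lbrakk>a \<in> carrier R; b \<in> carrier R; x \<in> carrier M\<rbrakk> \<Longrightarrow>
        (a \<oplus> b) \<odot>\<^bsub>M\<^esub> x = a \<odot>\<^bsub>M\<^esub> x \<oplus>\<^bsub>M\<^esub> b \<odot>\<^bsub>M\<^esub> x"
    and smult_r_distr:
      "\<lbrakk>a \<in> carrier R; x \<in> carrier M; y \<in> carrier M\<rbrakk> \<Longrightarrow>
        a \<odot>\<^bsub>M\<^esub> (x \<oplus>\<^bsub>M\<^esub> y) = a \<odot>\<^bsub>M\<^esub> x \<oplus>\<^bsub>M\<^esub> a \<odot>\<^bsub>M\<^esub> y"
    and smult_assoc:
      "\<lbrakk>a \<in> carrier R; b \<in> carrier R; x \<in> carrier M\<rbrakk> \<Longrightarrow>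
        (a \<otimes> b) \<odot>\<^bsub>M\<^esub> x = a \<odot>\<^bsub>M\<^esub> (b \<odot>\<^bsub>M\<^esub> x)"
    and smult_one:
      "x \<in> carrier M \<Longrightarrow> \<one> \<odot>\<^bsub>M\<^esub> x = x"

definition fin_gen :: "('r, 'c) ring_scheme \<Rightarrow> ('r, 'm, 'd) module_scheme \<Rightarrow> bool" where
  "fin_gen R M \<longleftrightarrow>
    (\<exists>S. finite S \<and> S \<subseteq> carrier M \<and> (\<forall>N. submodule N R M \<and> S \<subseteq> N \<longrightarrow> N = carrier M))"

text \<open>Membership in \<open>R-mod\<close>.\<close>

definition fg_module :: "('r, 'c) ring_scheme \<Rightarrow> ('r, 'm, 'd) module_scheme \<Rightarrow> bool" where
  "fg_module R M \<longleftrightarrow> left_module R M \<and> fin_gen R M"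

definition mk_module ::
  "'m set \<Rightarrow> 'm \<Rightarrow> ('m \<Rightarrow> 'm \<Rightarrow> 'm) \<Rightarrow> ('r \<Rightarrow> 'm \<Rightarrow> 'm) \<Rightarrow> ('r, 'm) module" where
  "mk_module C z p s =
    \<lparr>carrier = C, monoid.mult = undefined, one = undefined, ring.zero = z, ring.add = p, smult = s\<rparr>"

definition regular_module :: "('r, 'c) ring_scheme \<Rightarrow> ('r, 'r) module" where
  "regular_module R = mk_module (carrier R) \<zero>\<^bsub>R\<^esub> (ring.add R) (monoid.mult R)"

definition free_module :: "('r, 'c) ring_scheme \<Rightarrow> nat \<Rightarrow> ('r, nat \<Rightarrow> 'r) module" where
  "free_module R n = mk_module ({..<n} \<rightarrow>\<^sub>E carrier R)
    (\<lambda>i\<in>{..<n}. \<zero>\<^bsub>R\<^esub>)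
    (\<lambda>u v. \<lambda>i\<in>{..<n}. u i \<oplus>\<^bsub>R\<^esub> v i)
    (\<lambda>a u. \<lambda>i\<in>{..<n}. a \<otimes>\<^bsub>R\<^esub> u i)"

definition dsum_module ::
  "('r, 'm, 'c) module_scheme \<Rightarrow> ('r, 'n, 'd) module_scheme \<Rightarrow> ('r, 'm \<times> 'n) module" where
  "dsum_module M N = mk_module (carrier M \<times> carrier N)
    (\<zero>\<^bsub>M\<^esub>, \<zero>\<^bsub>N\<^esub>)
    (\<lambda>(x, y) (x', y'). (x \<oplus>\<^bsub>M\<^esub> x', y \<oplus>\<^bsub>N\<^esub> y'))
    (\<lambda>a (x, y). (a \<odot>\<^bsub>M\<^esub> x, a \<odot>\<^bsub>N\<^esub> y))"

definition quotient_module ::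
  "('r, 'm, 'c) module_scheme \<Rightarrow> 'm set \<Rightarrow> ('r, 'm set) module" where
  "quotient_module M H = mk_module (a_rcosets\<^bsub>M\<^esub> H) H (set_add M)
    (\<lambda>a C. \<Union>c\<in>C. H +>\<^bsub>M\<^esub> (a \<odot>\<^bsub>M\<^esub> c))"

text \<open>
  Homomorphisms are extensional outside the carrier, so that distinct elements of
  \<open>module_homs R M N\<close> are distinct homomorphisms.
\<close>

definition module_homs ::
  "('r, 'b) ring_scheme \<Rightarrow> ('r, 'm, 'c) module_scheme \<Rightarrow> ('r, 'n, 'd) module_scheme
    \<Rightarrow> ('m \<Rightarrow> 'n) set" where
  "module_homs R M N = {h \<in> carrier M \<rightarrow>\<^sub>E carrier N.
    (\<forall>x\<in>carrier M. \<forall>y\<in>carrier M. h (x \<oplus>\<^bsub>M\<^esub> y) = h x \<oplus>\<^bsub>N\<^esub> h y) \<and>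
    (\<forall>a\<in>carrier R. \<forall>x\<in>carrier M. h (a \<odot>\<^bsub>M\<^esub> x) = a \<odot>\<^bsub>N\<^esub> h x)}"

definition hom_zero ::
  "('r, 'b) ring_scheme \<Rightarrow> ('r, 'm, 'c) module_scheme \<Rightarrow> ('r, 'n, 'd) module_scheme \<Rightarrow> bool" where
  "hom_zero R M N \<longleftrightarrow> (\<forall>h\<in>module_homs R M N. \<forall>x\<in>carrier M. h x = \<zero>\<^bsub>N\<^esub>)"

definition module_iso ::
  "('r, 'b) ring_scheme \<Rightarrow> ('r, 'm, 'c) module_scheme \<Rightarrow> ('r, 'n, 'd) module_scheme \<Rightarrow> bool" where
  "module_iso R M N \<longleftrightarrow> (\<exists>h\<in>module_homs R M N. bij_betw h (carrier M) (carrier N))"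

subsection \<open>Direct summands and the number of indecomposable ones\<close>

definition direct_decomposition ::
  "('r, 'c) ring_scheme \<Rightarrow> ('r, 'm, 'd) module_scheme \<Rightarrow> 'm set \<Rightarrow> 'm set \<Rightarrow> bool" where
  "direct_decomposition R M S S' \<longleftrightarrow> submodule S R M \<and> submodule S' R M \<and>
    S \<inter> S' = {\<zero>\<^bsub>M\<^esub>} \<and> S <+>\<^bsub>M\<^esub> S' = carrier M"

definition indecomposable :: "('r, 'c) ring_scheme \<Rightarrow> ('r, 'm, 'd) module_scheme \<Rightarrow> bool" where
  "indecomposable R M \<longleftrightarrow> carrier M \<noteq> {\<zero>\<^bsub>M\<^esub>} \<and>
    (\<forall>S S'. direct_decomposition R M S S' \<longrightarrow> S = {\<zero>\<^bsub>M\<^esub>} \<or> S' = {\<zero>\<^bsub>M\<^esub>})"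

definition indec_summands ::
  "('r, 'c) ring_scheme \<Rightarrow> ('r, 'm, 'd) module_scheme \<Rightarrow> 'm set set" where
  "indec_summands R M =
    {S. (\<exists>S'. direct_decomposition R M S S') \<and> indecomposable R (M\<lparr>carrier := S\<rparr>)}"

definition num_indec_summands :: "('r, 'c) ring_scheme \<Rightarrow> ('r, 'm, 'd) module_scheme \<Rightarrow> nat" where
  "num_indec_summands R M = card (indec_summands R M //
    {(S, S'). S \<in> indec_summands R M \<and> S' \<in> indec_summands R M \<and>
      module_iso R (M\<lparr>carrier := S\<rparr>) (M\<lparr>carrier := S'\<rparr>)})"

subsection \<open>Projective modules and projective covers\<close>

text \<open>
  A finitely generated projective module is a direct summand of a free module of finite rank. The
  lifting property would quantify over modules with arbitrary carrier types.
\<close>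

definition fg_projective :: "('r, 'c) ring_scheme \<Rightarrow> ('r, 'm, 'd) module_scheme \<Rightarrow> bool" where
  "fg_projective R P \<longleftrightarrow> left_module R P \<and>
    (\<exists>n. \<exists>i\<in>module_homs R P (free_module R n). \<exists>p\<in>module_homs R (free_module R n) P.
      \<forall>x\<in>carrier P. p (i x) = x)"

definition superfluous ::
  "('r, 'c) ring_scheme \<Rightarrow> ('r, 'm, 'd) module_scheme \<Rightarrow> 'm set \<Rightarrow> bool" where
  "superfluous R M S \<longleftrightarrow> submodule S R M \<and>
    (\<forall>L. submodule L R M \<and> L <+>\<^bsub>M\<^esub> S = carrier M \<longrightarrow> L = carrier M)"

definition projective_cover ::
  "('r, 'b) ring_scheme \<Rightarrow> ('r, 'p, 'c) module_scheme \<Rightarrow> ('p \<Rightarrow> 'm) \<Rightarrow> ('r, 'm, 'd) module_scheme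
    \<Rightarrow> bool" where
  "projective_cover R P \<pi> M \<longleftrightarrow> fg_projective R P \<and> \<pi> \<in> module_homs R P M \<and>
    \<pi> ` carrier P = carrier M \<and> superfluous R P (a_kernel P M \<pi>)"

section \<open>Finite dimensional algebras and the Auslander--Reiten translation\<close>

text \<open>The library's \<open>algebra\<close> locale covers commutative algebras only. The zero algebra is allowed.\<close>

locale fd_algebra = K?: field K + A?: ring A + KA?: module K A
  for K :: "('k, 'c) ring_scheme" (structure) and A :: "('k, 'a, 'd) module_scheme" (structure) +
  assumes smult_mult_left:
      "\<lbrakk>k \<in> carrier K; x \<in> carrier A; y \<in> carrier A\<rbrakk> \<Longrightarrow>
        (k \<odot>\<^bsub>A\<^esub> x) \<otimes>\<^bsub>A\<^esub> y = k \<odot>\<^bsub>A\<^esub> (x \<otimes>\<^bsub>A\<^esub> y)"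
    and smult_mult_right:
      "\<lbrakk>k \<in> carrier K; x \<in> carrier A; y \<in> carrier A\<rbrakk> \<Longrightarrow>
        x \<otimes>\<^bsub>A\<^esub> (k \<odot>\<^bsub>A\<^esub> y) = k \<odot>\<^bsub>A\<^esub> (x \<otimes>\<^bsub>A\<^esub> y)"
    and finite_dim: "fin_gen K A"

text \<open>
  A minimal projective presentation \<open>P1 \<rightarrow> P0 \<rightarrow> N \<rightarrow> 0\<close>: \<open>g\<close> is a projective cover of \<open>N\<close>, and \<open>f\<close>
  induces a projective cover of the kernel of \<open>g\<close>.
\<close>

definition min_proj_presentation ::
  "('r, 'b) ring_scheme \<Rightarrow> ('r, 'p, 'c) module_scheme \<Rightarrow> ('p \<Rightarrow> 'q) \<Rightarrow> ('r, 'q, 'd) module_scheme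
    \<Rightarrow> ('q \<Rightarrow> 'n) \<Rightarrow> ('r, 'n, 'e) module_scheme \<Rightarrow> bool" where
  "min_proj_presentation R P1 f P0 g N \<longleftrightarrow>
    projective_cover R P0 g N \<and> projective_cover R P1 f (P0\<lparr>carrier := a_kernel P0 N g\<rparr>)"

text \<open>The right \<open>R\<close>-module \<open>Hom\<^sub>R(P, R)\<close>, as a left module over the opposite ring.\<close>

definition hom_dual ::
  "('r, 'c) ring_scheme \<Rightarrow> ('r, 'p, 'd) module_scheme \<Rightarrow> ('r, 'p \<Rightarrow> 'r) module" where
  "hom_dual R P = mk_module (module_homs R P (regular_module R))
    (\<lambda>x\<in>carrier P. \<zero>\<^bsub>R\<^esub>)
    (\<lambda>\<phi> \<psi>. \<lambda>x\<in>carrier P. \<phi> x \<oplus>\<^bsub>R\<^esub> \<psi> x)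
    (\<lambda>a \<phi>. \<lambda>x\<in>carrier P. \<phi> x \<otimes>\<^bsub>R\<^esub> a)"

text \<open>The cokernel of \<open>Hom\<^sub>R(f, R) : Hom\<^sub>R(P0, R) \<rightarrow> Hom\<^sub>R(P1, R)\<close>.\<close>

definition transpose_of_presentation ::
  "('r, 'b) ring_scheme \<Rightarrow> ('r, 'p, 'c) module_scheme \<Rightarrow> ('p \<Rightarrow> 'q) \<Rightarrow> ('r, 'q, 'd) module_scheme
    \<Rightarrow> ('r, ('p \<Rightarrow> 'r) set) module" where
  "transpose_of_presentation R P1 f P0 = quotient_module (hom_dual R P1)
    ((\<lambda>\<phi>. compose (carrier P1) \<phi> f) ` carrier (hom_dual R P0))"

text \<open>
  The left \<open>B\<close>-module \<open>Hom\<^sub>K(Y, K)\<close> for a right \<open>B\<close>-module \<open>Y\<close>; the field acts on \<open>Y\<close> through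
  \<open>k \<mapsto> k \<cdot> 1\<^sub>B\<close>.
\<close>

definition k_dual ::
  "('k, 'b) ring_scheme \<Rightarrow> ('k, 'r, 'c) module_scheme \<Rightarrow> ('r, 'm, 'd) module_scheme
    \<Rightarrow> ('r, 'm \<Rightarrow> 'k) module" where
  "k_dual K B Y = mk_module
    (module_homs K
      (mk_module (carrier Y) \<zero>\<^bsub>Y\<^esub> (ring.add Y) (\<lambda>k y. (k \<odot>\<^bsub>B\<^esub> \<one>\<^bsub>B\<^esub>) \<odot>\<^bsub>Y\<^esub> y))
      (regular_module K))
    (\<lambda>y\<in>carrier Y. \<zero>\<^bsub>K\<^esub>)
    (\<lambda>\<phi> \<psi>. \<lambda>y\<in>carrier Y. \<phi> y \<oplus>\<^bsub>K\<^esub> \<psi> y)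
    (\<lambda>b \<phi>. \<lambda>y\<in>carrier Y. \<phi> (b \<odot>\<^bsub>Y\<^esub> y))"

text \<open>
  \<open>\<tau> N = D Tr N\<close>, computed from a chosen minimal projective presentation. Every finitely generated
  projective \<open>B\<close>-module is isomorphic to a submodule of some \<open>B\<^sup>n\<close>, so the carrier type
  \<open>nat \<Rightarrow> 'b\<close> is large enough for a presentation of every module in \<open>B-mod\<close> to exist. Different choices
  give isomorphic results.
\<close>

definition AR_translate ::
  "('k, 'c) ring_scheme \<Rightarrow> ('k, 'b, 'd) module_scheme \<Rightarrow> ('b, 'n, 'e) module_scheme
    \<Rightarrow> ('b, ((nat \<Rightarrow> 'b) \<Rightarrow> 'b) set \<Rightarrow> 'k) module" where
  "AR_translate K B N =
    (let (P1, f, P0, g) =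
      (SOME (P1 :: ('b, nat \<Rightarrow> 'b) module, f, P0 :: ('b, nat \<Rightarrow> 'b) module, g).
        min_proj_presentation B P1 f P0 g N)
     in k_dual K B (transpose_of_presentation B P1 f P0))"

section \<open>Support tau-tilting pairs\<close>

definition tau_rigid ::
  "('k, 'c) ring_scheme \<Rightarrow> ('k, 'b, 'd) module_scheme \<Rightarrow> ('b, 'n, 'e) module_scheme \<Rightarrow> bool" where
  "tau_rigid K B N \<longleftrightarrow> fg_module B N \<and> hom_zero B N (AR_translate K B N)"

definition tau_rigid_pair ::
  "('k, 'c) ring_scheme \<Rightarrow> ('k, 'b, 'd) module_scheme \<Rightarrow> ('b, 'n, 'e) module_scheme
    \<Rightarrow> ('b, 'p, 'f) module_scheme \<Rightarrow> bool" where
  "tau_rigid_pair K B N P \<longleftrightarrow> tau_rigid K B N \<and> fg_projective B P \<and> hom_zero B P N"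

definition support_tau_tilting_pair ::
  "('k, 'c) ring_scheme \<Rightarrow> ('k, 'b, 'd) module_scheme \<Rightarrow> ('b, 'n, 'e) module_scheme
    \<Rightarrow> ('b, 'p, 'f) module_scheme \<Rightarrow> bool" where
  "support_tau_tilting_pair K B N P \<longleftrightarrow> tau_rigid_pair K B N P \<and>
    num_indec_summands B N + num_indec_summands B P = num_indec_summands B (regular_module B)"

section \<open>Bimodules and tensor products\<close>

record ('a, 'm) bimodule = "('a, 'm) module" +
  rsmult :: "'m \<Rightarrow> 'a \<Rightarrow> 'm"

locale bimodule = fd_algebra K A + left_module A M
  for K :: "('k, 'c) ring_scheme" and A :: "('k, 'a, 'd) module_scheme"
    and M :: "('a, 'm, 'e) bimodule_scheme" +
  assumes rsmult_closed:
      "\<lbrakk>m \<in> carrier M; a \<in> carrier A\<rbrakk> \<Longrightarrow> rsmult M m a \<in> carrier M"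
    and rsmult_add_left:
      "\<lbrakk>m \<in> carrier M; n \<in> carrier M; a \<in> carrier A\<rbrakk> \<Longrightarrow>
        rsmult M (m \<oplus>\<^bsub>M\<^esub> n) a = rsmult M m a \<oplus>\<^bsub>M\<^esub> rsmult M n a"
    and rsmult_add_right:
      "\<lbrakk>m \<in> carrier M; a \<in> carrier A; b \<in> carrier A\<rbrakk> \<Longrightarrow>
        rsmult M m (a \<oplus>\<^bsub>A\<^esub> b) = rsmult M m a \<oplus>\<^bsub>M\<^esub> rsmult M m b"
    and rsmult_mult:
      "\<lbrakk>m \<in> carrier M; a \<in> carrier A; b \<in> carrier A\<rbrakk> \<Longrightarrow>
        rsmult M m (a \<otimes>\<^bsub>A\<^esub> b) = rsmult M (rsmult M m a) b"
    and rsmult_one: "m \<in> carrier M \<Longrightarrow> rsmult M m \<one>\<^bsub>A\<^esub> = m"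
    and smult_rsmult:
      "\<lbrakk>a \<in> carrier A; m \<in> carrier M; b \<in> carrier A\<rbrakk> \<Longrightarrow>
        rsmult M (a \<odot>\<^bsub>M\<^esub> m) b = a \<odot>\<^bsub>M\<^esub> rsmult M m b"
    and field_central:
      "\<lbrakk>k \<in> carrier K; m \<in> carrier M\<rbrakk> \<Longrightarrow>
        (k \<odot>\<^bsub>A\<^esub> \<one>\<^bsub>A\<^esub>) \<odot>\<^bsub>M\<^esub> m = rsmult M m (k \<odot>\<^bsub>A\<^esub> \<one>\<^bsub>A\<^esub>)"

definition fg_bimodule ::
  "('k, 'c) ring_scheme \<Rightarrow> ('k, 'a, 'd) module_scheme \<Rightarrow> ('a, 'm, 'e) bimodule_scheme \<Rightarrow> bool" where
  "fg_bimodule K A M \<longleftrightarrow> bimodule K A M \<and>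
    (\<exists>S. finite S \<and> S \<subseteq> carrier M \<and>
      (\<forall>N. submodule N A M \<and> (\<forall>x\<in>N. \<forall>a\<in>carrier A. rsmult M x a \<in> N) \<and> S \<subseteq> N
        \<longrightarrow> N = carrier M))"

text \<open>
  \<open>M \<otimes>\<^sub>A X\<close> is the free abelian group on the set \<open>M \<times> X\<close> modulo the subgroup generated by the
  relations of additivity in both arguments and of \<open>A\<close>-balancedness.
\<close>

abbreviation tensor_free ::
  "('a, 'm, 'c) bimodule_scheme \<Rightarrow> ('a, 'x, 'd) module_scheme \<Rightarrow> ('m \<times> 'x \<Rightarrow>\<^sub>0 int) monoid" where
  "tensor_free M X \<equiv> free_Abelian_group (carrier M \<times> carrier X)"

definition tensor_relations ::
  "('a, 'b) ring_scheme \<Rightarrow> ('a, 'm, 'c) bimodule_scheme \<Rightarrow> ('a, 'x, 'd) module_scheme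
    \<Rightarrow> ('m \<times> 'x \<Rightarrow>\<^sub>0 int) set" where
  "tensor_relations A M X = generate (tensor_free M X)
    ({frag_of (m \<oplus>\<^bsub>M\<^esub> m', x) - frag_of (m, x) - frag_of (m', x) | m m' x.
        m \<in> carrier M \<and> m' \<in> carrier M \<and> x \<in> carrier X} \<union>
     {frag_of (m, x \<oplus>\<^bsub>X\<^esub> x') - frag_of (m, x) - frag_of (m, x') | m x x'.
        m \<in> carrier M \<and> x \<in> carrier X \<and> x' \<in> carrier X} \<union>
     {frag_of (rsmult M m a, x) - frag_of (m, a \<odot>\<^bsub>X\<^esub> x) | m a x.
        m \<in> carrier M \<and> a \<in> carrier A \<and> x \<in> carrier X})"

definition tensor_class ::
  "('a, 'b) ring_scheme \<Rightarrow> ('a, 'm, 'c) bimodule_scheme \<Rightarrow> ('a, 'x, 'd) module_scheme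
    \<Rightarrow> ('m \<times> 'x \<Rightarrow>\<^sub>0 int) \<Rightarrow> ('m \<times> 'x \<Rightarrow>\<^sub>0 int) set" where
  "tensor_class A M X u = tensor_relations A M X #>\<^bsub>tensor_free M X\<^esub> u"

definition pure_tensor ::
  "('a, 'b) ring_scheme \<Rightarrow> ('a, 'm, 'c) bimodule_scheme \<Rightarrow> ('a, 'x, 'd) module_scheme
    \<Rightarrow> 'm \<Rightarrow> 'x \<Rightarrow> ('m \<times> 'x \<Rightarrow>\<^sub>0 int) set" where
  "pure_tensor A M X m x = tensor_class A M X (frag_of (m, x))"

definition tensor ::
  "('a, 'b) ring_scheme \<Rightarrow> ('a, 'm, 'c) bimodule_scheme \<Rightarrow> ('a, 'x, 'd) module_scheme
    \<Rightarrow> ('a, ('m \<times> 'x \<Rightarrow>\<^sub>0 int) set) module" where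
  "tensor A M X =
    (let Q = tensor_free M X Mod tensor_relations A M X
     in mk_module (carrier Q) \<one>\<^bsub>Q\<^esub> (monoid.mult Q)
      (\<lambda>a C. \<Union>u\<in>C. tensor_class A M X (frag_extend (\<lambda>(m, x). frag_of (a \<odot>\<^bsub>M\<^esub> m, x)) u)))"

text \<open>The map \<open>id\<^sub>M \<otimes> f : M \<otimes>\<^sub>A X \<rightarrow> M \<otimes>\<^sub>A Y\<close> induced by \<open>f : X \<rightarrow> Y\<close>.\<close>

definition tensor_map ::
  "('a, 'b) ring_scheme \<Rightarrow> ('a, 'm, 'c) bimodule_scheme \<Rightarrow> ('a, 'y, 'd) module_scheme
    \<Rightarrow> ('x \<Rightarrow> 'y) \<Rightarrow> ('m \<times> 'x \<Rightarrow>\<^sub>0 int) set \<Rightarrow> ('m \<times> 'y \<Rightarrow>\<^sub>0 int) set" where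
  "tensor_map A M Y f C =
    (\<Union>u\<in>C. tensor_class A M Y (frag_extend (\<lambda>(m, x). frag_of (m, f x)) u))"

section \<open>Trivial extensions\<close>

definition trivial_extension ::
  "('k, 'a, 'c) module_scheme \<Rightarrow> ('a, 'm, 'd) bimodule_scheme \<Rightarrow> ('k, 'a \<times> 'm) module" where
  "trivial_extension A M = \<lparr>carrier = carrier A \<times> carrier M,
    monoid.mult = (\<lambda>(r, m) (r', m'). (r \<otimes>\<^bsub>A\<^esub> r', (r \<odot>\<^bsub>M\<^esub> m') \<oplus>\<^bsub>M\<^esub> rsmult M m r')),
    one = (\<one>\<^bsub>A\<^esub>, \<zero>\<^bsub>M\<^esub>), ring.zero = (\<zero>\<^bsub>A\<^esub>, \<zero>\<^bsub>M\<^esub>),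
    ring.add = (\<lambda>(r, m) (r', m'). (r \<oplus>\<^bsub>A\<^esub> r', m \<oplus>\<^bsub>M\<^esub> m')),
    smult = (\<lambda>k (r, m). (k \<odot>\<^bsub>A\<^esub> r, (k \<odot>\<^bsub>A\<^esub> \<one>\<^bsub>A\<^esub>) \<odot>\<^bsub>M\<^esub> m))\<rparr>"

text \<open>
  The module over the trivial extension given by a pair \<open>(X, \<alpha>)\<close> with \<open>\<alpha> : M \<otimes>\<^sub>A X \<rightarrow> X\<close>: the element
  \<open>(a, m)\<close> acts by \<open>x \<mapsto> a x + \<alpha> (m \<otimes> x)\<close>.
\<close>

definition pair_module ::
  "('a, 'b) ring_scheme \<Rightarrow> ('a, 'm, 'c) bimodule_scheme \<Rightarrow> ('a, 'x, 'd) module_scheme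
    \<Rightarrow> (('m \<times> 'x \<Rightarrow>\<^sub>0 int) set \<Rightarrow> 'x) \<Rightarrow> ('a \<times> 'm, 'x) module" where
  "pair_module A M X \<alpha> = mk_module (carrier X) \<zero>\<^bsub>X\<^esub> (ring.add X)
    (\<lambda>(a, m) x. (a \<odot>\<^bsub>X\<^esub> x) \<oplus>\<^bsub>X\<^esub> \<alpha> (pure_tensor A M X m x))"

text \<open>
  On objects, \<open>T N = (N \<oplus> F N, \<alpha>)\<close>. Under \<open>F (N \<oplus> F N) \<cong> F N \<oplus> F (F N)\<close> the first component of an
  element is its image under \<open>F\<close> of the projection to \<open>N\<close>, and the structure map sends it to the
  second summand of \<open>N \<oplus> F N\<close>.
\<close>

definition T_functor ::
  "('a, 'b) ring_scheme \<Rightarrow> ('a, 'm, 'c) bimodule_scheme \<Rightarrow> ('a, 'x, 'd) module_scheme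
    \<Rightarrow> ('a \<times> 'm, 'x \<times> ('m \<times> 'x \<Rightarrow>\<^sub>0 int) set) module" where
  "T_functor A M N = pair_module A M (dsum_module N (tensor A M N))
    (\<lambda>z. (\<zero>\<^bsub>N\<^esub>, tensor_map A M N fst z))"

definition Z_functor ::
  "('a, 'b) ring_scheme \<Rightarrow> ('a, 'm, 'c) bimodule_scheme \<Rightarrow> ('a, 'x, 'd) module_scheme
    \<Rightarrow> ('a \<times> 'm, 'x) module" where
  "Z_functor A M N = pair_module A M N (\<lambda>z. \<zero>\<^bsub>N\<^esub>)"

end

theory Submission
  imports Defs
begin

text \<open>
  By Auslander and Reiten, \<open>Hom(Y, \<tau> N) = 0\<close> iff \<open>Hom(P0, Y) \<rightarrow> Hom(P1, Y)\<close> is onto for a minimal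
  projective presentation \<open>P1 \<rightarrow> P0 \<rightarrow> N \<rightarrow> 0\<close>: the cokernel of this map has \<open>K\<close>-dual \<open>Hom(Y, D Tr N)\<close>.
  The functor \<open>T\<close> is left adjoint to restriction of scalars, right exact, and preserves projectives,
  and \<open>M\<close> acts nilpotently on every module over \<open>\<Lambda>\<close>. Hence \<open>T\<close> maps a minimal presentation of \<open>X\<close> to
  one of \<open>TX\<close>, while \<open>ZX\<close> has the minimal presentation \<open>T(P1 \<oplus> Q) \<rightarrow> T(P0) \<rightarrow> ZX\<close>, where \<open>Q\<close> is a
  projective cover of \<open>M \<otimes> X\<close>. Applying the criterion with \<open>Hom(TP, Y) = Hom(P, Y)\<close> turns the rigidity
  of \<open>TX\<close> and \<open>ZX\<close> into that of \<open>X\<close> plus the extra vanishing conditions.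

  The numbers of summands of \<open>X\<close>, \<open>TX\<close> and \<open>ZX\<close> agree: an idempotent endomorphism of \<open>TX\<close> induces one
  of \<open>X = TX / M \<cdot> TX\<close>, and because \<open>M\<close> is nilpotent the summand of \<open>TX\<close> is \<open>T\<close> of the summand of \<open>X\<close>.
  Since only isomorphism classes of indecomposable submodule summands are compared, the
  Krull--Schmidt theorem is not needed.
\<close>

section \<open>Modules and linear maps\<close>

text \<open>The translate is built from a presentation picked by choice on a fixed carrier type,
  then a quotient and a dual, so it is never computed directly. It is replaced by the condition
  \<open>hom_surj\<close>, which does not depend on the presentation. Elements of
  \<open>Hom(Y, D Tr N)\<close> are read as balanced forms on \<open>Hom(P1, B) \<times> Y\<close>;
  dual bases stand in for the isomorphism \<open>Hom(P1, B) \<otimes> Y \<cong> Hom(P1, Y)\<close>,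
  and a functional on a vector space of any dimension detects a map outside the image.

  The extra conditions come from restricting scalars. Over \<open>A\<close> the module
  \<open>T X\<close> is \<open>X \<oplus> M \<otimes> X\<close>, so each condition on maps into
  \<open>T X\<close> splits into two. \<open>Z X\<close> restricts to \<open>X\<close> alone, but
  its presentation has the summand \<open>Q\<close>, whose image in \<open>T P0\<close> is killed by
  every map to \<open>Z X\<close>; hence all of \<open>Hom(Q, X)\<close> can be reached only if it
  is zero.

  Minimal presentations over the trivial extension are transported from \<open>A\<close>. Existence
  over \<open>A\<close> uses a strictly monotone function from submodules to the naturals in place
  of dimension theory.\<close>

lemma (in abelian_group) diff_zero_iff:
  assumes "x \<in> carrier G" "y \<in> carrier G" shows "x \<ominus> y = \<zero> \<longleftrightarrow> x = y"
proof
  assume "x \<ominus> y = \<zero>"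
  then have "(x \<ominus> y) \<oplus> y = y" using assms by simp
  then show "x = y" using assms by (simp add: minus_eq a_assoc l_neg)
qed (use assms in \<open>simp add: minus_eq r_neg\<close>)

lemma (in abelian_group) diff_add_cancel:
  assumes "x \<in> carrier G" "y \<in> carrier G"
  shows "y \<oplus> (x \<ominus> y) = x" "(x \<ominus> y) \<oplus> y = x" "(x \<oplus> y) \<ominus> y = x"
    "(x \<oplus> y) \<ominus> x = y"
  using assms by (simp_all add: minus_eq a_ac r_neg r_neg1 r_neg2 l_neg
      a_lcomm[of x y "\<ominus> x"])

lemma (in abelian_group) neg_zero [simp]: "\<ominus> \<zero> = \<zero>"
  by (rule minus_equality) auto

lemma (in abelian_group) diff_zero [simp]: "x \<in> carrier G \<Longrightarrow> x \<ominus> \<zero> = x"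
  by (simp add: minus_eq)

section \<open>Elementary identities and submodules over a ring\<close>

context left_module
begin

declare smult_closed [simp, intro] smult_one [simp]

lemma smult_l_null [simp]:
  assumes "x \<in> carrier M" shows "\<zero>\<^bsub>R\<^esub> \<odot>\<^bsub>M\<^esub> x = \<zero>\<^bsub>M\<^esub>"
proof -
  have "\<zero>\<^bsub>R\<^esub> \<odot>\<^bsub>M\<^esub> x \<oplus>\<^bsub>M\<^esub> \<zero>\<^bsub>R\<^esub> \<odot>\<^bsub>M\<^esub> x = \<zero>\<^bsub>R\<^esub> \<odot>\<^bsub>M\<^esub> x"
    using assms smult_l_distr[of "\<zero>\<^bsub>R\<^esub>" "\<zero>\<^bsub>R\<^esub>" x] by simp
  then show ?thesis using assms M.add.r_cancel_one' by (metis smult_closed R.zero_closed)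
qed

lemma smult_r_null [simp]:
  assumes "a \<in> carrier R" shows "a \<odot>\<^bsub>M\<^esub> \<zero>\<^bsub>M\<^esub> = \<zero>\<^bsub>M\<^esub>"
proof -
  have "a \<odot>\<^bsub>M\<^esub> \<zero>\<^bsub>M\<^esub> \<oplus>\<^bsub>M\<^esub> a \<odot>\<^bsub>M\<^esub> \<zero>\<^bsub>M\<^esub> = a \<odot>\<^bsub>M\<^esub> \<zero>\<^bsub>M\<^esub>"
    using assms smult_r_distr[of a "\<zero>\<^bsub>M\<^esub>" "\<zero>\<^bsub>M\<^esub>"] by simp
  then show ?thesis using assms M.add.r_cancel_one' by (metis smult_closed M.zero_closed)
qed

lemma smult_l_minus:
  assumes "a \<in> carrier R" "x \<in> carrier M"
  shows "(\<ominus>\<^bsub>R\<^esub> a) \<odot>\<^bsub>M\<^esub> x = \<ominus>\<^bsub>M\<^esub> (a \<odot>\<^bsub>M\<^esub> x)"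
  using assms smult_l_distr[of "\<ominus>\<^bsub>R\<^esub> a" a x] by (simp add: R.l_neg M.minus_equality)

lemma smult_r_minus:
  assumes "a \<in> carrier R" "x \<in> carrier M"
  shows "a \<odot>\<^bsub>M\<^esub> (\<ominus>\<^bsub>M\<^esub> x) = \<ominus>\<^bsub>M\<^esub> (a \<odot>\<^bsub>M\<^esub> x)"
  using assms smult_r_distr[of a "\<ominus>\<^bsub>M\<^esub> x" x] by (simp add: M.l_neg M.minus_equality)

lemma smult_r_diff:
  assumes "a \<in> carrier R" "x \<in> carrier M" "y \<in> carrier M"
  shows "a \<odot>\<^bsub>M\<^esub> (x \<ominus>\<^bsub>M\<^esub> y) = a \<odot>\<^bsub>M\<^esub> x \<ominus>\<^bsub>M\<^esub> a \<odot>\<^bsub>M\<^esub> y"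
  using assms by (simp add: M.minus_eq smult_r_distr smult_r_minus)

text \<open>Multiplication by -1 supplies the negatives, so only closure under sums and scalars has
  to be checked.\<close>

lemma submoduleI:
  assumes "S \<subseteq> carrier M" "\<zero>\<^bsub>M\<^esub> \<in> S" "\<And>x y. x \<in> S \<Longrightarrow> y \<in> S \<Longrightarrow> x \<oplus>\<^bsub>M\<^esub> y \<in> S"
    "\<And>a x. a \<in> carrier R \<Longrightarrow> x \<in> S \<Longrightarrow> a \<odot>\<^bsub>M\<^esub> x \<in> S"
  shows "submodule S R M"
proof (intro submodule.intro submodule_axioms.intro M.add.subgroupI)
  fix x assume "x \<in> S"
  moreover have "(\<ominus>\<^bsub>R\<^esub> \<one>\<^bsub>R\<^esub>) \<odot>\<^bsub>M\<^esub> x = \<ominus>\<^bsub>M\<^esub> x"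
    using \<open>x \<in> S\<close> assms(1) smult_l_minus[of "\<one>\<^bsub>R\<^esub>" x] by auto
  ultimately show "\<ominus>\<^bsub>M\<^esub> x \<in> S" using assms(4)[of "\<ominus>\<^bsub>R\<^esub> \<one>\<^bsub>R\<^esub>" x] by simp
qed (use assms in \<open>auto simp: a_inv_def\<close>)

lemma submoduleD:
  assumes "submodule S R M"
  shows "S \<subseteq> carrier M" "\<zero>\<^bsub>M\<^esub> \<in> S" "\<And>x y. x \<in> S \<Longrightarrow> y \<in> S \<Longrightarrow> x \<oplus>\<^bsub>M\<^esub> y \<in> S"
    "\<And>a x. a \<in> carrier R \<Longrightarrow> x \<in> S \<Longrightarrow> a \<odot>\<^bsub>M\<^esub> x \<in> S"
    "\<And>x. x \<in> S \<Longrightarrow> \<ominus>\<^bsub>M\<^esub> x \<in> S"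
    "\<And>x y. x \<in> S \<Longrightarrow> y \<in> S \<Longrightarrow> x \<ominus>\<^bsub>M\<^esub> y \<in> S"
proof -
  interpret S: submodule S R M by fact
  show "S \<subseteq> carrier M" "\<zero>\<^bsub>M\<^esub> \<in> S" "\<And>x y. x \<in> S \<Longrightarrow> y \<in> S \<Longrightarrow> x \<oplus>\<^bsub>M\<^esub> y \<in> S"
    "\<And>a x. a \<in> carrier R \<Longrightarrow> x \<in> S \<Longrightarrow> a \<odot>\<^bsub>M\<^esub> x \<in> S"
    using S.subset S.one_closed S.m_closed by auto
  show *: "\<ominus>\<^bsub>M\<^esub> x \<in> S" if "x \<in> S" for x using that S.m_inv_closed by (simp add: a_inv_def)
  show "x \<ominus>\<^bsub>M\<^esub> y \<in> S" if "x \<in> S" "y \<in> S" for x y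
    using that * S.m_closed by (simp add: M.minus_eq)
qed

lemma submodule_carrier: "submodule (carrier M) R M"
  by (rule submoduleI) auto

lemma submodule_zero: "submodule {\<zero>\<^bsub>M\<^esub>} R M"
  by (rule submoduleI) auto

lemma submodule_Int:
  assumes "submodule S R M" "submodule T R M" shows "submodule (S \<inter> T) R M"
  by (rule submoduleI) (use submoduleD[OF assms(1)] submoduleD[OF assms(2)] in auto)

lemma mem_set_add: "x \<in> S <+>\<^bsub>M\<^esub> T \<longleftrightarrow> (\<exists>s\<in>S. \<exists>t\<in>T. x = s \<oplus>\<^bsub>M\<^esub> t)"
  by (auto simp: set_add_def')

lemma submodule_sum:
  assumes "submodule S R M" "submodule T R M" shows "submodule (S <+>\<^bsub>M\<^esub> T) R M"
proof (rule submoduleI)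
  note S = submoduleD[OF assms(1)] and T = submoduleD[OF assms(2)]
  show "S <+>\<^bsub>M\<^esub> T \<subseteq> carrier M" using S(1) T(1) by (auto simp: mem_set_add subset_eq)
  show "\<zero>\<^bsub>M\<^esub> \<in> S <+>\<^bsub>M\<^esub> T" unfolding mem_set_add using S(2) T(2) by (metis M.l_zero M.zero_closed)
  show "x \<oplus>\<^bsub>M\<^esub> y \<in> S <+>\<^bsub>M\<^esub> T" if xy: "x \<in> S <+>\<^bsub>M\<^esub> T" "y \<in> S <+>\<^bsub>M\<^esub> T" for x y
  proof -
    obtain s t s' t' where *: "x = s \<oplus>\<^bsub>M\<^esub> t" "y = s' \<oplus>\<^bsub>M\<^esub> t'" "s \<in> S" "s' \<in> S" "t \<in> T" "t' \<in> T"
      using xy by (auto simp: mem_set_add)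
    then have "x \<oplus>\<^bsub>M\<^esub> y = (s \<oplus>\<^bsub>M\<^esub> s') \<oplus>\<^bsub>M\<^esub> (t \<oplus>\<^bsub>M\<^esub> t')"
      using S(1) T(1) by (simp add: M.a_ac subset_eq)
    then show ?thesis using * S(3) T(3) unfolding mem_set_add by metis
  qed
  show "a \<odot>\<^bsub>M\<^esub> x \<in> S <+>\<^bsub>M\<^esub> T" if a: "a \<in> carrier R" and x: "x \<in> S <+>\<^bsub>M\<^esub> T" for a x
  proof -
    obtain s t where "x = s \<oplus>\<^bsub>M\<^esub> t" "s \<in> S" "t \<in> T" using x by (auto simp: mem_set_add)
    then show ?thesis using a S T unfolding mem_set_add
      by (intro bexI[of _ "a \<odot>\<^bsub>M\<^esub> s"] bexI[of _ "a \<odot>\<^bsub>M\<^esub> t"]) (auto simp: smult_r_distr subset_eq)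
  qed
qed

end

lemma left_moduleI:
  assumes "ring R" and "\<zero>\<^bsub>M\<^esub> \<in> carrier M"
    and "\<And>x y. \<lbrakk>x \<in> carrier M; y \<in> carrier M\<rbrakk> \<Longrightarrow> x \<oplus>\<^bsub>M\<^esub> y \<in> carrier M"
    and "\<And>x y z. \<lbrakk>x \<in> carrier M; y \<in> carrier M; z \<in> carrier M\<rbrakk> \<Longrightarrow>
        (x \<oplus>\<^bsub>M\<^esub> y) \<oplus>\<^bsub>M\<^esub> z = x \<oplus>\<^bsub>M\<^esub> (y \<oplus>\<^bsub>M\<^esub> z)"
    and "\<And>x y. \<lbrakk>x \<in> carrier M; y \<in> carrier M\<rbrakk> \<Longrightarrow> x \<oplus>\<^bsub>M\<^esub> y = y \<oplus>\<^bsub>M\<^esub> x"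
    and "\<And>x. x \<in> carrier M \<Longrightarrow> \<zero>\<^bsub>M\<^esub> \<oplus>\<^bsub>M\<^esub> x = x"
    and "\<And>x. x \<in> carrier M \<Longrightarrow> \<exists>y\<in>carrier M. y \<oplus>\<^bsub>M\<^esub> x = \<zero>\<^bsub>M\<^esub>"
    and "\<And>a x. \<lbrakk>a \<in> carrier R; x \<in> carrier M\<rbrakk> \<Longrightarrow> a \<odot>\<^bsub>M\<^esub> x \<in> carrier M"
    and "\<And>a b x. \<lbrakk>a \<in> carrier R; b \<in> carrier R; x \<in> carrier M\<rbrakk> \<Longrightarrow>
        (a \<oplus>\<^bsub>R\<^esub> b) \<odot>\<^bsub>M\<^esub> x = a \<odot>\<^bsub>M\<^esub> x \<oplus>\<^bsub>M\<^esub> b \<odot>\<^bsub>M\<^esub> x"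
    and "\<And>a x y. \<lbrakk>a \<in> carrier R; x \<in> carrier M; y \<in> carrier M\<rbrakk> \<Longrightarrow>
        a \<odot>\<^bsub>M\<^esub> (x \<oplus>\<^bsub>M\<^esub> y) = a \<odot>\<^bsub>M\<^esub> x \<oplus>\<^bsub>M\<^esub> a \<odot>\<^bsub>M\<^esub> y"
    and "\<And>a b x. \<lbrakk>a \<in> carrier R; b \<in> carrier R; x \<in> carrier M\<rbrakk> \<Longrightarrow>
        (a \<otimes>\<^bsub>R\<^esub> b) \<odot>\<^bsub>M\<^esub> x = a \<odot>\<^bsub>M\<^esub> (b \<odot>\<^bsub>M\<^esub> x)"
    and "\<And>x. x \<in> carrier M \<Longrightarrow> \<one>\<^bsub>R\<^esub> \<odot>\<^bsub>M\<^esub> x = x"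
  shows "left_module R M"
proof (intro left_module.intro left_module_axioms.intro)
  show "abelian_group M" using assms by (intro abelian_groupI) auto
qed (use assms in auto)

lemma mk_module_simps [simp]:
  "carrier (mk_module C z p s) = C" "\<zero>\<^bsub>mk_module C z p s\<^esub> = z"
  "x \<oplus>\<^bsub>mk_module C z p s\<^esub> y = p x y" "a \<odot>\<^bsub>mk_module C z p s\<^esub> x = s a x"
  by (simp_all add: mk_module_def)

text \<open>Linearity is separated from the extensionality required by \<open>module_homs\<close>:
  composites and lambda terms are then linear as they stand, with no restriction to a carrier.
  \<open>module_homs_iff\<close> and \<open>restrict_module_homs\<close> translate between the
  two.\<close>

definition lin ::
  "('r, 'b) ring_scheme \<Rightarrow> ('r, 'm, 'c) module_scheme \<Rightarrow> ('r, 'n, 'd) module_scheme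
    \<Rightarrow> ('m \<Rightarrow> 'n) \<Rightarrow> bool" where
  "lin R M N h \<longleftrightarrow> (\<forall>x\<in>carrier M. h x \<in> carrier N) \<and>
    (\<forall>x\<in>carrier M. \<forall>y\<in>carrier M. h (x \<oplus>\<^bsub>M\<^esub> y) = h x \<oplus>\<^bsub>N\<^esub> h y) \<and>
    (\<forall>a\<in>carrier R. \<forall>x\<in>carrier M. h (a \<odot>\<^bsub>M\<^esub> x) = a \<odot>\<^bsub>N\<^esub> h x)"

lemma linI:
  assumes "\<And>x. x \<in> carrier M \<Longrightarrow> h x \<in> carrier N"
    and "\<And>x y. x \<in> carrier M \<Longrightarrow> y \<in> carrier M \<Longrightarrow> h (x \<oplus>\<^bsub>M\<^esub> y) = h x \<oplus>\<^bsub>N\<^esub> h y"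
    and "\<And>a x. a \<in> carrier R \<Longrightarrow> x \<in> carrier M \<Longrightarrow> h (a \<odot>\<^bsub>M\<^esub> x) = a \<odot>\<^bsub>N\<^esub> h x"
  shows "lin R M N h"
  using assms by (simp add: lin_def)

lemma linD:
  assumes "lin R M N h"
  shows "x \<in> carrier M \<Longrightarrow> h x \<in> carrier N"
    "x \<in> carrier M \<Longrightarrow> y \<in> carrier M \<Longrightarrow> h (x \<oplus>\<^bsub>M\<^esub> y) = h x \<oplus>\<^bsub>N\<^esub> h y"
    "a \<in> carrier R \<Longrightarrow> x \<in> carrier M \<Longrightarrow> h (a \<odot>\<^bsub>M\<^esub> x) = a \<odot>\<^bsub>N\<^esub> h x"
  using assms by (simp_all add: lin_def)

lemma module_homs_iff: "h \<in> module_homs R M N \<longleftrightarrow> lin R M N h \<and> h \<in> extensional (carrier M)"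
  by (auto simp: module_homs_def lin_def PiE_def)

lemma lin_cong:
  assumes "left_module R M" "\<And>x. x \<in> carrier M \<Longrightarrow> h x = h' x"
  shows "lin R M N h \<longleftrightarrow> lin R M N h'"
proof -
  interpret left_module R M by fact
  show ?thesis using assms(2) by (simp add: lin_def)
qed

lemma restrict_module_homs:
  assumes "left_module R M" "lin R M N h"
  shows "restrict h (carrier M) \<in> module_homs R M N"
  using iffD2[OF lin_cong[OF assms(1), of "restrict h (carrier M)" h] assms(2)]
  by (simp add: module_homs_iff)

lemma lin_comp:
  assumes "lin R M N h" "lin R N L g" shows "lin R M L (\<lambda>x. g (h x))"
  using assms by (simp add: lin_def)

lemma lin_id: "lin R M M (\<lambda>x. x)"
  by (simp add: lin_def)

section \<open>Kernels, images and inverses of linear maps\<close>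

context
  fixes R M N h
  assumes M: "left_module R M" and N: "left_module R N" and h: "lin R M N h"
begin

interpretation M: left_module R M by (rule M)
interpretation N: left_module R N by (rule N)

text \<open>Zero is its own multiple by the scalar 0, so linearity over \<open>R\<close> settles
  this; the scalar -1 does the same for negatives below.\<close>

lemma lin_zero: "h \<zero>\<^bsub>M\<^esub> = \<zero>\<^bsub>N\<^esub>"
  using linD(3)[OF h, of "\<zero>\<^bsub>R\<^esub>" "\<zero>\<^bsub>M\<^esub>"] linD(1)[OF h] by simp

lemma lin_minus: "x \<in> carrier M \<Longrightarrow> h (\<ominus>\<^bsub>M\<^esub> x) = \<ominus>\<^bsub>N\<^esub> h x"
  using linD(3)[OF h, of "\<ominus>\<^bsub>R\<^esub> \<one>\<^bsub>R\<^esub>" x] linD(1)[OF h] by (simp add: M.smult_l_minus N.smult_l_minus)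

lemma lin_diff: "x \<in> carrier M \<Longrightarrow> y \<in> carrier M \<Longrightarrow> h (x \<ominus>\<^bsub>M\<^esub> y) = h x \<ominus>\<^bsub>N\<^esub> h y"
  using linD[OF h] by (simp add: M.minus_eq N.minus_eq lin_minus)

lemma lin_finsum:
  assumes "finite I" "f \<in> I \<rightarrow> carrier M"
  shows "h (finsum M f I) = finsum N (\<lambda>i. h (f i)) I"
  using assms
proof (induction I)
  case (insert i I)
  then have "(\<lambda>i. h (f i)) \<in> insert i I \<rightarrow> carrier N" using linD(1)[OF h] by auto
  then show ?case using insert linD[OF h] by (simp add: Pi_def)
qed (simp add: lin_zero)

lemma lin_kernel: "a_kernel M N h = {x \<in> carrier M. h x = \<zero>\<^bsub>N\<^esub>}"
  by (simp add: a_kernel_def')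

lemma submodule_vimage:
  assumes "submodule S R N" shows "submodule {x \<in> carrier M. h x \<in> S} R M"
  by (rule M.submoduleI) (use N.submoduleD[OF assms] linD[OF h] lin_zero in auto)

lemma submodule_image:
  assumes "submodule S R M" shows "submodule (h ` S) R N"
proof (rule N.submoduleI)
  note S = M.submoduleD[OF assms]
  show "h ` S \<subseteq> carrier N" using S linD[OF h] by auto
  show "\<zero>\<^bsub>N\<^esub> \<in> h ` S" using S(2) lin_zero by (metis imageI)
  show "x \<oplus>\<^bsub>N\<^esub> y \<in> h ` S" if xy: "x \<in> h ` S" "y \<in> h ` S" for x y
  proof -
    obtain u v where "x = h u" "y = h v" "u \<in> S" "v \<in> S" using xy by auto
    then have "x \<oplus>\<^bsub>N\<^esub> y = h (u \<oplus>\<^bsub>M\<^esub> v)" "u \<oplus>\<^bsub>M\<^esub> v \<in> S" using S linD(2)[OF h, of u v] by (auto simp: subset_eq)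
    then show ?thesis by blast
  qed
  show "a \<odot>\<^bsub>N\<^esub> x \<in> h ` S" if a: "a \<in> carrier R" and x: "x \<in> h ` S" for a x
  proof -
    obtain u where "x = h u" "u \<in> S" using x by auto
    then have "a \<odot>\<^bsub>N\<^esub> x = h (a \<odot>\<^bsub>M\<^esub> u)" "a \<odot>\<^bsub>M\<^esub> u \<in> S" using S a linD(3)[OF h, of a u] by auto
    then show ?thesis by blast
  qed
qed

lemma submodule_kernel: "submodule {x \<in> carrier M. h x = \<zero>\<^bsub>N\<^esub>} R M"
  using submodule_vimage[OF N.submodule_zero] by simp

lemma lin_inv_into:
  assumes "bij_betw h (carrier M) (carrier N)"
  shows "lin R N M (inv_into (carrier M) h)"
proof -
  let ?g = "inv_into (carrier M) h"
  have g: "?g y \<in> carrier M" "h (?g y) = y" if "y \<in> carrier N" for y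
    using assms that bij_betw_imp_surj_on inv_into_into f_inv_into_f by metis+
  have gI: "?g (h x) = x" if "x \<in> carrier M" for x
    using assms that by (simp add: bij_betw_def)
  show ?thesis
  proof (rule linI)
    show "?g (x \<oplus>\<^bsub>N\<^esub> y) = ?g x \<oplus>\<^bsub>M\<^esub> ?g y" if "x \<in> carrier N" "y \<in> carrier N" for x y
      using gI[of "?g x \<oplus>\<^bsub>M\<^esub> ?g y"] g that linD(2)[OF h] by simp
    show "?g (a \<odot>\<^bsub>N\<^esub> x) = a \<odot>\<^bsub>M\<^esub> ?g x" if "a \<in> carrier R" "x \<in> carrier N" for a x
      using gI[of "a \<odot>\<^bsub>M\<^esub> ?g x"] g that linD(3)[OF h] by simp
  qed (use g in auto)
qed

lemma lin_inj_on: "inj_on h (carrier M) \<longleftrightarrow> (\<forall>x\<in>carrier M. h x = \<zero>\<^bsub>N\<^esub> \<longrightarrow> x = \<zero>\<^bsub>M\<^esub>)"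
proof
  assume "inj_on h (carrier M)"
  then show "\<forall>x\<in>carrier M. h x = \<zero>\<^bsub>N\<^esub> \<longrightarrow> x = \<zero>\<^bsub>M\<^esub>"
    using lin_zero by (metis inj_onD M.zero_closed)
next
  assume *: "\<forall>x\<in>carrier M. h x = \<zero>\<^bsub>N\<^esub> \<longrightarrow> x = \<zero>\<^bsub>M\<^esub>"
  show "inj_on h (carrier M)"
  proof (rule inj_onI)
    fix x y assume xy: "x \<in> carrier M" "y \<in> carrier M" "h x = h y"
    then have "h (x \<ominus>\<^bsub>M\<^esub> y) = \<zero>\<^bsub>N\<^esub>" using lin_diff linD(1)[OF h] N.diff_zero_iff by simp
    then show "x = y" using * xy M.diff_zero_iff[of x y] by simp
  qed
qed

end

lemma update_carrier_simps [simp]: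
  fixes M :: "('r, 'm, 'c) module_scheme"
  shows "x \<oplus>\<^bsub>M\<lparr>carrier := S\<rparr>\<^esub> y = x \<oplus>\<^bsub>M\<^esub> y" "a \<odot>\<^bsub>M\<lparr>carrier := S\<rparr>\<^esub> x = a \<odot>\<^bsub>M\<^esub> x"
    "\<zero>\<^bsub>M\<lparr>carrier := S\<rparr>\<^esub> = \<zero>\<^bsub>M\<^esub>"
  by simp_all

context left_module
begin

lemma left_module_submodule:
  assumes "submodule S R M" shows "left_module R (M\<lparr>carrier := S\<rparr>)"
proof -
  note S = submoduleD[OF assms]
  have *: "\<exists>y\<in>S. y \<oplus>\<^bsub>M\<^esub> x = \<zero>\<^bsub>M\<^esub>" if "x \<in> S" for x
    using that S by (meson M.l_neg subsetD)
  show ?thesis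
    by (rule left_moduleI)
      (use S * in \<open>auto simp: subset_eq M.a_assoc smult_l_distr smult_r_distr smult_assoc R.ring_axioms
        intro: M.a_comm\<close>)
qed

lemma submodule_submodule:
  assumes "submodule S R M"
  shows "submodule T R (M\<lparr>carrier := S\<rparr>) \<longleftrightarrow> submodule T R M \<and> T \<subseteq> S"
proof -
  interpret S: left_module R "M\<lparr>carrier := S\<rparr>" by (rule left_module_submodule[OF assms])
  note s = submoduleD[OF assms]
  show ?thesis
  proof
    assume T: "submodule T R (M\<lparr>carrier := S\<rparr>)"
    show "submodule T R M \<and> T \<subseteq> S"
    proof
      show "submodule T R M" by (rule submoduleI) (use s S.submoduleD[OF T] in auto)
    qed (use S.submoduleD(1)[OF T] in simp)
  next
    assume T: "submodule T R M \<and> T \<subseteq> S"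
    show "submodule T R (M\<lparr>carrier := S\<rparr>)"
      by (rule S.submoduleI) (use T submoduleD[of T] in auto)
  qed
qed

end

lemma lin_restrict_carrier:
  assumes "lin R M N h" "S \<subseteq> carrier M" "h ` S \<subseteq> T"
  shows "lin R (M\<lparr>carrier := S\<rparr>) (N\<lparr>carrier := T\<rparr>) h" "lin R (M\<lparr>carrier := S\<rparr>) N h"
  using assms by (auto simp: lin_def subset_eq)

text \<open>A linear map agrees on the carrier with its restriction, which lies in
  \<open>module_homs\<close>. With this, vanishing of Hom can be discussed without
  extensionality.\<close>

lemma hom_zero_iff:
  assumes "left_module R M"
  shows "hom_zero R M N \<longleftrightarrow> (\<forall>h. lin R M N h \<longrightarrow> (\<forall>x\<in>carrier M. h x = \<zero>\<^bsub>N\<^esub>))"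
proof
  assume *: "hom_zero R M N"
  show "\<forall>h. lin R M N h \<longrightarrow> (\<forall>x\<in>carrier M. h x = \<zero>\<^bsub>N\<^esub>)"
  proof (intro allI impI ballI)
    fix h x assume "lin R M N h" "x \<in> carrier M"
    then show "h x = \<zero>\<^bsub>N\<^esub>" using * restrict_module_homs[OF assms] unfolding hom_zero_def by fastforce
  qed
qed (auto simp: hom_zero_def module_homs_iff)

lemma module_iso_iff:
  assumes "left_module R M"
  shows "module_iso R M N \<longleftrightarrow> (\<exists>h. lin R M N h \<and> bij_betw h (carrier M) (carrier N))"
proof
  assume "\<exists>h. lin R M N h \<and> bij_betw h (carrier M) (carrier N)"
  then obtain h where "lin R M N h" "bij_betw h (carrier M) (carrier N)" by blast
  then show "module_iso R M N" unfolding module_iso_def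
    using restrict_module_homs[OF assms] bij_betw_cong[of "carrier M" "restrict h (carrier M)" h]
    by (metis restrict_apply')
qed (auto simp: module_iso_def module_homs_iff)

lemma module_iso_refl: "left_module R M \<Longrightarrow> module_iso R M M"
  unfolding module_iso_iff by (intro exI[of _ "\<lambda>x. x"] conjI lin_id) (simp add: bij_betw_def)

lemma module_iso_sym:
  assumes "left_module R M" "left_module R N" "module_iso R M N" shows "module_iso R N M"
  using assms bij_betw_inv_into lin_inv_into unfolding module_iso_iff[OF assms(1)] module_iso_iff[OF assms(2)]
  by metis

lemma module_iso_trans:
  assumes "left_module R M" "left_module R N" "module_iso R M N" "module_iso R N L"
  shows "module_iso R M L"
proof -
  obtain h g where "lin R M N h" "bij_betw h (carrier M) (carrier N)"
    "lin R N L g" "bij_betw g (carrier N) (carrier L)"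
    using assms by (auto simp: module_iso_iff)
  then have "lin R M L (\<lambda>x. g (h x))" "bij_betw (\<lambda>x. g (h x)) (carrier M) (carrier L)"
    using lin_comp bij_betw_trans[of h _ _ g] by (auto simp: comp_def)
  then show ?thesis using assms(1) by (auto simp: module_iso_iff)
qed

section \<open>Projective modules and projective covers\<close>

lemma left_module_regular: "ring R \<Longrightarrow> left_module R (regular_module R)"
proof -
  assume "ring R"
  then interpret ring R .
  show ?thesis
    by (rule left_moduleI) (auto simp: regular_module_def l_distr r_distr m_assoc a_assoc ring_axioms
        intro: a_comm bexI[of _ "\<ominus>\<^bsub>R\<^esub> x" for x] l_neg)
qed

lemma regular_module_simps [simp]:
  "carrier (regular_module R) = carrier R" "\<zero>\<^bsub>regular_module R\<^esub> = \<zero>\<^bsub>R\<^esub>"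
  "x \<oplus>\<^bsub>regular_module R\<^esub> y = x \<oplus>\<^bsub>R\<^esub> y" "a \<odot>\<^bsub>regular_module R\<^esub> x = a \<otimes>\<^bsub>R\<^esub> x"
  by (simp_all add: regular_module_def)

lemma free_module_simps [simp]:
  "u \<in> carrier (free_module R n) \<longleftrightarrow> u \<in> extensional {..<n} \<and> (\<forall>i<n. u i \<in> carrier R)"
  "\<zero>\<^bsub>free_module R n\<^esub> = (\<lambda>i\<in>{..<n}. \<zero>\<^bsub>R\<^esub>)"
  "u \<oplus>\<^bsub>free_module R n\<^esub> v = (\<lambda>i\<in>{..<n}. u i \<oplus>\<^bsub>R\<^esub> v i)"
  "a \<odot>\<^bsub>free_module R n\<^esub> u = (\<lambda>i\<in>{..<n}. a \<otimes>\<^bsub>R\<^esub> u i)"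
  by (auto simp: free_module_def PiE_iff)

lemma left_module_free: "ring R \<Longrightarrow> left_module R (free_module R n)"
proof -
  assume "ring R"
  then interpret ring R .
  note ext = extensionalityI[where A = "{..<n}"]
  show ?thesis
  proof (rule left_moduleI)
    fix x assume "x \<in> carrier (free_module R n)"
    then show "\<exists>y\<in>carrier (free_module R n). y \<oplus>\<^bsub>free_module R n\<^esub> x = \<zero>\<^bsub>free_module R n\<^esub>"
      by (intro bexI[of _ "\<lambda>i\<in>{..<n}. \<ominus>\<^bsub>R\<^esub> x i"]) (auto simp: l_neg intro!: ext)
  next
    show "x \<oplus>\<^bsub>free_module R n\<^esub> y = y \<oplus>\<^bsub>free_module R n\<^esub> x"
      if "x \<in> carrier (free_module R n)" "y \<in> carrier (free_module R n)" for x y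
      using that by (auto intro!: ext a_comm)
  qed (auto simp: l_distr r_distr m_assoc a_assoc ring_axioms intro!: ext)
qed

section \<open>Finite sums and dual bases\<close>

lemma (in left_module) finsum_smult:
  assumes "finite I" "a \<in> carrier R" "f \<in> I \<rightarrow> carrier M"
  shows "a \<odot>\<^bsub>M\<^esub> finsum M f I = finsum M (\<lambda>i. a \<odot>\<^bsub>M\<^esub> f i) I"
  using assms(1,3)
proof (induction I)
  case (insert i I)
  then have "(\<lambda>i. a \<odot>\<^bsub>M\<^esub> f i) \<in> insert i I \<rightarrow> carrier M" using assms(2) by auto
  then show ?case using insert assms(2) by (simp add: Pi_def smult_r_distr)
qed (simp add: assms)

text \<open>The dual basis form of finitely generated projectivity. It makes maps out of
  \<open>P\<close> computable from their values on the \<open>e i\<close>, which a retraction of a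
  free module does not show directly.\<close>

definition dual_basis ::
  "('r, 'c) ring_scheme \<Rightarrow> ('r, 'p, 'd) module_scheme \<Rightarrow> nat \<Rightarrow> (nat \<Rightarrow> 'p) \<Rightarrow> (nat \<Rightarrow> 'p \<Rightarrow> 'r) \<Rightarrow> bool"
  where "dual_basis R P n e \<epsilon> \<longleftrightarrow> (\<forall>i<n. e i \<in> carrier P \<and> lin R P (regular_module R) (\<epsilon> i)) \<and>
    (\<forall>x\<in>carrier P. finsum P (\<lambda>i. \<epsilon> i x \<odot>\<^bsub>P\<^esub> e i) {..<n} = x)"

text \<open>The coefficients \<open>\<epsilon> i x\<close> are themselves linear in
  \<open>x\<close>, so any choice of vectors \<open>y i\<close> yields a linear map. With coordinate
  functions it gives maps out of free modules, with a dual basis maps out of projective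
  ones.\<close>

lemma lin_finsum_smult:
  fixes n :: nat
  assumes P: "left_module R P" and N: "left_module R N"
    and \<epsilon>: "\<And>i. i < n \<Longrightarrow> lin R P (regular_module R) (\<epsilon> i)" and y: "\<And>i. i < n \<Longrightarrow> y i \<in> carrier N"
  shows "lin R P N (\<lambda>x. finsum N (\<lambda>i. \<epsilon> i x \<odot>\<^bsub>N\<^esub> y i) {..<n})"
proof -
  interpret P: left_module R P by (rule P)
  interpret N: left_module R N by (rule N)
  have e [simp]: "\<epsilon> i x \<in> carrier R" if "i < n" "x \<in> carrier P" for i x
    using linD(1)[OF \<epsilon>] that by auto
  show ?thesis
  proof (rule linI)
    fix x z assume x: "x \<in> carrier P" and z: "z \<in> carrier P"
    show "finsum N (\<lambda>i. \<epsilon> i x \<odot>\<^bsub>N\<^esub> y i) {..<n} \<in> carrier N"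
      using x y by (auto intro!: N.finsum_closed)
    have "finsum N (\<lambda>i. \<epsilon> i (x \<oplus>\<^bsub>P\<^esub> z) \<odot>\<^bsub>N\<^esub> y i) {..<n} =
        finsum N (\<lambda>i. \<epsilon> i x \<odot>\<^bsub>N\<^esub> y i \<oplus>\<^bsub>N\<^esub> \<epsilon> i z \<odot>\<^bsub>N\<^esub> y i) {..<n}"
      using x z y linD(2)[OF \<epsilon>] by (intro N.finsum_cong') (auto simp: N.smult_l_distr)
    also have "\<dots> = finsum N (\<lambda>i. \<epsilon> i x \<odot>\<^bsub>N\<^esub> y i) {..<n} \<oplus>\<^bsub>N\<^esub> finsum N (\<lambda>i. \<epsilon> i z \<odot>\<^bsub>N\<^esub> y i) {..<n}"
      using x y z by (intro N.finsum_addf) auto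
    finally show "finsum N (\<lambda>i. \<epsilon> i (x \<oplus>\<^bsub>P\<^esub> z) \<odot>\<^bsub>N\<^esub> y i) {..<n} = \<dots>" .
  next
    fix a x assume a: "a \<in> carrier R" and x: "x \<in> carrier P"
    have "finsum N (\<lambda>i. \<epsilon> i (a \<odot>\<^bsub>P\<^esub> x) \<odot>\<^bsub>N\<^esub> y i) {..<n} =
        finsum N (\<lambda>i. a \<odot>\<^bsub>N\<^esub> (\<epsilon> i x \<odot>\<^bsub>N\<^esub> y i)) {..<n}"
      using x a y linD(3)[OF \<epsilon>] by (intro N.finsum_cong') (auto simp: N.smult_assoc)
    also have "\<dots> = a \<odot>\<^bsub>N\<^esub> finsum N (\<lambda>i. \<epsilon> i x \<odot>\<^bsub>N\<^esub> y i) {..<n}"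
      using x y a by (intro N.finsum_smult[symmetric]) auto
    finally show "finsum N (\<lambda>i. \<epsilon> i (a \<odot>\<^bsub>P\<^esub> x) \<odot>\<^bsub>N\<^esub> y i) {..<n} = \<dots>" .
  qed
qed

lemma dual_basis_lin:
  assumes "left_module R P" "left_module R N" "dual_basis R P n e \<epsilon>" "lin R P N h" "x \<in> carrier P"
  shows "finsum N (\<lambda>i. \<epsilon> i x \<odot>\<^bsub>N\<^esub> h (e i)) {..<n} = h x"
proof -
  interpret P: left_module R P by fact
  interpret N: left_module R N by fact
  have e: "\<epsilon> i x \<in> carrier R" "e i \<in> carrier P" if "i < n" for i
    using assms(3,5) that linD(1) unfolding dual_basis_def by fastforce+
  have "h x = h (finsum P (\<lambda>i. \<epsilon> i x \<odot>\<^bsub>P\<^esub> e i) {..<n})" using assms(3,5) by (simp add: dual_basis_def)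
  also have "\<dots> = finsum N (\<lambda>i. h (\<epsilon> i x \<odot>\<^bsub>P\<^esub> e i)) {..<n}"
    using e by (intro lin_finsum[OF assms(1,2,4)]) auto
  also have "\<dots> = finsum N (\<lambda>i. \<epsilon> i x \<odot>\<^bsub>N\<^esub> h (e i)) {..<n}"
    using e linD[OF assms(4)] by (intro N.finsum_cong') auto
  finally show ?thesis by simp
qed

lemma lin_proj: "i < n \<Longrightarrow> lin R (free_module R n) (regular_module R) (\<lambda>u. u i)"
  by (rule linI) auto

lemma free_module_dual_basis:
  assumes "ring R"
  shows "dual_basis R (free_module R n) n (\<lambda>j. \<lambda>i\<in>{..<n}. if i = j then \<one>\<^bsub>R\<^esub> else \<zero>\<^bsub>R\<^esub>) (\<lambda>i u. u i)"
proof -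
  interpret ring R by fact
  let ?F = "free_module R n" and ?e = "\<lambda>j. \<lambda>i\<in>{..<n}. if i = j then \<one>\<^bsub>R\<^esub> else \<zero>\<^bsub>R\<^esub>"
  interpret F: left_module R ?F by (rule left_module_free[OF assms])
  interpret R: left_module R "regular_module R" by (rule left_module_regular[OF assms])
  have "finsum ?F (\<lambda>j. x j \<odot>\<^bsub>?F\<^esub> ?e j) {..<n} = x" (is "?s = x") if x: "x \<in> carrier ?F" for x
  proof (rule extensionalityI[of _ "{..<n}"])
    have c: "(\<lambda>j. x j \<odot>\<^bsub>?F\<^esub> ?e j) \<in> {..<n} \<rightarrow> carrier ?F"
      using x by (intro Pi_I F.smult_closed) auto
    then have "?s \<in> carrier ?F" by (rule F.finsum_closed)
    then show "?s \<in> extensional {..<n}" "x \<in> extensional {..<n}" using x by auto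
    fix i assume i: "i \<in> {..<n}"
    then have "?s i = finsum (regular_module R) (\<lambda>j. (x j \<odot>\<^bsub>?F\<^esub> ?e j) i) {..<n}"
      by (intro lin_finsum[OF F.left_module_axioms R.left_module_axioms lin_proj _ c]) auto
    also have "\<dots> = finsum (regular_module R) (\<lambda>j. if i = j then x i else \<zero>\<^bsub>regular_module R\<^esub>) {..<n}"
      using x i by (intro R.finsum_cong') auto
    also have "\<dots> = x i" using x i
      by (intro R.finsum_singleton[of i "{..<n}" "\<lambda>_. x i", simplified]) auto
    finally show "?s i = x i" .
  qed
  then show ?thesis by (auto simp: dual_basis_def lin_proj)
qed

lemma fg_projectiveE:
  assumes "fg_projective R P"
  obtains n i p where "lin R P (free_module R n) i" "lin R (free_module R n) P p"
    "\<And>x. x \<in> carrier P \<Longrightarrow> p (i x) = x"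
  using assms unfolding fg_projective_def by (auto simp: module_homs_iff)

lemma fg_projectiveI:
  assumes P: "left_module R P" and i: "lin R P (free_module R n) i" and p: "lin R (free_module R n) P p"
    and pi: "\<And>x. x \<in> carrier P \<Longrightarrow> p (i x) = x"
  shows "fg_projective R P"
proof -
  have F: "left_module R (free_module R n)" using P left_module_free by (auto simp: left_module_def)
  have "\<forall>x\<in>carrier P. restrict p (carrier (free_module R n)) (restrict i (carrier P) x) = x"
    using pi linD(1)[OF i] by simp
  then show ?thesis
    unfolding fg_projective_def using P restrict_module_homs[OF P i] restrict_module_homs[OF F p] by blast
qed

text \<open>For a retraction \<open>p i = id\<close> through a free module take \<open>e j\<close>
  to be \<open>p\<close> of the unit vectors and \<open>\<epsilon> j\<close> the coordinates of
  \<open>i\<close>. Conversely the \<open>\<epsilon> j\<close> together form \<open>i\<close>, and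
  the combinations of the \<open>e j\<close> form \<open>p\<close>.\<close>

lemma fg_projective_iff_dual_basis:
  "fg_projective R P \<longleftrightarrow> left_module R P \<and> (\<exists>n e \<epsilon>. dual_basis R P n e \<epsilon>)"
proof (intro iffI conjI; (elim conjE exE)?)
  assume P: "fg_projective R P"
  then show "left_module R P" by (simp add: fg_projective_def)
  then interpret P: left_module R P .
  obtain n i p where i: "lin R P (free_module R n) i" and p: "lin R (free_module R n) P p"
    and pi: "\<And>x. x \<in> carrier P \<Longrightarrow> p (i x) = x"
    using fg_projectiveE[OF P] by blast
  let ?e = "\<lambda>j. \<lambda>i\<in>{..<n}. if i = j then \<one>\<^bsub>R\<^esub> else \<zero>\<^bsub>R\<^esub>"
  note F = free_module_dual_basis[OF P.R.ring_axioms, of n]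
  have "dual_basis R P n (\<lambda>j. p (?e j)) (\<lambda>j x. i x j)"
    unfolding dual_basis_def
  proof (intro conjI allI impI ballI)
    fix j assume "j < n"
    then show "p (?e j) \<in> carrier P" by (intro linD(1)[OF p]) auto
    show "lin R P (regular_module R) (\<lambda>x. i x j)" using lin_comp[OF i lin_proj[OF \<open>j < n\<close>]] .
  next
    fix x assume "x \<in> carrier P"
    then show "finsum P (\<lambda>j. i x j \<odot>\<^bsub>P\<^esub> p (?e j)) {..<n} = x"
      using dual_basis_lin[OF left_module_free[OF P.R.ring_axioms] P.left_module_axioms F p, of "i x"]
        pi linD(1)[OF i] by simp
  qed
  then show "\<exists>n e \<epsilon>. dual_basis R P n e \<epsilon>" by blast
next
  fix n e \<epsilon> assume "left_module R P" and b: "dual_basis R P n e \<epsilon>"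
  then interpret P: left_module R P by simp
  note F = left_module_free[OF P.R.ring_axioms, of n]
  have "lin R P (free_module R n) (\<lambda>x. \<lambda>j\<in>{..<n}. \<epsilon> j x)"
    using b by (auto simp: dual_basis_def lin_def)
  moreover have "lin R (free_module R n) P (\<lambda>u. finsum P (\<lambda>j. u j \<odot>\<^bsub>P\<^esub> e j) {..<n})"
    using b by (intro lin_finsum_smult[OF F P.left_module_axioms] lin_proj) (auto simp: dual_basis_def)
  moreover have "finsum P (\<lambda>j. (\<lambda>j\<in>{..<n}. \<epsilon> j x) j \<odot>\<^bsub>P\<^esub> e j) {..<n} = x" if "x \<in> carrier P" for x
  proof -
    have "finsum P (\<lambda>j. (\<lambda>j\<in>{..<n}. \<epsilon> j x) j \<odot>\<^bsub>P\<^esub> e j) {..<n} = finsum P (\<lambda>j. \<epsilon> j x \<odot>\<^bsub>P\<^esub> e j) {..<n}"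
      using b that linD(1)[of R P "regular_module R"]
      by (intro P.finsum_cong') (auto simp: dual_basis_def)
    then show ?thesis using b that by (simp add: dual_basis_def)
  qed
  ultimately show "fg_projective R P" by (intro fg_projectiveI[OF P.left_module_axioms])
qed

lemma fg_projective_left_module: "fg_projective R P \<Longrightarrow> left_module R P"
  by (simp add: fg_projective_def)

lemma fg_projective_retract:
  assumes "fg_projective R P" "left_module R Q" "lin R Q P i" "lin R P Q p"
    "\<And>x. x \<in> carrier Q \<Longrightarrow> p (i x) = x"
  shows "fg_projective R Q"
proof -
  obtain n j q where "lin R P (free_module R n) j" "lin R (free_module R n) P q"
    "\<And>x. x \<in> carrier P \<Longrightarrow> q (j x) = x"
    using fg_projectiveE[OF assms(1)] by blast
  then show ?thesis
    using fg_projectiveI[OF assms(2) lin_comp[OF assms(3), of "free_module R n" j]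
        lin_comp[OF _ assms(4), of "free_module R n" q]] assms(5) linD(1)[OF assms(3)] by simp
qed

text \<open>Choose preimages \<open>l i\<close> of the \<open>h (e i)\<close> under \<open>g\<close>
  and use them as the images of the \<open>e i\<close>; the dual basis expansion makes the composite
  with \<open>g\<close> equal to \<open>h\<close>.\<close>

lemma projective_lift:
  assumes P: "fg_projective R P" and "left_module R L" "left_module R N"
    and h: "lin R P N h" and g: "lin R L N g" and sub: "\<And>x. x \<in> carrier P \<Longrightarrow> h x \<in> g ` carrier L"
  obtains h' where "lin R P L h'" "\<And>x. x \<in> carrier P \<Longrightarrow> g (h' x) = h x"
proof -
  interpret P: left_module R P using P by (rule fg_projective_left_module)
  interpret L: left_module R L by fact
  interpret N: left_module R N by fact
  obtain n e \<epsilon> where b: "dual_basis R P n e \<epsilon>" using P by (auto simp: fg_projective_iff_dual_basis)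
  have "\<forall>i. \<exists>l. i < n \<longrightarrow> l \<in> carrier L \<and> g l = h (e i)"
  proof
    fix i show "\<exists>l. i < n \<longrightarrow> l \<in> carrier L \<and> g l = h (e i)"
    proof (cases "i < n")
      case True
      then have "h (e i) \<in> g ` carrier L" using sub b by (simp add: dual_basis_def)
      then show ?thesis by auto
    qed simp
  qed
  then obtain l where l: "\<And>i. i < n \<Longrightarrow> l i \<in> carrier L \<and> g (l i) = h (e i)" by metis
  have \<epsilon>: "\<epsilon> i x \<in> carrier R" if "i < n" "x \<in> carrier P" for i x
    using b that linD(1)[of R P "regular_module R"] by (auto simp: dual_basis_def)
  let ?h = "\<lambda>x. finsum L (\<lambda>i. \<epsilon> i x \<odot>\<^bsub>L\<^esub> l i) {..<n}"
  show thesis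
  proof
    show "lin R P L ?h"
      using b l by (intro lin_finsum_smult) (auto simp: dual_basis_def P.left_module_axioms L.left_module_axioms)
    fix x assume x: "x \<in> carrier P"
    have "g (?h x) = finsum N (\<lambda>i. g (\<epsilon> i x \<odot>\<^bsub>L\<^esub> l i)) {..<n}"
      using \<epsilon> x l by (intro lin_finsum[OF assms(2,3) g]) auto
    also have "\<dots> = finsum N (\<lambda>i. \<epsilon> i x \<odot>\<^bsub>N\<^esub> h (e i)) {..<n}"
      using \<epsilon> x l linD[OF g] by (intro N.finsum_cong') (auto, metis N.smult_closed)
    also have "\<dots> = h x" using dual_basis_lin[OF P.left_module_axioms assms(3) b h x] .
    finally show "g (?h x) = h x" .
  qed
qed

section \<open>Direct sums of modules\<close>

lemma dsum_module_simps [simp]: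
  "carrier (dsum_module M N) = carrier M \<times> carrier N" "\<zero>\<^bsub>dsum_module M N\<^esub> = (\<zero>\<^bsub>M\<^esub>, \<zero>\<^bsub>N\<^esub>)"
  "(x, y) \<oplus>\<^bsub>dsum_module M N\<^esub> (x', y') = (x \<oplus>\<^bsub>M\<^esub> x', y \<oplus>\<^bsub>N\<^esub> y')"
  "a \<odot>\<^bsub>dsum_module M N\<^esub> (x, y) = (a \<odot>\<^bsub>M\<^esub> x, a \<odot>\<^bsub>N\<^esub> y)"
  by (simp_all add: dsum_module_def)

lemma left_module_dsum:
  assumes "left_module R M" "left_module R N" shows "left_module R (dsum_module M N)"
proof -
  interpret M: left_module R M by fact
  interpret N: left_module R N by fact
  show ?thesis
  proof (rule left_moduleI)
    fix x assume "x \<in> carrier (dsum_module M N)"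
    then show "\<exists>y\<in>carrier (dsum_module M N). y \<oplus>\<^bsub>dsum_module M N\<^esub> x = \<zero>\<^bsub>dsum_module M N\<^esub>"
      by (intro bexI[of _ "(\<ominus>\<^bsub>M\<^esub> fst x, \<ominus>\<^bsub>N\<^esub> snd x)"]) (auto simp: M.l_neg N.l_neg)
  qed (auto simp: M.smult_l_distr N.smult_l_distr M.smult_r_distr N.smult_r_distr M.smult_assoc N.smult_assoc
      M.a_assoc N.a_assoc M.R.ring_axioms intro: M.a_comm N.a_comm)
qed

lemma fg_projective_dsum:
  assumes "fg_projective R P" "fg_projective R Q" shows "fg_projective R (dsum_module P Q)"
proof -
  interpret P: left_module R P using assms(1) by (rule fg_projective_left_module)
  interpret Q: left_module R Q using assms(2) by (rule fg_projective_left_module)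
  note PQ = left_module_dsum[OF P.left_module_axioms Q.left_module_axioms]
  obtain n i p where i: "lin R P (free_module R n) i" and p: "lin R (free_module R n) P p"
    and pi: "\<And>x. x \<in> carrier P \<Longrightarrow> p (i x) = x"
    using fg_projectiveE[OF assms(1)] by blast
  obtain m j q where j: "lin R Q (free_module R m) j" and q: "lin R (free_module R m) Q q"
    and qj: "\<And>x. x \<in> carrier Q \<Longrightarrow> q (j x) = x"
    using fg_projectiveE[OF assms(2)] by blast
  have i1: "i x \<in> carrier (free_module R n)" if "x \<in> carrier P" for x using linD(1)[OF i that] .
  have j1: "j x \<in> carrier (free_module R m)" if "x \<in> carrier Q" for x using linD(1)[OF j that] .
  \<comment> \<open>The free module of rank \<open>n + m\<close> holds the coordinates of
    \<open>i x\<close> in its first \<open>n\<close> places and those of \<open>j y\<close>, shifted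
    by \<open>n\<close>, in the rest; \<open>?p\<close> cuts a vector at the same place.\<close>
  let ?i = "\<lambda>(x, y). \<lambda>k\<in>{..<n + m}. if k < n then i x k else j y (k - n)"
  let ?p = "\<lambda>u. (p (restrict u {..<n}), q (\<lambda>k\<in>{..<m}. u (k + n)))"
  have "?i z \<in> carrier (free_module R (n + m))" if "z \<in> carrier P \<times> carrier Q" for z
    using that i1 j1 by (auto split: prod.splits)
  then have "lin R (dsum_module P Q) (free_module R (n + m)) ?i"
    using linD[OF i] linD[OF j]
    by (intro linI) (auto simp: not_less less_diff_conv2 intro!: restrict_ext)
  moreover have "lin R (free_module R (n + m)) (dsum_module P Q) ?p"
  proof -
    have 1: "lin R (free_module R (n + m)) (free_module R n) (\<lambda>u. restrict u {..<n})"
      by (rule linI) (auto intro!: restrict_ext)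
    have 2: "lin R (free_module R (n + m)) (free_module R m) (\<lambda>u. \<lambda>k\<in>{..<m}. u (k + n))"
      by (rule linI) (auto intro!: restrict_ext)
    show ?thesis using linD[OF lin_comp[OF 1 p]] linD[OF lin_comp[OF 2 q]]
      by (intro linI) (simp_all del: free_module_simps)
  qed
  moreover have "?p (?i z) = z" if "z \<in> carrier (dsum_module P Q)" for z
  proof -
    obtain x y where z: "z = (x, y)" "x \<in> carrier P" "y \<in> carrier Q"
      using \<open>z \<in> carrier (dsum_module P Q)\<close> by (cases z) auto
    have "restrict (?i z) {..<n} = i x" "(\<lambda>k\<in>{..<m}. ?i z (k + n)) = j y"
      using i1[OF z(2)] j1[OF z(3)] z(1)
      by (auto simp: restrict_def extensional_def fun_eq_iff)
    then show ?thesis using z pi qj by simp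
  qed
  ultimately show ?thesis
    using fg_projective_retract[OF _ PQ, of "free_module R (n + m)" ?i ?p]
      left_module_free[OF P.R.ring_axioms] free_module_dual_basis[OF P.R.ring_axioms, of "n + m"]
    by (auto simp: fg_projective_iff_dual_basis)
qed

text \<open>
  A map \<open>\<pi>\<close> onto \<open>M\<close> has superfluous kernel iff no proper submodule is mapped onto \<open>M\<close>; this form
  avoids sums of submodules.
\<close>

definition essential_epi ::
  "('r, 'b) ring_scheme \<Rightarrow> ('r, 'p, 'c) module_scheme \<Rightarrow> ('p \<Rightarrow> 'm) \<Rightarrow> ('r, 'm, 'd) module_scheme \<Rightarrow> bool"
  where "essential_epi R P \<pi> M \<longleftrightarrow> lin R P M \<pi> \<and> \<pi> ` carrier P = carrier M \<and>
    (\<forall>L. submodule L R P \<and> \<pi> ` L = carrier M \<longrightarrow> L = carrier P)"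

text \<open>Two elements with the same image differ by an element of the kernel, so \<open>L\<close>
  together with the kernel exhausts \<open>P\<close> exactly when \<open>\<pi>\<close> maps
  \<open>L\<close> onto \<open>M\<close>. Superfluity of the kernel thus becomes the last clause of
  \<open>essential_epi\<close>.\<close>

lemma projective_cover_iff:
  assumes M: "left_module R M"
  shows "projective_cover R P \<pi> M \<longleftrightarrow>
    fg_projective R P \<and> essential_epi R P \<pi> M \<and> \<pi> \<in> extensional (carrier P)"
proof -
  have "superfluous R P (a_kernel P M \<pi>) \<longleftrightarrow> (\<forall>L. submodule L R P \<and> \<pi> ` L = carrier M \<longrightarrow> L = carrier P)"
    if P: "left_module R P" and \<pi>: "lin R P M \<pi>" and s: "\<pi> ` carrier P = carrier M"
  proof -
    interpret M: left_module R M by (rule M)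
    interpret P: left_module R P by (rule P)
    note k = lin_kernel[OF P M \<pi>]
    have "L <+>\<^bsub>P\<^esub> a_kernel P M \<pi> = carrier P \<longleftrightarrow> \<pi> ` L = carrier M" if "submodule L R P" for L
    proof
      note L = P.submoduleD[OF that]
      assume *: "L <+>\<^bsub>P\<^esub> a_kernel P M \<pi> = carrier P"
      show "\<pi> ` L = carrier M"
      proof
        show "\<pi> ` L \<subseteq> carrier M" using L(1) s by auto
        show "carrier M \<subseteq> \<pi> ` L"
        proof
          fix y assume "y \<in> carrier M"
          then obtain x where "x \<in> carrier P" "y = \<pi> x" using s by auto
          moreover have "x \<in> L <+>\<^bsub>P\<^esub> a_kernel P M \<pi>" using * \<open>x \<in> carrier P\<close> by simp
          then obtain l z where "x = l \<oplus>\<^bsub>P\<^esub> z" "l \<in> L" "z \<in> carrier P" "\<pi> z = \<zero>\<^bsub>M\<^esub>"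
            unfolding P.mem_set_add k by blast
          ultimately show "y \<in> \<pi> ` L" using L(1) linD[OF \<pi>] by (auto simp: subset_eq)
        qed
      qed
    next
      note L = P.submoduleD[OF that]
      assume *: "\<pi> ` L = carrier M"
      have "x \<in> L <+>\<^bsub>P\<^esub> a_kernel P M \<pi>" if x: "x \<in> carrier P" for x
      proof -
        have "\<pi> x \<in> \<pi> ` L" using * x linD(1)[OF \<pi>] by simp
        then obtain l where "l \<in> L" "\<pi> x = \<pi> l" by auto
        then have "x = l \<oplus>\<^bsub>P\<^esub> (x \<ominus>\<^bsub>P\<^esub> l)" "x \<ominus>\<^bsub>P\<^esub> l \<in> a_kernel P M \<pi>"
          using L(1) x linD(1)[OF \<pi>]
          by (auto simp: k P.diff_add_cancel lin_diff[OF P M \<pi>] M.diff_zero_iff subset_eq)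
        then show ?thesis using \<open>l \<in> L\<close> by (auto simp: P.mem_set_add)
      qed
      moreover have "L <+>\<^bsub>P\<^esub> a_kernel P M \<pi> \<subseteq> carrier P" using L(1) by (auto simp: P.mem_set_add k subset_eq)
      ultimately show "L <+>\<^bsub>P\<^esub> a_kernel P M \<pi> = carrier P" by blast
    qed
    then show ?thesis using submodule_kernel[OF P M \<pi>] unfolding superfluous_def k by blast
  qed
  then show ?thesis
    using fg_projective_left_module[of R P] unfolding projective_cover_def essential_epi_def module_homs_iff
    by blast
qed

section \<open>Essential epimorphisms and the uniqueness of projective covers\<close>

lemma essential_epiD:
  assumes "essential_epi R P \<pi> M"
  shows "lin R P M \<pi>" "\<pi> ` carrier P = carrier M"
    "submodule L R P \<Longrightarrow> \<pi> ` L = carrier M \<Longrightarrow> L = carrier P"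
  using assms by (auto simp: essential_epi_def)

lemma essential_epi_cong:
  assumes "left_module R P" "essential_epi R P \<pi> M" "\<And>x. x \<in> carrier P \<Longrightarrow> \<pi> x = \<pi>' x"
  shows "essential_epi R P \<pi>' M"
proof -
  interpret P: left_module R P by fact
  have "\<pi>' ` L = \<pi> ` L" if "L \<subseteq> carrier P" for L using assms(3) that by (intro image_cong) auto
  then show ?thesis using assms lin_cong[OF assms(1), of \<pi> \<pi>'] P.submoduleD(1)
    unfolding essential_epi_def by (metis order_refl)
qed

text \<open>The image of \<open>h\<close> is a submodule that \<open>\<pi>\<close> maps onto
  \<open>M\<close>, so it cannot be proper.\<close>

lemma essential_epi_lift_surj:
  assumes "left_module R L" "left_module R P" "left_module R M" "essential_epi R P \<pi> M" "lin R L P h"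
    "(\<lambda>x. \<pi> (h x)) ` carrier L = carrier M"
  shows "h ` carrier L = carrier P"
proof -
  interpret L: left_module R L by fact
  show ?thesis
    using essential_epiD(3)[OF assms(4) submodule_image[OF assms(1,2,5) L.submodule_carrier]] assms(6)
    by (simp add: image_image)
qed

text \<open>A lift \<open>h\<close> of \<open>\<pi>\<close> over \<open>\<pi>'\<close> is onto
  because \<open>\<pi>'\<close> is essential, and it has a section \<open>s\<close> because
  \<open>P'\<close> is projective. The section is a lift of \<open>\<pi>'\<close> over
  \<open>\<pi>\<close>, hence onto as well, which makes \<open>h\<close> injective.\<close>

lemma projective_cover_unique:
  assumes P: "fg_projective R P" and P': "fg_projective R P'" and M: "left_module R M"
    and \<pi>: "essential_epi R P \<pi> M" and \<pi>': "essential_epi R P' \<pi>' M"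
  obtains h where "lin R P P' h" "bij_betw h (carrier P) (carrier P')"
    "\<And>x. x \<in> carrier P \<Longrightarrow> \<pi>' (h x) = \<pi> x"
proof -
  note Pm = fg_projective_left_module[OF P] and Pm' = fg_projective_left_module[OF P']
  note e = essential_epiD[OF \<pi>] and e' = essential_epiD[OF \<pi>']
  obtain h where h: "lin R P P' h" "\<And>x. x \<in> carrier P \<Longrightarrow> \<pi>' (h x) = \<pi> x"
    using projective_lift[OF P Pm' M e(1) e'(1)] e'(2) linD(1)[OF e(1)] by metis
  have hs: "h ` carrier P = carrier P'"
    using essential_epi_lift_surj[OF Pm Pm' M \<pi>' h(1)] h(2) e(2) by (simp cong: image_cong)
  obtain s where s: "lin R P' P s" "\<And>x. x \<in> carrier P' \<Longrightarrow> h (s x) = x"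
    using projective_lift[OF P' Pm Pm' lin_id h(1)] hs by metis
  have "\<pi> (s x) = \<pi>' x" if "x \<in> carrier P'" for x using h(2)[of "s x"] s that linD(1)[OF s(1)] by simp
  then have ss: "s ` carrier P' = carrier P"
    using essential_epi_lift_surj[OF Pm' Pm M \<pi> s(1)] e'(2) by (simp cong: image_cong)
  have "inj_on h (carrier P)"
  proof (rule inj_on_inverseI)
    fix x assume "x \<in> carrier P"
    then obtain y where "y \<in> carrier P'" "x = s y" unfolding ss[symmetric] by blast
    then show "s (h x) = x" using s(2) by simp
  qed
  then show thesis using that[OF h(1)] hs h(2) by (simp add: bij_betw_def)
qed

lemma essential_epi_precompose_iso:
  assumes "left_module R P" "left_module R P'" "left_module R M" "essential_epi R P \<pi> M"
    "lin R P' P \<theta>" "bij_betw \<theta> (carrier P') (carrier P)"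
  shows "essential_epi R P' (\<lambda>x. \<pi> (\<theta> x)) M"
proof -
  interpret P: left_module R P by fact
  interpret P': left_module R P' by fact
  note e = essential_epiD[OF assms(4)]
  have s: "\<theta> ` carrier P' = carrier P" using assms(6) by (simp add: bij_betw_def)
  show ?thesis unfolding essential_epi_def
  proof (intro conjI allI impI; (elim conjE)?)
    show "lin R P' M (\<lambda>x. \<pi> (\<theta> x))" using lin_comp[OF assms(5) e(1)] .
    show "(\<lambda>x. \<pi> (\<theta> x)) ` carrier P' = carrier M" using s e(2) by (metis image_image)
    fix L assume L: "submodule L R P'" "(\<lambda>x. \<pi> (\<theta> x)) ` L = carrier M"
    have "\<theta> ` L = carrier P"
      using e(3)[OF submodule_image[OF assms(2,1,5) L(1)]] L(2) by (simp add: image_image)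
    then show "L = carrier P'" using assms(6) P'.submoduleD(1)[OF L(1)]
      by (metis bij_betw_def inj_on_image_eq_iff order_refl)
  qed
qed

lemma essential_epi_postcompose_iso:
  assumes "left_module R M" "left_module R M'" "essential_epi R P \<pi> M"
    "lin R M M' \<theta>" "bij_betw \<theta> (carrier M) (carrier M')" "left_module R P"
  shows "essential_epi R P (\<lambda>x. \<theta> (\<pi> x)) M'"
proof -
  interpret P: left_module R P by fact
  note e = essential_epiD[OF assms(3)]
  have s: "\<theta> ` carrier M = carrier M'" using assms(5) by (simp add: bij_betw_def)
  show ?thesis unfolding essential_epi_def
  proof (intro conjI allI impI; (elim conjE)?)
    show "lin R P M' (\<lambda>x. \<theta> (\<pi> x))" using lin_comp[OF e(1) assms(4)] .
    show "(\<lambda>x. \<theta> (\<pi> x)) ` carrier P = carrier M'" using s e(2) by (metis image_image)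
    fix L assume L: "submodule L R P" "(\<lambda>x. \<theta> (\<pi> x)) ` L = carrier M'"
    have "\<theta> ` \<pi> ` L = \<theta> ` carrier M" using L(2) s by (simp add: image_image)
    moreover have "\<pi> ` L \<subseteq> carrier M" using P.submoduleD(1)[OF L(1)] e(2) by auto
    ultimately have "\<pi> ` L = carrier M" using assms(5)
      by (metis bij_betw_def inj_on_image_eq_iff order_refl)
    then show "L = carrier P" using e(3) L(1) by blast
  qed
qed

section \<open>Minimal projective presentations\<close>

text \<open>The presentation in terms of \<open>essential_epi\<close>, free of the extensionality of
  \<open>f\<close> and \<open>g\<close>, and with the kernel of \<open>g\<close> as a set that can
  be rewritten.\<close>

definition min_pres ::
  "('r, 'b) ring_scheme \<Rightarrow> ('r, 'p, 'c) module_scheme \<Rightarrow> ('p \<Rightarrow> 'q) \<Rightarrow> ('r, 'q, 'd) module_scheme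
    \<Rightarrow> ('q \<Rightarrow> 'n) \<Rightarrow> ('r, 'n, 'e) module_scheme \<Rightarrow> bool" where
  "min_pres R P1 f P0 g N \<longleftrightarrow> fg_projective R P0 \<and> fg_projective R P1 \<and> essential_epi R P0 g N \<and>
    essential_epi R P1 f (P0\<lparr>carrier := {x \<in> carrier P0. g x = \<zero>\<^bsub>N\<^esub>}\<rparr>)"

lemma min_proj_presentation_iff:
  assumes N: "left_module R N"
  shows "min_proj_presentation R P1 f P0 g N \<longleftrightarrow>
    min_pres R P1 f P0 g N \<and> f \<in> extensional (carrier P1) \<and> g \<in> extensional (carrier P0)"
proof (cases "fg_projective R P0 \<and> essential_epi R P0 g N")
  case True
  then have g: "lin R P0 N g" and P0: "left_module R P0"
    using essential_epiD(1) fg_projective_left_module by auto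
  interpret P0: left_module R P0 by (rule P0)
  have k: "a_kernel P0 N g = {x \<in> carrier P0. g x = \<zero>\<^bsub>N\<^esub>}" using lin_kernel[OF P0 N g] .
  have "left_module R (P0\<lparr>carrier := {x \<in> carrier P0. g x = \<zero>\<^bsub>N\<^esub>}\<rparr>)"
    using P0.left_module_submodule[OF submodule_kernel[OF P0 N g]] .
  then show ?thesis
    using True projective_cover_iff[OF N] projective_cover_iff
    unfolding min_proj_presentation_def min_pres_def k by blast
qed (auto simp: min_proj_presentation_def min_pres_def projective_cover_iff[OF N])

text \<open>The condition that stands for the vanishing of maps from \<open>Y\<close> into the
  translate. It involves neither quotients nor duals, so it can be moved along isomorphisms of
  presentations and along the adjunction of \<open>T\<close>.\<close>

definition hom_surj ::
  "('r, 'b) ring_scheme \<Rightarrow> ('r, 'p, 'c) module_scheme \<Rightarrow> ('p \<Rightarrow> 'q) \<Rightarrow> ('r, 'q, 'd) module_scheme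
    \<Rightarrow> ('r, 'y, 'e) module_scheme \<Rightarrow> bool" where
  "hom_surj R P1 f P0 Y \<longleftrightarrow>
    (\<forall>\<psi>. lin R P1 Y \<psi> \<longrightarrow> (\<exists>\<phi>. lin R P0 Y \<phi> \<and> (\<forall>x\<in>carrier P1. \<psi> x = \<phi> (f x))))"

text \<open>Uniqueness of covers gives an isomorphism \<open>a\<close> of \<open>P0'\<close> with
  \<open>P0\<close> over \<open>N\<close>; it carries kernel to kernel, and a second use of
  uniqueness gives \<open>b\<close> over \<open>a\<close>. The resulting commutative square
  transports extensions. This frees the criterion from the presentation chosen inside
  \<open>AR_translate\<close>.\<close>

lemma hom_surj_min_pres_unique:
  assumes N: "left_module R N"
    and p: "min_pres R P1 f P0 g N" and p': "min_pres R P1' f' P0' g' N" and s: "hom_surj R P1 f P0 Y"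
  shows "hom_surj R P1' f' P0' Y"
proof -
  have P: "fg_projective R P0" "fg_projective R P1" "fg_projective R P0'" "fg_projective R P1'"
    and g: "essential_epi R P0 g N" and g': "essential_epi R P0' g' N"
    using p p' by (simp_all add: min_pres_def)
  note lm = P[THEN fg_projective_left_module]
  interpret P0: left_module R P0 by (rule lm)
  interpret P0': left_module R P0' by (rule lm)
  let ?K = "P0\<lparr>carrier := {x \<in> carrier P0. g x = \<zero>\<^bsub>N\<^esub>}\<rparr>"
  let ?K' = "P0'\<lparr>carrier := {x \<in> carrier P0'. g' x = \<zero>\<^bsub>N\<^esub>}\<rparr>"
  have K: "left_module R ?K" "left_module R ?K'"
    by (intro P0.left_module_submodule P0'.left_module_submodule
        submodule_kernel[OF _ N essential_epiD(1)] P0.left_module_axioms P0'.left_module_axioms g g')+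
  have f: "essential_epi R P1 f ?K" and f': "essential_epi R P1' f' ?K'"
    using p p' by (simp_all add: min_pres_def)
  obtain a where a: "lin R P0' P0 a" "bij_betw a (carrier P0') (carrier P0)"
    and ga: "\<And>x. x \<in> carrier P0' \<Longrightarrow> g (a x) = g' x"
    using projective_cover_unique[OF P(3,1) N g' g] by blast
  have aK: "bij_betw a (carrier ?K') (carrier ?K)"
    unfolding bij_betw_def
  proof
    show "inj_on a (carrier ?K')" using a(2) by (auto simp: bij_betw_def inj_on_def)
    have aP: "a ` carrier P0' = carrier P0" using a(2) by (simp add: bij_betw_def)
    show "a ` carrier ?K' = carrier ?K"
    proof
      show "a ` carrier ?K' \<subseteq> carrier ?K" using ga aP by auto
      show "carrier ?K \<subseteq> a ` carrier ?K'"
      proof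
        fix y assume y: "y \<in> carrier ?K"
        then obtain x where "x \<in> carrier P0'" "y = a x" using aP by auto
        then show "y \<in> a ` carrier ?K'" using y ga by auto
      qed
    qed
  qed
  have "lin R ?K' ?K a" using a(1) ga by (auto simp: lin_def)
  \<comment> \<open>After composition with \<open>a\<close>, both \<open>P1'\<close> and
    \<open>P1\<close> cover the same kernel \<open>?K\<close>, so they can be compared.\<close>
  then have "essential_epi R P1' (\<lambda>x. a (f' x)) ?K"
    using essential_epi_postcompose_iso[OF K(2,1) f' _ aK lm(4)] by blast
  then obtain b where b: "lin R P1' P1 b" "bij_betw b (carrier P1') (carrier P1)"
    and fb: "\<And>x. x \<in> carrier P1' \<Longrightarrow> f (b x) = a (f' x)"
    using projective_cover_unique[OF P(4,2) K(1) _ f] by blast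
  let ?c = "inv_into (carrier P1') b"
  show ?thesis unfolding hom_surj_def
  proof (intro allI impI)
    fix \<psi> assume "lin R P1' Y \<psi>"
    then obtain \<phi> where \<phi>: "lin R P0 Y \<phi>" "\<And>x. x \<in> carrier P1 \<Longrightarrow> \<psi> (?c x) = \<phi> (f x)"
      using s lin_comp[OF lin_inv_into[OF lm(4,2) b]] unfolding hom_surj_def by blast
    \<comment> \<open>A map on \<open>P1'\<close> is carried to \<open>P1\<close> by the inverse of
      \<open>b\<close>, extended over \<open>f\<close>, and the extension is brought back along
      \<open>a\<close>.\<close>
    have "\<psi> x = \<phi> (a (f' x))" if "x \<in> carrier P1'" for x
      using \<phi>(2)[of "b x"] b that fb linD(1)[OF b(1)] by (simp add: bij_betw_def)
    then show "\<exists>\<phi>. lin R P0' Y \<phi> \<and> (\<forall>x\<in>carrier P1'. \<psi> x = \<phi> (f' x))"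
      using lin_comp[OF a(1) \<phi>(1)] by blast
  qed
qed

text \<open>The embedding into a free module has as its image an isomorphic submodule, whose
  elements are functions on the naturals as required by the carrier type in
  \<open>AR_translate\<close>.\<close>

lemma fg_projective_standard_copy:
  fixes P :: "('r, 'p, 'd) module_scheme"
  assumes "fg_projective R P"
  obtains P' :: "('r, nat \<Rightarrow> 'r) module" and \<theta>
  where "fg_projective R P'" "lin R P' P \<theta>" "bij_betw \<theta> (carrier P') (carrier P)"
proof -
  have P: "left_module R P" by (rule fg_projective_left_module[OF assms])
  interpret P: left_module R P by (rule P)
  obtain n i p where i: "lin R P (free_module R n) i" and p: "lin R (free_module R n) P p"
    and pi: "\<And>x. x \<in> carrier P \<Longrightarrow> p (i x) = x" using fg_projectiveE[OF assms] by blast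
  note F = left_module_free[OF P.R.ring_axioms, of n]
  interpret F: left_module R "free_module R n" by (rule F)
  let ?P = "(free_module R n)\<lparr>carrier := i ` carrier P\<rparr>"
  have im: "submodule (i ` carrier P) R (free_module R n)"
    using submodule_image[OF P F i P.submodule_carrier] .
  have sub: "i ` carrier P \<subseteq> carrier (free_module R n)" using F.submoduleD(1)[OF im] .
  have pP: "lin R ?P P p" using lin_restrict_carrier(2)[OF p sub order_refl] .
  have iP: "lin R P ?P i" using i by (auto simp: lin_def)
  have "bij_betw p (carrier ?P) (carrier P)"
    by (rule bij_betw_byWitness[of _ i]) (use pi in auto)
  moreover have "i (p x) = x" if "x \<in> carrier ?P" for x using that pi by auto
  ultimately show thesis
    using that[of ?P p] fg_projective_retract[OF assms F.left_module_submodule[OF im] pP iP] pP by blast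
qed

text \<open>The choice in \<open>AR_translate\<close> ranges over one fixed carrier type. It picks
  an actual presentation only if one exists there, so a presentation found on any type is copied
  over.\<close>

lemma min_pres_standard_copy:
  fixes N :: "('r, 'n, 'e) module_scheme"
  assumes N: "left_module R N" and p: "min_pres R P1 f P0 g N"
  shows "\<exists>(P1' :: ('r, nat \<Rightarrow> 'r) module) f' (P0' :: ('r, nat \<Rightarrow> 'r) module) g'.
    min_proj_presentation R P1' f' P0' g' N"
proof -
  have P: "fg_projective R P0" "fg_projective R P1" and g: "essential_epi R P0 g N"
    using p by (simp_all add: min_pres_def)
  note lm = P[THEN fg_projective_left_module]
  obtain P0' :: "('r, nat \<Rightarrow> 'r) module" and \<theta>0 where P0': "fg_projective R P0'"
    and \<theta>0: "lin R P0' P0 \<theta>0" "bij_betw \<theta>0 (carrier P0') (carrier P0)"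
    by (rule fg_projective_standard_copy[OF P(1)])
  obtain P1' :: "('r, nat \<Rightarrow> 'r) module" and \<theta>1 where P1': "fg_projective R P1'"
    and \<theta>1: "lin R P1' P1 \<theta>1" "bij_betw \<theta>1 (carrier P1') (carrier P1)"
    by (rule fg_projective_standard_copy[OF P(2)])
  note lm' = fg_projective_left_module[OF P0'] fg_projective_left_module[OF P1']
  interpret P0: left_module R P0 by (rule lm)
  interpret P0': left_module R P0' by (rule lm')
  let ?g = "restrict (\<lambda>x. g (\<theta>0 x)) (carrier P0')"
  have g': "essential_epi R P0' ?g N"
    using essential_epi_cong[OF lm'(1) essential_epi_precompose_iso[OF lm(1) lm'(1) N g \<theta>0]] by simp
  let ?K = "P0\<lparr>carrier := {x \<in> carrier P0. g x = \<zero>\<^bsub>N\<^esub>}\<rparr>"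
  let ?K' = "P0'\<lparr>carrier := {x \<in> carrier P0'. ?g x = \<zero>\<^bsub>N\<^esub>}\<rparr>"
  have K: "left_module R ?K" "left_module R ?K'"
    by (intro P0.left_module_submodule P0'.left_module_submodule
        submodule_kernel[OF _ N essential_epiD(1)] P0.left_module_axioms P0'.left_module_axioms g g')+
  \<comment> \<open>The inverse of \<open>\<theta>0\<close> identifies the old kernel with the new
    one, so that \<open>f\<close> followed by it covers the new kernel.\<close>
  let ?i = "inv_into (carrier P0') \<theta>0"
  note i = lin_inv_into[OF lm'(1) lm(1) \<theta>0] bij_betw_inv_into[OF \<theta>0(2)]
  have i1: "\<theta>0 (?i x) = x" "?i x \<in> carrier P0'" if "x \<in> carrier P0" for x
    using that \<theta>0(2) i(2) by (auto simp: bij_betw_inv_into_right bij_betw_apply)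
  have i2: "?i (\<theta>0 x) = x" "\<theta>0 x \<in> carrier P0" if "x \<in> carrier P0'" for x
    using that \<theta>0(2) by (auto simp: bij_betw_inv_into_left bij_betw_apply)
  have iK: "lin R ?K ?K' ?i" using i(1) i1 by (auto simp: lin_def)
  have "bij_betw ?i (carrier ?K) (carrier ?K')"
    by (rule bij_betw_byWitness[of _ \<theta>0]) (use i1 i2 in auto)
  moreover have "essential_epi R P1' (\<lambda>x. f (\<theta>1 x)) ?K"
    using essential_epi_precompose_iso[OF lm(2) lm'(2) K(1) _ \<theta>1] p by (simp add: min_pres_def)
  ultimately have "essential_epi R P1' (\<lambda>x. ?i (f (\<theta>1 x))) ?K'"
    using essential_epi_postcompose_iso[OF K _ iK _ lm'(2)] by blast
  then have "essential_epi R P1' (restrict (\<lambda>x. ?i (f (\<theta>1 x))) (carrier P1')) ?K'"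
    by (rule essential_epi_cong[OF lm'(2)]) simp
  then have "min_proj_presentation R P1' (restrict (\<lambda>x. ?i (f (\<theta>1 x))) (carrier P1')) P0' ?g N"
    using g' P0' P1' by (simp add: min_proj_presentation_iff[OF N] min_pres_def)
  then show ?thesis by blast
qed

section \<open>Homomorphisms into the Auslander--Reiten translate\<close>

text \<open>Stated for additive maps of abelian groups because it is applied to evaluation at a
  point and to maps between modules over different rings.\<close>

lemma additive_finsum:
  assumes G: "abelian_group G" and H: "abelian_group H" and I: "finite I" "u \<in> I \<rightarrow> carrier G"
    and h: "\<And>x. x \<in> carrier G \<Longrightarrow> h x \<in> carrier H"
      "\<And>x y. x \<in> carrier G \<Longrightarrow> y \<in> carrier G \<Longrightarrow> h (x \<oplus>\<^bsub>G\<^esub> y) = h x \<oplus>\<^bsub>H\<^esub> h y"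
  shows "h (finsum G u I) = finsum H (\<lambda>i. h (u i)) I"
proof -
  interpret G: abelian_group G by (rule G)
  interpret H: abelian_group H by (rule H)
  have h0: "h \<zero>\<^bsub>G\<^esub> = \<zero>\<^bsub>H\<^esub>"
    using h(2)[of "\<zero>\<^bsub>G\<^esub>" "\<zero>\<^bsub>G\<^esub>"] h(1)[of "\<zero>\<^bsub>G\<^esub>"] H.add.r_cancel_one' by force
  from I show ?thesis
  proof (induction I)
    case (insert i I)
    then have "(\<lambda>i. h (u i)) \<in> insert i I \<rightarrow> carrier H" using h(1) by auto
    then show ?case using insert h by (simp add: Pi_def)
  qed (simp add: h0)
qed

text \<open>Zorn's lemma gives a subspace \<open>U\<close> maximal among those that contain
  \<open>W\<close> and miss \<open>v\<close>. Modulo \<open>U\<close> every vector is a unique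
  multiple of \<open>v\<close>, and that coefficient is the functional.\<close>

lemma (in left_module) separating_functional:
  assumes R: "field R" and W: "submodule W R M" and v: "v \<in> carrier M" "v \<notin> W"
  obtains \<mu> where "lin R M (regular_module R) \<mu>" "\<And>w. w \<in> W \<Longrightarrow> \<mu> w = \<zero>\<^bsub>R\<^esub>" "\<mu> v = \<one>\<^bsub>R\<^esub>"
proof -
  interpret F: field R by (rule R)
  let ?\<A> = "{U. submodule U R M \<and> W \<subseteq> U \<and> v \<notin> U}"
  have "\<exists>U\<in>?\<A>. \<forall>X\<in>?\<A>. U \<subseteq> X \<longrightarrow> X = U"
  proof (rule subset_Zorn_nonempty)
    show "?\<A> \<noteq> {}" using W v by blast
    fix C assume C: "C \<noteq> {}" "subset.chain ?\<A> C"
    then have sub: "\<And>U. U \<in> C \<Longrightarrow> submodule U R M" "\<And>U. U \<in> C \<Longrightarrow> W \<subseteq> U \<and> v \<notin> U"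
      by (auto simp: subset.chain_def)
    have "submodule (\<Union>C) R M"
    proof (rule submoduleI)
      show "\<Union>C \<subseteq> carrier M" using sub(1)[THEN submoduleD(1)] by blast
      show "\<zero>\<^bsub>M\<^esub> \<in> \<Union>C" using sub(1)[THEN submoduleD(2)] C(1) by blast
      show "a \<odot>\<^bsub>M\<^esub> x \<in> \<Union>C" if "a \<in> carrier R" "x \<in> \<Union>C" for a x
        using sub(1)[THEN submoduleD(4)] that by blast
      show "x \<oplus>\<^bsub>M\<^esub> y \<in> \<Union>C" if xy: "x \<in> \<Union>C" "y \<in> \<Union>C" for x y
      proof -
        obtain U V where "U \<in> C" "V \<in> C" "x \<in> U" "y \<in> V" using xy by blast
        moreover have "U \<subseteq> V \<or> V \<subseteq> U" using C(2) calculation by (auto simp: subset.chain_def)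
        ultimately show ?thesis using sub(1)[THEN submoduleD(3)] by blast
      qed
    qed
    then show "\<Union>C \<in> ?\<A>" using sub C(1) by blast
  qed
  then obtain U where UA: "U \<in> ?\<A>" and UX: "\<forall>X\<in>?\<A>. U \<subseteq> X \<longrightarrow> X = U" by (rule bexE)
  then have U: "submodule U R M" "W \<subseteq> U" "v \<notin> U" by simp_all
  have max: "X = U" if "submodule X R M" "U \<subseteq> X" "v \<notin> X" for X
    using UX U(2) that by (metis (no_types, lifting) mem_Collect_eq subset_trans)
  note u = submoduleD[OF U(1)]
  have ex: "\<exists>k\<in>carrier R. x \<ominus>\<^bsub>M\<^esub> k \<odot>\<^bsub>M\<^esub> v \<in> U" if x: "x \<in> carrier M" for x
  proof (cases "x \<in> U")
    case True
    then show ?thesis using v by (intro bexI[of _ "\<zero>\<^bsub>R\<^esub>"]) (auto simp: x)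
  next
    case False
    \<comment> \<open>This is \<open>U\<close> enlarged by the line through \<open>x\<close>. As
      \<open>x\<close> lies outside \<open>U\<close>, maximality forces it to contain
      \<open>v\<close>.\<close>
    let ?X = "{u \<oplus>\<^bsub>M\<^esub> k \<odot>\<^bsub>M\<^esub> x | u k. u \<in> U \<and> k \<in> carrier R}"
    have "submodule ?X R M"
    proof (rule submoduleI)
      show "?X \<subseteq> carrier M" using u(1) x by auto
      show "\<zero>\<^bsub>M\<^esub> \<in> ?X" using u(2) x by (force intro: exI[of _ "\<zero>\<^bsub>M\<^esub>"] exI[of _ "\<zero>\<^bsub>R\<^esub>"])
      show "a \<odot>\<^bsub>M\<^esub> y \<in> ?X" if a: "a \<in> carrier R" and yz: "y \<in> ?X" for a y
      proof -
        obtain w k where y: "y = w \<oplus>\<^bsub>M\<^esub> k \<odot>\<^bsub>M\<^esub> x" "w \<in> U" "k \<in> carrier R" using yz by blast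
        then have "a \<odot>\<^bsub>M\<^esub> y = a \<odot>\<^bsub>M\<^esub> w \<oplus>\<^bsub>M\<^esub> (a \<otimes>\<^bsub>R\<^esub> k) \<odot>\<^bsub>M\<^esub> x"
          using u(1) x a by (auto simp: smult_r_distr smult_assoc)
        then show ?thesis using y a u(4) by blast
      qed
      show "y \<oplus>\<^bsub>M\<^esub> z \<in> ?X" if yz: "y \<in> ?X" "z \<in> ?X" for y z
      proof -
        obtain w k w' k' where y: "y = w \<oplus>\<^bsub>M\<^esub> k \<odot>\<^bsub>M\<^esub> x" "w \<in> U" "k \<in> carrier R"
          "z = w' \<oplus>\<^bsub>M\<^esub> k' \<odot>\<^bsub>M\<^esub> x" "w' \<in> U" "k' \<in> carrier R" using yz by blast
        then have "y \<oplus>\<^bsub>M\<^esub> z = (w \<oplus>\<^bsub>M\<^esub> w') \<oplus>\<^bsub>M\<^esub> (k \<oplus>\<^bsub>R\<^esub> k') \<odot>\<^bsub>M\<^esub> x"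
          using u(1) x by (auto simp: smult_l_distr M.a_ac subset_eq)
        then show ?thesis using y u(3) by blast
      qed
    qed
    moreover have "U \<subseteq> ?X"
    proof
      fix w assume "w \<in> U"
      then have "w = w \<oplus>\<^bsub>M\<^esub> \<zero>\<^bsub>R\<^esub> \<odot>\<^bsub>M\<^esub> x" using u(1) x by auto
      then show "w \<in> ?X" using \<open>w \<in> U\<close> by blast
    qed
    moreover have "x = \<zero>\<^bsub>M\<^esub> \<oplus>\<^bsub>M\<^esub> \<one>\<^bsub>R\<^esub> \<odot>\<^bsub>M\<^esub> x" using x by simp
    then have "x \<in> ?X" using u(2) by blast
    ultimately have "v \<in> ?X" using max[of ?X] False by blast
    then obtain w k where w: "v = w \<oplus>\<^bsub>M\<^esub> k \<odot>\<^bsub>M\<^esub> x" "w \<in> U" "k \<in> carrier R" by blast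
    \<comment> \<open>Otherwise \<open>v\<close> would lie in \<open>U\<close>. Dividing the
      expression for \<open>v\<close> by \<open>k\<close> shows \<open>x\<close> to be a multiple of
      \<open>v\<close> modulo \<open>U\<close>.\<close>
    have "k \<noteq> \<zero>\<^bsub>R\<^esub>" using w U(3) x u(1) by auto
    then have k: "inv\<^bsub>R\<^esub> k \<in> carrier R" "inv\<^bsub>R\<^esub> k \<otimes>\<^bsub>R\<^esub> k = \<one>\<^bsub>R\<^esub>"
      using w(3) F.field_Units by auto
    have wM: "w \<in> carrier M" using w u(1) by auto
    have "inv\<^bsub>R\<^esub> k \<odot>\<^bsub>M\<^esub> v = inv\<^bsub>R\<^esub> k \<odot>\<^bsub>M\<^esub> w \<oplus>\<^bsub>M\<^esub> x"
      unfolding w(1) using wM w(3) k x by (simp add: smult_r_distr flip: smult_assoc)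
    then have "x \<ominus>\<^bsub>M\<^esub> inv\<^bsub>R\<^esub> k \<odot>\<^bsub>M\<^esub> v = \<ominus>\<^bsub>M\<^esub> (inv\<^bsub>R\<^esub> k \<odot>\<^bsub>M\<^esub> w)"
      using wM k x by (simp add: M.minus_eq M.minus_add M.a_ac M.r_neg1 M.r_neg2 M.r_neg)
    then show ?thesis using u(4,5) w(2) k(1) by (intro bexI[of _ "inv\<^bsub>R\<^esub> k"]) auto
  qed
  \<comment> \<open>Two distinct coefficients would put a nonzero multiple of \<open>v\<close> into
    \<open>U\<close>. Uniqueness also yields the linearity of \<open>\<mu>\<close>, since sums and
    multiples of coefficients are coefficients.\<close>
  have un: "k = k'" if "k \<in> carrier R" "k' \<in> carrier R" "x \<ominus>\<^bsub>M\<^esub> k \<odot>\<^bsub>M\<^esub> v \<in> U" "x \<ominus>\<^bsub>M\<^esub> k' \<odot>\<^bsub>M\<^esub> v \<in> U"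
    "x \<in> carrier M" for x k k'
  proof (rule ccontr)
    assume "k \<noteq> k'"
    let ?d = "k \<ominus>\<^bsub>R\<^esub> k'"
    have d: "?d \<in> carrier R" "?d \<noteq> \<zero>\<^bsub>R\<^esub>" using that \<open>k \<noteq> k'\<close> by (auto simp: R.diff_zero_iff)
    then have i: "inv\<^bsub>R\<^esub> ?d \<in> carrier R" "inv\<^bsub>R\<^esub> ?d \<otimes>\<^bsub>R\<^esub> ?d = \<one>\<^bsub>R\<^esub>"
      using F.field_Units by auto
    have "(x \<ominus>\<^bsub>M\<^esub> k' \<odot>\<^bsub>M\<^esub> v) \<ominus>\<^bsub>M\<^esub> (x \<ominus>\<^bsub>M\<^esub> k \<odot>\<^bsub>M\<^esub> v) = ?d \<odot>\<^bsub>M\<^esub> v"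
      using that v(1)
      by (simp add: M.minus_eq M.minus_add smult_l_distr smult_l_minus M.a_ac R.minus_eq M.r_neg1 M.r_neg2 M.r_neg)
    then have "?d \<odot>\<^bsub>M\<^esub> v \<in> U" using u(6)[OF that(4,3)] by simp
    then have "inv\<^bsub>R\<^esub> ?d \<odot>\<^bsub>M\<^esub> (?d \<odot>\<^bsub>M\<^esub> v) \<in> U" using u(4) i by blast
    then show False using U(3) i d v(1) by (simp flip: smult_assoc)
  qed
  define \<mu> where "\<mu> x = (THE k. k \<in> carrier R \<and> x \<ominus>\<^bsub>M\<^esub> k \<odot>\<^bsub>M\<^esub> v \<in> U)" for x
  have \<mu>: "\<mu> x \<in> carrier R \<and> x \<ominus>\<^bsub>M\<^esub> \<mu> x \<odot>\<^bsub>M\<^esub> v \<in> U" if "x \<in> carrier M" for x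
    unfolding \<mu>_def by (rule theI') (use ex[OF that] un that in blast)
  have \<mu>I: "\<mu> x = k" if "x \<in> carrier M" "k \<in> carrier R" "x \<ominus>\<^bsub>M\<^esub> k \<odot>\<^bsub>M\<^esub> v \<in> U" for x k
    using un[of "\<mu> x" k x] \<mu> that by blast
  show thesis
  proof
    show "lin R M (regular_module R) \<mu>"
    proof (rule linI)
      fix x y assume xy: "x \<in> carrier M" "y \<in> carrier M"
      note l = \<mu>[OF xy(1)] \<mu>[OF xy(2)]
      have "(x \<oplus>\<^bsub>M\<^esub> y) \<ominus>\<^bsub>M\<^esub> (\<mu> x \<oplus>\<^bsub>R\<^esub> \<mu> y) \<odot>\<^bsub>M\<^esub> v =
          (x \<ominus>\<^bsub>M\<^esub> \<mu> x \<odot>\<^bsub>M\<^esub> v) \<oplus>\<^bsub>M\<^esub> (y \<ominus>\<^bsub>M\<^esub> \<mu> y \<odot>\<^bsub>M\<^esub> v)"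
        using xy l v(1) by (simp add: M.minus_eq M.minus_add smult_l_distr M.a_ac)
      then show "\<mu> (x \<oplus>\<^bsub>M\<^esub> y) = \<mu> x \<oplus>\<^bsub>regular_module R\<^esub> \<mu> y"
        using l xy u(3) by (simp add: \<mu>I)
    next
      fix a x assume ax: "a \<in> carrier R" "x \<in> carrier M"
      note l = \<mu>[OF ax(2)]
      have "a \<odot>\<^bsub>M\<^esub> x \<ominus>\<^bsub>M\<^esub> (a \<otimes>\<^bsub>R\<^esub> \<mu> x) \<odot>\<^bsub>M\<^esub> v = a \<odot>\<^bsub>M\<^esub> (x \<ominus>\<^bsub>M\<^esub> \<mu> x \<odot>\<^bsub>M\<^esub> v)"
        using ax l v(1) by (simp add: smult_r_diff smult_assoc)
      then show "\<mu> (a \<odot>\<^bsub>M\<^esub> x) = a \<odot>\<^bsub>regular_module R\<^esub> \<mu> x"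
        using l ax u(4) by (simp add: \<mu>I)
    qed (use \<mu> in auto)
    show "\<mu> w = \<zero>\<^bsub>R\<^esub>" if "w \<in> W" for w
      using that U(2) u(1) v(1) by (intro \<mu>I) (auto simp: M.minus_eq subset_eq)
    show "\<mu> v = \<one>\<^bsub>R\<^esub>"
      using v(1) u(2) by (intro \<mu>I) (auto simp: M.minus_eq M.r_neg)
  qed
qed

text \<open>A field acting centrally through \<open>\<iota>\<close> is what turns Hom over
  \<open>B\<close> into a vector space over \<open>K\<close>. Both \<open>A\<close> and its trivial
  extension are instances.\<close>

locale central_field = K?: field K + B?: ring B
  for K :: "('k, 'c) ring_scheme" and B :: "('k, 'b, 'd) module_scheme" +
  fixes \<iota>
  defines "\<iota> k \<equiv> k \<odot>\<^bsub>B\<^esub> \<one>\<^bsub>B\<^esub>"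
  assumes scalar_closed [simp]: "k \<in> carrier K \<Longrightarrow> \<iota> k \<in> carrier B"
    and scalar_add: "\<lbrakk>k \<in> carrier K; l \<in> carrier K\<rbrakk> \<Longrightarrow> \<iota> (k \<oplus>\<^bsub>K\<^esub> l) = \<iota> k \<oplus>\<^bsub>B\<^esub> \<iota> l"
    and scalar_mult: "\<lbrakk>k \<in> carrier K; l \<in> carrier K\<rbrakk> \<Longrightarrow> \<iota> (k \<otimes>\<^bsub>K\<^esub> l) = \<iota> k \<otimes>\<^bsub>B\<^esub> \<iota> l"
    and scalar_one: "\<iota> \<one>\<^bsub>K\<^esub> = \<one>\<^bsub>B\<^esub>"
    and scalar_central: "\<lbrakk>k \<in> carrier K; b \<in> carrier B\<rbrakk> \<Longrightarrow> \<iota> k \<otimes>\<^bsub>B\<^esub> b = b \<otimes>\<^bsub>B\<^esub> \<iota> k"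

text \<open>Serves as the vector space on which a functional is chosen that separates a map
  \<open>P1\<close> to \<open>Y\<close> from those that extend over \<open>f\<close>.\<close>

definition hom_module ::
  "('k, 'c) ring_scheme \<Rightarrow> ('k, 'b, 'd) module_scheme \<Rightarrow> ('b, 'p, 'e) module_scheme
    \<Rightarrow> ('b, 'y, 'f) module_scheme \<Rightarrow> ('k, 'p \<Rightarrow> 'y) module" where
  "hom_module K B P Y = mk_module (module_homs B P Y) (\<lambda>x\<in>carrier P. \<zero>\<^bsub>Y\<^esub>)
    (\<lambda>\<phi> \<psi>. \<lambda>x\<in>carrier P. \<phi> x \<oplus>\<^bsub>Y\<^esub> \<psi> x)
    (\<lambda>k \<phi>. \<lambda>x\<in>carrier P. (k \<odot>\<^bsub>B\<^esub> \<one>\<^bsub>B\<^esub>) \<odot>\<^bsub>Y\<^esub> \<phi> x)"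

lemma module_homs_closed:
  assumes "left_module R P" "left_module R Y"
  shows "(\<lambda>x\<in>carrier P. \<zero>\<^bsub>Y\<^esub>) \<in> module_homs R P Y"
    and "\<phi> \<in> module_homs R P Y \<Longrightarrow> \<psi> \<in> module_homs R P Y \<Longrightarrow>
      (\<lambda>x\<in>carrier P. \<phi> x \<oplus>\<^bsub>Y\<^esub> \<psi> x) \<in> module_homs R P Y"
    and "\<phi> \<in> module_homs R P Y \<Longrightarrow> (\<lambda>x\<in>carrier P. \<ominus>\<^bsub>Y\<^esub> \<phi> x) \<in> module_homs R P Y"
proof -
  interpret P: left_module R P by fact
  interpret Y: left_module R Y by fact
  show "(\<lambda>x\<in>carrier P. \<zero>\<^bsub>Y\<^esub>) \<in> module_homs R P Y"
    by (intro restrict_module_homs assms linI) auto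
  show "(\<lambda>x\<in>carrier P. \<phi> x \<oplus>\<^bsub>Y\<^esub> \<psi> x) \<in> module_homs R P Y"
    if "\<phi> \<in> module_homs R P Y" "\<psi> \<in> module_homs R P Y"
    using that linD[of R P Y \<phi>] linD[of R P Y \<psi>] unfolding module_homs_iff[of \<phi>] module_homs_iff[of \<psi>]
    by (intro restrict_module_homs assms linI) (auto simp: Y.a_ac Y.smult_r_distr)
  show "(\<lambda>x\<in>carrier P. \<ominus>\<^bsub>Y\<^esub> \<phi> x) \<in> module_homs R P Y"
    if "\<phi> \<in> module_homs R P Y"
    using that linD[of R P Y \<phi>] unfolding module_homs_iff[of \<phi>]
    by (intro restrict_module_homs assms linI) (auto simp: Y.minus_add Y.smult_r_minus)
qed

lemma module_homs_mem: "\<phi> \<in> module_homs R P Y \<Longrightarrow> x \<in> carrier P \<Longrightarrow> \<phi> x \<in> carrier Y"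
  by (auto simp: module_homs_def)

lemma module_homs_eqI:
  assumes "\<phi> \<in> extensional (carrier P)" "\<psi> \<in> extensional (carrier P)" "\<And>x. x \<in> carrier P \<Longrightarrow> \<phi> x = \<psi> x"
  shows "\<phi> = \<psi>"
  using assms by (intro extensionalityI) (auto simp: module_homs_iff)

lemma module_homs_ext: "\<phi> \<in> module_homs R P Y \<Longrightarrow> \<phi> \<in> extensional (carrier P)"
  by (simp add: module_homs_iff)

lemma hom_abelian_group:
  assumes P: "left_module R P" and Y: "left_module R Y"
  shows "abelian_group (mk_module (module_homs R P Y) (\<lambda>x\<in>carrier P. \<zero>\<^bsub>Y\<^esub>)
    (\<lambda>\<phi> \<psi>. \<lambda>x\<in>carrier P. \<phi> x \<oplus>\<^bsub>Y\<^esub> \<psi> x) s)"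
proof -
  interpret Y: left_module R Y by fact
  note c = module_homs_closed[OF P Y] and m = module_homs_mem[of _ R P Y]
    and eqI = module_homs_eqI[of _ P]
  show ?thesis
  proof (rule abelian_groupI, unfold mk_module_simps)
    show "(\<lambda>x\<in>carrier P. \<zero>\<^bsub>Y\<^esub>) \<in> module_homs R P Y" by (rule c)
    fix \<phi> assume \<phi>: "\<phi> \<in> module_homs R P Y"
    show "(\<lambda>x\<in>carrier P. (\<lambda>x\<in>carrier P. \<zero>\<^bsub>Y\<^esub>) x \<oplus>\<^bsub>Y\<^esub> \<phi> x) = \<phi>"
      using \<phi> by (intro eqI) (auto simp: m module_homs_ext)
    show "\<exists>y\<in>module_homs R P Y. (\<lambda>x\<in>carrier P. y x \<oplus>\<^bsub>Y\<^esub> \<phi> x) = (\<lambda>x\<in>carrier P. \<zero>\<^bsub>Y\<^esub>)"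
      using \<phi> c(3)[OF \<phi>] by (intro bexI[of _ "\<lambda>x\<in>carrier P. \<ominus>\<^bsub>Y\<^esub> \<phi> x"] eqI) (auto simp: m Y.l_neg)
    fix \<psi> assume \<psi>: "\<psi> \<in> module_homs R P Y"
    show "(\<lambda>x\<in>carrier P. \<phi> x \<oplus>\<^bsub>Y\<^esub> \<psi> x) \<in> module_homs R P Y" using c(2)[OF \<phi> \<psi>] .
    show "(\<lambda>x\<in>carrier P. \<phi> x \<oplus>\<^bsub>Y\<^esub> \<psi> x) = (\<lambda>x\<in>carrier P. \<psi> x \<oplus>\<^bsub>Y\<^esub> \<phi> x)"
      using \<phi> \<psi> by (intro eqI) (auto simp: m Y.a_comm)
    fix \<chi> assume \<chi>: "\<chi> \<in> module_homs R P Y"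
    show "(\<lambda>x\<in>carrier P. (\<lambda>x\<in>carrier P. \<phi> x \<oplus>\<^bsub>Y\<^esub> \<psi> x) x \<oplus>\<^bsub>Y\<^esub> \<chi> x) =
        (\<lambda>x\<in>carrier P. \<phi> x \<oplus>\<^bsub>Y\<^esub> (\<lambda>x\<in>carrier P. \<psi> x \<oplus>\<^bsub>Y\<^esub> \<chi> x) x)"
      using \<phi> \<psi> \<chi> by (intro eqI) (auto simp: m Y.a_assoc)
  qed
qed

text \<open>Centrality of \<open>\<iota> k\<close> is what keeps the scalar multiple of a
  \<open>B\<close>-linear map \<open>B\<close>-linear.\<close>

lemma (in central_field) left_module_hom:
  assumes P: "left_module B P" and Y: "left_module B Y"
  shows "left_module K (hom_module K B P Y)"
proof -
  interpret P: left_module B P by fact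
  interpret Y: left_module B Y by fact
  note m = module_homs_mem[of _ B P Y] and eqI = module_homs_eqI[of _ P]
  note hd = hom_module_def
  have sc: "(\<lambda>x\<in>carrier P. \<iota> k \<odot>\<^bsub>Y\<^esub> \<phi> x) \<in> module_homs B P Y"
    if "k \<in> carrier K" "\<phi> \<in> module_homs B P Y" for k \<phi>
    using that linD[of B P Y \<phi>] scalar_closed[OF that(1)] scalar_central[OF that(1)] unfolding module_homs_iff[of \<phi>]
    by (intro restrict_module_homs P Y linI) (auto simp: Y.smult_r_distr simp flip: Y.smult_assoc)
  show ?thesis
  proof (intro left_module.intro left_module_axioms.intro)
    show "ring K" by (rule K.ring_axioms)
    show "abelian_group (hom_module K B P Y)" unfolding hd by (rule hom_abelian_group[OF P Y])
    show "\<one>\<^bsub>K\<^esub> \<odot>\<^bsub>hom_module K B P Y\<^esub> \<phi> = \<phi>" if "\<phi> \<in> carrier (hom_module K B P Y)" for \<phi>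
      using that scalar_one by (intro eqI) (auto simp: hd m \<iota>_def module_homs_ext)
    fix k \<phi> assume k: "k \<in> carrier K" and \<phi>: "\<phi> \<in> carrier (hom_module K B P Y)"
    then have \<phi>': "\<phi> \<in> module_homs B P Y" by (simp add: hd)
    show "k \<odot>\<^bsub>hom_module K B P Y\<^esub> \<phi> \<in> carrier (hom_module K B P Y)"
      using sc[OF k \<phi>'] by (simp add: hd \<iota>_def)
    { fix l assume l: "l \<in> carrier K"
      show "(k \<oplus>\<^bsub>K\<^esub> l) \<odot>\<^bsub>hom_module K B P Y\<^esub> \<phi> =
          k \<odot>\<^bsub>hom_module K B P Y\<^esub> \<phi> \<oplus>\<^bsub>hom_module K B P Y\<^esub> l \<odot>\<^bsub>hom_module K B P Y\<^esub> \<phi>"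
        using \<phi>' k l scalar_add[OF k l] scalar_closed[OF k] scalar_closed[OF l]
        by (intro eqI) (auto simp: hd m \<iota>_def Y.smult_l_distr)
      show "(k \<otimes>\<^bsub>K\<^esub> l) \<odot>\<^bsub>hom_module K B P Y\<^esub> \<phi> = k \<odot>\<^bsub>hom_module K B P Y\<^esub> (l \<odot>\<^bsub>hom_module K B P Y\<^esub> \<phi>)"
        using \<phi>' k l scalar_mult[OF k l] scalar_closed[OF k] scalar_closed[OF l]
        by (intro eqI) (auto simp: hd m \<iota>_def Y.smult_assoc) }
    fix \<psi> assume \<psi>: "\<psi> \<in> carrier (hom_module K B P Y)"
    then have \<psi>': "\<psi> \<in> module_homs B P Y" by (simp add: hd)
    show "k \<odot>\<^bsub>hom_module K B P Y\<^esub> (\<phi> \<oplus>\<^bsub>hom_module K B P Y\<^esub> \<psi>) =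
        k \<odot>\<^bsub>hom_module K B P Y\<^esub> \<phi> \<oplus>\<^bsub>hom_module K B P Y\<^esub> k \<odot>\<^bsub>hom_module K B P Y\<^esub> \<psi>"
      using \<phi>' \<psi>' scalar_closed[OF k] by (intro eqI) (auto simp: hd m \<iota>_def Y.smult_r_distr)
  qed
qed

text \<open>Stated for an abelian group with an additive action that preserves \<open>H\<close>,
  since \<open>hom_dual\<close> is a right module and hence no \<open>left_module\<close> over the
  same ring. The action on a coset is written as a union over representatives; all of them give the
  same coset.\<close>

lemma quotient_module_facts:
  assumes D: "abelian_group D" and H: "additive_subgroup H D"
  shows "carrier (quotient_module D H) = (\<lambda>\<phi>. H +>\<^bsub>D\<^esub> \<phi>) ` carrier D"
    and "\<lbrakk>\<phi> \<in> carrier D; \<psi> \<in> carrier D\<rbrakk> \<Longrightarrow> H +>\<^bsub>D\<^esub> \<phi> = H +>\<^bsub>D\<^esub> \<psi> \<longleftrightarrow> \<phi> \<ominus>\<^bsub>D\<^esub> \<psi> \<in> H"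
    and "\<lbrakk>\<phi> \<in> carrier D; \<psi> \<in> carrier D\<rbrakk> \<Longrightarrow>
      (H +>\<^bsub>D\<^esub> \<phi>) \<oplus>\<^bsub>quotient_module D H\<^esub> (H +>\<^bsub>D\<^esub> \<psi>) = H +>\<^bsub>D\<^esub> (\<phi> \<oplus>\<^bsub>D\<^esub> \<psi>)"
    and "\<lbrakk>\<phi> \<in> carrier D; \<And>c d. c \<in> carrier D \<Longrightarrow> d \<in> carrier D \<Longrightarrow> b \<odot>\<^bsub>D\<^esub> (c \<oplus>\<^bsub>D\<^esub> d) = b \<odot>\<^bsub>D\<^esub> c \<oplus>\<^bsub>D\<^esub> b \<odot>\<^bsub>D\<^esub> d;
      \<And>c. c \<in> carrier D \<Longrightarrow> b \<odot>\<^bsub>D\<^esub> c \<in> carrier D; \<And>c. c \<in> H \<Longrightarrow> b \<odot>\<^bsub>D\<^esub> c \<in> H\<rbrakk> \<Longrightarrow>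
      b \<odot>\<^bsub>quotient_module D H\<^esub> (H +>\<^bsub>D\<^esub> \<phi>) = H +>\<^bsub>D\<^esub> (b \<odot>\<^bsub>D\<^esub> \<phi>)"
proof -
  interpret D: abelian_group D by fact
  interpret H: abelian_subgroup H D using D H by (rule abelian_subgroupI3[rotated])
  show "carrier (quotient_module D H) = (\<lambda>\<phi>. H +>\<^bsub>D\<^esub> \<phi>) ` carrier D"
    by (auto simp: quotient_module_def A_RCOSETS_def')
  have eq: "H +>\<^bsub>D\<^esub> \<phi> = H +>\<^bsub>D\<^esub> \<psi> \<longleftrightarrow> \<phi> \<ominus>\<^bsub>D\<^esub> \<psi> \<in> H" if "\<phi> \<in> carrier D" "\<psi> \<in> carrier D" for \<phi> \<psi>
    using that H.a_rcos_module[of \<psi> \<phi>] H.a_rcos_self[of \<phi>] H.a_repr_independence'[of \<phi> \<psi>]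
    by (metis D.minus_eq)
  show "H +>\<^bsub>D\<^esub> \<phi> = H +>\<^bsub>D\<^esub> \<psi> \<longleftrightarrow> \<phi> \<ominus>\<^bsub>D\<^esub> \<psi> \<in> H" if "\<phi> \<in> carrier D" "\<psi> \<in> carrier D"
    using eq that .
  show "(H +>\<^bsub>D\<^esub> \<phi>) \<oplus>\<^bsub>quotient_module D H\<^esub> (H +>\<^bsub>D\<^esub> \<psi>) = H +>\<^bsub>D\<^esub> (\<phi> \<oplus>\<^bsub>D\<^esub> \<psi>)"
    if "\<phi> \<in> carrier D" "\<psi> \<in> carrier D"
    using that by (simp add: quotient_module_def H.a_rcos_sum)
  show "b \<odot>\<^bsub>quotient_module D H\<^esub> (H +>\<^bsub>D\<^esub> \<phi>) = H +>\<^bsub>D\<^esub> (b \<odot>\<^bsub>D\<^esub> \<phi>)"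
    if \<phi>: "\<phi> \<in> carrier D" and
      add: "\<And>c d. c \<in> carrier D \<Longrightarrow> d \<in> carrier D \<Longrightarrow> b \<odot>\<^bsub>D\<^esub> (c \<oplus>\<^bsub>D\<^esub> d) = b \<odot>\<^bsub>D\<^esub> c \<oplus>\<^bsub>D\<^esub> b \<odot>\<^bsub>D\<^esub> d"
      and c: "\<And>c. c \<in> carrier D \<Longrightarrow> b \<odot>\<^bsub>D\<^esub> c \<in> carrier D" and h: "\<And>c. c \<in> H \<Longrightarrow> b \<odot>\<^bsub>D\<^esub> c \<in> H"
  proof -
    have "H +>\<^bsub>D\<^esub> (b \<odot>\<^bsub>D\<^esub> d) = H +>\<^bsub>D\<^esub> (b \<odot>\<^bsub>D\<^esub> \<phi>)" if "d \<in> H +>\<^bsub>D\<^esub> \<phi>" for d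
    proof -
      obtain \<eta> where \<eta>: "\<eta> \<in> H" "d = \<eta> \<oplus>\<^bsub>D\<^esub> \<phi>" using \<open>d \<in> _\<close> by (auto simp: a_r_coset_def')
      then have "b \<odot>\<^bsub>D\<^esub> d = b \<odot>\<^bsub>D\<^esub> \<eta> \<oplus>\<^bsub>D\<^esub> b \<odot>\<^bsub>D\<^esub> \<phi>" using add \<phi> H.a_subset by auto
      then have "b \<odot>\<^bsub>D\<^esub> d \<ominus>\<^bsub>D\<^esub> b \<odot>\<^bsub>D\<^esub> \<phi> = b \<odot>\<^bsub>D\<^esub> \<eta>"
        using \<eta> \<phi> c H.a_subset by (simp add: D.diff_add_cancel subset_eq)
      then show ?thesis using eq[of "b \<odot>\<^bsub>D\<^esub> d" "b \<odot>\<^bsub>D\<^esub> \<phi>"] \<eta> \<phi> c h H.a_subset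
        by (auto simp: subset_eq)
    qed
    moreover have "\<phi> \<in> H +>\<^bsub>D\<^esub> \<phi>" using \<phi> by (rule H.a_rcos_self)
    ultimately have "(\<Union>d\<in>H +>\<^bsub>D\<^esub> \<phi>. H +>\<^bsub>D\<^esub> (b \<odot>\<^bsub>D\<^esub> d)) = H +>\<^bsub>D\<^esub> (b \<odot>\<^bsub>D\<^esub> \<phi>)"
      by (metis (no_types) UN_constant_eq)
    then show ?thesis by (simp add: quotient_module_def)
  qed
qed

section \<open>Maps into the dual of the transpose\<close>

context central_field
begin

context
  fixes P1 :: "('b, 'p, 'e) module_scheme" and P0 :: "('b, 'q, 'f) module_scheme"
    and f :: "'p \<Rightarrow> 'q" and Y :: "('b, 'y, 'g) module_scheme"
  assumes P1: "fg_projective B P1" and P0: "fg_projective B P0" and f: "lin B P1 P0 f"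
    and Y: "left_module B Y"
begin

abbreviation (input) "D1 \<equiv> hom_dual B P1"
abbreviation (input) "D0 \<equiv> hom_dual B P0"
abbreviation (input) "H \<equiv> (\<lambda>\<phi>. compose (carrier P1) \<phi> f) ` carrier D0"
abbreviation (input) "Tr \<equiv> transpose_of_presentation B P1 f P0"

lemmas P1m = fg_projective_left_module[OF P1] and P0m = fg_projective_left_module[OF P0]

interpretation P1: left_module B P1 by (rule P1m)
interpretation P0: left_module B P0 by (rule P0m)
interpretation Y: left_module B Y by (rule Y)

lemma reg: "left_module B (regular_module B)" by (rule left_module_regular) (rule B.ring_axioms)

lemma hom_dual_simps:
  fixes P :: "('b, 'z, 'h) module_scheme"
  shows "carrier (hom_dual B P) = module_homs B P (regular_module B)"
    "\<zero>\<^bsub>hom_dual B P\<^esub> = (\<lambda>x\<in>carrier P. \<zero>\<^bsub>B\<^esub>)"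
    "\<phi> \<oplus>\<^bsub>hom_dual B P\<^esub> \<psi> = (\<lambda>x\<in>carrier P. \<phi> x \<oplus>\<^bsub>B\<^esub> \<psi> x)"
    "b \<odot>\<^bsub>hom_dual B P\<^esub> \<phi> = (\<lambda>x\<in>carrier P. \<phi> x \<otimes>\<^bsub>B\<^esub> b)"
  by (simp_all add: hom_dual_def)

lemma hom_dual_iff:
  fixes P :: "('b, 'z, 'h) module_scheme"
  shows "\<phi> \<in> carrier (hom_dual B P) \<longleftrightarrow> lin B P (regular_module B) \<phi> \<and> \<phi> \<in> extensional (carrier P)"
  by (simp add: hom_dual_simps module_homs_iff)

lemma hom_dual_mem:
  fixes P :: "('b, 'z, 'h) module_scheme"
  shows "\<phi> \<in> carrier (hom_dual B P) \<Longrightarrow> x \<in> carrier P \<Longrightarrow> \<phi> x \<in> carrier B"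
  by (auto simp: hom_dual_simps dest: module_homs_mem)

lemma hom_dual_abelian_group:
  fixes P :: "('b, 'z, 'h) module_scheme"
  assumes "left_module B P"
  shows "abelian_group (hom_dual B P)"
  using hom_abelian_group[OF assms reg] by (simp add: hom_dual_def)

lemma hom_dual_smult:
  fixes P :: "('b, 'z, 'h) module_scheme"
  assumes P: "left_module B P" and b: "b \<in> carrier B" and \<phi>: "\<phi> \<in> carrier (hom_dual B P)"
  shows "b \<odot>\<^bsub>hom_dual B P\<^esub> \<phi> \<in> carrier (hom_dual B P)"
    "\<psi> \<in> carrier (hom_dual B P) \<Longrightarrow> b \<odot>\<^bsub>hom_dual B P\<^esub> (\<phi> \<oplus>\<^bsub>hom_dual B P\<^esub> \<psi>) =
      b \<odot>\<^bsub>hom_dual B P\<^esub> \<phi> \<oplus>\<^bsub>hom_dual B P\<^esub> b \<odot>\<^bsub>hom_dual B P\<^esub> \<psi>"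
proof -
  interpret P: left_module B P by (rule P)
  have l: "lin B P (regular_module B) \<phi>" using \<phi> by (simp add: hom_dual_iff)
  show "b \<odot>\<^bsub>hom_dual B P\<^esub> \<phi> \<in> carrier (hom_dual B P)"
    unfolding hom_dual_simps using linD[OF l] b
    by (intro restrict_module_homs P linI) (auto simp: B.l_distr B.m_assoc)
  show "b \<odot>\<^bsub>hom_dual B P\<^esub> (\<phi> \<oplus>\<^bsub>hom_dual B P\<^esub> \<psi>) =
      b \<odot>\<^bsub>hom_dual B P\<^esub> \<phi> \<oplus>\<^bsub>hom_dual B P\<^esub> b \<odot>\<^bsub>hom_dual B P\<^esub> \<psi>" if "\<psi> \<in> carrier (hom_dual B P)"
    unfolding hom_dual_simps using hom_dual_mem[OF \<phi>] hom_dual_mem[OF that] b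
    by (intro restrict_ext) (simp add: B.l_distr)
qed

interpretation D1: abelian_group D1 by (rule hom_dual_abelian_group[OF P1m])
interpretation D0: abelian_group D0 by (rule hom_dual_abelian_group[OF P0m])

lemma comp_f_closed: "\<phi> \<in> carrier D0 \<Longrightarrow> compose (carrier P1) \<phi> f \<in> carrier D1"
  using lin_comp[OF f] restrict_module_homs[OF P1m] unfolding compose_def hom_dual_iff
  by (auto simp: hom_dual_simps module_homs_iff)

lemma H_sub: "additive_subgroup H D1"
proof (rule additive_subgroupI, rule D1.add.subgroupI)
  show "H \<subseteq> carrier D1" using comp_f_closed by auto
  show "H \<noteq> {}" using D0.zero_closed by blast
  have add: "compose (carrier P1) (\<phi> \<oplus>\<^bsub>D0\<^esub> \<psi>) f = compose (carrier P1) \<phi> f \<oplus>\<^bsub>D1\<^esub> compose (carrier P1) \<psi> f"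
    for \<phi> \<psi> using linD(1)[OF f] by (auto simp: compose_def hom_dual_simps intro!: restrict_ext)
  show "\<phi> \<oplus>\<^bsub>D1\<^esub> \<psi> \<in> H" if "\<phi> \<in> H" "\<psi> \<in> H" for \<phi> \<psi>
    using that by (auto simp flip: add)
  show "\<ominus>\<^bsub>D1\<^esub> \<phi> \<in> H" if \<phi>: "\<phi> \<in> H" for \<phi>
  proof -
    obtain \<psi> where \<psi>: "\<psi> \<in> carrier D0" "\<phi> = compose (carrier P1) \<psi> f" using \<phi> by auto
    have "compose (carrier P1) \<zero>\<^bsub>D0\<^esub> f = \<zero>\<^bsub>D1\<^esub>"
      using linD(1)[OF f] by (auto simp: compose_def hom_dual_simps intro!: restrict_ext)
    then have "compose (carrier P1) (\<ominus>\<^bsub>D0\<^esub> \<psi>) f \<oplus>\<^bsub>D1\<^esub> \<phi> = \<zero>\<^bsub>D1\<^esub>"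
      using \<psi> by (simp add: D0.l_neg flip: add)
    then have "\<ominus>\<^bsub>D1\<^esub> \<phi> = compose (carrier P1) (\<ominus>\<^bsub>D0\<^esub> \<psi>) f"
      using \<psi> comp_f_closed by (intro D1.minus_equality) auto
    then show ?thesis using \<psi> by auto
  qed
qed

lemma H_smult: "b \<in> carrier B \<Longrightarrow> \<phi> \<in> H \<Longrightarrow> b \<odot>\<^bsub>D1\<^esub> \<phi> \<in> H"
proof -
  assume b: "b \<in> carrier B" and "\<phi> \<in> H"
  then obtain \<psi> where \<psi>: "\<psi> \<in> carrier D0" "\<phi> = compose (carrier P1) \<psi> f" by auto
  then have "b \<odot>\<^bsub>D1\<^esub> \<phi> = compose (carrier P1) (b \<odot>\<^bsub>D0\<^esub> \<psi>) f"
    using linD(1)[OF f] by (auto simp: compose_def hom_dual_simps intro!: restrict_ext)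
  then show ?thesis using hom_dual_smult(1)[OF P0m b \<psi>(1)] by auto
qed

definition "cl \<phi> = H +>\<^bsub>D1\<^esub> \<phi>"

lemma cl:
  shows "carrier Tr = cl ` carrier D1"
    and "\<lbrakk>\<phi> \<in> carrier D1; \<psi> \<in> carrier D1\<rbrakk> \<Longrightarrow> cl \<phi> = cl \<psi> \<longleftrightarrow> \<phi> \<ominus>\<^bsub>D1\<^esub> \<psi> \<in> H"
    and "\<lbrakk>\<phi> \<in> carrier D1; \<psi> \<in> carrier D1\<rbrakk> \<Longrightarrow> cl \<phi> \<oplus>\<^bsub>Tr\<^esub> cl \<psi> = cl (\<phi> \<oplus>\<^bsub>D1\<^esub> \<psi>)"
    and "\<lbrakk>\<phi> \<in> carrier D1; b \<in> carrier B\<rbrakk> \<Longrightarrow> b \<odot>\<^bsub>Tr\<^esub> cl \<phi> = cl (b \<odot>\<^bsub>D1\<^esub> \<phi>)"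
  unfolding cl_def transpose_of_presentation_def
  by (simp_all only: quotient_module_facts(1-3)[OF D1.abelian_group_axioms H_sub])
    (intro quotient_module_facts(4)[OF D1.abelian_group_axioms H_sub] hom_dual_smult[OF P1m] H_smult, assumption+)

abbreviation (input) "\<tau> \<equiv> k_dual K B Tr"

text \<open>Describes a functional on the cokernel by its values on the classes of elements of
  \<open>D1\<close>, so that membership in the dual can be tested on representatives.\<close>

lemma tau_iff:
  "\<chi> \<in> carrier \<tau> \<longleftrightarrow> \<chi> \<in> extensional (carrier Tr) \<and> (\<forall>\<phi>\<in>carrier D1. \<chi> (cl \<phi>) \<in> carrier K) \<and>
    (\<forall>\<phi>\<in>carrier D1. \<forall>\<psi>\<in>carrier D1. \<chi> (cl (\<phi> \<oplus>\<^bsub>D1\<^esub> \<psi>)) = \<chi> (cl \<phi>) \<oplus>\<^bsub>K\<^esub> \<chi> (cl \<psi>)) \<and>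
    (\<forall>k\<in>carrier K. \<forall>\<phi>\<in>carrier D1. \<chi> (cl (\<iota> k \<odot>\<^bsub>D1\<^esub> \<phi>)) = k \<otimes>\<^bsub>K\<^esub> \<chi> (cl \<phi>))"
  unfolding k_dual_def mk_module_simps module_homs_iff lin_def
  using cl(1,3,4) scalar_closed by (auto simp: \<iota>_def)

lemma tau_simps:
  "\<zero>\<^bsub>\<tau>\<^esub> = (\<lambda>y\<in>carrier Tr. \<zero>\<^bsub>K\<^esub>)" "\<phi> \<oplus>\<^bsub>\<tau>\<^esub> \<psi> = (\<lambda>y\<in>carrier Tr. \<phi> y \<oplus>\<^bsub>K\<^esub> \<psi> y)"
  "b \<odot>\<^bsub>\<tau>\<^esub> \<phi> = (\<lambda>y\<in>carrier Tr. \<phi> (b \<odot>\<^bsub>Tr\<^esub> y))"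
  by (simp_all add: k_dual_def)

text \<open>\<open>\<phi> \<star> y\<close> is the map \<open>p \<mapsto> \<phi>(p) y\<close>, the image of \<open>\<phi> \<otimes> y\<close> under \<open>Hom(P1, B) \<otimes> Y \<cong> Hom(P1, Y)\<close>.\<close>

definition star (infixl \<open>\<star>\<close> 70) where "\<phi> \<star> y = (\<lambda>x\<in>carrier P1. \<phi> x \<odot>\<^bsub>Y\<^esub> y)"

lemma hom_dual_smult_closed:
  fixes P :: "('b, 'z, 'h) module_scheme"
  assumes "left_module B P" "\<phi> \<in> carrier (hom_dual B P)" "y \<in> carrier Y"
  shows "(\<lambda>x\<in>carrier P. \<phi> x \<odot>\<^bsub>Y\<^esub> y) \<in> module_homs B P Y"
  using linD[of B P "regular_module B" \<phi>] assms unfolding hom_dual_iff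
  by (intro restrict_module_homs linI) (auto simp: Y.smult_l_distr Y.smult_assoc)

lemma star_closed: "\<phi> \<in> carrier D1 \<Longrightarrow> y \<in> carrier Y \<Longrightarrow> \<phi> \<star> y \<in> module_homs B P1 Y"
  unfolding star_def by (rule hom_dual_smult_closed[OF P1m])

text \<open>The map \<open>h\<close> is a balanced form \<open>\<beta>(\<phi>, y)\<close> that
  vanishes for \<open>\<phi>\<close> in \<open>H\<close>. Each \<open>\<phi> \<star> y\<close>
  factors as \<open>\<theta> f\<close>. Expanding \<open>\<phi>\<close> in a dual basis of
  \<open>P1\<close> and \<open>\<theta>\<close> in one of \<open>P0\<close> turns
  \<open>\<beta>(\<phi>, y)\<close> into a sum of values of \<open>\<beta>\<close> on the elements
  \<open>\<epsilon>' j f\<close> of \<open>H\<close>, all of which are zero.\<close>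

lemma hom_zero_if_hom_surj:
  assumes surj: "hom_surj B P1 f P0 Y" and h: "lin B Y \<tau> h" and y: "y \<in> carrier Y"
  shows "h y = \<zero>\<^bsub>\<tau>\<^esub>"
proof -
  let ?\<beta> = "\<lambda>\<phi> y. h y (cl \<phi>)"
  have \<beta>: "?\<beta> \<phi> y \<in> carrier K" if "\<phi> \<in> carrier D1" "y \<in> carrier Y" for \<phi> y
    using linD(1)[OF h that(2)] that(1) unfolding tau_iff by blast
  have \<beta>_add1: "?\<beta> (\<phi> \<oplus>\<^bsub>D1\<^esub> \<psi>) y = ?\<beta> \<phi> y \<oplus>\<^bsub>K\<^esub> ?\<beta> \<psi> y"
    if "\<phi> \<in> carrier D1" "\<psi> \<in> carrier D1" "y \<in> carrier Y" for \<phi> \<psi> y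
    using linD(1)[OF h that(3)] that(1,2) unfolding tau_iff by blast
  have cl_Tr: "cl \<phi> \<in> carrier Tr" if "\<phi> \<in> carrier D1" for \<phi> using that cl(1) by blast
  have \<beta>_add2: "?\<beta> \<phi> (y \<oplus>\<^bsub>Y\<^esub> z) = ?\<beta> \<phi> y \<oplus>\<^bsub>K\<^esub> ?\<beta> \<phi> z"
    if "\<phi> \<in> carrier D1" "y \<in> carrier Y" "z \<in> carrier Y" for \<phi> y z
    using linD(2)[OF h that(2,3)] cl_Tr[OF that(1)] by (simp add: tau_simps)
  \<comment> \<open>Linearity of \<open>h\<close> over \<open>B\<close> becomes balancedness,
    because \<open>B\<close> acts on the dual through the argument.\<close>
  have \<beta>_bal: "?\<beta> (b \<odot>\<^bsub>D1\<^esub> \<phi>) y = ?\<beta> \<phi> (b \<odot>\<^bsub>Y\<^esub> y)"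
    if "\<phi> \<in> carrier D1" "y \<in> carrier Y" "b \<in> carrier B" for \<phi> y b
    using linD(3)[OF h that(3,2)] cl_Tr[OF that(1)] cl(4)[OF that(1,3)] by (simp add: tau_simps)
  have \<beta>_H: "?\<beta> \<phi> y = \<zero>\<^bsub>K\<^esub>" if "\<phi> \<in> H" "y \<in> carrier Y" for \<phi> y
  proof -
    have 0: "?\<beta> \<zero>\<^bsub>D1\<^esub> y = \<zero>\<^bsub>K\<^esub>"
      using \<beta>_add1[of "\<zero>\<^bsub>D1\<^esub>" "\<zero>\<^bsub>D1\<^esub>" y] \<beta>[of "\<zero>\<^bsub>D1\<^esub>" y] that(2) K.add.r_cancel_one' by force
    have "\<phi> \<in> carrier D1" using that(1) comp_f_closed by auto
    then have "cl \<phi> = cl \<zero>\<^bsub>D1\<^esub>" using that(1) cl(2)[of \<phi> "\<zero>\<^bsub>D1\<^esub>"] by simp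
    then show ?thesis using 0 by simp
  qed
  have \<beta>_0: "?\<beta> \<phi> \<zero>\<^bsub>Y\<^esub> = \<zero>\<^bsub>K\<^esub>" if "\<phi> \<in> carrier D1" for \<phi>
    using \<beta>_add2[of \<phi> "\<zero>\<^bsub>Y\<^esub>" "\<zero>\<^bsub>Y\<^esub>"] \<beta>[of \<phi> "\<zero>\<^bsub>Y\<^esub>"] that K.add.r_cancel_one' by force
  obtain n e \<epsilon> where b1: "dual_basis B P1 n e \<epsilon>" using P1 by (auto simp: fg_projective_iff_dual_basis)
  then have e: "e i \<in> carrier P1" and \<epsilon>: "lin B P1 (regular_module B) (\<epsilon> i)" if "i < n" for i
    using that by (auto simp: dual_basis_def)
  define \<delta> where "\<delta> i = restrict (\<epsilon> i) (carrier P1)" for i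
  have \<delta>: "\<delta> i x = \<epsilon> i x" if "x \<in> carrier P1" for i x using that by (simp add: \<delta>_def)
  have \<delta>D: "\<delta> i \<in> carrier D1" if "i < n" for i
    using restrict_module_homs[OF P1m \<epsilon>[OF that]] by (simp add: hom_dual_simps \<delta>_def)
  \<comment> \<open>Any \<open>\<chi>\<close> in \<open>D1\<close> is the sum of the right multiples
    of the \<open>\<delta> i\<close> by \<open>\<chi> (e i)\<close>. Balancedness then moves the
    coefficients to the second argument, so the form depends only on the vectors
    \<open>\<chi> (e i) y\<close>.\<close>
  have expand: "finsum K (\<lambda>i. ?\<beta> (\<delta> i) (\<chi> (e i) \<odot>\<^bsub>Y\<^esub> y)) {..<n} = ?\<beta> \<chi> y"
    if \<chi>: "\<chi> \<in> carrier D1" and y: "y \<in> carrier Y" for \<chi> y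
  proof -
    let ?g = "\<lambda>i. \<chi> (e i) \<odot>\<^bsub>D1\<^esub> \<delta> i"
    have g: "?g \<in> {..<n} \<rightarrow> carrier D1"
      using \<delta>D hom_dual_mem[OF \<chi> e] hom_dual_smult(1)[OF P1m] by auto
    have "finsum D1 ?g {..<n} = \<chi>"
    proof (rule module_homs_eqI)
      have "finsum D1 ?g {..<n} \<in> carrier D1" using g by (rule D1.finsum_closed)
      then show "finsum D1 ?g {..<n} \<in> extensional (carrier P1)" by (simp add: hom_dual_iff)
      show "\<chi> \<in> extensional (carrier P1)" using \<chi> by (simp add: hom_dual_iff)
      fix x assume x: "x \<in> carrier P1"
      interpret r: left_module B "regular_module B" by (rule reg)
      have "finsum D1 ?g {..<n} x = finsum (regular_module B) (\<lambda>i. ?g i x) {..<n}"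
        using hom_dual_mem[OF _ x]
        by (intro additive_finsum[where h = "\<lambda>u. u x"] D1.abelian_group_axioms r.M.abelian_group_axioms g)
          (simp_all add: hom_dual_simps x)
      also have "\<dots> = finsum (regular_module B) (\<lambda>i. \<epsilon> i x \<odot>\<^bsub>regular_module B\<^esub> \<chi> (e i)) {..<n}"
        using x hom_dual_mem[OF \<delta>D x] hom_dual_mem[OF \<chi> e]
        by (intro r.M.finsum_cong') (auto simp: hom_dual_simps \<delta>)
      also have "\<dots> = \<chi> x"
        using \<chi> x by (intro dual_basis_lin[OF P1m reg b1]) (simp add: hom_dual_iff)
      finally show "finsum D1 ?g {..<n} x = \<chi> x" .
    qed
    then have "?\<beta> \<chi> y = ?\<beta> (finsum D1 ?g {..<n}) y" by simp
    also have "\<dots> = finsum K (\<lambda>i. ?\<beta> (?g i) y) {..<n}"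
      using y by (intro additive_finsum[where h = "\<lambda>u. ?\<beta> u y"] D1.abelian_group_axioms K.abelian_group_axioms g)
        (simp_all add: \<beta> \<beta>_add1)
    also have "\<dots> = finsum K (\<lambda>i. ?\<beta> (\<delta> i) (\<chi> (e i) \<odot>\<^bsub>Y\<^esub> y)) {..<n}"
      using y \<delta>D hom_dual_mem[OF \<chi> e] by (intro K.finsum_cong') (auto simp: \<beta>_bal \<beta>)
    finally show ?thesis by simp
  qed
  obtain m e' \<epsilon>' where b0: "dual_basis B P0 m e' \<epsilon>'" using P0 by (auto simp: fg_projective_iff_dual_basis)
  then have e': "e' j \<in> carrier P0" and \<epsilon>': "lin B P0 (regular_module B) (\<epsilon>' j)" if "j < m" for j
    using that by (auto simp: dual_basis_def)
  have fe: "f (e i) \<in> carrier P0" if "i < n" for i using linD(1)[OF f e[OF that]] .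
  have \<epsilon>fe: "\<epsilon>' j (f (e i)) \<in> carrier B" if "i < n" "j < m" for i j
    using linD(1)[OF \<epsilon>'[OF that(2)] fe[OF that(1)]] by simp
  \<comment> \<open>Induction on the inner index set detaches one \<open>j\<close> at a time. The
    stray double sum for that \<open>j\<close> is \<open>expand\<close> read backwards for
    \<open>\<epsilon>' j\<close> composed with \<open>f\<close>, an element of
    \<open>H\<close>.\<close>
  have zero: "finsum K (\<lambda>i. ?\<beta> (\<delta> i) (finsum Y (\<lambda>j. \<epsilon>' j (f (e i)) \<odot>\<^bsub>Y\<^esub> v j) J)) {..<n} = \<zero>\<^bsub>K\<^esub>"
    if v: "\<And>j. j < m \<Longrightarrow> v j \<in> carrier Y" and "finite J" "J \<subseteq> {..<m}" for v J
    using that(2,3)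
  proof (induction J)
    case empty
    show ?case
      by (rule K.add.finprod_one_eqI) (simp only: Y.finsum_empty \<beta>_0[OF \<delta>D] lessThan_iff)
  next
    case (insert j J)
    then have j: "j < m" "J \<subseteq> {..<m}" by auto
    have s: "(\<lambda>j. \<epsilon>' j (f (e i)) \<odot>\<^bsub>Y\<^esub> v j) \<in> J \<rightarrow> carrier Y" if "i < n" for i
      using j \<epsilon>fe[OF that] v by auto
    have "finsum K (\<lambda>i. ?\<beta> (\<delta> i) (finsum Y (\<lambda>j. \<epsilon>' j (f (e i)) \<odot>\<^bsub>Y\<^esub> v j) (insert j J))) {..<n} =
      finsum K (\<lambda>i. ?\<beta> (\<delta> i) (\<epsilon>' j (f (e i)) \<odot>\<^bsub>Y\<^esub> v j) \<oplus>\<^bsub>K\<^esub>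
        ?\<beta> (\<delta> i) (finsum Y (\<lambda>j. \<epsilon>' j (f (e i)) \<odot>\<^bsub>Y\<^esub> v j) J)) {..<n}"
      using insert.hyps s j v \<epsilon>fe \<delta>D \<beta> Y.finsum_closed[OF s]
      by (intro K.finsum_cong') (auto simp: \<beta>_add2)
    also have "\<dots> = finsum K (\<lambda>i. ?\<beta> (\<delta> i) (\<epsilon>' j (f (e i)) \<odot>\<^bsub>Y\<^esub> v j)) {..<n} \<oplus>\<^bsub>K\<^esub> \<zero>\<^bsub>K\<^esub>"
      using j v \<epsilon>fe \<delta>D \<beta> Y.finsum_closed[OF s] insert.IH[OF j(2)]
      by (subst K.finsum_addf) auto
    also have "finsum K (\<lambda>i. ?\<beta> (\<delta> i) (\<epsilon>' j (f (e i)) \<odot>\<^bsub>Y\<^esub> v j)) {..<n} = \<zero>\<^bsub>K\<^esub>"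
    proof -
      let ?\<chi> = "compose (carrier P1) (restrict (\<epsilon>' j) (carrier P0)) f"
      have d: "restrict (\<epsilon>' j) (carrier P0) \<in> carrier D0"
        using restrict_module_homs[OF P0m \<epsilon>'[OF j(1)]] by (simp add: hom_dual_simps)
      have "finsum K (\<lambda>i. ?\<beta> (\<delta> i) (\<epsilon>' j (f (e i)) \<odot>\<^bsub>Y\<^esub> v j)) {..<n} =
          finsum K (\<lambda>i. ?\<beta> (\<delta> i) (?\<chi> (e i) \<odot>\<^bsub>Y\<^esub> v j)) {..<n}"
        using v j \<epsilon>fe \<delta>D \<beta> e fe by (intro K.finsum_cong') (auto simp: compose_def)
      also have "\<dots> = ?\<beta> ?\<chi> (v j)" using expand[OF comp_f_closed[OF d]] v j by blast
      also have "\<dots> = \<zero>\<^bsub>K\<^esub>" using \<beta>_H[of ?\<chi>] d v j by blast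
      finally show ?thesis .
    qed
    finally show ?case by simp
  qed
  have "?\<beta> \<phi> y = \<zero>\<^bsub>K\<^esub>" if \<phi>: "\<phi> \<in> carrier D1" for \<phi>
  proof -
    have "lin B P1 Y (\<phi> \<star> y)" using star_closed[OF \<phi> y] by (simp add: module_homs_iff)
    then obtain \<theta> where \<theta>: "lin B P0 Y \<theta>" "\<And>x. x \<in> carrier P1 \<Longrightarrow> (\<phi> \<star> y) x = \<theta> (f x)"
      using surj unfolding hom_surj_def by blast
    \<comment> \<open>Both sides are the value of \<open>\<theta> f\<close> at \<open>e i\<close>:
      the left by the factorization of \<open>\<phi> \<star> y\<close>, the right by the dual basis
      of \<open>P0\<close>.\<close>
    have eq: "\<phi> (e i) \<odot>\<^bsub>Y\<^esub> y = finsum Y (\<lambda>j. \<epsilon>' j (f (e i)) \<odot>\<^bsub>Y\<^esub> \<theta> (e' j)) {..<m}" if "i < n" for i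
      using \<theta>(2)[OF e[OF that]] dual_basis_lin[OF P0m Y b0 \<theta>(1) fe[OF that]] e[OF that]
      by (simp add: star_def)
    have "finsum Y (\<lambda>j. \<epsilon>' j (f (e i)) \<odot>\<^bsub>Y\<^esub> \<theta> (e' j)) {..<m} \<in> carrier Y" if "i < n" for i
      using y hom_dual_mem[OF \<phi> e[OF that]] by (simp flip: eq[OF that])
    then have "?\<beta> \<phi> y =
      finsum K (\<lambda>i. ?\<beta> (\<delta> i) (finsum Y (\<lambda>j. \<epsilon>' j (f (e i)) \<odot>\<^bsub>Y\<^esub> \<theta> (e' j)) {..<m})) {..<n}"
      using \<beta>[OF \<delta>D] eq unfolding expand[OF \<phi> y, symmetric]
      by (intro K.finsum_cong') auto
    also have "\<dots> = \<zero>\<^bsub>K\<^esub>" using linD(1)[OF \<theta>(1) e'] by (intro zero) auto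
    finally show ?thesis .
  qed
  then show ?thesis
    using linD(1)[OF h y] unfolding tau_iff tau_simps
    by (intro extensionalityI[of _ "carrier Tr"]) (auto simp: cl(1))
qed

text \<open>If \<open>\<psi>\<close> does not extend over \<open>f\<close>, some functional
  \<open>\<mu>\<close> kills all maps that do and has value 1 at \<open>\<psi>\<close>. The
  assignment of \<open>\<mu> (\<phi> \<star> y)\<close> to \<open>y\<close> and the class of
  \<open>\<phi>\<close> is a map from \<open>Y\<close> into the dual, hence zero by assumption. But
  \<open>\<psi>\<close> is a sum of maps of the form \<open>\<phi> \<star> y\<close>, so
  \<open>\<mu>\<close> would vanish at it.\<close>

lemma hom_surj_if_hom_zero:
  assumes zero: "\<And>h y. lin B Y \<tau> h \<Longrightarrow> y \<in> carrier Y \<Longrightarrow> h y = \<zero>\<^bsub>\<tau>\<^esub>"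
  shows "hom_surj B P1 f P0 Y"
proof (rule ccontr)
  let ?V = "hom_module K B P1 Y" and ?U = "hom_module K B P0 Y"
  have V: "left_module K ?V" "left_module K ?U" using left_module_hom P1m P0m Y by auto
  interpret V: left_module K ?V by (rule V)
  interpret U: left_module K ?U by (rule V)
  let ?c = "\<lambda>\<phi>. compose (carrier P1) \<phi> f"
  have cV: "?c \<phi> \<in> module_homs B P1 Y" if "\<phi> \<in> module_homs B P0 Y" for \<phi>
    using that restrict_module_homs[OF P1m lin_comp[OF f, of Y \<phi>]]
    by (simp add: compose_def module_homs_iff)
  have "lin K ?U ?V ?c"
    using cV linD(1)[OF f] by (intro linI) (auto simp: hom_module_def compose_def intro!: restrict_ext)
  then have W: "submodule (?c ` carrier ?U) K ?V"
    by (rule submodule_image[OF V(2,1) _ U.submodule_carrier])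
  assume "\<not> hom_surj B P1 f P0 Y"
  then obtain \<psi> where \<psi>: "lin B P1 Y \<psi>"
    and n\<psi>: "\<And>\<phi>. lin B P0 Y \<phi> \<Longrightarrow> \<exists>x\<in>carrier P1. \<psi> x \<noteq> \<phi> (f x)"
    unfolding hom_surj_def by blast
  let ?\<psi> = "restrict \<psi> (carrier P1)"
  have \<psi>V: "?\<psi> \<in> carrier ?V" using restrict_module_homs[OF P1m \<psi>] by (simp add: hom_module_def)
  have "?\<psi> \<notin> ?c ` carrier ?U"
  proof
    assume "?\<psi> \<in> ?c ` carrier ?U"
    then obtain \<phi> where "lin B P0 Y \<phi>" "?\<psi> = ?c \<phi>" by (auto simp: hom_module_def module_homs_iff)
    then show False using n\<psi>[of \<phi>] by (auto simp: compose_def dest: fun_cong split: if_splits)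
  qed
  then obtain \<mu> where \<mu>: "lin K ?V (regular_module K) \<mu>" "\<And>w. w \<in> ?c ` carrier ?U \<Longrightarrow> \<mu> w = \<zero>\<^bsub>K\<^esub>"
    "\<mu> ?\<psi> = \<one>\<^bsub>K\<^esub>"
    using V.separating_functional[OF K.field_axioms W \<psi>V] by blast
  have \<mu>K: "\<mu> (\<phi> \<star> y) \<in> carrier K" if "\<phi> \<in> carrier D1" "y \<in> carrier Y" for \<phi> y
    using linD(1)[OF \<mu>(1)] star_closed[OF that] by (simp add: hom_module_def)
  have star_V: "\<phi> \<star> y \<in> carrier ?V" if "\<phi> \<in> carrier D1" "y \<in> carrier Y" for \<phi> y
    using star_closed[OF that] by (simp add: hom_module_def)
  have star_add1: "(\<phi> \<oplus>\<^bsub>D1\<^esub> \<phi>') \<star> y = \<phi> \<star> y \<oplus>\<^bsub>?V\<^esub> \<phi>' \<star> y"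
    if "\<phi> \<in> carrier D1" "\<phi>' \<in> carrier D1" "y \<in> carrier Y" for \<phi> \<phi>' y
    using that hom_dual_mem[OF that(1)] hom_dual_mem[OF that(2)]
    by (auto simp: star_def hom_module_def hom_dual_simps Y.smult_l_distr intro!: restrict_ext)
  have star_add2: "\<phi> \<star> (y \<oplus>\<^bsub>Y\<^esub> y') = \<phi> \<star> y \<oplus>\<^bsub>?V\<^esub> \<phi> \<star> y'"
    if "\<phi> \<in> carrier D1" "y \<in> carrier Y" "y' \<in> carrier Y" for \<phi> y y'
    using that hom_dual_mem[OF that(1)]
    by (auto simp: star_def hom_module_def Y.smult_r_distr intro!: restrict_ext)
  have star_bal: "(b \<odot>\<^bsub>D1\<^esub> \<phi>) \<star> y = \<phi> \<star> (b \<odot>\<^bsub>Y\<^esub> y)"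
    if "\<phi> \<in> carrier D1" "y \<in> carrier Y" "b \<in> carrier B" for \<phi> y b
    using that hom_dual_mem[OF that(1)]
    by (auto simp: star_def hom_dual_simps Y.smult_assoc intro!: restrict_ext)
  have star_scalar: "(\<iota> k \<odot>\<^bsub>D1\<^esub> \<phi>) \<star> y = k \<odot>\<^bsub>?V\<^esub> (\<phi> \<star> y)"
    if "\<phi> \<in> carrier D1" "y \<in> carrier Y" "k \<in> carrier K" for \<phi> y k
  proof (unfold star_def hom_module_def hom_dual_simps mk_module_simps, intro restrict_ext)
    fix x assume x: "x \<in> carrier P1"
    then have p: "\<phi> x \<in> carrier B" using hom_dual_mem[OF that(1)] by simp
    have "(\<phi> x \<otimes>\<^bsub>B\<^esub> \<iota> k) \<odot>\<^bsub>Y\<^esub> y = \<iota> k \<odot>\<^bsub>Y\<^esub> (\<phi> x \<odot>\<^bsub>Y\<^esub> y)"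
      using p that scalar_closed[OF that(3)] by (simp add: Y.smult_assoc flip: scalar_central)
    then show "(\<lambda>x\<in>carrier P1. \<phi> x \<otimes>\<^bsub>B\<^esub> \<iota> k) x \<odot>\<^bsub>Y\<^esub> y =
        (k \<odot>\<^bsub>B\<^esub> \<one>\<^bsub>B\<^esub>) \<odot>\<^bsub>Y\<^esub> (\<lambda>x\<in>carrier P1. \<phi> x \<odot>\<^bsub>Y\<^esub> y) x"
      using x by (simp add: \<iota>_def)
  qed
  \<comment> \<open>If \<open>\<delta>\<close> factors through \<open>f\<close>, so does
    \<open>\<delta> \<star> y\<close>, and \<open>\<mu>\<close> kills it. This makes the following
    \<open>h\<close> independent of representatives.\<close>
  have star_H: "\<mu> (\<delta> \<star> y) = \<zero>\<^bsub>K\<^esub>" if d: "\<delta> \<in> H" and y: "y \<in> carrier Y" for \<delta> y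
  proof -
    obtain \<eta> where \<eta>: "\<eta> \<in> carrier D0" "\<delta> = ?c \<eta>" using d by blast
    have "\<delta> \<star> y = ?c (\<lambda>x\<in>carrier P0. \<eta> x \<odot>\<^bsub>Y\<^esub> y)"
      using \<eta>(2) linD(1)[OF f] by (auto simp: star_def compose_def intro!: restrict_ext)
    moreover have "(\<lambda>x\<in>carrier P0. \<eta> x \<odot>\<^bsub>Y\<^esub> y) \<in> carrier ?U"
      using hom_dual_smult_closed[OF P0m \<eta>(1) y] by (simp add: hom_module_def)
    ultimately show ?thesis using \<mu>(2) by blast
  qed
  \<comment> \<open>A class is evaluated at some representative and is undefined off the carrier, as
    extensionality of the dual demands.\<close>
  define h where "h y = (\<lambda>C\<in>carrier Tr. \<mu> ((SOME \<phi>. \<phi> \<in> carrier D1 \<and> cl \<phi> = C) \<star> y))" for y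
  have h_cl: "h y (cl \<phi>) = \<mu> (\<phi> \<star> y)" if \<phi>: "\<phi> \<in> carrier D1" and y: "y \<in> carrier Y" for \<phi> y
  proof -
    define \<rho> where "\<rho> = (SOME \<rho>. \<rho> \<in> carrier D1 \<and> cl \<rho> = cl \<phi>)"
    have \<rho>: "\<rho> \<in> carrier D1 \<and> cl \<rho> = cl \<phi>" unfolding \<rho>_def by (rule someI[of _ \<phi>]) (use \<phi> in simp)
    then have d: "\<rho> \<ominus>\<^bsub>D1\<^esub> \<phi> \<in> H" "\<rho> \<ominus>\<^bsub>D1\<^esub> \<phi> \<in> carrier D1" using cl(2) \<phi> by auto
    have "\<mu> (\<rho> \<star> y) = \<mu> (\<phi> \<star> y \<oplus>\<^bsub>?V\<^esub> (\<rho> \<ominus>\<^bsub>D1\<^esub> \<phi>) \<star> y)"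
      using star_add1[OF \<phi> d(2) y] \<rho> \<phi> by (simp add: D1.diff_add_cancel)
    also have "\<dots> = \<mu> (\<phi> \<star> y) \<oplus>\<^bsub>K\<^esub> \<zero>\<^bsub>K\<^esub>"
      using linD(2)[OF \<mu>(1) star_V[OF \<phi> y] star_V[OF d(2) y]] star_H[OF d(1) y] by simp
    finally show ?thesis using \<phi> y \<mu>K cl(1) by (simp add: h_def \<rho>_def)
  qed
  have ext: "h y \<in> extensional (carrier Tr)" for y by (simp add: h_def)
  have smD: "b \<odot>\<^bsub>D1\<^esub> \<phi> \<in> carrier D1" if "b \<in> carrier B" "\<phi> \<in> carrier D1" for b \<phi>
    using hom_dual_smult(1)[OF P1m that] .
  have "lin B Y \<tau> h"
  proof (rule linI)
    show "h y \<in> carrier \<tau>" if y: "y \<in> carrier Y" for y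
      unfolding tau_iff
      using y ext[of y] \<mu>K linD(2)[OF \<mu>(1)] linD(3)[OF \<mu>(1)] star_V smD
      by (simp add: h_cl star_add1 star_scalar)
    show "h (y \<oplus>\<^bsub>Y\<^esub> z) = h y \<oplus>\<^bsub>\<tau>\<^esub> h z" if y: "y \<in> carrier Y" "z \<in> carrier Y" for y z
    proof (rule extensionalityI[of _ "carrier Tr"])
      fix C assume "C \<in> carrier Tr"
      then obtain \<phi> where "\<phi> \<in> carrier D1" "C = cl \<phi>" using cl(1) by auto
      then show "h (y \<oplus>\<^bsub>Y\<^esub> z) C = (h y \<oplus>\<^bsub>\<tau>\<^esub> h z) C"
        using y linD(2)[OF \<mu>(1)] star_V cl(1) by (simp add: h_cl star_add2 tau_simps)
    qed (simp_all add: ext tau_simps)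
    show "h (b \<odot>\<^bsub>Y\<^esub> y) = b \<odot>\<^bsub>\<tau>\<^esub> h y" if y: "b \<in> carrier B" "y \<in> carrier Y" for b y
    proof (rule extensionalityI[of _ "carrier Tr"])
      fix C assume "C \<in> carrier Tr"
      then obtain \<phi> where "\<phi> \<in> carrier D1" "C = cl \<phi>" using cl(1) by auto
      then show "h (b \<odot>\<^bsub>Y\<^esub> y) C = (b \<odot>\<^bsub>\<tau>\<^esub> h y) C"
        using y smD cl(1) by (simp add: h_cl star_bal tau_simps cl(4))
    qed (simp_all add: ext tau_simps)
  qed
  then have 0: "\<mu> (\<phi> \<star> y) = \<zero>\<^bsub>K\<^esub>" if "\<phi> \<in> carrier D1" "y \<in> carrier Y" for \<phi> y
    using zero[of h y] that h_cl[OF that] cl(1) by (simp add: tau_simps)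
  obtain n e \<epsilon> where b1: "dual_basis B P1 n e \<epsilon>" using P1 by (auto simp: fg_projective_iff_dual_basis)
  then have e: "e i \<in> carrier P1" and \<epsilon>: "lin B P1 (regular_module B) (\<epsilon> i)" if "i < n" for i
    using that by (auto simp: dual_basis_def)
  let ?\<epsilon> = "\<lambda>i. restrict (\<epsilon> i) (carrier P1)"
  have \<epsilon>D: "?\<epsilon> i \<in> carrier D1" if "i < n" for i
    using restrict_module_homs[OF P1m \<epsilon>[OF that]] by (simp add: hom_dual_simps)
  let ?g = "\<lambda>i. ?\<epsilon> i \<star> \<psi> (e i)"
  have g: "?g \<in> {..<n} \<rightarrow> carrier ?V" using \<epsilon>D star_V linD(1)[OF \<psi> e] by auto
  \<comment> \<open>The dual basis expansion of \<open>\<psi>\<close>, now as an identity of maps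
    and not only of values.\<close>
  have "finsum ?V ?g {..<n} = ?\<psi>"
  proof (rule module_homs_eqI)
    have "finsum ?V ?g {..<n} \<in> carrier ?V" using g by (rule V.finsum_closed)
    then show "finsum ?V ?g {..<n} \<in> extensional (carrier P1)" by (simp add: hom_module_def module_homs_iff)
    fix x assume x: "x \<in> carrier P1"
    have "finsum ?V ?g {..<n} x = finsum Y (\<lambda>i. ?g i x) {..<n}"
      by (intro additive_finsum[where h = "\<lambda>u. u x"] V.abelian_group_axioms Y.abelian_group_axioms g)
        (use x in \<open>auto simp: hom_module_def dest: module_homs_mem\<close>)
    also have "\<dots> = finsum Y (\<lambda>i. \<epsilon> i x \<odot>\<^bsub>Y\<^esub> \<psi> (e i)) {..<n}"
      using x linD(1)[OF \<epsilon>] linD(1)[OF \<psi> e] by (intro Y.finsum_cong') (auto simp: star_def)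
    also have "\<dots> = \<psi> x" using dual_basis_lin[OF P1m Y b1 \<psi> x] .
    finally show "finsum ?V ?g {..<n} x = ?\<psi> x" using x by simp
  qed simp
  then have "\<mu> ?\<psi> = finsum (regular_module K) (\<lambda>i. \<mu> (?g i)) {..<n}"
    using lin_finsum[OF V(1) left_module_regular[OF K.ring_axioms] \<mu>(1) _ g] by simp
  also have "\<dots> = \<zero>\<^bsub>regular_module K\<^esub>"
  proof -
    interpret r: left_module K "regular_module K" by (rule left_module_regular[OF K.ring_axioms])
    show ?thesis using 0 \<epsilon>D linD(1)[OF \<psi> e] by (intro r.M.add.finprod_one_eqI) auto
  qed
  finally show False using \<mu>(3) by simp
qed

lemma hom_zero_dual_transpose_iff: "hom_zero B Y \<tau> \<longleftrightarrow> hom_surj B P1 f P0 Y"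
  unfolding hom_zero_iff[OF Y] using hom_zero_if_hom_surj hom_surj_if_hom_zero by blast

end

text \<open>A copy of the given presentation exists on the carrier type in
  \<open>AR_translate\<close>, so the chosen quadruple is a minimal presentation. The criterion
  holds for that one and is carried to the given one by uniqueness.\<close>

lemma hom_zero_AR_translate_iff:
  assumes N: "left_module B N" and p: "min_pres B P1 f P0 g N" and Y: "left_module B Y"
  shows "hom_zero B Y (AR_translate K B N) \<longleftrightarrow> hom_surj B P1 f P0 Y"
proof -
  define q where "q = (SOME (P1 :: ('b, nat \<Rightarrow> 'b) module, f, P0 :: ('b, nat \<Rightarrow> 'b) module, g).
    min_proj_presentation B P1 f P0 g N)"
  obtain Q1 f' Q0 g' where q: "q = (Q1, f', Q0, g')" by (cases q)
  have "case q of (P1, f, P0, g) \<Rightarrow> min_proj_presentation B P1 f P0 g N"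
    unfolding q_def by (rule someI_ex) (use min_pres_standard_copy[OF N p] in auto)
  then have "min_proj_presentation B Q1 f' Q0 g' N" by (simp add: q)
  then have p': "min_pres B Q1 f' Q0 g' N" by (simp add: min_proj_presentation_iff[OF N])
  have Q: "fg_projective B Q1" "fg_projective B Q0"
    and ess: "essential_epi B Q1 f' (Q0\<lparr>carrier := {x \<in> carrier Q0. g' x = \<zero>\<^bsub>N\<^esub>}\<rparr>)"
    using p' by (simp_all add: min_pres_def)
  have f': "lin B Q1 Q0 f'" using essential_epiD(1)[OF ess] by (auto simp: lin_def)
  have "AR_translate K B N = k_dual K B (transpose_of_presentation B Q1 f' Q0)"
    unfolding AR_translate_def q_def[symmetric] by (simp add: q)
  then have "hom_zero B Y (AR_translate K B N) \<longleftrightarrow> hom_surj B Q1 f' Q0 Y"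
    using hom_zero_dual_transpose_iff[OF Q f' Y] by simp
  then show ?thesis using hom_surj_min_pres_unique[OF N p p'] hom_surj_min_pres_unique[OF N p' p] by blast
qed

end

section \<open>Existence of minimal projective presentations\<close>

lemma regular_module_minus [simp]: "x \<ominus>\<^bsub>regular_module R\<^esub> y = x \<ominus>\<^bsub>R\<^esub> y"
  by (simp add: a_minus_def a_inv_def m_inv_def)

text \<open>A natural number that grows strictly with the submodule bounds all chains at once. Such
  a function is inherited by images and by smaller families of submodules, and it supports arguments
  by a least or greatest value.\<close>

definition finite_length :: "('r, 'b) ring_scheme \<Rightarrow> ('r, 'm, 'd) module_scheme \<Rightarrow> bool" where
  "finite_length R M \<longleftrightarrow> (\<exists>d :: 'm set \<Rightarrow> nat. \<forall>S T. submodule S R M \<and> submodule T R M \<and> S \<subset> T \<longrightarrow> d S < d T)"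

text \<open>A nonzero ideal contains a unit and hence everything, so the values 0 and 1 separate the
  only two submodules.\<close>

lemma finite_length_field:
  assumes "field K" shows "finite_length K (regular_module K)"
  unfolding finite_length_def
proof (intro exI allI impI; elim conjE)
  interpret K: field K by fact
  interpret M: left_module K "regular_module K" by (rule left_module_regular[OF K.ring_axioms])
  fix S T assume S: "submodule S K (regular_module K)" and T: "submodule T K (regular_module K)" and ST: "S \<subset> T"
  have full: "U = carrier K" if U: "submodule U K (regular_module K)" "U \<noteq> {\<zero>\<^bsub>K\<^esub>}" for U
  proof -
    note u = M.submoduleD[OF U(1)]
    obtain x where x: "x \<in> U" "x \<noteq> \<zero>\<^bsub>K\<^esub>" using U(2) u(2) by auto
    then have "inv\<^bsub>K\<^esub> x \<in> carrier K" "inv\<^bsub>K\<^esub> x \<otimes>\<^bsub>K\<^esub> x = \<one>\<^bsub>K\<^esub>" using K.field_Units u(1) by auto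
    then have "\<one>\<^bsub>K\<^esub> \<in> U" using u(4)[of "inv\<^bsub>K\<^esub> x" x] x(1) by simp
    then have "y \<in> U" if "y \<in> carrier K" for y using u(4)[of y "\<one>\<^bsub>K\<^esub>"] that by simp
    then show ?thesis using u(1) by auto
  qed
  have "S = {\<zero>\<^bsub>K\<^esub>}" using full[OF S] M.submoduleD(1)[OF T] ST by auto
  then show "(if S = {\<zero>\<^bsub>K\<^esub>} then 0 else 1) < (if T = {\<zero>\<^bsub>K\<^esub>} then 0 else 1 :: nat)" using ST by auto
qed

text \<open>Measure a submodule by the sum of the lengths of its leading ideals. If a smaller
  submodule has the same leading ideals as a larger one, elimination coordinate by coordinate shows
  that they coincide.\<close>

lemma finite_length_free:
  assumes "ring R" and fl: "finite_length R (regular_module R)"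
  shows "finite_length R (free_module R n)"
proof -
  let ?F = "free_module R n" and ?R = "regular_module R"
  interpret R: ring R by fact
  interpret M: left_module R ?R by (rule left_module_regular[OF R.ring_axioms])
  interpret F: left_module R ?F by (rule left_module_free[OF R.ring_axioms])
  obtain d :: "_ \<Rightarrow> nat" where d: "\<And>S T. submodule S R ?R \<Longrightarrow> submodule T R ?R \<Longrightarrow> S \<subset> T \<Longrightarrow> d S < d T"
    using fl unfolding finite_length_def by blast
  \<comment> \<open>The ideal of possible entries at place \<open>i\<close> among the vectors of
    \<open>U\<close> whose earlier entries vanish.\<close>
  define lead where "lead U i = (\<lambda>u. u i) ` (U \<inter> {u \<in> carrier ?F. \<forall>j<i. u j = \<zero>\<^bsub>R\<^esub>})" for U i
  have lead: "submodule (lead U i) R ?R" if "submodule U R ?F" "i < n" for U i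
    unfolding lead_def
  proof (intro submodule_image[OF F.left_module_axioms M.left_module_axioms lin_proj[OF that(2)]] F.submodule_Int that)
    show "submodule {u \<in> carrier ?F. \<forall>j<i. u j = \<zero>\<^bsub>R\<^esub>} R ?F"
      by (rule F.submoduleI) (use that(2) in auto)
  qed
  have lead_mono: "lead S i \<subseteq> lead T i" if "S \<subseteq> T" for S T i using that by (auto simp: lead_def)
  have d_mono: "d (lead S i) \<le> d (lead T i)"
    if "submodule S R ?F" "submodule T R ?F" "S \<subseteq> T" "i < n" for S T i
    using d[OF lead lead, of S i T i] lead_mono[of S T i] that by (cases "lead S i = lead T i") (auto simp: psubset_eq)
  show ?thesis unfolding finite_length_def
  proof (intro exI allI impI; elim conjE)
    fix S T assume S: "submodule S R ?F" and T: "submodule T R ?F" and ST: "S \<subset> T"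
    note s = F.submoduleD[OF S] and t = F.submoduleD[OF T]
    have "\<exists>i<n. lead S i \<noteq> lead T i"
    proof (rule ccontr)
      assume "\<not> (\<exists>i<n. lead S i \<noteq> lead T i)"
      then have eq: "\<And>i. i < n \<Longrightarrow> lead S i = lead T i" by blast
      have "u \<in> S" if u: "u \<in> T" for u
      proof -
        \<comment> \<open>Elimination: if \<open>w\<close> agrees with \<open>u\<close> before place
          \<open>k\<close>, the entry of the difference at \<open>k\<close> is a leading entry of
          \<open>T\<close>, hence of \<open>S\<close>, and a vector of \<open>S\<close> starting
          with it corrects \<open>w\<close> without touching the earlier places.\<close>
        have "\<exists>w\<in>S. \<forall>j<k. (u \<ominus>\<^bsub>?F\<^esub> w) j = \<zero>\<^bsub>R\<^esub>" if "k \<le> n" for k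
          using that
        proof (induction k)
          case 0
          show ?case using s(2) by auto
        next
          case (Suc k)
          then obtain w where w: "w \<in> S" "\<And>j. j < k \<Longrightarrow> (u \<ominus>\<^bsub>?F\<^esub> w) j = \<zero>\<^bsub>R\<^esub>" by auto
          let ?v = "u \<ominus>\<^bsub>?F\<^esub> w"
          have uw: "u \<in> carrier ?F" "w \<in> carrier ?F" using u w(1) s(1) t(1) by auto
          have "?v \<in> T" using t(6) u w(1) ST by auto
          then have "?v k \<in> lead T k" using w(2) t(1) by (auto simp: lead_def)
          then have "?v k \<in> lead S k" using eq Suc.prems by simp
          then obtain z where z: "z \<in> S" "?v k = z k" "\<And>j. j < k \<Longrightarrow> z j = \<zero>\<^bsub>R\<^esub>"
            unfolding lead_def by auto
          have zF: "z \<in> carrier ?F" using z s(1) by auto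
          have v: "?v \<in> carrier ?F" using uw by (rule F.M.minus_closed)
          have "u \<ominus>\<^bsub>?F\<^esub> (w \<oplus>\<^bsub>?F\<^esub> z) = ?v \<ominus>\<^bsub>?F\<^esub> z"
            using uw zF by (simp add: F.M.minus_eq F.M.minus_add F.M.a_assoc del: free_module_simps)
          moreover have "(?v \<ominus>\<^bsub>?F\<^esub> z) j = ?v j \<ominus>\<^bsub>R\<^esub> z j" if "j < n" for j
            using lin_diff[OF F.left_module_axioms M.left_module_axioms lin_proj[OF that] v zF]
            by (simp del: free_module_simps)
          ultimately have "(u \<ominus>\<^bsub>?F\<^esub> (w \<oplus>\<^bsub>?F\<^esub> z)) j = \<zero>\<^bsub>R\<^esub>" if "j < Suc k" for j
            using that Suc.prems w(2)[of j] z(2) z(3)[of j] v zF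
            by (cases "j = k") (auto simp: R.diff_zero_iff)
          then show ?case using s(3)[OF w(1) z(1)] by blast
        qed
        then obtain w where w: "w \<in> S" "\<And>j. j < n \<Longrightarrow> (u \<ominus>\<^bsub>?F\<^esub> w) j = \<zero>\<^bsub>R\<^esub>" by blast
        have uw: "u \<in> carrier ?F" "w \<in> carrier ?F" using u w(1) s(1) t(1) by auto
        have "u \<ominus>\<^bsub>?F\<^esub> w = \<zero>\<^bsub>?F\<^esub>"
          using F.M.minus_closed[OF uw] w(2) by (intro extensionalityI[of _ "{..<n}"]) auto
        then show ?thesis using F.diff_zero_iff[OF uw] w(1) by simp
      qed
      then show False using ST by blast
    qed
    then obtain i where i: "i < n" "lead S i \<subset> lead T i" using lead_mono ST by blast
    show "(\<Sum>i<n. d (lead S i)) < (\<Sum>i<n. d (lead T i))"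
      using d_mono[OF S T] ST d[OF lead[OF S] lead[OF T] i(2)] i(1)
      by (intro sum_strict_mono_ex1) auto
  qed
qed

text \<open>Submodules of \<open>N\<close> are measured through their preimages, and surjectivity
  keeps strict inclusions strict.\<close>

lemma finite_length_image:
  assumes L: "left_module R L" and N: "left_module R N" and \<pi>: "lin R L N \<pi>" "\<pi> ` carrier L = carrier N"
    and fl: "finite_length R L"
  shows "finite_length R N"
proof -
  interpret N: left_module R N by (rule N)
  obtain d :: "_ \<Rightarrow> nat" where d: "\<And>S T. submodule S R L \<Longrightarrow> submodule T R L \<Longrightarrow> S \<subset> T \<Longrightarrow> d S < d T"
    using fl unfolding finite_length_def by blast
  show ?thesis unfolding finite_length_def
  proof (intro exI allI impI; elim conjE)
    fix S T assume S: "submodule S R N" and T: "submodule T R N" and ST: "S \<subset> T"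
    obtain y where y: "y \<in> T" "y \<notin> S" using ST by blast
    then have "y \<in> \<pi> ` carrier L" using \<pi>(2) N.submoduleD(1)[OF T] by auto
    then obtain x where "x \<in> carrier L" "\<pi> x = y" by auto
    then have "{x \<in> carrier L. \<pi> x \<in> S} \<subset> {x \<in> carrier L. \<pi> x \<in> T}" using y ST by blast
    then show "d {x \<in> carrier L. \<pi> x \<in> S} < d {x \<in> carrier L. \<pi> x \<in> T}"
      by (rule d[OF submodule_vimage[OF L N \<pi>(1) S] submodule_vimage[OF L N \<pi>(1) T]])
  qed
qed

section \<open>Generators, Fitting decompositions and covers as direct summands\<close>

context left_module
begin

lemma lin_from_free:
  assumes "\<And>i. i < n \<Longrightarrow> l i \<in> carrier M"
  shows "lin R (free_module R n) M (\<lambda>u. finsum M (\<lambda>i. u i \<odot>\<^bsub>M\<^esub> l i) {..<n})"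
  using assms by (intro lin_finsum_smult left_module_free lin_proj R.ring_axioms left_module_axioms)

definition gen :: "nat \<Rightarrow> (nat \<Rightarrow> 'm) \<Rightarrow> 'm set" where
  "gen n l = (\<lambda>u. finsum M (\<lambda>i. u i \<odot>\<^bsub>M\<^esub> l i) {..<n}) ` carrier (free_module R n)"

lemma submodule_gen:
  assumes "\<And>i. i < n \<Longrightarrow> l i \<in> carrier M" shows "submodule (gen n l) R M"
proof -
  interpret F: left_module R "free_module R n" by (rule left_module_free[OF R.ring_axioms])
  show ?thesis unfolding gen_def
    by (rule submodule_image[OF F.left_module_axioms left_module_axioms lin_from_free[OF assms] F.submodule_carrier])
qed

lemma mem_gen:
  assumes "\<And>i. i < n \<Longrightarrow> l i \<in> carrier M" "j < n" shows "l j \<in> gen n l"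
  unfolding gen_def
proof (rule image_eqI)
  let ?e = "\<lambda>i\<in>{..<n}. if i = j then \<one>\<^bsub>R\<^esub> else \<zero>\<^bsub>R\<^esub>"
  show "?e \<in> carrier (free_module R n)" by auto
  have "finsum M (\<lambda>i. ?e i \<odot>\<^bsub>M\<^esub> l i) {..<n} = finsum M (\<lambda>i. if j = i then l i else \<zero>\<^bsub>M\<^esub>) {..<n}"
    using assms by (intro M.finsum_cong') auto
  also have "\<dots> = l j" using assms by (intro M.finsum_singleton) auto
  finally show "l j = finsum M (\<lambda>i. ?e i \<odot>\<^bsub>M\<^esub> l i) {..<n}" by simp
qed

lemma gen_subset:
  assumes "submodule S R M" "\<And>i. i < n \<Longrightarrow> l i \<in> S" shows "gen n l \<subseteq> S"
proof -
  note s = submoduleD[OF assms(1)]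
  have "finsum M (\<lambda>i. u i \<odot>\<^bsub>M\<^esub> l i) {..<k} \<in> S" if u: "u \<in> carrier (free_module R n)" and "k \<le> n" for u k
    using that(2)
  proof (induction k)
    case (Suc k)
    have "(\<lambda>i. u i \<odot>\<^bsub>M\<^esub> l i) \<in> {..<Suc k} \<rightarrow> carrier M"
    proof
      fix i assume "i \<in> {..<Suc k}"
      then have "i < n" using Suc.prems by simp
      then show "u i \<odot>\<^bsub>M\<^esub> l i \<in> carrier M" using u s(1) assms(2) by auto
    qed
    moreover have "u k \<odot>\<^bsub>M\<^esub> l k \<in> S" using u assms(2) s(4) Suc.prems by simp
    ultimately show ?case using Suc s(3) by (simp add: lessThan_Suc Pi_def)
  qed (simp add: s)
  then show ?thesis by (auto simp: gen_def)
qed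

lemma fin_gen_imp_gen:
  assumes "fin_gen R M"
  obtains n l where "\<And>i. i < n \<Longrightarrow> l i \<in> carrier M" "gen n l = carrier M"
proof -
  obtain S where "finite S \<and> S \<subseteq> carrier M \<and> (\<forall>N. submodule N R M \<and> S \<subseteq> N \<longrightarrow> N = carrier M)"
    using assms unfolding fin_gen_def by (rule exE)
  then have S: "finite S" "S \<subseteq> carrier M"
    and min: "\<And>N. submodule N R M \<Longrightarrow> S \<subseteq> N \<Longrightarrow> N = carrier M" by simp_all
  obtain n and l :: "nat \<Rightarrow> 'm" where l: "S = l ` {i. i < n}"
    using finite_imp_nat_seg_image_inj_on[OF S(1)] by blast
  have lc: "\<And>i. i < n \<Longrightarrow> l i \<in> carrier M" using l S(2) by auto
  moreover have "gen n l = carrier M"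
    using min[OF submodule_gen[of n l, OF lc]] mem_gen[of n l, OF lc] l by auto
  ultimately show thesis by (rule that)
qed

text \<open>Among the finitely generated submodules of \<open>S\<close> one has greatest length. It
  is \<open>S\<close> itself, since a missing element could be added as one more generator.\<close>

lemma finite_length_submodule_gen:
  assumes fl: "finite_length R M" and S: "submodule S R M"
  obtains n l where "\<And>i. i < n \<Longrightarrow> l i \<in> S" "gen n l = S"
proof -
  obtain d :: "_ \<Rightarrow> nat" where d: "\<And>S T. submodule S R M \<Longrightarrow> submodule T R M \<Longrightarrow> S \<subset> T \<Longrightarrow> d S < d T"
    using fl unfolding finite_length_def by blast
  note s = submoduleD[OF S]
  define P where "P T \<longleftrightarrow> (\<exists>n l. (\<forall>i<n. l i \<in> S) \<and> T = gen n l)" for T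
  have PD: "submodule T R M \<and> T \<subseteq> S" if T: "P T" for T
  proof -
    obtain n l where l: "\<And>i. i < n \<Longrightarrow> l i \<in> S" "T = gen n l" using T unfolding P_def by blast
    then show ?thesis using submodule_gen[of n l] gen_subset[OF S, of n l] s(1) by blast
  qed
  have bd: "\<forall>T. P T \<longrightarrow> d T < Suc (d S)"
    using PD d[OF _ S] by (metis less_Suc_eq psubsetI)
  have "P (gen 0 (\<lambda>_. \<zero>\<^bsub>M\<^esub>))" unfolding P_def by blast
  then obtain T where T: "P T" and max: "\<And>U. P U \<Longrightarrow> d U \<le> d T"
    using ex_has_greatest_nat[of P _ d "Suc (d S)"] bd by metis
  then obtain n l where l: "\<And>i. i < n \<Longrightarrow> l i \<in> S" "T = gen n l" unfolding P_def by blast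
  have "S \<subseteq> T"
  proof (rule ccontr)
    assume "\<not> S \<subseteq> T"
    then obtain x where x: "x \<in> S" "x \<notin> T" by blast
    \<comment> \<open>The missing element becomes generator number \<open>n\<close>, after the
      \<open>n\<close> old ones.\<close>
    let ?l = "l(n := x)"
    have l': "\<And>i. i < Suc n \<Longrightarrow> ?l i \<in> S" using l(1) x(1) by (auto simp: less_Suc_eq)
    then have c: "\<And>i. i < Suc n \<Longrightarrow> ?l i \<in> carrier M" using s(1) by blast
    have "T \<subseteq> gen (Suc n) ?l" unfolding l(2)
    proof (rule gen_subset[OF submodule_gen[of "Suc n" ?l, OF c]])
      show "l i \<in> gen (Suc n) ?l" if "i < n" for i using mem_gen[of "Suc n" ?l i, OF c] that by simp
    qed
    moreover have "x \<in> gen (Suc n) ?l" using mem_gen[of "Suc n" ?l n, OF c] by simp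
    ultimately have "d T < d (gen (Suc n) ?l)" using PD[OF T] submodule_gen[of "Suc n" ?l, OF c] x(2) by (intro d) auto
    moreover have "P (gen (Suc n) ?l)" using l' unfolding P_def by blast
    ultimately show False using max by fastforce
  qed
  then have "gen n l = S" using l(2) PD[OF T] by auto
  then show thesis using that[of n l] l(1) by blast
qed

text \<open>The component in \<open>I\<close> is unique because \<open>I\<close> and
  \<open>J\<close> meet only in zero. Uniqueness then gives linearity, and also the values on
  \<open>I\<close> and on \<open>J\<close>.\<close>

lemma projection_exists:
  assumes I: "submodule I R M" and J: "submodule J R M" and IJ: "I \<inter> J = {\<zero>\<^bsub>M\<^esub>}"
    and sum: "\<And>x. x \<in> carrier M \<Longrightarrow> \<exists>i\<in>I. x \<ominus>\<^bsub>M\<^esub> i \<in> J"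
  shows "\<exists>e. lin R M M e \<and> (\<forall>x\<in>carrier M. e x \<in> I) \<and> (\<forall>x\<in>carrier M. x \<ominus>\<^bsub>M\<^esub> e x \<in> J) \<and>
    (\<forall>x\<in>I. e x = x) \<and> (\<forall>x\<in>J. e x = \<zero>\<^bsub>M\<^esub>)"
proof -
  note i = submoduleD[OF I] and j = submoduleD[OF J]
  obtain e where e: "\<And>x. x \<in> carrier M \<Longrightarrow> e x \<in> I \<and> x \<ominus>\<^bsub>M\<^esub> e x \<in> J" using sum by metis
  have un: "e x = y" if "x \<in> carrier M" "y \<in> I" "x \<ominus>\<^bsub>M\<^esub> y \<in> J" for x y
  proof -
    have c: "e x \<in> carrier M" "y \<in> carrier M" using e that i(1) by auto
    have "(x \<ominus>\<^bsub>M\<^esub> y) \<ominus>\<^bsub>M\<^esub> (x \<ominus>\<^bsub>M\<^esub> e x) = e x \<ominus>\<^bsub>M\<^esub> y"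
      using that(1) c by (simp add: M.minus_eq M.minus_add M.a_ac M.r_neg1 M.r_neg2 M.r_neg)
    then have "e x \<ominus>\<^bsub>M\<^esub> y \<in> I \<inter> J" using e[OF that(1)] that i(6) j(6) by (metis IntI)
    then show ?thesis using IJ diff_zero_iff[OF c] by auto
  qed
  show ?thesis
  proof (intro exI[of _ e] conjI ballI)
    show "lin R M M e"
    proof (rule linI)
      show "e (x \<oplus>\<^bsub>M\<^esub> y) = e x \<oplus>\<^bsub>M\<^esub> e y" if xy: "x \<in> carrier M" "y \<in> carrier M" for x y
      proof (rule un)
        have c: "e x \<in> carrier M" "e y \<in> carrier M" using e xy i(1) by auto
        have "(x \<oplus>\<^bsub>M\<^esub> y) \<ominus>\<^bsub>M\<^esub> (e x \<oplus>\<^bsub>M\<^esub> e y) = (x \<ominus>\<^bsub>M\<^esub> e x) \<oplus>\<^bsub>M\<^esub> (y \<ominus>\<^bsub>M\<^esub> e y)"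
          using xy c by (simp add: M.minus_eq M.minus_add M.a_ac)
        then show "(x \<oplus>\<^bsub>M\<^esub> y) \<ominus>\<^bsub>M\<^esub> (e x \<oplus>\<^bsub>M\<^esub> e y) \<in> J" using e xy j(3) by simp
      qed (use xy e i in auto)
      show "e (a \<odot>\<^bsub>M\<^esub> x) = a \<odot>\<^bsub>M\<^esub> e x" if ax: "a \<in> carrier R" "x \<in> carrier M" for a x
      proof (rule un)
        have "e x \<in> carrier M" using e ax i(1) by auto
        then have "a \<odot>\<^bsub>M\<^esub> x \<ominus>\<^bsub>M\<^esub> a \<odot>\<^bsub>M\<^esub> e x = a \<odot>\<^bsub>M\<^esub> (x \<ominus>\<^bsub>M\<^esub> e x)" using ax by (simp add: smult_r_diff)
        then show "a \<odot>\<^bsub>M\<^esub> x \<ominus>\<^bsub>M\<^esub> a \<odot>\<^bsub>M\<^esub> e x \<in> J" using e ax j(4) by simp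
      qed (use ax e i in auto)
    qed (use e i(1) in auto)
    show "e x = x" if "x \<in> I" for x
      using that i(1) j(2) by (intro un) (auto simp: M.minus_eq M.r_neg subset_eq)
    show "e x = \<zero>\<^bsub>M\<^esub>" if "x \<in> J" for x using that i(2) j(1) by (intro un) (auto simp: subset_eq)
  qed (use e in auto)
qed

lemma lin_funpow: "lin R M M h \<Longrightarrow> lin R M M (h ^^ k)"
proof (induction k)
  case (Suc k)
  then show ?case using lin_comp[of R M M "h ^^ k" M h] by (simp add: comp_def)
qed (simp add: lin_id id_def)

text \<open>For suitable \<open>k\<close> the image and the kernel of \<open>h ^^ k\<close> do not
  change any more when \<open>k\<close> is doubled. Then they are complementary, and
  \<open>p\<close> is the projection onto the image along the kernel.\<close>

lemma fitting:
  assumes fl: "finite_length R M" and h: "lin R M M h"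
  obtains k p where "k > 0" "lin R M M p" "\<And>x. x \<in> carrier M \<Longrightarrow> p (p x) = p x"
    "p ` carrier M = (h ^^ k) ` carrier M"
proof -
  obtain d :: "_ \<Rightarrow> nat" where d: "\<And>S T. submodule S R M \<Longrightarrow> submodule T R M \<Longrightarrow> S \<subset> T \<Longrightarrow> d S < d T"
    using fl unfolding finite_length_def by blast
  have dm: "d S \<le> d T" "S = T \<or> d S < d T" if "submodule S R M" "submodule T R M" "S \<subseteq> T" for S T
    using d[OF that(1,2)] that(3) by fastforce+
  note L = left_module_axioms and hk = lin_funpow[OF h]
  let ?I = "\<lambda>k. (h ^^ k) ` carrier M" and ?K = "\<lambda>k. {x \<in> carrier M. (h ^^ k) x = \<zero>\<^bsub>M\<^esub>}"
  have I: "submodule (?I k) R M" and K: "submodule (?K k) R M" for k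
    using submodule_image[OF L L hk submodule_carrier] submodule_kernel[OF L L hk] by blast+
  \<comment> \<open>Both terms decrease as \<open>k\<close> grows along doublings: the length of the
    image, and the gap between the lengths of the module and the kernel. A single minimum therefore
    stabilizes both.\<close>
  let ?m = "\<lambda>k. d (?I k) + (d (carrier M) - d (?K k))"
  obtain k :: nat where k: "k > 0" and min: "\<And>l. l > 0 \<Longrightarrow> ?m k \<le> ?m l"
    using ex_has_least_nat[of "\<lambda>k. k > 0" 1 ?m] by auto
  have two: "(h ^^ (k + k)) x = (h ^^ k) ((h ^^ k) x)" for x by (simp add: funpow_add)
  have Isub: "?I (k + k) \<subseteq> ?I k" using linD(1)[OF hk] by (auto simp: two)
  have Ksub: "?K k \<subseteq> ?K (k + k)" using lin_zero[OF L L hk] by (auto simp: two)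
  have "?m k \<le> ?m (k + k)" using min k by simp
  \<comment> \<open>Rules out that the subtraction of naturals in \<open>?m\<close> hides a growth
    of the kernel.\<close>
  moreover have "d (?K (k + k)) \<le> d (carrier M)" using dm(1)[OF K submodule_carrier] by blast
  ultimately have eq: "?I (k + k) = ?I k" "?K k = ?K (k + k)"
    using dm(2)[OF I I Isub] dm(2)[OF K K Ksub] dm(1)[OF I I Isub] dm(1)[OF K K Ksub] by linarith+
  have IK: "?I k \<inter> ?K k = {\<zero>\<^bsub>M\<^esub>}"
    proof
      show "?I k \<inter> ?K k \<subseteq> {\<zero>\<^bsub>M\<^esub>}"
      proof
        fix y assume "y \<in> ?I k \<inter> ?K k"
        then obtain x where x: "x \<in> carrier M" "y = (h ^^ k) x" "(h ^^ k) y = \<zero>\<^bsub>M\<^esub>" by auto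
        then have "x \<in> ?K (k + k)" by (simp add: two)
        then show "y \<in> {\<zero>\<^bsub>M\<^esub>}" using x eq(2) by auto
      qed
      show "{\<zero>\<^bsub>M\<^esub>} \<subseteq> ?I k \<inter> ?K k" using submoduleD(2)[OF I] submoduleD(2)[OF K] by blast
    qed
  \<comment> \<open>As the image is stable, \<open>(h ^^ k) x\<close> is also
    \<open>(h ^^ k)\<close> of an element \<open>(h ^^ k) z\<close>; subtracting the latter from
    \<open>x\<close> leaves a kernel element.\<close>
  have dec: "\<exists>y\<in>?I k. x \<ominus>\<^bsub>M\<^esub> y \<in> ?K k" if x: "x \<in> carrier M" for x
  proof -
    from x have "(h ^^ k) x \<in> ?I (k + k)" using eq(1) by blast
    then obtain z where z: "z \<in> carrier M" "(h ^^ k) x = (h ^^ k) ((h ^^ k) z)" by (auto simp: two)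
    have "x \<ominus>\<^bsub>M\<^esub> (h ^^ k) z \<in> ?K k"
      using x z linD(1)[OF hk] by (simp add: lin_diff[OF L L hk] diff_zero_iff)
    then show ?thesis using z(1) by blast
  qed
  obtain p where p: "lin R M M p" "\<And>x. x \<in> carrier M \<Longrightarrow> p x \<in> ?I k" "\<And>x. x \<in> ?I k \<Longrightarrow> p x = x"
    using projection_exists[OF I K IK dec] by blast
  have "p ` carrier M = ?I k"
  proof
    show "p ` carrier M \<subseteq> ?I k" using p(2) by auto
    show "?I k \<subseteq> p ` carrier M"
    proof
      fix y assume "y \<in> ?I k"
      then have "y = p y" "y \<in> carrier M" using p(3) submoduleD(1)[OF I] by auto
      then show "y \<in> p ` carrier M" by (rule image_eqI)
    qed
  qed
  then show thesis using that[OF k p(1)] p(2,3) by auto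
qed

text \<open>
  Among the direct summands of \<open>M\<close> that \<open>\<pi>\<close> maps onto \<open>N\<close> a shortest one is a projective cover:
  a smaller submodule onto \<open>N\<close> would, by Fitting's lemma, contain such a summand.
\<close>

lemma projective_cover_summand:
  assumes proj: "fg_projective R M" and fl: "finite_length R M" and N: "left_module R N"
    and \<pi>: "lin R M N \<pi>" "\<pi> ` carrier M = carrier N"
  obtains S where "submodule S R M" "fg_projective R (M\<lparr>carrier := S\<rparr>)" "essential_epi R (M\<lparr>carrier := S\<rparr>) \<pi> N"
proof -
  obtain d :: "_ \<Rightarrow> nat" where d: "\<And>S T. submodule S R M \<Longrightarrow> submodule T R M \<Longrightarrow> S \<subset> T \<Longrightarrow> d S < d T"
    using fl unfolding finite_length_def by blast
  note L = left_module_axioms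
  \<comment> \<open>A summand is recorded as the image of an idempotent, which is the form that
    Fitting's lemma delivers.\<close>
  define Q where "Q S \<longleftrightarrow>
    (\<exists>e. lin R M M e \<and> (\<forall>x\<in>carrier M. e (e x) = e x) \<and> e ` carrier M = S \<and> \<pi> ` S = carrier N)" for S
  have "Q (carrier M)" using \<pi>(2) unfolding Q_def by (intro exI[of _ "\<lambda>x. x"]) (auto simp: lin_id)
  then obtain S where QS: "Q S" and min: "\<And>T. Q T \<Longrightarrow> d S \<le> d T"
    using ex_has_least_nat[of Q _ d] by metis
  obtain e where e: "lin R M M e" "\<And>x. x \<in> carrier M \<Longrightarrow> e (e x) = e x" "e ` carrier M = S"
    and \<pi>S: "\<pi> ` S = carrier N" using QS unfolding Q_def by blast
  have S: "submodule S R M" using submodule_image[OF L L e(1) submodule_carrier] e(3) by simp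
  note s = submoduleD[OF S]
  have eS: "e x = x" if "x \<in> S" for x using that e(2,3) by blast
  have eM: "e x \<in> S" if "x \<in> carrier M" for x using that e(3) by blast
  let ?S = "M\<lparr>carrier := S\<rparr>"
  have Sm: "left_module R ?S" by (rule left_module_submodule[OF S])
  have iS: "lin R ?S M (\<lambda>x. x)" using s(1) by (auto simp: lin_def)
  have eS': "lin R M ?S e" using e(1) eM by (auto simp: lin_def)
  have pS: "fg_projective R ?S" using fg_projective_retract[OF proj Sm iS eS'] eS by simp
  have \<pi>l: "lin R ?S N \<pi>" using lin_comp[OF iS \<pi>(1)] .
  have "L' = carrier ?S" if L': "submodule L' R ?S" "\<pi> ` L' = carrier N" for L'
  proof (rule ccontr)
    assume "L' \<noteq> carrier ?S"
    then have sub: "submodule L' R M" "L' \<subset> S" using submodule_submodule[OF S] L'(1) by auto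
    note l = submoduleD[OF sub(1)]
    have Lm: "left_module R (M\<lparr>carrier := L'\<rparr>)" by (rule left_module_submodule[OF sub(1)])
    have \<pi>L: "lin R (M\<lparr>carrier := L'\<rparr>) N \<pi>" using lin_restrict_carrier(2)[OF \<pi>(1) l(1) order_refl] .
    have "\<pi> x \<in> \<pi> ` carrier (M\<lparr>carrier := L'\<rparr>)" if "x \<in> carrier ?S" for x
      using that L'(2) \<pi>S by auto
    then obtain g where g: "lin R ?S (M\<lparr>carrier := L'\<rparr>) g" "\<And>x. x \<in> carrier ?S \<Longrightarrow> \<pi> (g x) = \<pi> x"
      by (rule projective_lift[OF pS Lm N \<pi>l \<pi>L]) blast+
    \<comment> \<open>\<open>g\<close> pushes \<open>S\<close> into the smaller submodule without
      changing \<open>\<pi>\<close>, by projectivity of \<open>S\<close>. Precomposing with the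
      projection \<open>e\<close> makes it an endomorphism of the whole module, to which Fitting's
      lemma applies.\<close>
    define h where "h x = g (e x)" for x
    have h: "lin R M M h" using lin_comp[OF eS' g(1)] l(1) by (auto simp: lin_def h_def)
    have hL: "h x \<in> L'" if "x \<in> carrier M" for x using linD(1)[OF g(1)] eM that by (simp add: h_def)
    obtain k p where k: "k > 0" and p: "lin R M M p" "\<And>x. x \<in> carrier M \<Longrightarrow> p (p x) = p x"
      "p ` carrier M = (h ^^ k) ` carrier M"
      using fitting[OF fl h] by metis
    let ?I = "(h ^^ k) ` carrier M"
    have I: "submodule ?I R M" using submodule_image[OF L L p(1) submodule_carrier] p(3) by simp
    have IM: "?I \<subseteq> carrier M" using submoduleD(1)[OF I] .
    \<comment> \<open>The exponent is positive, so the last application of \<open>h\<close> places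
      the image inside \<open>L'\<close>.\<close>
    obtain k' where k': "k = Suc k'" using k by (cases k) auto
    have IL: "?I \<subseteq> L'" using hL linD(1)[OF lin_funpow[OF h]] by (auto simp: k')
    \<comment> \<open>All powers of \<open>h\<close> preserve \<open>\<pi>\<close> on
      \<open>S\<close>. The Fitting image is therefore still mapped onto \<open>N\<close>, although
      it lies in \<open>L'\<close> and is shorter than \<open>S\<close>.\<close>
    have fix_S: "(h ^^ j) x \<in> S \<and> \<pi> ((h ^^ j) x) = \<pi> x" if "x \<in> S" for j x
    proof (induction j)
      case (Suc j)
      then have y: "(h ^^ j) x \<in> S" "\<pi> ((h ^^ j) x) = \<pi> x" by auto
      then have "h ((h ^^ j) x) \<in> S" using hL sub(2) s(1) by blast
      moreover have "\<pi> (h ((h ^^ j) x)) = \<pi> x" using y eS g(2) by (simp add: h_def)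
      ultimately show ?case by simp
    qed (use that in simp)
    have "\<pi> ` ?I = carrier N"
    proof
      show "\<pi> ` ?I \<subseteq> carrier N" using IM linD(1)[OF \<pi>(1)] by blast
      show "carrier N \<subseteq> \<pi> ` ?I"
      proof
        fix y assume "y \<in> carrier N"
        then obtain x where "x \<in> S" "y = \<pi> x" using \<pi>S by blast
        then have "y = \<pi> ((h ^^ k) x)" "x \<in> carrier M" using fix_S s(1) by auto
        then show "y \<in> \<pi> ` ?I" by blast
      qed
    qed
    then have "Q ?I" using p unfolding Q_def by (intro exI[of _ p]) auto
    then have "d S \<le> d ?I" by (rule min)
    moreover have "d ?I < d S" using IL sub(2) by (intro d I S) blast
    ultimately show False by simp
  qed
  then have "essential_epi R ?S \<pi> N" using \<pi>l \<pi>S by (auto simp: essential_epi_def)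
  then show thesis using that S pS by blast
qed

end

lemma fg_projective_free: "ring R \<Longrightarrow> fg_projective R (free_module R n)"
  using left_module_free free_module_dual_basis unfolding fg_projective_iff_dual_basis by blast

section \<open>Covers and presentations over a finite dimensional algebra\<close>

context fd_algebra
begin

lemma left_module_K: "left_module K A"
proof (intro left_module.intro left_module_axioms.intro)
  show "ring K" by (rule K.ring_axioms)
  show "abelian_group A" by (rule A.abelian_group_axioms)
qed (auto simp: KA.smult_l_distr KA.smult_r_distr KA.smult_assoc1)

lemma scalar_smult:
  assumes "k \<in> carrier K" "x \<in> carrier A"
  shows "(k \<odot>\<^bsub>A\<^esub> \<one>\<^bsub>A\<^esub>) \<otimes>\<^bsub>A\<^esub> x = k \<odot>\<^bsub>A\<^esub> x" "x \<otimes>\<^bsub>A\<^esub> (k \<odot>\<^bsub>A\<^esub> \<one>\<^bsub>A\<^esub>) = k \<odot>\<^bsub>A\<^esub> x"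
  using assms smult_mult_left[of k "\<one>\<^bsub>A\<^esub>" x] smult_mult_right[of k x "\<one>\<^bsub>A\<^esub>"] by auto

text \<open>Left ideals are subspaces because \<open>k x = (k 1) x\<close>. A length function for
  subspaces of \<open>A\<close>, an image of a finite free module over the field, therefore serves
  for left ideals.\<close>

lemma finite_length_regular: "finite_length A (regular_module A)"
proof -
  interpret V: left_module K A by (rule left_module_K)
  interpret M: left_module A "regular_module A" by (rule left_module_regular[OF A.ring_axioms])
  obtain n l where l: "\<And>i. i < n \<Longrightarrow> l i \<in> carrier A" "V.gen n l = carrier A"
    using V.fin_gen_imp_gen[OF finite_dim] by blast
  have "finite_length K A"
    using finite_length_image[OF left_module_free[OF K.ring_axioms] left_module_K V.lin_from_free[OF l(1)]]
      finite_length_free[OF K.ring_axioms finite_length_field[OF K.field_axioms], of n] l(2)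
    by (simp add: V.gen_def)
  then obtain d :: "_ \<Rightarrow> nat" where d: "\<And>S T. submodule S K A \<Longrightarrow> submodule T K A \<Longrightarrow> S \<subset> T \<Longrightarrow> d S < d T"
    unfolding finite_length_def by blast
  have "submodule S K A" if "submodule S A (regular_module A)" for S
  proof (rule V.submoduleI)
    note s = M.submoduleD[OF that]
    show "S \<subseteq> carrier A" "\<zero>\<^bsub>A\<^esub> \<in> S" "\<And>x y. x \<in> S \<Longrightarrow> y \<in> S \<Longrightarrow> x \<oplus>\<^bsub>A\<^esub> y \<in> S" using s by auto
    fix k x assume "k \<in> carrier K" "x \<in> S"
    then show "k \<odot>\<^bsub>A\<^esub> x \<in> S" using s(1) s(4)[of "k \<odot>\<^bsub>A\<^esub> \<one>\<^bsub>A\<^esub>" x] by (auto simp: scalar_smult)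
  qed
  then show ?thesis unfolding finite_length_def using d by blast
qed

lemma projective_cover_exists:
  assumes N: "left_module A N" and l: "\<And>i. i < n \<Longrightarrow> l i \<in> carrier N"
    "(\<lambda>u. finsum N (\<lambda>i. u i \<odot>\<^bsub>N\<^esub> l i) {..<n}) ` carrier (free_module A n) = carrier N"
  obtains S \<pi> where "submodule S A (free_module A n)"
    "fg_projective A ((free_module A n)\<lparr>carrier := S\<rparr>)" "essential_epi A ((free_module A n)\<lparr>carrier := S\<rparr>) \<pi> N"
proof -
  interpret N: left_module A N by (rule N)
  interpret F: left_module A "free_module A n" by (rule left_module_free[OF A.ring_axioms])
  show thesis
    using F.projective_cover_summand[OF fg_projective_free[OF A.ring_axioms]
        finite_length_free[OF A.ring_axioms finite_length_regular] N N.lin_from_free[OF l(1)] l(2)] that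
    by blast
qed

text \<open>Both covers are summands of finite free modules. The second exists because the kernel of
  the first, a submodule of a module of finite length, is again finitely generated.\<close>

lemma min_pres_exists:
  assumes "fg_module A N"
  obtains P1 :: "('a, nat \<Rightarrow> 'a) module" and f and P0 :: "('a, nat \<Rightarrow> 'a) module" and g
  where "min_pres A P1 f P0 g N"
proof -
  have N: "left_module A N" and "fin_gen A N" using assms by (auto simp: fg_module_def)
  interpret N: left_module A N by (rule N)
  obtain n l where l: "\<And>i. i < n \<Longrightarrow> l i \<in> carrier N" "N.gen n l = carrier N"
    using N.fin_gen_imp_gen[OF \<open>fin_gen A N\<close>] by blast
  let ?F = "free_module A n"
  interpret F: left_module A ?F by (rule left_module_free[OF A.ring_axioms])
  obtain S g where S: "submodule S A ?F" and P0: "fg_projective A (?F\<lparr>carrier := S\<rparr>)"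
    and g: "essential_epi A (?F\<lparr>carrier := S\<rparr>) g N"
    by (rule projective_cover_exists[OF N l(1) l(2)[unfolded N.gen_def]])
  note P0m = fg_projective_left_module[OF P0]
  let ?T = "{x \<in> carrier (?F\<lparr>carrier := S\<rparr>). g x = \<zero>\<^bsub>N\<^esub>}"
  have "submodule ?T A (?F\<lparr>carrier := S\<rparr>)" using submodule_kernel[OF P0m N essential_epiD(1)[OF g]] .
  then have T: "submodule ?T A ?F" using F.submodule_submodule[OF S] by blast
  let ?K = "?F\<lparr>carrier := ?T\<rparr>"
  have Km: "left_module A ?K" by (rule F.left_module_submodule[OF T])
  interpret K: left_module A ?K by (rule Km)
  obtain m v where v: "\<And>i. i < m \<Longrightarrow> v i \<in> ?T" "F.gen m v = ?T"
    using F.finite_length_submodule_gen[OF finite_length_free[OF A.ring_axioms finite_length_regular] T] by blast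
  have v': "\<And>i. i < m \<Longrightarrow> v i \<in> carrier ?K" using v(1) by simp
  \<comment> \<open>The kernel was generated inside the free module; the cover needs generation
    inside the kernel as a module of its own.\<close>
  have "F.gen m v \<subseteq> K.gen m v"
  proof (rule F.gen_subset)
    show "submodule (K.gen m v) A ?F"
      using K.submodule_gen[of m v, OF v'] F.submodule_submodule[OF T, of "K.gen m v"] by simp
  qed (rule K.mem_gen[of m v, OF v'])
  moreover have "K.gen m v \<subseteq> ?T" using K.submoduleD(1)[OF K.submodule_gen[of m v, OF v']] by simp
  ultimately have gen: "K.gen m v = carrier ?K" using v(2) by simp
  obtain S1 f where P1: "fg_projective A ((free_module A m)\<lparr>carrier := S1\<rparr>)"
    and f: "essential_epi A ((free_module A m)\<lparr>carrier := S1\<rparr>) f ?K"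
    by (rule projective_cover_exists[OF Km v' gen[unfolded K.gen_def]])
  have "min_pres A ((free_module A m)\<lparr>carrier := S1\<rparr>) f (?F\<lparr>carrier := S\<rparr>) g N"
    using P0 P1 g f by (simp add: min_pres_def)
  then show thesis by (rule that)
qed

lemma central_field: "central_field K A"
proof (intro central_field.intro central_field_axioms.intro K.field_axioms A.ring_axioms)
  show "(k \<odot>\<^bsub>A\<^esub> \<one>\<^bsub>A\<^esub>) \<otimes>\<^bsub>A\<^esub> b = b \<otimes>\<^bsub>A\<^esub> (k \<odot>\<^bsub>A\<^esub> \<one>\<^bsub>A\<^esub>)"
    if "k \<in> carrier K" "b \<in> carrier A" for k b using that by (simp add: scalar_smult)
qed (auto simp: KA.smult_l_distr KA.smult_assoc1 scalar_smult(1))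

end

section \<open>Tensor products\<close>

lemma (in group) coset_eq_iff:
  assumes "subgroup N G" "u \<in> carrier G" "v \<in> carrier G"
  shows "N #> u = N #> v \<longleftrightarrow> u \<otimes> inv v \<in> N"
proof -
  have "N #> u = N #> v \<longleftrightarrow> u \<in> N #> v"
    using repr_independence[OF _ assms(3,1), of u] rcos_self[OF assms(2,1)] by auto
  also have "\<dots> \<longleftrightarrow> u \<otimes> inv v \<in> N" using subgroup.rcos_module[OF assms(1) is_group assms(3,2)] .
  finally show ?thesis .
qed

section \<open>The tensor product and its universal property\<close>

context bimodule
begin

abbreviation gens where "gens X \<equiv>
  {frag_of (m \<oplus>\<^bsub>M\<^esub> m', x) - frag_of (m, x) - frag_of (m', x) | m m' x.
    m \<in> carrier M \<and> m' \<in> carrier M \<and> x \<in> carrier X} \<union>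
  {frag_of (m, x \<oplus>\<^bsub>X\<^esub> x') - frag_of (m, x) - frag_of (m, x') | m x x'.
    m \<in> carrier M \<and> x \<in> carrier X \<and> x' \<in> carrier X} \<union>
  {frag_of (rsmult M m a, x) - frag_of (m, a \<odot>\<^bsub>X\<^esub> x) | m a x.
    m \<in> carrier M \<and> a \<in> carrier A \<and> x \<in> carrier X}"

lemma keys_frag_diff:
  assumes "u \<in> carrier (free_Abelian_group S)" "v \<in> carrier (free_Abelian_group S)"
  shows "u - v \<in> carrier (free_Abelian_group S)"
  using assms keys_diff[of u v] by auto

lemma gens_carrier:
  assumes X: "left_module A X" shows "gens X \<subseteq> carrier (tensor_free M X)"
proof -
  interpret X: left_module A X by (rule X)
  have "u \<in> carrier (tensor_free M X)" if "u \<in> gens X" for u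
    using that by (auto simp del: carrier_free_Abelian_group_iff intro!: keys_frag_diff
        simp: rsmult_closed)
  then show ?thesis by (rule subsetI)
qed

context
  fixes X :: "('a, 'x, 'f) module_scheme"
  assumes X: "left_module A X"
begin

interpretation X: left_module A X by (rule X)

abbreviation (input) "gX \<equiv> tensor_free M X"
abbreviation (input) "nX \<equiv> tensor_relations A M X"
abbreviation (input) "cX \<equiv> tensor_class A M X"
abbreviation (input) "fX \<equiv> tensor A M X"

interpretation G: comm_group gX by (rule abelian_free_Abelian_group)

lemma relations_subgroup: "subgroup nX gX"
  unfolding tensor_relations_def by (rule G.generate_is_subgroup[OF gens_carrier[OF X]])

lemma relations_gen: "u \<in> gens X \<Longrightarrow> u \<in> nX"
  unfolding tensor_relations_def by (rule generate.incl)

lemma relations_subset: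
  assumes "subgroup H gX" "gens X \<subseteq> H" shows "nX \<subseteq> H"
  unfolding tensor_relations_def by (rule G.generate_subgroup_incl[OF assms(2,1)])

lemma cls_eq_iff: "u \<in> carrier gX \<Longrightarrow> v \<in> carrier gX \<Longrightarrow> cX u = cX v \<longleftrightarrow> u - v \<in> nX"
  unfolding tensor_class_def by (subst G.coset_eq_iff[OF relations_subgroup]) auto

lemma cls_self: "u \<in> carrier gX \<Longrightarrow> u \<in> cX u"
  unfolding tensor_class_def by (rule G.rcos_self[OF _ relations_subgroup])

lemma mem_cls: "u \<in> carrier gX \<Longrightarrow> v \<in> cX u \<Longrightarrow> v \<in> carrier gX \<and> cX v = cX u"
proof
  assume u: "u \<in> carrier gX" and v: "v \<in> cX u"
  show "v \<in> carrier gX"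
    using G.r_coset_subset_G[OF subgroup.subset[OF relations_subgroup] u] v unfolding tensor_class_def by (rule subsetD)
  show "cX v = cX u"
    using G.repr_independence[of v nX u, OF _ u relations_subgroup] v unfolding tensor_class_def by simp
qed

lemma tensor_simps:
  "carrier fX = cX ` carrier gX" "\<zero>\<^bsub>fX\<^esub> = cX 0"
  "u \<in> carrier gX \<Longrightarrow> v \<in> carrier gX \<Longrightarrow> cX u \<oplus>\<^bsub>fX\<^esub> cX v = cX (u + v)"
  "a \<odot>\<^bsub>fX\<^esub> C = (\<Union>u\<in>C. cX (frag_extend (\<lambda>(m, x). frag_of (a \<odot>\<^bsub>M\<^esub> m, x)) u))"
proof -
  interpret N: normal nX gX by (rule G.subgroup_imp_normal[OF relations_subgroup])
  show "carrier fX = cX ` carrier gX"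
    by (auto simp: tensor_def Let_def FactGroup_def RCOSETS_def tensor_class_def)
  have "nX #>\<^bsub>gX\<^esub> 0 = nX" using G.coset_mult_one[of nX] N.subset by simp
  then show "\<zero>\<^bsub>fX\<^esub> = cX 0" by (simp add: tensor_def Let_def FactGroup_def tensor_class_def)
  show "cX u \<oplus>\<^bsub>fX\<^esub> cX v = cX (u + v)" if "u \<in> carrier gX" "v \<in> carrier gX"
    using N.rcos_sum[OF that] by (simp add: tensor_def Let_def FactGroup_def tensor_class_def)
  show "a \<odot>\<^bsub>fX\<^esub> C = (\<Union>u\<in>C. cX (frag_extend (\<lambda>(m, x). frag_of (a \<odot>\<^bsub>M\<^esub> m, x)) u))"
    by (simp add: tensor_def Let_def)
qed

lemma abelian_group_tensor: "abelian_group fX"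
proof (rule abelian_groupI)
  show "\<zero>\<^bsub>fX\<^esub> \<in> carrier fX" unfolding tensor_simps by auto
  fix C D assume "C \<in> carrier fX" "D \<in> carrier fX"
  then obtain u v where u: "u \<in> carrier gX" "C = cX u" and v: "v \<in> carrier gX" "D = cX v"
    unfolding tensor_simps(1) by auto
  have uv: "u + v \<in> carrier gX" "v + u \<in> carrier gX" using G.m_closed[OF u(1) v(1)] by (auto simp: add.commute)
  show "C \<oplus>\<^bsub>fX\<^esub> D \<in> carrier fX" using uv u v by (simp add: tensor_simps(1,3) del: carrier_free_Abelian_group_iff)
  show "C \<oplus>\<^bsub>fX\<^esub> D = D \<oplus>\<^bsub>fX\<^esub> C" using u v by (simp add: tensor_simps(3) add.commute del: carrier_free_Abelian_group_iff)
  show "\<zero>\<^bsub>fX\<^esub> \<oplus>\<^bsub>fX\<^esub> C = C" using u tensor_simps(3)[of 0 u] by (simp add: tensor_simps(2))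
  have "- u \<in> carrier gX" using u by simp
  then show "\<exists>y\<in>carrier fX. y \<oplus>\<^bsub>fX\<^esub> C = \<zero>\<^bsub>fX\<^esub>"
    using u by (intro bexI[of _ "cX (- u)"]) (auto simp: tensor_simps(1-3) simp del: carrier_free_Abelian_group_iff)
  fix E assume "E \<in> carrier fX"
  then obtain w where w: "w \<in> carrier gX" "E = cX w" unfolding tensor_simps(1) by auto
  have vw: "v + w \<in> carrier gX" using G.m_closed[OF v(1) w(1)] by simp
  show "C \<oplus>\<^bsub>fX\<^esub> D \<oplus>\<^bsub>fX\<^esub> E = C \<oplus>\<^bsub>fX\<^esub> (D \<oplus>\<^bsub>fX\<^esub> E)"
    using u v w uv vw by (simp add: tensor_simps(3) add.assoc del: carrier_free_Abelian_group_iff)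
qed

interpretation FX: abelian_group fX by (rule abelian_group_tensor)

lemma pure_tensor_closed [simp, intro]:
  "m \<in> carrier M \<Longrightarrow> x \<in> carrier X \<Longrightarrow> pure_tensor A M X m x \<in> carrier fX"
  unfolding tensor_simps(1) pure_tensor_def by auto

lemma cls_diff:
  assumes "u \<in> carrier gX" "v \<in> carrier gX" shows "cX u \<ominus>\<^bsub>fX\<^esub> cX v = cX (u - v)"
proof -
  have c: "cX u \<in> carrier fX" "cX v \<in> carrier fX" "cX (u - v) \<in> carrier fX"
    using assms keys_frag_diff[OF assms] by (auto simp: tensor_simps(1) simp del: carrier_free_Abelian_group_iff)
  have "cX u = cX (u - v) \<oplus>\<^bsub>fX\<^esub> cX v"
    using assms keys_frag_diff[OF assms] by (simp add: tensor_simps(3) del: carrier_free_Abelian_group_iff)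
  then show ?thesis using c FX.diff_add_cancel(3) by simp
qed

text \<open>Differences take the place of sums because this is the shape of the induction rule for
  free abelian groups, where they also account for negative coefficients.\<close>

lemma tensor_induct_diff:
  assumes C: "C \<in> carrier fX" and zero: "P \<zero>\<^bsub>fX\<^esub>"
    and diff: "\<And>C D. C \<in> carrier fX \<Longrightarrow> D \<in> carrier fX \<Longrightarrow> P C \<Longrightarrow> P D \<Longrightarrow> P (C \<ominus>\<^bsub>fX\<^esub> D)"
    and pure: "\<And>m x. m \<in> carrier M \<Longrightarrow> x \<in> carrier X \<Longrightarrow> P (pure_tensor A M X m x)"
  shows "P C"
proof -
  obtain u where u: "u \<in> carrier gX" "C = cX u" using C unfolding tensor_simps(1) by auto
  have "Poly_Mapping.keys u \<subseteq> carrier M \<times> carrier X" using u by simp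
  then have "P (cX u)"
  proof (rule free_Abelian_group_induct[where P = "\<lambda>u. P (cX u)"])
    show "P (cX 0)" using zero tensor_simps(2) by simp
    show "P (cX (u - v))" if "Poly_Mapping.keys u \<subseteq> carrier M \<times> carrier X"
      "Poly_Mapping.keys v \<subseteq> carrier M \<times> carrier X" "P (cX u)" "P (cX v)" for u v
      using that diff[of "cX u" "cX v"] cls_diff[of u v] by (auto simp: tensor_simps(1))
    show "P (cX (frag_of p))" if "p \<in> carrier M \<times> carrier X" for p
      using that pure by (cases p) (auto simp: pure_tensor_def)
  qed
  then show ?thesis using u by simp
qed

lemma pure_tensor_add_left:
  assumes "m \<in> carrier M" "m' \<in> carrier M" "x \<in> carrier X"
  shows "pure_tensor A M X (m \<oplus>\<^bsub>M\<^esub> m') x = pure_tensor A M X m x \<oplus>\<^bsub>fX\<^esub> pure_tensor A M X m' x"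
proof -
  have "frag_of (m \<oplus>\<^bsub>M\<^esub> m', x) - frag_of (m, x) - frag_of (m', x) \<in> nX"
    by (rule relations_gen) (use assms in blast)
  moreover have "frag_of (m, x) + frag_of (m', x) \<in> carrier gX" using assms G.m_closed[of "frag_of (m, x)" "frag_of (m', x)"] by auto
  ultimately show ?thesis using assms
    by (simp add: pure_tensor_def tensor_simps(3) cls_eq_iff diff_diff_eq del: carrier_free_Abelian_group_iff)
qed

lemma pure_tensor_add_right:
  assumes "m \<in> carrier M" "x \<in> carrier X" "x' \<in> carrier X"
  shows "pure_tensor A M X m (x \<oplus>\<^bsub>X\<^esub> x') = pure_tensor A M X m x \<oplus>\<^bsub>fX\<^esub> pure_tensor A M X m x'"
proof -
  have "frag_of (m, x \<oplus>\<^bsub>X\<^esub> x') - frag_of (m, x) - frag_of (m, x') \<in> nX"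
    by (rule relations_gen) (use assms in blast)
  moreover have "frag_of (m, x) + frag_of (m, x') \<in> carrier gX" using assms G.m_closed[of "frag_of (m, x)" "frag_of (m, x')"] by auto
  ultimately show ?thesis using assms
    by (simp add: pure_tensor_def tensor_simps(3) cls_eq_iff diff_diff_eq del: carrier_free_Abelian_group_iff)
qed

lemma pure_tensor_balanced:
  assumes "m \<in> carrier M" "a \<in> carrier A" "x \<in> carrier X"
  shows "pure_tensor A M X (rsmult M m a) x = pure_tensor A M X m (a \<odot>\<^bsub>X\<^esub> x)"
proof -
  have "frag_of (rsmult M m a, x) - frag_of (m, a \<odot>\<^bsub>X\<^esub> x) \<in> nX"
    by (rule relations_gen) (use assms in blast)
  then show ?thesis using assms
    by (simp add: pure_tensor_def cls_eq_iff rsmult_closed del: carrier_free_Abelian_group_iff)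
qed

lemma tensor_universal:
  assumes H: "comm_group H"
    and b: "\<And>m x. m \<in> carrier M \<Longrightarrow> x \<in> carrier X \<Longrightarrow> b m x \<in> carrier H"
    "\<And>m m' x. m \<in> carrier M \<Longrightarrow> m' \<in> carrier M \<Longrightarrow> x \<in> carrier X \<Longrightarrow> b (m \<oplus>\<^bsub>M\<^esub> m') x = b m x \<otimes>\<^bsub>H\<^esub> b m' x"
    "\<And>m x x'. m \<in> carrier M \<Longrightarrow> x \<in> carrier X \<Longrightarrow> x' \<in> carrier X \<Longrightarrow> b m (x \<oplus>\<^bsub>X\<^esub> x') = b m x \<otimes>\<^bsub>H\<^esub> b m x'"
    "\<And>m a x. m \<in> carrier M \<Longrightarrow> a \<in> carrier A \<Longrightarrow> x \<in> carrier X \<Longrightarrow> b (rsmult M m a) x = b m (a \<odot>\<^bsub>X\<^esub> x)"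
  shows "\<exists>h. (\<forall>C\<in>carrier fX. h C \<in> carrier H) \<and>
    (\<forall>C\<in>carrier fX. \<forall>D\<in>carrier fX. h (C \<oplus>\<^bsub>fX\<^esub> D) = h C \<otimes>\<^bsub>H\<^esub> h D) \<and>
    (\<forall>m\<in>carrier M. \<forall>x\<in>carrier X. h (pure_tensor A M X m x) = b m x)"
proof -
  interpret H: comm_group H by (rule H)
  have "(\<lambda>(m, x). b m x) ` (carrier M \<times> carrier X) \<subseteq> carrier H" using b(1) by auto
  then obtain h where h: "h \<in> hom gX H" "\<And>p. p \<in> carrier M \<times> carrier X \<Longrightarrow> h (frag_of p) = (case p of (m, x) \<Rightarrow> b m x)"
    using H.free_Abelian_group_universal by blast
  interpret h: group_hom gX H h by unfold_locales (rule h(1))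
  have hd: "h (u - v) = h u \<otimes>\<^bsub>H\<^esub> inv\<^bsub>H\<^esub> h v" if "u \<in> carrier gX" "v \<in> carrier gX" for u v
  proof -
    have "- v \<in> carrier gX" "h (- v) = inv\<^bsub>H\<^esub> h v" using h.hom_inv[OF that(2)] that(2) by auto
    then show ?thesis using h.hom_mult[OF that(1), of "- v"] by simp
  qed
  have hb: "h (frag_of (m, x)) = b m x" if "m \<in> carrier M" "x \<in> carrier X" for m x
    using h(2)[of "(m, x)"] that by simp
  have fr: "frag_of (m, x) \<in> carrier gX" if "m \<in> carrier M" "x \<in> carrier X" for m x using that by simp
  have "nX \<subseteq> kernel gX H h"
  proof (rule relations_subset[OF h.subgroup_kernel])
    have "h u = \<one>\<^bsub>H\<^esub>" if "u \<in> gens X" for u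
      using that
    proof (elim UnE CollectE exE conjE)
      fix m m' x assume *: "u = frag_of (m \<oplus>\<^bsub>M\<^esub> m', x) - frag_of (m, x) - frag_of (m', x)"
        "m \<in> carrier M" "m' \<in> carrier M" "x \<in> carrier X"
      then show ?thesis using fr keys_frag_diff[OF fr fr]
        by (simp add: hd hb b H.m_ac H.inv_mult del: carrier_free_Abelian_group_iff)
    next
      fix m x x' assume *: "u = frag_of (m, x \<oplus>\<^bsub>X\<^esub> x') - frag_of (m, x) - frag_of (m, x')"
        "m \<in> carrier M" "x \<in> carrier X" "x' \<in> carrier X"
      then show ?thesis using fr keys_frag_diff[OF fr fr]
        by (simp add: hd hb b H.m_ac H.inv_mult del: carrier_free_Abelian_group_iff)
    next
      fix m a x assume *: "u = frag_of (rsmult M m a, x) - frag_of (m, a \<odot>\<^bsub>X\<^esub> x)"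
        "m \<in> carrier M" "a \<in> carrier A" "x \<in> carrier X"
      then show ?thesis by (simp add: hd hb b rsmult_closed fr del: carrier_free_Abelian_group_iff)
    qed
    then show "gens X \<subseteq> kernel gX H h"
      using subsetD[OF gens_carrier[OF X]] unfolding kernel_def by (intro subsetI CollectI conjI)
  qed
  then have N1: "h u = \<one>\<^bsub>H\<^esub>" if "u \<in> nX" for u using that by (auto simp: kernel_def)
  \<comment> \<open>The value on a class is read off at an arbitrary representative; two of them
    differ by a relation, which \<open>h\<close> sends to the unit.\<close>
  define f where "f C = h (SOME u. u \<in> C)" for C
  have f: "f (cX u) = h u" if u: "u \<in> carrier gX" for u
  proof -
    define v where "v = (SOME v. v \<in> cX u)"
    have "v \<in> cX u" unfolding v_def by (rule someI[of _ u]) (rule cls_self[OF u])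
    then have v: "v \<in> carrier gX" "v - u \<in> nX" using mem_cls[OF u, of v] cls_eq_iff[of v u] u by auto
    then have "h v \<otimes>\<^bsub>H\<^esub> inv\<^bsub>H\<^esub> h u = \<one>\<^bsub>H\<^esub>" using N1 hd[OF v(1) u] by simp
    then have "h v = h u" using v(1) u by (metis H.inv_equality H.inv_inv h.hom_closed H.inv_closed)
    then show ?thesis by (simp add: f_def v_def)
  qed
  show ?thesis
  proof (intro exI[of _ f] conjI ballI)
    show "f C \<in> carrier H" if "C \<in> carrier fX" for C
      using that h.hom_closed f unfolding tensor_simps(1) by auto
    show "f (C \<oplus>\<^bsub>fX\<^esub> D) = f C \<otimes>\<^bsub>H\<^esub> f D" if CD: "C \<in> carrier fX" "D \<in> carrier fX" for C D
    proof -
      obtain u v where u: "u \<in> carrier gX" "C = cX u" and v: "v \<in> carrier gX" "D = cX v"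
        using CD unfolding tensor_simps(1) by auto
      have "u + v \<in> carrier gX" using G.m_closed[OF u(1) v(1)] by simp
      then show ?thesis using u v h.hom_mult[OF u(1) v(1)]
        by (simp add: tensor_simps(3) f del: carrier_free_Abelian_group_iff)
    qed
    show "f (pure_tensor A M X m x) = b m x" if "m \<in> carrier M" "x \<in> carrier X" for m x
      using that f[OF fr] hb by (simp add: pure_tensor_def)
  qed
qed

lemma tensor_ext:
  assumes "abelian_group H" "C \<in> carrier fX"
    and "\<And>C. C \<in> carrier fX \<Longrightarrow> f C \<in> carrier H" "\<And>C. C \<in> carrier fX \<Longrightarrow> g C \<in> carrier H"
    and "\<And>C D. C \<in> carrier fX \<Longrightarrow> D \<in> carrier fX \<Longrightarrow> f (C \<oplus>\<^bsub>fX\<^esub> D) = f C \<oplus>\<^bsub>H\<^esub> f D"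
      "\<And>C D. C \<in> carrier fX \<Longrightarrow> D \<in> carrier fX \<Longrightarrow> g (C \<oplus>\<^bsub>fX\<^esub> D) = g C \<oplus>\<^bsub>H\<^esub> g D"
    and "\<And>m x. m \<in> carrier M \<Longrightarrow> x \<in> carrier X \<Longrightarrow> f (pure_tensor A M X m x) = g (pure_tensor A M X m x)"
  shows "f C = g C"
proof -
  interpret H: abelian_group H by fact
  have diff: "k (C \<ominus>\<^bsub>fX\<^esub> D) = k C \<ominus>\<^bsub>H\<^esub> k D"
    if k: "\<And>C. C \<in> carrier fX \<Longrightarrow> k C \<in> carrier H"
      "\<And>C D. C \<in> carrier fX \<Longrightarrow> D \<in> carrier fX \<Longrightarrow> k (C \<oplus>\<^bsub>fX\<^esub> D) = k C \<oplus>\<^bsub>H\<^esub> k D"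
      and CD: "C \<in> carrier fX" "D \<in> carrier fX" for k C D
    using k(2)[of "C \<ominus>\<^bsub>fX\<^esub> D" D] k(1) CD FX.diff_add_cancel(2)[OF CD]
      H.diff_add_cancel(3)[of "k (C \<ominus>\<^bsub>fX\<^esub> D)" "k D"] by simp
  have zero: "k \<zero>\<^bsub>fX\<^esub> = \<zero>\<^bsub>H\<^esub>"
    if k: "\<And>C. C \<in> carrier fX \<Longrightarrow> k C \<in> carrier H"
      "\<And>C D. C \<in> carrier fX \<Longrightarrow> D \<in> carrier fX \<Longrightarrow> k (C \<oplus>\<^bsub>fX\<^esub> D) = k C \<oplus>\<^bsub>H\<^esub> k D" for k
    using k(2)[of "\<zero>\<^bsub>fX\<^esub>" "\<zero>\<^bsub>fX\<^esub>"] k(1)[of "\<zero>\<^bsub>fX\<^esub>"] H.add.r_cancel_one' by force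
  show ?thesis
    by (rule tensor_induct_diff[OF assms(2), of "\<lambda>C. f C = g C"])
      (use zero[of f, OF assms(3,5)] zero[of g, OF assms(4,6)]
        diff[of f, OF assms(3,5)] diff[of g, OF assms(4,6)] assms(7) in auto)
qed

end

text \<open>Maps of generators \<open>M \<times> X \<rightarrow> M \<times> Y\<close> that respect the relations descend to the tensor products.\<close>

lemma tensor_class_map:
  assumes X: "left_module A X" and Y: "left_module A Y" and u: "u \<in> carrier (tensor_free M X)"
    and p: "\<And>m x. m \<in> carrier M \<Longrightarrow> x \<in> carrier X \<Longrightarrow> p m \<in> carrier M \<and> f x \<in> carrier Y"
    and padd: "\<And>m m'. m \<in> carrier M \<Longrightarrow> m' \<in> carrier M \<Longrightarrow> p (m \<oplus>\<^bsub>M\<^esub> m') = p m \<oplus>\<^bsub>M\<^esub> p m'"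
    and prs: "\<And>m a. m \<in> carrier M \<Longrightarrow> a \<in> carrier A \<Longrightarrow> p (rsmult M m a) = rsmult M (p m) a"
    and f: "lin A X Y f"
  shows "(\<Union>v\<in>tensor_class A M X u. tensor_class A M Y (frag_extend (\<lambda>(m, x). frag_of (p m, f x)) v)) =
    tensor_class A M Y (frag_extend (\<lambda>(m, x). frag_of (p m, f x)) u)"
proof -
  let ?E = "frag_extend (\<lambda>(m, x). frag_of (p m, f x))"
  interpret X: left_module A X by (rule X)
  interpret Y: left_module A Y by (rule Y)
  interpret GX: comm_group "tensor_free M X" by (rule abelian_free_Abelian_group)
  interpret GY: comm_group "tensor_free M Y" by (rule abelian_free_Abelian_group)
  have EG: "?E v \<in> carrier (tensor_free M Y)" if "v \<in> carrier (tensor_free M X)" for v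
  proof -
    have "Poly_Mapping.keys v \<subseteq> carrier M \<times> carrier X" using that by simp
    then show ?thesis unfolding carrier_free_Abelian_group_iff
      by (intro order_trans[OF keys_frag_extend]) (use p in auto)
  qed
  interpret E: group_hom "tensor_free M X" "tensor_free M Y" ?E
    by unfold_locales (rule homI, use EG in \<open>auto simp: frag_extend_add simp del: carrier_free_Abelian_group_iff\<close>)
  \<comment> \<open>The elements that are sent to relations form a subgroup. Once it contains the
    generating relations it contains all of them.\<close>
  let ?H = "{v \<in> carrier (tensor_free M X). ?E v \<in> tensor_relations A M Y}"
  note sY = relations_subgroup[OF Y]
  have "subgroup ?H (tensor_free M X)"
  proof (rule GX.subgroupI)
    show "?H \<noteq> {}" using subgroup.one_closed[OF sY] by force
    show "inv\<^bsub>tensor_free M X\<^esub> v \<in> ?H" if "v \<in> ?H" for v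
      using that subgroup.m_inv_closed[OF sY, of "?E v"] GX.inv_closed[of v] E.hom_inv[of v]
      by (simp del: carrier_free_Abelian_group_iff inv_free_Abelian_group)
    show "v \<otimes>\<^bsub>tensor_free M X\<^esub> w \<in> ?H" if "v \<in> ?H" "w \<in> ?H" for v w
      using that subgroup.m_closed[OF sY, of "?E v" "?E w"] GX.m_closed[of v w] E.hom_mult[of v w]
      by (simp del: carrier_free_Abelian_group_iff mult_free_Abelian_group)
  qed auto
  moreover have "?E v \<in> tensor_relations A M Y" if "v \<in> gens X" for v
    using that
  proof (elim UnE CollectE exE conjE)
    fix m m' x assume *: "v = frag_of (m \<oplus>\<^bsub>M\<^esub> m', x) - frag_of (m, x) - frag_of (m', x)"
      "m \<in> carrier M" "m' \<in> carrier M" "x \<in> carrier X"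
    then have "?E v = frag_of (p m \<oplus>\<^bsub>M\<^esub> p m', f x) - frag_of (p m, f x) - frag_of (p m', f x)"
      by (simp add: frag_extend_diff padd)
    then show ?thesis using * p by (intro relations_gen[OF Y]) blast
  next
    fix m x x' assume *: "v = frag_of (m, x \<oplus>\<^bsub>X\<^esub> x') - frag_of (m, x) - frag_of (m, x')"
      "m \<in> carrier M" "x \<in> carrier X" "x' \<in> carrier X"
    then have "?E v = frag_of (p m, f x \<oplus>\<^bsub>Y\<^esub> f x') - frag_of (p m, f x) - frag_of (p m, f x')"
      by (simp add: frag_extend_diff linD[OF f])
    then show ?thesis using * p by (intro relations_gen[OF Y]) blast
  next
    fix m a x assume *: "v = frag_of (rsmult M m a, x) - frag_of (m, a \<odot>\<^bsub>X\<^esub> x)"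
      "m \<in> carrier M" "a \<in> carrier A" "x \<in> carrier X"
    then have "?E v = frag_of (rsmult M (p m) a, f x) - frag_of (p m, a \<odot>\<^bsub>Y\<^esub> f x)"
      by (simp add: frag_extend_diff prs linD[OF f])
    then show ?thesis using * p by (intro relations_gen[OF Y]) blast
  qed
  then have "gens X \<subseteq> ?H" using gens_carrier[OF X] by (intro subsetI CollectI conjI) (rule subsetD)
  ultimately have sub: "tensor_relations A M X \<subseteq> ?H" by (rule relations_subset[OF X])
  have "tensor_class A M Y (?E v) = tensor_class A M Y (?E u)" if v: "v \<in> tensor_class A M X u" for v
  proof -
    have vG: "v \<in> carrier (tensor_free M X)" "v - u \<in> tensor_relations A M X"
      using mem_cls[OF X u v] cls_eq_iff[OF X _ u] by auto
    then have "?E v - ?E u \<in> tensor_relations A M Y" using sub by (auto simp: frag_extend_diff)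
    then show ?thesis using cls_eq_iff[OF Y EG[OF vG(1)] EG[OF u]] by simp
  qed
  then show ?thesis using cls_self[OF X u] by blast
qed

lemma tensor_smult_pure:
  assumes X: "left_module A X" and "a \<in> carrier A" "m \<in> carrier M" "x \<in> carrier X"
  shows "a \<odot>\<^bsub>tensor A M X\<^esub> pure_tensor A M X m x = pure_tensor A M X (a \<odot>\<^bsub>M\<^esub> m) x"
  using tensor_class_map[OF X X, of "frag_of (m, x)" "\<lambda>m. a \<odot>\<^bsub>M\<^esub> m" "\<lambda>x. x"] assms
  by (simp add: tensor_simps[OF X] pure_tensor_def lin_id smult_r_distr smult_rsmult)

text \<open>On representatives a scalar acts by a homomorphism of free groups, the one induced by
  \<open>a\<close> acting on \<open>M\<close> from the left. It respects the relations because the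
  left and right actions commute.\<close>

lemma tensor_smult_add:
  assumes X: "left_module A X" and a: "a \<in> carrier A" and C: "C \<in> carrier (tensor A M X)" and D: "D \<in> carrier (tensor A M X)"
  shows "a \<odot>\<^bsub>tensor A M X\<^esub> C \<in> carrier (tensor A M X)"
    "a \<odot>\<^bsub>tensor A M X\<^esub> (C \<oplus>\<^bsub>tensor A M X\<^esub> D) = a \<odot>\<^bsub>tensor A M X\<^esub> C \<oplus>\<^bsub>tensor A M X\<^esub> a \<odot>\<^bsub>tensor A M X\<^esub> D"
proof -
  let ?E = "frag_extend (\<lambda>(m, x). frag_of (a \<odot>\<^bsub>M\<^esub> m, x))"
  interpret G: comm_group "tensor_free M X" by (rule abelian_free_Abelian_group)
  have EG: "?E v \<in> carrier (tensor_free M X)" if "v \<in> carrier (tensor_free M X)" for v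
  proof -
    have "Poly_Mapping.keys v \<subseteq> carrier M \<times> carrier X" using that by simp
    then show ?thesis unfolding carrier_free_Abelian_group_iff
      by (intro order_trans[OF keys_frag_extend]) (use a in auto)
  qed
  have sm: "a \<odot>\<^bsub>tensor A M X\<^esub> tensor_class A M X u = tensor_class A M X (?E u)"
    if "u \<in> carrier (tensor_free M X)" for u
    unfolding tensor_simps(4)[OF X]
    by (rule tensor_class_map[OF X X that]) (use a in \<open>auto simp: smult_r_distr smult_rsmult lin_id\<close>)
  obtain u v where u: "u \<in> carrier (tensor_free M X)" "C = tensor_class A M X u"
    and v: "v \<in> carrier (tensor_free M X)" "D = tensor_class A M X v"
    using C D unfolding tensor_simps(1)[OF X] by auto
  have uv: "u + v \<in> carrier (tensor_free M X)" using G.m_closed[OF u(1) v(1)] by simp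
  show "a \<odot>\<^bsub>tensor A M X\<^esub> C \<in> carrier (tensor A M X)"
    using u sm EG by (simp add: tensor_simps(1)[OF X] del: carrier_free_Abelian_group_iff)
  show "a \<odot>\<^bsub>tensor A M X\<^esub> (C \<oplus>\<^bsub>tensor A M X\<^esub> D) = a \<odot>\<^bsub>tensor A M X\<^esub> C \<oplus>\<^bsub>tensor A M X\<^esub> a \<odot>\<^bsub>tensor A M X\<^esub> D"
    using u v uv sm EG by (simp add: tensor_simps(3)[OF X] frag_extend_add del: carrier_free_Abelian_group_iff)
qed

text \<open>Each remaining axiom equates two additive functions of the tensor, so it is enough to
  compare them on pure tensors.\<close>

lemma left_module_tensor:
  assumes X: "left_module A X" shows "left_module A (tensor A M X)"
proof -
  interpret X: left_module A X by (rule X)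
  interpret FX: abelian_group "tensor A M X" by (rule abelian_group_tensor[OF X])
  note c = tensor_smult_add(1)[OF X _ _ FX.zero_closed] and add = tensor_smult_add(2)[OF X]
    and pure = tensor_smult_pure[OF X] and ext = tensor_ext[OF X FX.abelian_group_axioms]
  show ?thesis
  proof (intro left_module.intro left_module_axioms.intro)
    show "ring A" by (rule A.ring_axioms)
    show "abelian_group (tensor A M X)" by (rule FX.abelian_group_axioms)
    fix a C assume a: "a \<in> carrier A" and C: "C \<in> carrier (tensor A M X)"
    show "a \<odot>\<^bsub>tensor A M X\<^esub> C \<in> carrier (tensor A M X)" using c[OF a C] .
    show "a \<odot>\<^bsub>tensor A M X\<^esub> (C \<oplus>\<^bsub>tensor A M X\<^esub> D) = a \<odot>\<^bsub>tensor A M X\<^esub> C \<oplus>\<^bsub>tensor A M X\<^esub> a \<odot>\<^bsub>tensor A M X\<^esub> D"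
      if "D \<in> carrier (tensor A M X)" for D using add[OF a C that] .
    show "(a \<oplus>\<^bsub>A\<^esub> b) \<odot>\<^bsub>tensor A M X\<^esub> C = a \<odot>\<^bsub>tensor A M X\<^esub> C \<oplus>\<^bsub>tensor A M X\<^esub> b \<odot>\<^bsub>tensor A M X\<^esub> C"
      if "b \<in> carrier A" for b
      by (rule ext[OF C, where f = "\<lambda>C. (a \<oplus>\<^bsub>A\<^esub> b) \<odot>\<^bsub>tensor A M X\<^esub> C"])
        (use a that in \<open>auto simp: c add pure smult_l_distr pure_tensor_add_left[OF X] FX.a_ac\<close>)
    show "(a \<otimes>\<^bsub>A\<^esub> b) \<odot>\<^bsub>tensor A M X\<^esub> C = a \<odot>\<^bsub>tensor A M X\<^esub> (b \<odot>\<^bsub>tensor A M X\<^esub> C)"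
      if "b \<in> carrier A" for b
      by (rule ext[OF C, where f = "\<lambda>C. (a \<otimes>\<^bsub>A\<^esub> b) \<odot>\<^bsub>tensor A M X\<^esub> C"])
        (use a that in \<open>auto simp: c add pure smult_assoc\<close>)
  next
    fix C assume C: "C \<in> carrier (tensor A M X)"
    show "\<one>\<^bsub>A\<^esub> \<odot>\<^bsub>tensor A M X\<^esub> C = C"
      by (rule ext[OF C, where f = "\<lambda>C. \<one>\<^bsub>A\<^esub> \<odot>\<^bsub>tensor A M X\<^esub> C"]) (auto simp: c add pure)
  qed
qed

lemma tensor_map_pure:
  assumes "left_module A X" "left_module A Y" "lin A X Y f" "m \<in> carrier M" "x \<in> carrier X"
  shows "tensor_map A M Y f (pure_tensor A M X m x) = pure_tensor A M Y m (f x)"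
  using tensor_class_map[OF assms(1,2), of "frag_of (m, x)" "\<lambda>m. m" f] assms linD(1)[OF assms(3)]
  by (simp add: tensor_map_def pure_tensor_def)

lemma tensor_lin:
  assumes X: "left_module A X" and Y: "left_module A Y"
    and b: "\<And>m x. m \<in> carrier M \<Longrightarrow> x \<in> carrier X \<Longrightarrow> b m x \<in> carrier Y"
    "\<And>m m' x. m \<in> carrier M \<Longrightarrow> m' \<in> carrier M \<Longrightarrow> x \<in> carrier X \<Longrightarrow> b (m \<oplus>\<^bsub>M\<^esub> m') x = b m x \<oplus>\<^bsub>Y\<^esub> b m' x"
    "\<And>m x x'. m \<in> carrier M \<Longrightarrow> x \<in> carrier X \<Longrightarrow> x' \<in> carrier X \<Longrightarrow> b m (x \<oplus>\<^bsub>X\<^esub> x') = b m x \<oplus>\<^bsub>Y\<^esub> b m x'"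
    "\<And>m a x. m \<in> carrier M \<Longrightarrow> a \<in> carrier A \<Longrightarrow> x \<in> carrier X \<Longrightarrow> b (rsmult M m a) x = b m (a \<odot>\<^bsub>X\<^esub> x)"
    "\<And>m a x. m \<in> carrier M \<Longrightarrow> a \<in> carrier A \<Longrightarrow> x \<in> carrier X \<Longrightarrow> b (a \<odot>\<^bsub>M\<^esub> m) x = a \<odot>\<^bsub>Y\<^esub> b m x"
  shows "\<exists>h. lin A (tensor A M X) Y h \<and> (\<forall>m\<in>carrier M. \<forall>x\<in>carrier X. h (pure_tensor A M X m x) = b m x)"
proof -
  interpret Y: left_module A Y by (rule Y)
  interpret FX: left_module A "tensor A M X" by (rule left_module_tensor[OF X])
  have "\<exists>h. (\<forall>C\<in>carrier (tensor A M X). h C \<in> carrier Y) \<and>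
    (\<forall>C\<in>carrier (tensor A M X). \<forall>D\<in>carrier (tensor A M X).
      h (C \<oplus>\<^bsub>tensor A M X\<^esub> D) = h C \<oplus>\<^bsub>Y\<^esub> h D) \<and>
    (\<forall>m\<in>carrier M. \<forall>x\<in>carrier X. h (pure_tensor A M X m x) = b m x)"
    using tensor_universal[OF X Y.a_comm_group, of b] b by simp
  then obtain h where h: "\<And>C. C \<in> carrier (tensor A M X) \<Longrightarrow> h C \<in> carrier Y"
    "\<And>C D. C \<in> carrier (tensor A M X) \<Longrightarrow> D \<in> carrier (tensor A M X) \<Longrightarrow> h (C \<oplus>\<^bsub>tensor A M X\<^esub> D) = h C \<oplus>\<^bsub>Y\<^esub> h D"
    "\<And>m x. m \<in> carrier M \<Longrightarrow> x \<in> carrier X \<Longrightarrow> h (pure_tensor A M X m x) = b m x"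
    by blast
  have "h (a \<odot>\<^bsub>tensor A M X\<^esub> C) = a \<odot>\<^bsub>Y\<^esub> h C" if a: "a \<in> carrier A" and C: "C \<in> carrier (tensor A M X)" for a C
    by (rule tensor_ext[OF X Y.M.abelian_group_axioms C, where f = "\<lambda>C. h (a \<odot>\<^bsub>tensor A M X\<^esub> C)"])
      (use a in \<open>auto simp: h b tensor_smult_pure[OF X] FX.smult_r_distr Y.smult_r_distr pure_tensor_closed[OF X]\<close>)
  then show ?thesis using h by (intro exI[of _ h]) (auto simp: lin_def)
qed

lemma tensor_lin_ext:
  assumes X: "left_module A X" and Y: "left_module A Y" and "lin A (tensor A M X) Y f" "lin A (tensor A M X) Y g"
    and "\<And>m x. m \<in> carrier M \<Longrightarrow> x \<in> carrier X \<Longrightarrow> f (pure_tensor A M X m x) = g (pure_tensor A M X m x)"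
    and "C \<in> carrier (tensor A M X)"
  shows "f C = g C"
proof -
  interpret Y: left_module A Y by (rule Y)
  show ?thesis
    by (rule tensor_ext[OF X Y.M.abelian_group_axioms assms(6)]) (use assms linD in auto)
qed

lemma tensor_submodule:
  assumes X: "left_module A X" and U: "submodule U A (tensor A M X)"
    and "\<And>m x. m \<in> carrier M \<Longrightarrow> x \<in> carrier X \<Longrightarrow> pure_tensor A M X m x \<in> U"
  shows "U = carrier (tensor A M X)"
proof -
  interpret FX: left_module A "tensor A M X" by (rule left_module_tensor[OF X])
  note u = FX.submoduleD[OF U]
  have "C \<in> U" if "C \<in> carrier (tensor A M X)" for C
    by (rule tensor_induct_diff[OF X that, of "\<lambda>C. C \<in> U"]) (use u assms(3) in auto)
  then show ?thesis using u(1) by blast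
qed

end

text \<open>An intersection instead of a set of linear combinations, so that a span is bounded from
  above simply by exhibiting a submodule that contains the generators.\<close>

definition span :: "('r, 'c) ring_scheme \<Rightarrow> ('r, 'm, 'd) module_scheme \<Rightarrow> 'm set \<Rightarrow> 'm set" where
  "span R M S = {x \<in> carrier M. \<forall>U. submodule U R M \<and> S \<subseteq> U \<longrightarrow> x \<in> U}"

context left_module
begin

lemma submodule_span: "submodule (span R M S) R M"
  by (rule submoduleI) (auto simp: span_def dest: submoduleD)

lemma span_superset: "S \<subseteq> carrier M \<Longrightarrow> S \<subseteq> span R M S"
  by (auto simp: span_def)

lemma span_minimal: "submodule U R M \<Longrightarrow> S \<subseteq> U \<Longrightarrow> span R M S \<subseteq> U"
  by (auto simp: span_def)

end

context bimodule
begin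

text \<open>Right exactness of \<open>M \<otimes>\<^sub>A -\<close>: an inverse of \<open>FP / span \<rightarrow> FX\<close> is given by \<open>m \<otimes> g p \<mapsto> m \<otimes> p\<close>.\<close>

lemma tensor_kernel:
  assumes P: "left_module A P" and X: "left_module A X" and g: "lin A P X g" "g ` carrier P = carrier X"
    and Fg: "lin A (tensor A M P) (tensor A M X) Fg"
      "\<And>m p. m \<in> carrier M \<Longrightarrow> p \<in> carrier P \<Longrightarrow> Fg (pure_tensor A M P m p) = pure_tensor A M X m (g p)"
    and w: "w \<in> carrier (tensor A M P)" "Fg w = \<zero>\<^bsub>tensor A M X\<^esub>"
  shows "w \<in> span A (tensor A M P)
    {pure_tensor A M P m p | m p. m \<in> carrier M \<and> p \<in> carrier P \<and> g p = \<zero>\<^bsub>X\<^esub>}"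
    (is "_ \<in> span A _ ?S")
proof -
  let ?FP = "tensor A M P" and ?FX = "tensor A M X"
  interpret P: left_module A P by (rule P)
  interpret X: left_module A X by (rule X)
  interpret FP: left_module A ?FP by (rule left_module_tensor[OF P])
  interpret FX: left_module A ?FX by (rule left_module_tensor[OF X])
  define U where "U = span A ?FP ?S"
  have U: "submodule U A ?FP" unfolding U_def by (rule FP.submodule_span)
  note u = FP.submoduleD[OF U]
  have SU: "pure_tensor A M P m p \<in> U" if "m \<in> carrier M" "p \<in> carrier P" "g p = \<zero>\<^bsub>X\<^esub>" for m p
    using FP.span_superset[of ?S] that pure_tensor_closed[OF P] unfolding U_def by blast
  have Us: "additive_subgroup U ?FP" using U by (simp add: additive_subgroup_def submodule_def)
  interpret U: abelian_subgroup U ?FP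
    by (rule abelian_subgroupI3[OF Us FP.M.abelian_group_axioms])
  note q = quotient_module_facts(1-3)[OF FP.M.abelian_group_axioms Us]
  let ?Q = "?FP A_Mod U" and ?c = "\<lambda>w. U +>\<^bsub>?FP\<^esub> w"
  have Q: "comm_group ?Q" by (rule U.a_factorgroup_is_comm_group)
  have Qc: "?c w \<in> carrier ?Q" if "w \<in> carrier ?FP" for w
    using that by (auto simp: A_FactGroup_def' A_RCOSETS_def')
  have Qm: "?c w \<otimes>\<^bsub>?Q\<^esub> ?c v = ?c (w \<oplus>\<^bsub>?FP\<^esub> v)" if "w \<in> carrier ?FP" "v \<in> carrier ?FP" for w v
    using that by (simp add: U.a_rcos_sum)
  \<comment> \<open>A set-theoretic section of \<open>g\<close>. It need not be linear, because
    changing a preimage alters the pure tensor only by an element of \<open>U\<close>.\<close>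
  obtain s where s: "\<And>x. x \<in> carrier X \<Longrightarrow> s x \<in> carrier P \<and> g (s x) = x"
  proof -
    have "\<forall>x\<in>carrier X. \<exists>p. p \<in> carrier P \<and> g p = x" using g(2) by (simp add: set_eq_iff image_iff) (metis)
    from bchoice[OF this] show thesis using that by blast
  qed
  have eq: "?c (pure_tensor A M P m p) = ?c (pure_tensor A M P m p')"
    if "m \<in> carrier M" "p \<in> carrier P" "p' \<in> carrier P" "g p = g p'" for m p p'
  proof -
    have "pure_tensor A M P m p = pure_tensor A M P m (p \<ominus>\<^bsub>P\<^esub> p') \<oplus>\<^bsub>?FP\<^esub> pure_tensor A M P m p'"
      using that pure_tensor_add_right[OF P, of m "p \<ominus>\<^bsub>P\<^esub> p'" p'] by (simp add: P.diff_add_cancel)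
    then have "pure_tensor A M P m p \<ominus>\<^bsub>?FP\<^esub> pure_tensor A M P m p' = pure_tensor A M P m (p \<ominus>\<^bsub>P\<^esub> p')"
      using that pure_tensor_closed[OF P] by (simp add: FP.M.diff_add_cancel)
    moreover have "pure_tensor A M P m (p \<ominus>\<^bsub>P\<^esub> p') \<in> U"
      using that linD(1)[OF g(1)] by (intro SU) (auto simp: lin_diff[OF P X g(1)] X.diff_zero_iff)
    ultimately show ?thesis using q(2) that pure_tensor_closed[OF P] by simp
  qed
  have "\<exists>h. (\<forall>C\<in>carrier ?FX. h C \<in> carrier ?Q) \<and>
    (\<forall>C\<in>carrier ?FX. \<forall>D\<in>carrier ?FX. h (C \<oplus>\<^bsub>?FX\<^esub> D) = h C \<otimes>\<^bsub>?Q\<^esub> h D) \<and>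
    (\<forall>m\<in>carrier M. \<forall>x\<in>carrier X. h (pure_tensor A M X m x) = ?c (pure_tensor A M P m (s x)))"
  proof (rule tensor_universal[OF X Q])
    fix m x assume m: "m \<in> carrier M" and x: "x \<in> carrier X"
    note sx = s[OF x]
    show "?c (pure_tensor A M P m (s x)) \<in> carrier ?Q" using m sx Qc pure_tensor_closed[OF P] by simp
    show "?c (pure_tensor A M P (m \<oplus>\<^bsub>M\<^esub> m') (s x)) =
        ?c (pure_tensor A M P m (s x)) \<otimes>\<^bsub>?Q\<^esub> ?c (pure_tensor A M P m' (s x))" if "m' \<in> carrier M" for m'
      using m sx that pure_tensor_closed[OF P] by (simp only: Qm pure_tensor_add_left[OF P])
    show "?c (pure_tensor A M P m (s (x \<oplus>\<^bsub>X\<^esub> x'))) =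
        ?c (pure_tensor A M P m (s x)) \<otimes>\<^bsub>?Q\<^esub> ?c (pure_tensor A M P m (s x'))" if x': "x' \<in> carrier X" for x'
    proof -
      have "?c (pure_tensor A M P m (s (x \<oplus>\<^bsub>X\<^esub> x'))) = ?c (pure_tensor A M P m (s x \<oplus>\<^bsub>P\<^esub> s x'))"
        using m sx s[OF x'] s[of "x \<oplus>\<^bsub>X\<^esub> x'"] x x' linD(2)[OF g(1)] by (intro eq) auto
      then show ?thesis using m sx s[OF x'] pure_tensor_closed[OF P]
        by (simp only: Qm pure_tensor_add_right[OF P])
    qed
    show "?c (pure_tensor A M P (rsmult M m a) (s x)) = ?c (pure_tensor A M P m (s (a \<odot>\<^bsub>X\<^esub> x)))"
      if a: "a \<in> carrier A" for a
    proof -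
      have "?c (pure_tensor A M P m (s (a \<odot>\<^bsub>X\<^esub> x))) = ?c (pure_tensor A M P m (a \<odot>\<^bsub>P\<^esub> s x))"
        using m sx s[of "a \<odot>\<^bsub>X\<^esub> x"] x a linD(3)[OF g(1)] by (intro eq) auto
      then show ?thesis using m sx a by (simp add: pure_tensor_balanced[OF P])
    qed
  qed
  then obtain h where h: "\<And>C. C \<in> carrier ?FX \<Longrightarrow> h C \<in> carrier ?Q"
    "\<And>C D. C \<in> carrier ?FX \<Longrightarrow> D \<in> carrier ?FX \<Longrightarrow> h (C \<oplus>\<^bsub>?FX\<^esub> D) = h C \<otimes>\<^bsub>?Q\<^esub> h D"
    "\<And>m x. m \<in> carrier M \<Longrightarrow> x \<in> carrier X \<Longrightarrow> h (pure_tensor A M X m x) = ?c (pure_tensor A M P m (s x))"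
    by metis
  interpret Q: comm_group ?Q by (rule Q)
  \<comment> \<open>The factor group is multiplicative; it is rewritten as an additive record so
    that \<open>tensor_ext\<close> can compare two maps into it.\<close>
  let ?H = "mk_module (carrier ?Q) \<one>\<^bsub>?Q\<^esub> (monoid.mult ?Q) undefined"
  have H: "abelian_group ?H"
    by (rule abelian_groupI)
      (simp_all del: add_A_FactGroup add: Q.m_ac Q.l_inv_ex)
  have "h (Fg w) = ?c w"
  proof (rule tensor_ext[OF P H w(1)])
    fix m p assume m: "m \<in> carrier M" "p \<in> carrier P"
    then show "h (Fg (pure_tensor A M P m p)) = ?c (pure_tensor A M P m p)"
      using s[of "g p"] linD(1)[OF g(1)] by (simp add: Fg(2) h(3)) (intro eq, auto)
  qed (use h linD[OF Fg(1)] Qc Qm in auto)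
  moreover have "h \<zero>\<^bsub>?FX\<^esub> = \<one>\<^bsub>?Q\<^esub>"
    using h(2)[of "\<zero>\<^bsub>?FX\<^esub>" "\<zero>\<^bsub>?FX\<^esub>"] h(1)[of "\<zero>\<^bsub>?FX\<^esub>"] Q.r_cancel_one' by force
  moreover have "\<one>\<^bsub>?Q\<^esub> = ?c \<zero>\<^bsub>?FP\<^esub>" using FP.a_coset_add_zero[OF u(1)] by (simp add: A_FactGroup_def')
  ultimately have "?c w = ?c \<zero>\<^bsub>?FP\<^esub>" using w(2) by simp
  then show ?thesis using q(2)[OF w(1), of "\<zero>\<^bsub>?FP\<^esub>"] w(1) by (simp add: U_def)
qed

end

section \<open>Modules over the trivial extension\<close>

definition restrict_scalars ::
  "('a, 'm, 'e) bimodule_scheme \<Rightarrow> ('a \<times> 'm, 'y, 'f) module_scheme \<Rightarrow> ('a, 'y) module" where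
  "restrict_scalars M Y = mk_module (carrier Y) \<zero>\<^bsub>Y\<^esub> (ring.add Y) (\<lambda>a y. (a, \<zero>\<^bsub>M\<^esub>) \<odot>\<^bsub>Y\<^esub> y)"

lemma restrict_scalars_simps [simp]:
  "carrier (restrict_scalars M Y) = carrier Y" "\<zero>\<^bsub>restrict_scalars M Y\<^esub> = \<zero>\<^bsub>Y\<^esub>"
  "x \<oplus>\<^bsub>restrict_scalars M Y\<^esub> y = x \<oplus>\<^bsub>Y\<^esub> y" "a \<odot>\<^bsub>restrict_scalars M Y\<^esub> y = (a, \<zero>\<^bsub>M\<^esub>) \<odot>\<^bsub>Y\<^esub> y"
  by (simp_all add: restrict_scalars_def)

lemma dsum_minus:
  assumes "left_module R M" "left_module R N" "x \<in> carrier M" "y \<in> carrier N" "x' \<in> carrier M" "y' \<in> carrier N"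
  shows "(x, y) \<ominus>\<^bsub>dsum_module M N\<^esub> (x', y') = (x \<ominus>\<^bsub>M\<^esub> x', y \<ominus>\<^bsub>N\<^esub> y')"
proof -
  interpret M: left_module R M by fact
  interpret N: left_module R N by fact
  interpret D: left_module R "dsum_module M N" by (rule left_module_dsum) fact+
  have "(x, y) = (x \<ominus>\<^bsub>M\<^esub> x', y \<ominus>\<^bsub>N\<^esub> y') \<oplus>\<^bsub>dsum_module M N\<^esub> (x', y')"
    using assms by (simp add: M.diff_add_cancel N.diff_add_cancel)
  then show ?thesis
    using D.M.diff_add_cancel(3)[of "(x \<ominus>\<^bsub>M\<^esub> x', y \<ominus>\<^bsub>N\<^esub> y')" "(x', y')"] assms by simp
qed

context bimodule
begin

abbreviation \<Lambda> where "\<Lambda> \<equiv> trivial_extension A M"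

lemma trivial_extension_simps [simp]:
  "carrier \<Lambda> = carrier A \<times> carrier M" "\<zero>\<^bsub>\<Lambda>\<^esub> = (\<zero>\<^bsub>A\<^esub>, \<zero>\<^bsub>M\<^esub>)" "\<one>\<^bsub>\<Lambda>\<^esub> = (\<one>\<^bsub>A\<^esub>, \<zero>\<^bsub>M\<^esub>)"
  "(a, m) \<oplus>\<^bsub>\<Lambda>\<^esub> (b, n) = (a \<oplus>\<^bsub>A\<^esub> b, m \<oplus>\<^bsub>M\<^esub> n)"
  "(a, m) \<otimes>\<^bsub>\<Lambda>\<^esub> (b, n) = (a \<otimes>\<^bsub>A\<^esub> b, (a \<odot>\<^bsub>M\<^esub> n) \<oplus>\<^bsub>M\<^esub> rsmult M m b)"
  "k \<odot>\<^bsub>\<Lambda>\<^esub> (a, m) = (k \<odot>\<^bsub>A\<^esub> a, (k \<odot>\<^bsub>A\<^esub> \<one>\<^bsub>A\<^esub>) \<odot>\<^bsub>M\<^esub> m)"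
  by (simp_all add: trivial_extension_def)

lemma rsmult_zero:
  shows "a \<in> carrier A \<Longrightarrow> rsmult M \<zero>\<^bsub>M\<^esub> a = \<zero>\<^bsub>M\<^esub>" "m \<in> carrier M \<Longrightarrow> rsmult M m \<zero>\<^bsub>A\<^esub> = \<zero>\<^bsub>M\<^esub>"
proof -
  show "rsmult M \<zero>\<^bsub>M\<^esub> a = \<zero>\<^bsub>M\<^esub>" if "a \<in> carrier A"
    using rsmult_add_left[of "\<zero>\<^bsub>M\<^esub>" "\<zero>\<^bsub>M\<^esub>" a] rsmult_closed[of "\<zero>\<^bsub>M\<^esub>" a] that
      M.add.r_cancel_one' by force
  show "rsmult M m \<zero>\<^bsub>A\<^esub> = \<zero>\<^bsub>M\<^esub>" if "m \<in> carrier M"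
    using rsmult_add_right[of m "\<zero>\<^bsub>A\<^esub>" "\<zero>\<^bsub>A\<^esub>"] rsmult_closed[of m "\<zero>\<^bsub>A\<^esub>"] that
      M.add.r_cancel_one' by force
qed

lemma ring_trivial_extension: "ring \<Lambda>"
proof (rule ringI)
  show "abelian_group \<Lambda>"
  proof (rule abelian_groupI)
    fix x assume "x \<in> carrier \<Lambda>"
    then show "\<exists>y\<in>carrier \<Lambda>. y \<oplus>\<^bsub>\<Lambda>\<^esub> x = \<zero>\<^bsub>\<Lambda>\<^esub>"
      by (intro bexI[of _ "(\<ominus>\<^bsub>A\<^esub> fst x, \<ominus>\<^bsub>M\<^esub> snd x)"]) (auto simp: A.l_neg M.l_neg)
  qed (auto simp: A.a_assoc M.a_assoc intro: A.a_comm M.a_comm)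
  show "Group.monoid \<Lambda>"
  proof (rule monoidI)
    fix x y z assume "x \<in> carrier \<Lambda>" "y \<in> carrier \<Lambda>" "z \<in> carrier \<Lambda>"
    then show "x \<otimes>\<^bsub>\<Lambda>\<^esub> y \<otimes>\<^bsub>\<Lambda>\<^esub> z = x \<otimes>\<^bsub>\<Lambda>\<^esub> (y \<otimes>\<^bsub>\<Lambda>\<^esub> z)"
      by (auto simp: A.m_assoc smult_assoc rsmult_mult rsmult_add_left smult_r_distr smult_rsmult rsmult_closed M.a_assoc)
  qed (auto simp: rsmult_closed rsmult_zero rsmult_one)
qed (auto simp: A.l_distr A.r_distr smult_l_distr smult_r_distr rsmult_add_left rsmult_add_right rsmult_closed M.a_ac)

text \<open>The unit times \<open>k\<close> is the pair of \<open>k 1\<close> and zero. It commutes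
  with the elements of \<open>M\<close> by \<open>field_central\<close>, the central action of
  \<open>K\<close> on the bimodule.\<close>

lemma central_field_trivial_extension: "central_field K \<Lambda>"
proof (intro central_field.intro central_field_axioms.intro K.field_axioms ring_trivial_extension)
  show "(k \<odot>\<^bsub>\<Lambda>\<^esub> \<one>\<^bsub>\<Lambda>\<^esub>) \<otimes>\<^bsub>\<Lambda>\<^esub> b = b \<otimes>\<^bsub>\<Lambda>\<^esub> (k \<odot>\<^bsub>\<Lambda>\<^esub> \<one>\<^bsub>\<Lambda>\<^esub>)"
    if "k \<in> carrier K" "b \<in> carrier \<Lambda>" for k b
    using that by (cases b) (auto simp: scalar_smult rsmult_zero field_central[symmetric])
qed (auto simp: KA.smult_l_distr KA.smult_assoc1 scalar_smult(1) rsmult_zero)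

section \<open>The modules T X and Z X\<close>

context
  fixes X :: "('a, 'x, 'f) module_scheme"
  assumes X: "left_module A X"
begin

interpretation X: left_module A X by (rule X)
interpretation FX: left_module A "tensor A M X" by (rule left_module_tensor[OF X])

lemma pure_tensor_zero:
  shows "m \<in> carrier M \<Longrightarrow> pure_tensor A M X m \<zero>\<^bsub>X\<^esub> = \<zero>\<^bsub>tensor A M X\<^esub>"
    and "x \<in> carrier X \<Longrightarrow> pure_tensor A M X \<zero>\<^bsub>M\<^esub> x = \<zero>\<^bsub>tensor A M X\<^esub>"
proof -
  show "pure_tensor A M X m \<zero>\<^bsub>X\<^esub> = \<zero>\<^bsub>tensor A M X\<^esub>" if "m \<in> carrier M"
    using pure_tensor_add_right[OF X that X.M.zero_closed X.M.zero_closed] pure_tensor_closed[OF X that X.M.zero_closed]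
      FX.add.r_cancel_one' by force
  show "pure_tensor A M X \<zero>\<^bsub>M\<^esub> x = \<zero>\<^bsub>tensor A M X\<^esub>" if "x \<in> carrier X"
    using pure_tensor_add_left[OF X M.zero_closed M.zero_closed that] pure_tensor_closed[OF X M.zero_closed that]
      FX.add.r_cancel_one' by force
qed

lemma T_simps [simp]:
  "carrier (T_functor A M X) = carrier X \<times> carrier (tensor A M X)"
  "\<zero>\<^bsub>T_functor A M X\<^esub> = (\<zero>\<^bsub>X\<^esub>, \<zero>\<^bsub>tensor A M X\<^esub>)"
  "(x, w) \<oplus>\<^bsub>T_functor A M X\<^esub> (x', w') = (x \<oplus>\<^bsub>X\<^esub> x', w \<oplus>\<^bsub>tensor A M X\<^esub> w')"
  by (simp_all add: T_functor_def pair_module_def)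

text \<open>Under the structure map a pure tensor of \<open>m\<close> with \<open>(x, w)\<close>
  forgets \<open>w\<close>, since it is mapped along \<open>fst\<close>. This closed form replaces
  \<open>tensor_map\<close> from here on.\<close>

lemma T_smult [simp]:
  assumes "a \<in> carrier A" "m \<in> carrier M" "x \<in> carrier X" "w \<in> carrier (tensor A M X)"
  shows "(a, m) \<odot>\<^bsub>T_functor A M X\<^esub> (x, w) = (a \<odot>\<^bsub>X\<^esub> x, a \<odot>\<^bsub>tensor A M X\<^esub> w \<oplus>\<^bsub>tensor A M X\<^esub> pure_tensor A M X m x)"
proof -
  have "lin A (dsum_module X (tensor A M X)) X fst" by (rule linI) auto
  then have "tensor_map A M X fst (pure_tensor A M (dsum_module X (tensor A M X)) m (x, w)) = pure_tensor A M X m x"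
    using tensor_map_pure[OF left_module_dsum[OF X FX.left_module_axioms] X _ assms(2), of fst "(x, w)"] assms by simp
  then show ?thesis using assms by (simp add: T_functor_def pair_module_def)
qed

lemma left_module_T: "left_module \<Lambda> (T_functor A M X)"
proof (rule left_moduleI)
  note p = pure_tensor_closed[OF X]
  show "ring \<Lambda>" by (rule ring_trivial_extension)
  fix x assume "x \<in> carrier (T_functor A M X)"
  then show "\<exists>y\<in>carrier (T_functor A M X). y \<oplus>\<^bsub>T_functor A M X\<^esub> x = \<zero>\<^bsub>T_functor A M X\<^esub>"
    by (intro bexI[of _ "(\<ominus>\<^bsub>X\<^esub> fst x, \<ominus>\<^bsub>tensor A M X\<^esub> snd x)"]) (auto simp: X.l_neg FX.l_neg)
next
  note p = pure_tensor_closed[OF X] pure_tensor_add_left[OF X] pure_tensor_add_right[OF X]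
    pure_tensor_balanced[OF X] tensor_smult_pure[OF X] pure_tensor_zero
  { fix a x y assume "a \<in> carrier \<Lambda>" "x \<in> carrier (T_functor A M X)" "y \<in> carrier (T_functor A M X)"
    then show "a \<odot>\<^bsub>T_functor A M X\<^esub> (x \<oplus>\<^bsub>T_functor A M X\<^esub> y) =
        a \<odot>\<^bsub>T_functor A M X\<^esub> x \<oplus>\<^bsub>T_functor A M X\<^esub> a \<odot>\<^bsub>T_functor A M X\<^esub> y"
      by (auto simp: p X.smult_r_distr FX.smult_r_distr FX.M.a_ac) }
  fix a b x assume *: "a \<in> carrier \<Lambda>" "b \<in> carrier \<Lambda>" "x \<in> carrier (T_functor A M X)"
  then show "(a \<oplus>\<^bsub>\<Lambda>\<^esub> b) \<odot>\<^bsub>T_functor A M X\<^esub> x =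
      a \<odot>\<^bsub>T_functor A M X\<^esub> x \<oplus>\<^bsub>T_functor A M X\<^esub> b \<odot>\<^bsub>T_functor A M X\<^esub> x"
    by (auto simp: p X.smult_l_distr FX.smult_l_distr FX.M.a_ac)
  from * show "(a \<otimes>\<^bsub>\<Lambda>\<^esub> b) \<odot>\<^bsub>T_functor A M X\<^esub> x = a \<odot>\<^bsub>T_functor A M X\<^esub> (b \<odot>\<^bsub>T_functor A M X\<^esub> x)"
    by (auto simp: p X.smult_assoc FX.smult_assoc FX.smult_r_distr FX.M.a_ac rsmult_closed)
qed (auto simp: pure_tensor_closed[OF X] pure_tensor_zero X.M.a_ac FX.M.a_ac)

lemma Z_simps [simp]:
  "carrier (Z_functor A M X) = carrier X" "\<zero>\<^bsub>Z_functor A M X\<^esub> = \<zero>\<^bsub>X\<^esub>"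
  "x \<oplus>\<^bsub>Z_functor A M X\<^esub> y = x \<oplus>\<^bsub>X\<^esub> y"
  by (simp_all add: Z_functor_def pair_module_def)

lemma Z_smult [simp]: "a \<in> carrier A \<Longrightarrow> x \<in> carrier X \<Longrightarrow> (a, m) \<odot>\<^bsub>Z_functor A M X\<^esub> x = a \<odot>\<^bsub>X\<^esub> x"
  by (simp add: Z_functor_def pair_module_def)

lemma left_module_Z: "left_module \<Lambda> (Z_functor A M X)"
  by (rule left_moduleI)
    (auto simp: ring_trivial_extension X.M.a_ac X.smult_l_distr X.smult_r_distr X.smult_assoc
      intro: bexI[of _ "\<ominus>\<^bsub>X\<^esub> x" for x] X.l_neg)

end

abbreviation (input) m_act where "m_act Y m y \<equiv> (\<zero>\<^bsub>A\<^esub>, m) \<odot>\<^bsub>Y\<^esub> y"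

lemma left_module_restrict_scalars:
  assumes "left_module \<Lambda> Y" shows "left_module A (restrict_scalars M Y)"
proof -
  interpret Y: left_module \<Lambda> Y by fact
  have e: "(a, \<zero>\<^bsub>M\<^esub>) \<in> carrier \<Lambda>" if "a \<in> carrier A" for a using that by simp
  show ?thesis
  proof (rule left_moduleI)
    fix a b x assume a: "a \<in> carrier A" and b: "b \<in> carrier A" and x: "x \<in> carrier (restrict_scalars M Y)"
    show "(a \<oplus>\<^bsub>A\<^esub> b) \<odot>\<^bsub>restrict_scalars M Y\<^esub> x =
        a \<odot>\<^bsub>restrict_scalars M Y\<^esub> x \<oplus>\<^bsub>restrict_scalars M Y\<^esub> b \<odot>\<^bsub>restrict_scalars M Y\<^esub> x"
      using Y.smult_l_distr[OF e[OF a] e[OF b]] x by simp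
    show "(a \<otimes>\<^bsub>A\<^esub> b) \<odot>\<^bsub>restrict_scalars M Y\<^esub> x = a \<odot>\<^bsub>restrict_scalars M Y\<^esub> (b \<odot>\<^bsub>restrict_scalars M Y\<^esub> x)"
      using Y.smult_assoc[OF e[OF a] e[OF b]] x a b by (simp add: rsmult_zero)
  next
    fix x assume "x \<in> carrier (restrict_scalars M Y)"
    then show "\<one>\<^bsub>A\<^esub> \<odot>\<^bsub>restrict_scalars M Y\<^esub> x = x" using Y.smult_one[of x] by simp
  qed (auto simp: A.ring_axioms Y.M.a_ac Y.smult_r_distr intro: bexI[of _ "\<ominus>\<^bsub>Y\<^esub> x" for x] Y.M.l_neg)
qed

section \<open>Maps out of T P into a module over the trivial extension\<close>

context
  fixes Y :: "('a \<times> 'm, 'y, 'f) module_scheme"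
  assumes Y: "left_module \<Lambda> Y"
begin

interpretation Y: left_module \<Lambda> Y by (rule Y)

lemma smult_split:
  assumes "a \<in> carrier A" "m \<in> carrier M" "y \<in> carrier Y"
  shows "(a, m) \<odot>\<^bsub>Y\<^esub> y = (a, \<zero>\<^bsub>M\<^esub>) \<odot>\<^bsub>Y\<^esub> y \<oplus>\<^bsub>Y\<^esub> m_act Y m y"
  using Y.smult_l_distr[of "(a, \<zero>\<^bsub>M\<^esub>)" "(\<zero>\<^bsub>A\<^esub>, m)" y] assms by simp

lemma m_act_add:
  assumes "m \<in> carrier M" "m' \<in> carrier M" "y \<in> carrier Y"
  shows "m_act Y (m \<oplus>\<^bsub>M\<^esub> m') y = m_act Y m y \<oplus>\<^bsub>Y\<^esub> m_act Y m' y"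
  using Y.smult_l_distr[of "(\<zero>\<^bsub>A\<^esub>, m)" "(\<zero>\<^bsub>A\<^esub>, m')" y] assms by simp

lemma m_act_smult:
  assumes "m \<in> carrier M" "a \<in> carrier A" "y \<in> carrier Y"
  shows "m_act Y m ((a, \<zero>\<^bsub>M\<^esub>) \<odot>\<^bsub>Y\<^esub> y) = m_act Y (rsmult M m a) y"
    "(a, \<zero>\<^bsub>M\<^esub>) \<odot>\<^bsub>Y\<^esub> m_act Y m y = m_act Y (a \<odot>\<^bsub>M\<^esub> m) y"
  using Y.smult_assoc[of "(\<zero>\<^bsub>A\<^esub>, m)" "(a, \<zero>\<^bsub>M\<^esub>)" y] Y.smult_assoc[of "(a, \<zero>\<^bsub>M\<^esub>)" "(\<zero>\<^bsub>A\<^esub>, m)" y] assms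
  by (simp_all add: rsmult_closed rsmult_zero)

text \<open>The ideal of pairs with first component zero has square zero. This is the nilpotence
  behind the passage to \<open>Y / MY\<close>.\<close>

lemma m_act_m_act:
  assumes "m \<in> carrier M" "m' \<in> carrier M" "y \<in> carrier Y"
  shows "m_act Y m (m_act Y m' y) = \<zero>\<^bsub>Y\<^esub>"
  using Y.smult_assoc[of "(\<zero>\<^bsub>A\<^esub>, m)" "(\<zero>\<^bsub>A\<^esub>, m')" y] Y.smult_l_null[of y] assms by (simp add: rsmult_zero)

text \<open>\<open>T\<close> is left adjoint to restriction of scalars.\<close>

lemma T_extend:
  assumes P: "left_module A P" and u: "lin A P (restrict_scalars M Y) u"
  shows "\<exists>h. lin \<Lambda> (T_functor A M P) Y h \<and> (\<forall>p\<in>carrier P. h (p, \<zero>\<^bsub>tensor A M P\<^esub>) = u p)"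
proof -
  let ?R = "restrict_scalars M Y" and ?FP = "tensor A M P"
  interpret P: left_module A P by (rule P)
  interpret FP: left_module A ?FP by (rule left_module_tensor[OF P])
  note R = left_module_restrict_scalars[OF Y]
  note u' = linD[OF u, simplified]
  \<comment> \<open>The second component is forced: a pure tensor of \<open>m\<close> and
    \<open>p\<close> is \<open>m\<close> times \<open>p\<close> in \<open>T P\<close>, so it has to
    go to \<open>m\<close> times \<open>u p\<close>.\<close>
  have "\<exists>ev. lin A ?FP ?R ev \<and> (\<forall>m\<in>carrier M. \<forall>p\<in>carrier P. ev (pure_tensor A M P m p) = m_act Y m (u p))"
    using u' by (intro tensor_lin[OF P R]) (auto simp: m_act_add Y.smult_r_distr m_act_smult)
  then obtain ev where ev: "lin A ?FP ?R ev"
    "\<And>m p. m \<in> carrier M \<Longrightarrow> p \<in> carrier P \<Longrightarrow> ev (pure_tensor A M P m p) = m_act Y m (u p)" by blast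
  note e' = linD[OF ev(1), simplified]
  let ?h = "\<lambda>(p, w). u p \<oplus>\<^bsub>Y\<^esub> ev w"
  \<comment> \<open>In \<open>T P\<close> the part \<open>M\<close> times the second summand is
    zero, so linearity of \<open>?h\<close> requires \<open>M\<close> to kill the values of
    \<open>ev\<close>. They already lie in \<open>M\<close> times \<open>Y\<close>.\<close>
  have me: "m_act Y m (ev w) = \<zero>\<^bsub>Y\<^esub>" if "m \<in> carrier M" "w \<in> carrier ?FP" for m w
  proof (rule tensor_ext[OF P Y.M.abelian_group_axioms that(2), where f = "\<lambda>w. m_act Y m (ev w)"])
    show "m_act Y m (ev (C \<oplus>\<^bsub>?FP\<^esub> D)) = m_act Y m (ev C) \<oplus>\<^bsub>Y\<^esub> m_act Y m (ev D)"
      if "C \<in> carrier ?FP" "D \<in> carrier ?FP" for C D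
      using e' that \<open>m \<in> carrier M\<close> by (simp add: Y.smult_r_distr)
    show "m_act Y m (ev (pure_tensor A M P m' p)) = \<zero>\<^bsub>Y\<^esub>" if "m' \<in> carrier M" "p \<in> carrier P" for m' p
      using ev(2)[OF that] m_act_m_act u' that \<open>m \<in> carrier M\<close> by simp
  qed (use e' that(1) in auto)
  have "lin \<Lambda> (T_functor A M P) Y ?h"
  proof (rule linI)
    show "?h x \<in> carrier Y" if "x \<in> carrier (T_functor A M P)" for x using that u' e' P by auto
    show "?h (x \<oplus>\<^bsub>T_functor A M P\<^esub> y) = ?h x \<oplus>\<^bsub>Y\<^esub> ?h y"
      if "x \<in> carrier (T_functor A M P)" "y \<in> carrier (T_functor A M P)" for x y
      using that u' e' P by (auto simp: Y.M.a_ac)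
    show "?h (b \<odot>\<^bsub>T_functor A M P\<^esub> x) = b \<odot>\<^bsub>Y\<^esub> ?h x"
      if "b \<in> carrier \<Lambda>" "x \<in> carrier (T_functor A M P)" for b x
    proof -
      obtain a m p w where *: "b = (a, m)" "x = (p, w)" "a \<in> carrier A" "m \<in> carrier M" "p \<in> carrier P" "w \<in> carrier ?FP"
        using \<open>b \<in> carrier \<Lambda>\<close> \<open>x \<in> carrier (T_functor A M P)\<close> P by (cases b, cases x) auto
      have "b \<odot>\<^bsub>Y\<^esub> ?h x = ((a, \<zero>\<^bsub>M\<^esub>) \<odot>\<^bsub>Y\<^esub> u p \<oplus>\<^bsub>Y\<^esub> m_act Y m (u p)) \<oplus>\<^bsub>Y\<^esub> (a, \<zero>\<^bsub>M\<^esub>) \<odot>\<^bsub>Y\<^esub> ev w"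
        using * u' e' me by (simp add: Y.smult_r_distr smult_split[OF *(3,4)])
      moreover have "?h (b \<odot>\<^bsub>T_functor A M P\<^esub> x) =
          (a, \<zero>\<^bsub>M\<^esub>) \<odot>\<^bsub>Y\<^esub> u p \<oplus>\<^bsub>Y\<^esub> ((a, \<zero>\<^bsub>M\<^esub>) \<odot>\<^bsub>Y\<^esub> ev w \<oplus>\<^bsub>Y\<^esub> m_act Y m (u p))"
        using * u' e' P ev(2) pure_tensor_closed[OF P] by simp
      ultimately show ?thesis using * u' e' by (simp add: Y.M.a_ac)
    qed
  qed
  moreover have "?h (p, \<zero>\<^bsub>?FP\<^esub>) = u p" if "p \<in> carrier P" for p
    using lin_zero[OF FP.left_module_axioms R ev(1)] u' that by simp
  ultimately show ?thesis by blast
qed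

text \<open>Splits a map on \<open>T P\<close> into its parts on \<open>P\<close> and on the tensor
  product. The second part is determined by the first, because pure tensors are multiples by
  \<open>M\<close> of elements of \<open>P\<close>.\<close>

lemma T_decompose:
  assumes P: "left_module A P" and h: "lin \<Lambda> (T_functor A M P) Y h"
  shows "p \<in> carrier P \<Longrightarrow> w \<in> carrier (tensor A M P) \<Longrightarrow>
      h (p, w) = h (p, \<zero>\<^bsub>tensor A M P\<^esub>) \<oplus>\<^bsub>Y\<^esub> h (\<zero>\<^bsub>P\<^esub>, w)"
    and "m \<in> carrier M \<Longrightarrow> p \<in> carrier P \<Longrightarrow> h (\<zero>\<^bsub>P\<^esub>, pure_tensor A M P m p) = m_act Y m (h (p, \<zero>\<^bsub>tensor A M P\<^esub>))"
    and "lin A P (restrict_scalars M Y) (\<lambda>p. h (p, \<zero>\<^bsub>tensor A M P\<^esub>))"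
    and "lin A (tensor A M P) (restrict_scalars M Y) (\<lambda>w. h (\<zero>\<^bsub>P\<^esub>, w))"
proof -
  interpret P: left_module A P by (rule P)
  interpret FP: left_module A "tensor A M P" by (rule left_module_tensor[OF P])
  note h' = linD[OF h]
  show "h (p, w) = h (p, \<zero>\<^bsub>tensor A M P\<^esub>) \<oplus>\<^bsub>Y\<^esub> h (\<zero>\<^bsub>P\<^esub>, w)" if "p \<in> carrier P" "w \<in> carrier (tensor A M P)"
    using h'(2)[of "(p, \<zero>\<^bsub>tensor A M P\<^esub>)" "(\<zero>\<^bsub>P\<^esub>, w)"] that P by simp
  show "h (\<zero>\<^bsub>P\<^esub>, pure_tensor A M P m p) = m_act Y m (h (p, \<zero>\<^bsub>tensor A M P\<^esub>))" if "m \<in> carrier M" "p \<in> carrier P"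
    using h'(3)[of "(\<zero>\<^bsub>A\<^esub>, m)" "(p, \<zero>\<^bsub>tensor A M P\<^esub>)"] that P pure_tensor_closed[OF P] by simp
  show "lin A P (restrict_scalars M Y) (\<lambda>p. h (p, \<zero>\<^bsub>tensor A M P\<^esub>))"
  proof (rule linI)
    show "h (a \<odot>\<^bsub>P\<^esub> p, \<zero>\<^bsub>tensor A M P\<^esub>) = a \<odot>\<^bsub>restrict_scalars M Y\<^esub> h (p, \<zero>\<^bsub>tensor A M P\<^esub>)"
      if "a \<in> carrier A" "p \<in> carrier P" for a p
      using h'(3)[of "(a, \<zero>\<^bsub>M\<^esub>)" "(p, \<zero>\<^bsub>tensor A M P\<^esub>)"] that P pure_tensor_zero[OF P] by simp
    show "h (p \<oplus>\<^bsub>P\<^esub> q, \<zero>\<^bsub>tensor A M P\<^esub>) = h (p, \<zero>\<^bsub>tensor A M P\<^esub>) \<oplus>\<^bsub>restrict_scalars M Y\<^esub> h (q, \<zero>\<^bsub>tensor A M P\<^esub>)"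
      if "p \<in> carrier P" "q \<in> carrier P" for p q
      using h'(2)[of "(p, \<zero>\<^bsub>tensor A M P\<^esub>)" "(q, \<zero>\<^bsub>tensor A M P\<^esub>)"] that P by simp
  qed (use h'(1) P in auto)
  show "lin A (tensor A M P) (restrict_scalars M Y) (\<lambda>w. h (\<zero>\<^bsub>P\<^esub>, w))"
  proof (rule linI)
    show "h (\<zero>\<^bsub>P\<^esub>, a \<odot>\<^bsub>tensor A M P\<^esub> w) = a \<odot>\<^bsub>restrict_scalars M Y\<^esub> h (\<zero>\<^bsub>P\<^esub>, w)"
      if "a \<in> carrier A" "w \<in> carrier (tensor A M P)" for a w
      using h'(3)[of "(a, \<zero>\<^bsub>M\<^esub>)" "(\<zero>\<^bsub>P\<^esub>, w)"] that P pure_tensor_zero[OF P] by simp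
    show "h (\<zero>\<^bsub>P\<^esub>, v \<oplus>\<^bsub>tensor A M P\<^esub> w) = h (\<zero>\<^bsub>P\<^esub>, v) \<oplus>\<^bsub>restrict_scalars M Y\<^esub> h (\<zero>\<^bsub>P\<^esub>, w)"
      if "v \<in> carrier (tensor A M P)" "w \<in> carrier (tensor A M P)" for v w
      using h'(2)[of "(\<zero>\<^bsub>P\<^esub>, v)" "(\<zero>\<^bsub>P\<^esub>, w)"] that P by simp
  qed (use h'(1) P in auto)
qed

text \<open>The copy of \<open>P\<close> in the first summand generates \<open>T P\<close> over the
  trivial extension.\<close>

lemma T_lin_ext:
  assumes P: "left_module A P" and h: "lin \<Lambda> (T_functor A M P) Y h" and h': "lin \<Lambda> (T_functor A M P) Y h'"
    and eq: "\<And>p. p \<in> carrier P \<Longrightarrow> h (p, \<zero>\<^bsub>tensor A M P\<^esub>) = h' (p, \<zero>\<^bsub>tensor A M P\<^esub>)"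
    and z: "z \<in> carrier (T_functor A M P)"
  shows "h z = h' z"
proof -
  note d = T_decompose[OF P h] and d' = T_decompose[OF P h']
  obtain p w where pw: "z = (p, w)" "p \<in> carrier P" "w \<in> carrier (tensor A M P)" using z P by (cases z) auto
  have "h (\<zero>\<^bsub>P\<^esub>, w) = h' (\<zero>\<^bsub>P\<^esub>, w)"
    using tensor_lin_ext[OF P left_module_restrict_scalars[OF Y] d(4) d'(4) _ pw(3)] d(2) d'(2) eq by simp
  then show ?thesis using pw d(1) d'(1) eq by simp
qed

lemma hom_zero_T_iff:
  assumes P: "left_module A P"
  shows "hom_zero \<Lambda> (T_functor A M P) Y \<longleftrightarrow> hom_zero A P (restrict_scalars M Y)"
proof -
  interpret P: left_module A P by (rule P)
  interpret FP: left_module A "tensor A M P" by (rule left_module_tensor[OF P])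
  have z: "lin \<Lambda> (T_functor A M P) Y (\<lambda>_. \<zero>\<^bsub>Y\<^esub>)"
    by (rule linI) auto
  show ?thesis
    unfolding hom_zero_iff[OF left_module_T[OF P]] hom_zero_iff[OF P]
  proof (intro iffI allI impI ballI)
    fix u p assume *: "\<forall>h. lin \<Lambda> (T_functor A M P) Y h \<longrightarrow> (\<forall>x\<in>carrier (T_functor A M P). h x = \<zero>\<^bsub>Y\<^esub>)"
      and u: "lin A P (restrict_scalars M Y) u" and p: "p \<in> carrier P"
    obtain h where "lin \<Lambda> (T_functor A M P) Y h" "\<forall>p\<in>carrier P. h (p, \<zero>\<^bsub>tensor A M P\<^esub>) = u p"
      using T_extend[OF P u] by blast
    moreover have "(p, \<zero>\<^bsub>tensor A M P\<^esub>) \<in> carrier (T_functor A M P)" using p P by simp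
    ultimately show "u p = \<zero>\<^bsub>restrict_scalars M Y\<^esub>" using * p by auto
  next
    fix h x assume *: "\<forall>u. lin A P (restrict_scalars M Y) u \<longrightarrow> (\<forall>p\<in>carrier P. u p = \<zero>\<^bsub>restrict_scalars M Y\<^esub>)"
      and h: "lin \<Lambda> (T_functor A M P) Y h" and x: "x \<in> carrier (T_functor A M P)"
    show "h x = \<zero>\<^bsub>Y\<^esub>"
      using T_lin_ext[OF P h z _ x] * T_decompose(3)[OF P h] by simp
  qed
qed

text \<open>The adjunction applied at both ends. \<open>f'\<close> is compared with \<open>f\<close>
  only after a map into \<open>Y\<close>, so it may have a second component as long as maps into
  \<open>Y\<close> do not see it; the presentation of \<open>Z X\<close> is of this kind.\<close>

lemma hom_surj_T_iff:
  assumes P: "left_module A P" and Q: "left_module A Q" and f': "lin \<Lambda> (T_functor A M P) (T_functor A M Q) f'"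
    and f: "\<And>p. p \<in> carrier P \<Longrightarrow> f p \<in> carrier Q"
      "\<And>\<phi> p. lin \<Lambda> (T_functor A M Q) Y \<phi> \<Longrightarrow> p \<in> carrier P \<Longrightarrow>
        \<phi> (f' (p, \<zero>\<^bsub>tensor A M P\<^esub>)) = \<phi> (f p, \<zero>\<^bsub>tensor A M Q\<^esub>)"
  shows "hom_surj \<Lambda> (T_functor A M P) f' (T_functor A M Q) Y \<longleftrightarrow> hom_surj A P f Q (restrict_scalars M Y)"
proof
  interpret P: left_module A P by (rule P)
  interpret FP: left_module A "tensor A M P" by (rule left_module_tensor[OF P])
  assume s: "hom_surj \<Lambda> (T_functor A M P) f' (T_functor A M Q) Y"
  show "hom_surj A P f Q (restrict_scalars M Y)" unfolding hom_surj_def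
  proof (intro allI impI)
    fix \<psi> assume "lin A P (restrict_scalars M Y) \<psi>"
    then obtain h where h: "lin \<Lambda> (T_functor A M P) Y h" "\<forall>p\<in>carrier P. h (p, \<zero>\<^bsub>tensor A M P\<^esub>) = \<psi> p"
      using T_extend[OF P] by blast
    then obtain \<phi> where \<phi>: "lin \<Lambda> (T_functor A M Q) Y \<phi>" "\<forall>x\<in>carrier (T_functor A M P). h x = \<phi> (f' x)"
      using s unfolding hom_surj_def by blast
    have "\<psi> p = \<phi> (f p, \<zero>\<^bsub>tensor A M Q\<^esub>)" if "p \<in> carrier P" for p
    proof -
      have "(p, \<zero>\<^bsub>tensor A M P\<^esub>) \<in> carrier (T_functor A M P)" using that P by simp
      then show ?thesis using \<phi> h(2) f(2)[OF \<phi>(1) that] that by auto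
    qed
    then show "\<exists>\<phi>. lin A Q (restrict_scalars M Y) \<phi> \<and> (\<forall>p\<in>carrier P. \<psi> p = \<phi> (f p))"
      using T_decompose(3)[OF Q \<phi>(1)] by blast
  qed
next
  assume s: "hom_surj A P f Q (restrict_scalars M Y)"
  show "hom_surj \<Lambda> (T_functor A M P) f' (T_functor A M Q) Y" unfolding hom_surj_def
  proof (intro allI impI)
    fix \<psi> assume \<psi>: "lin \<Lambda> (T_functor A M P) Y \<psi>"
    obtain \<phi>0 where \<phi>0: "lin A Q (restrict_scalars M Y) \<phi>0" "\<forall>p\<in>carrier P. \<psi> (p, \<zero>\<^bsub>tensor A M P\<^esub>) = \<phi>0 (f p)"
      using s T_decompose(3)[OF P \<psi>] unfolding hom_surj_def by blast
    obtain \<phi> where \<phi>: "lin \<Lambda> (T_functor A M Q) Y \<phi>" "\<forall>q\<in>carrier Q. \<phi> (q, \<zero>\<^bsub>tensor A M Q\<^esub>) = \<phi>0 q"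
      using T_extend[OF Q \<phi>0(1)] by blast
    have "\<psi> x = \<phi> (f' x)" if "x \<in> carrier (T_functor A M P)" for x
      by (rule T_lin_ext[OF P \<psi> lin_comp[OF f' \<phi>(1)] _ that]) (use \<phi>(2) \<phi>0(2) f(1) f(2)[OF \<phi>(1)] in simp)
    then show "\<exists>\<phi>. lin \<Lambda> (T_functor A M Q) Y \<phi> \<and> (\<forall>x\<in>carrier (T_functor A M P). \<psi> x = \<phi> (f' x))"
      using \<phi>(1) by blast
  qed
qed

abbreviation (input) "MY \<equiv> span A (restrict_scalars M Y) {m_act Y m y | m y. m \<in> carrier M \<and> y \<in> carrier Y}"

text \<open>Since \<open>M\<close> acts nilpotently, a map \<open>TP \<rightarrow> Y\<close> is an essential epimorphism if \<open>P \<rightarrow> Y / MY\<close> is.\<close>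

lemma T_essential_epi:
  assumes P: "left_module A P" and h: "lin \<Lambda> (T_functor A M P) Y h"
    and hu: "\<And>p. p \<in> carrier P \<Longrightarrow> h (p, \<zero>\<^bsub>tensor A M P\<^esub>) = u p"
    and surj: "\<And>y. y \<in> carrier Y \<Longrightarrow> \<exists>p\<in>carrier P. y \<ominus>\<^bsub>Y\<^esub> u p \<in> MY"
    and ess: "\<And>L. submodule L A P \<Longrightarrow> (\<And>y. y \<in> carrier Y \<Longrightarrow> \<exists>p\<in>L. y \<ominus>\<^bsub>Y\<^esub> u p \<in> MY) \<Longrightarrow> L = carrier P"
  shows "essential_epi \<Lambda> (T_functor A M P) h Y"
proof -
  let ?R = "restrict_scalars M Y" and ?FP = "tensor A M P" and ?TP = "T_functor A M P"
  interpret P: left_module A P by (rule P)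
  interpret FP: left_module A ?FP by (rule left_module_tensor[OF P])
  interpret R: left_module A ?R by (rule left_module_restrict_scalars[OF Y])
  interpret TP: left_module \<Lambda> ?TP by (rule left_module_T[OF P])
  note h' = linD[OF h] and d = T_decompose[OF P h]
  have TPc: "(p, \<zero>\<^bsub>?FP\<^esub>) \<in> carrier ?TP" if "p \<in> carrier P" for p using that P by simp
  have uY: "u p \<in> carrier Y" if "p \<in> carrier P" for p using h'(1)[OF TPc[OF that]] hu[OF that] by simp
  have gens: "{m_act Y m y | m y. m \<in> carrier M \<and> y \<in> carrier Y} \<subseteq> carrier ?R" by auto
  have MYs: "submodule MY A ?R" by (rule R.submodule_span)
  note my = R.submoduleD[OF MYs]
  have mMY: "m_act Y m y \<in> MY" if "m \<in> carrier M" "y \<in> carrier Y" for m y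
    using R.span_superset[OF gens] that by blast
  \<comment> \<open>The elements annihilated by \<open>M\<close> form a submodule that contains all
    products by \<open>M\<close>, hence all of \<open>MY\<close>.\<close>
  have kill: "m_act Y m z = \<zero>\<^bsub>Y\<^esub>" if "z \<in> MY" "m \<in> carrier M" for m z
  proof -
    let ?U = "{z \<in> carrier Y. \<forall>m\<in>carrier M. m_act Y m z = \<zero>\<^bsub>Y\<^esub>}"
    have "submodule ?U A ?R"
      by (rule R.submoduleI) (auto simp: Y.smult_r_distr m_act_smult rsmult_closed)
    then have "MY \<subseteq> ?U" by (rule R.span_minimal) (auto simp: m_act_m_act)
    then show ?thesis using that by blast
  qed
  \<comment> \<open>Modulo \<open>MY\<close> every \<open>y\<close> is some \<open>u p\<close>, and
    \<open>M\<close> does not see elements of \<open>MY\<close>. So the products of \<open>M\<close>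
    with \<open>Y\<close> are already products with values of \<open>u\<close>.\<close>
  have MY_sub: "MY \<subseteq> S" if S: "submodule S \<Lambda> Y" and uS: "\<And>p. p \<in> carrier P \<Longrightarrow> u p \<in> S" for S
  proof (rule R.span_minimal)
    note s = Y.submoduleD[OF S]
    show "submodule S A ?R" by (rule R.submoduleI) (use s in auto)
    show "{m_act Y m y | m y. m \<in> carrier M \<and> y \<in> carrier Y} \<subseteq> S"
    proof safe
      fix m y assume m: "m \<in> carrier M" and y: "y \<in> carrier Y"
      obtain p where p: "p \<in> carrier P" "y \<ominus>\<^bsub>Y\<^esub> u p \<in> MY" using surj[OF y] by blast
      have "m_act Y m y = m_act Y m (u p) \<oplus>\<^bsub>Y\<^esub> m_act Y m (y \<ominus>\<^bsub>Y\<^esub> u p)"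
        using m y uY[OF p(1)] by (simp add: Y.M.diff_add_cancel flip: Y.smult_r_distr)
      also have "\<dots> = m_act Y m (u p)" using kill[OF p(2) m] m uY[OF p(1)] by simp
      finally show "m_act Y m y \<in> S" using s(4)[of "(\<zero>\<^bsub>A\<^esub>, m)" "u p"] uS[OF p(1)] m by simp
    qed
  qed
  have im: "submodule (h ` carrier ?TP) \<Lambda> Y"
    by (rule submodule_image[OF TP.left_module_axioms Y h TP.submodule_carrier])
  note i = Y.submoduleD[OF im]
  have uI: "u p \<in> h ` carrier ?TP" if "p \<in> carrier P" for p using hu[OF that] TPc[OF that] by force
  have "h ` carrier ?TP = carrier Y"
  proof
    show "h ` carrier ?TP \<subseteq> carrier Y" by (rule i(1))
    show "carrier Y \<subseteq> h ` carrier ?TP"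
    proof
      fix y assume y: "y \<in> carrier Y"
      obtain p where p: "p \<in> carrier P" "y \<ominus>\<^bsub>Y\<^esub> u p \<in> MY" using surj[OF y] by blast
      have "u p \<oplus>\<^bsub>Y\<^esub> (y \<ominus>\<^bsub>Y\<^esub> u p) \<in> h ` carrier ?TP"
        using MY_sub[OF im uI] p i(3)[OF uI[OF p(1)]] by blast
      then show "y \<in> h ` carrier ?TP" using y uY[OF p(1)] by (simp add: Y.M.diff_add_cancel)
    qed
  qed
  moreover have "L = carrier ?TP" if L: "submodule L \<Lambda> ?TP" and hL: "h ` L = carrier Y" for L
  proof -
    note l = TP.submoduleD[OF L]
    have lc: "p \<in> carrier P \<and> w \<in> carrier ?FP" if "(p, w) \<in> L" for p w using l(1) that P by auto
    have hMY: "h (\<zero>\<^bsub>P\<^esub>, w) \<in> MY" if "w \<in> carrier ?FP" for w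
    proof -
      have "{w \<in> carrier ?FP. h (\<zero>\<^bsub>P\<^esub>, w) \<in> MY} = carrier ?FP"
        using submodule_vimage[OF FP.left_module_axioms R.left_module_axioms d(4) MYs] d(2) mMY hu uY
          pure_tensor_closed[OF P] by (intro tensor_submodule[OF P]) auto
      then show ?thesis using that by blast
    qed
    have fst_L: "submodule (fst ` L) A P"
    proof (rule P.submoduleI)
      show "fst ` L \<subseteq> carrier P" using lc by force
      show "\<zero>\<^bsub>P\<^esub> \<in> fst ` L" using l(2) P by force
      show "x \<oplus>\<^bsub>P\<^esub> y \<in> fst ` L" if xy: "x \<in> fst ` L" "y \<in> fst ` L" for x y
      proof -
        obtain v w where "(x, v) \<in> L" "(y, w) \<in> L" using xy by auto
        then show ?thesis using l(3)[of "(x, v)" "(y, w)"] P by force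
      qed
      show "a \<odot>\<^bsub>P\<^esub> x \<in> fst ` L" if a: "a \<in> carrier A" and x: "x \<in> fst ` L" for a x
      proof -
        obtain v where v: "(x, v) \<in> L" using x by auto
        then have "(a, \<zero>\<^bsub>M\<^esub>) \<odot>\<^bsub>?TP\<^esub> (x, v) \<in> L" using l(4) a by simp
        moreover have "(a, \<zero>\<^bsub>M\<^esub>) \<odot>\<^bsub>?TP\<^esub> (x, v) = (a \<odot>\<^bsub>P\<^esub> x, a \<odot>\<^bsub>?FP\<^esub> v \<oplus>\<^bsub>?FP\<^esub> pure_tensor A M P \<zero>\<^bsub>M\<^esub> x)"
          using lc[OF v] a by (intro T_smult[OF P]) auto
        ultimately show ?thesis by force
      qed
    qed
    \<comment> \<open>The second summand is mapped into \<open>MY\<close>, so modulo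
      \<open>MY\<close> only first components count, and \<open>ess\<close> applies to them.\<close>
    have "fst ` L = carrier P"
    proof (rule ess[OF fst_L])
      fix y assume "y \<in> carrier Y"
      then obtain z where "z \<in> L" "y = h z" using hL by blast
      then obtain p w where pw: "(p, w) \<in> L" "y = h (p, w)" by (cases z) auto
      then have "y = u p \<oplus>\<^bsub>Y\<^esub> h (\<zero>\<^bsub>P\<^esub>, w)" using d(1)[of p w] hu[of p] lc[OF pw(1)] by simp
      moreover have "h (\<zero>\<^bsub>P\<^esub>, w) \<in> carrier Y" using linD(1)[OF d(4)] lc[OF pw(1)] by simp
      ultimately have "y \<ominus>\<^bsub>Y\<^esub> u p = h (\<zero>\<^bsub>P\<^esub>, w)" using uY lc[OF pw(1)] by (simp add: Y.M.diff_add_cancel)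
      then show "\<exists>p\<in>fst ` L. y \<ominus>\<^bsub>Y\<^esub> u p \<in> MY" using hMY lc[OF pw(1)] pw(1) by force
    qed
    then have ex: "\<exists>w. (p, w) \<in> L" if "p \<in> carrier P" for p using that by (metis fst_conv imageE prod.collapse)
    \<comment> \<open>If \<open>(p, w)\<close> lies in \<open>L\<close>, so does its multiple by
      \<open>m\<close>, which is the pure tensor of \<open>m\<close> and \<open>p\<close> alone.
      Thus \<open>L\<close> contains the whole second summand.\<close>
    have "{w \<in> carrier ?FP. (\<zero>\<^bsub>P\<^esub>, w) \<in> L} = carrier ?FP"
    proof (rule tensor_submodule[OF P])
      show "submodule {w \<in> carrier ?FP. (\<zero>\<^bsub>P\<^esub>, w) \<in> L} A ?FP"
      proof (rule FP.submoduleI)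
        show "v \<oplus>\<^bsub>?FP\<^esub> w \<in> {w \<in> carrier ?FP. (\<zero>\<^bsub>P\<^esub>, w) \<in> L}"
          if "v \<in> {w \<in> carrier ?FP. (\<zero>\<^bsub>P\<^esub>, w) \<in> L}" "w \<in> {w \<in> carrier ?FP. (\<zero>\<^bsub>P\<^esub>, w) \<in> L}" for v w
          using that l(3)[of "(\<zero>\<^bsub>P\<^esub>, v)" "(\<zero>\<^bsub>P\<^esub>, w)"] P by simp
        show "a \<odot>\<^bsub>?FP\<^esub> w \<in> {w \<in> carrier ?FP. (\<zero>\<^bsub>P\<^esub>, w) \<in> L}"
          if "a \<in> carrier A" "w \<in> {w \<in> carrier ?FP. (\<zero>\<^bsub>P\<^esub>, w) \<in> L}" for a w
          using that l(4)[of "(a, \<zero>\<^bsub>M\<^esub>)" "(\<zero>\<^bsub>P\<^esub>, w)"] P pure_tensor_zero[OF P] by simp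
      qed (use l(2) P in auto)
      fix m p assume m: "m \<in> carrier M" and p: "p \<in> carrier P"
      obtain w where "(p, w) \<in> L" using ex[OF p] by blast
      then show "pure_tensor A M P m p \<in> {w \<in> carrier ?FP. (\<zero>\<^bsub>P\<^esub>, w) \<in> L}"
        using l(4)[of "(\<zero>\<^bsub>A\<^esub>, m)" "(p, w)"] m p lc[of p w] P pure_tensor_closed[OF P] by simp
    qed
    then have F: "(\<zero>\<^bsub>P\<^esub>, w) \<in> L" if "w \<in> carrier ?FP" for w using that by blast
    have "(p, w) \<in> L" if p: "p \<in> carrier P" and "w \<in> carrier ?FP" for p w
    proof -
      obtain v where v: "(p, v) \<in> L" using ex[OF p] by blast
      then have "(p, v) \<oplus>\<^bsub>?TP\<^esub> (\<zero>\<^bsub>P\<^esub>, w \<ominus>\<^bsub>?FP\<^esub> v) \<in> L" using that lc[OF v] by (intro l(3) F) auto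
      then show ?thesis using that lc[OF v] P by (simp add: FP.M.diff_add_cancel)
    qed
    then show ?thesis using l(1) P by auto
  qed
  ultimately show ?thesis using h by (auto simp: essential_epi_def)
qed

end

end

section \<open>Projectivity, generation and Hom for T and Z\<close>

context bimodule
begin

lemma T_inclusion:
  assumes P: "left_module A P"
  shows "p \<in> carrier P \<Longrightarrow> q \<in> carrier P \<Longrightarrow> (p \<oplus>\<^bsub>P\<^esub> q, \<zero>\<^bsub>tensor A M P\<^esub>) =
      (p, \<zero>\<^bsub>tensor A M P\<^esub>) \<oplus>\<^bsub>T_functor A M P\<^esub> (q, \<zero>\<^bsub>tensor A M P\<^esub>)"
    and "a \<in> carrier A \<Longrightarrow> p \<in> carrier P \<Longrightarrow>
      (a, \<zero>\<^bsub>M\<^esub>) \<odot>\<^bsub>T_functor A M P\<^esub> (p, \<zero>\<^bsub>tensor A M P\<^esub>) = (a \<odot>\<^bsub>P\<^esub> p, \<zero>\<^bsub>tensor A M P\<^esub>)"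
    and "m \<in> carrier M \<Longrightarrow> p \<in> carrier P \<Longrightarrow> w \<in> carrier (tensor A M P) \<Longrightarrow>
      m_act (T_functor A M P) m (p, w) = (\<zero>\<^bsub>P\<^esub>, pure_tensor A M P m p)"
    and "a \<in> carrier A \<Longrightarrow> w \<in> carrier (tensor A M P) \<Longrightarrow>
      (a, \<zero>\<^bsub>M\<^esub>) \<odot>\<^bsub>T_functor A M P\<^esub> (\<zero>\<^bsub>P\<^esub>, w) = (\<zero>\<^bsub>P\<^esub>, a \<odot>\<^bsub>tensor A M P\<^esub> w)"
    and "p \<in> carrier P \<Longrightarrow> (p, \<zero>\<^bsub>tensor A M P\<^esub>) \<in> carrier (T_functor A M P)"
    and "w \<in> carrier (tensor A M P) \<Longrightarrow> (\<zero>\<^bsub>P\<^esub>, w) \<in> carrier (T_functor A M P)"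
proof -
  interpret P: left_module A P by (rule P)
  interpret FP: left_module A "tensor A M P" by (rule left_module_tensor[OF P])
  show "p \<in> carrier P \<Longrightarrow> q \<in> carrier P \<Longrightarrow> (p \<oplus>\<^bsub>P\<^esub> q, \<zero>\<^bsub>tensor A M P\<^esub>) =
      (p, \<zero>\<^bsub>tensor A M P\<^esub>) \<oplus>\<^bsub>T_functor A M P\<^esub> (q, \<zero>\<^bsub>tensor A M P\<^esub>)"
    "p \<in> carrier P \<Longrightarrow> (p, \<zero>\<^bsub>tensor A M P\<^esub>) \<in> carrier (T_functor A M P)"
    "w \<in> carrier (tensor A M P) \<Longrightarrow> (\<zero>\<^bsub>P\<^esub>, w) \<in> carrier (T_functor A M P)"
    using P by simp_all
  show "a \<in> carrier A \<Longrightarrow> p \<in> carrier P \<Longrightarrow>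
      (a, \<zero>\<^bsub>M\<^esub>) \<odot>\<^bsub>T_functor A M P\<^esub> (p, \<zero>\<^bsub>tensor A M P\<^esub>) = (a \<odot>\<^bsub>P\<^esub> p, \<zero>\<^bsub>tensor A M P\<^esub>)"
    "m \<in> carrier M \<Longrightarrow> p \<in> carrier P \<Longrightarrow> w \<in> carrier (tensor A M P) \<Longrightarrow>
      m_act (T_functor A M P) m (p, w) = (\<zero>\<^bsub>P\<^esub>, pure_tensor A M P m p)"
    "a \<in> carrier A \<Longrightarrow> w \<in> carrier (tensor A M P) \<Longrightarrow>
      (a, \<zero>\<^bsub>M\<^esub>) \<odot>\<^bsub>T_functor A M P\<^esub> (\<zero>\<^bsub>P\<^esub>, w) = (\<zero>\<^bsub>P\<^esub>, a \<odot>\<^bsub>tensor A M P\<^esub> w)"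
    using P pure_tensor_zero[OF P] pure_tensor_closed[OF P] by simp_all
qed

lemma regular_trivial_extension: "left_module \<Lambda> (regular_module \<Lambda>)"
  by (rule left_module_regular[OF ring_trivial_extension])

text \<open>Reducing a dual basis of \<open>T P\<close> modulo \<open>M\<close>, that is, taking
  first components, gives one of \<open>P\<close>. Conversely the coordinate functions of
  \<open>P\<close> extend to \<open>T P\<close> by adjunction, and the same \<open>e i\<close>,
  placed in the first summand, belong to them.\<close>

lemma fg_projective_T_iff:
  assumes P: "left_module A P"
  shows "fg_projective \<Lambda> (T_functor A M P) \<longleftrightarrow> fg_projective A P"
proof
  let ?TP = "T_functor A M P" and ?FP = "tensor A M P" and ?L = "regular_module \<Lambda>"
  interpret P: left_module A P by (rule P)
  interpret FP: left_module A ?FP by (rule left_module_tensor[OF P])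
  interpret TP: left_module \<Lambda> ?TP by (rule left_module_T[OF P])
  note TPm = TP.left_module_axioms
  interpret L: left_module \<Lambda> ?L by (rule regular_trivial_extension)
  { assume "fg_projective \<Lambda> ?TP"
    then obtain n e \<epsilon> where b: "dual_basis \<Lambda> ?TP n e \<epsilon>" by (auto simp: fg_projective_iff_dual_basis)
    then have e: "e i \<in> carrier P \<times> carrier ?FP" and \<epsilon>: "lin \<Lambda> ?TP ?L (\<epsilon> i)" if "i < n" for i
      using that T_simps(1)[OF P] by (auto simp: dual_basis_def)
    have \<epsilon>c: "\<epsilon> i (p, \<zero>\<^bsub>?FP\<^esub>) \<in> carrier A \<times> carrier M" if "i < n" "p \<in> carrier P" for i p
      using linD(1)[OF \<epsilon>[OF that(1)] T_inclusion(5)[OF P that(2)]] by simp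
    have "dual_basis A P n (\<lambda>i. fst (e i)) (\<lambda>i p. fst (\<epsilon> i (p, \<zero>\<^bsub>?FP\<^esub>)))"
      unfolding dual_basis_def
    proof (intro conjI allI impI ballI)
      fix i assume i: "i < n"
      show "fst (e i) \<in> carrier P" using e[OF i] by auto
      note l = T_decompose(3)[OF regular_trivial_extension P \<epsilon>[OF i]]
      show "lin A P (regular_module A) (\<lambda>p. fst (\<epsilon> i (p, \<zero>\<^bsub>?FP\<^esub>)))"
      proof (rule linI)
        show "fst (\<epsilon> i (x, \<zero>\<^bsub>?FP\<^esub>)) \<in> carrier (regular_module A)" if "x \<in> carrier P" for x
          using \<epsilon>c[OF i that] by auto
        show "fst (\<epsilon> i (x \<oplus>\<^bsub>P\<^esub> y, \<zero>\<^bsub>?FP\<^esub>)) =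
            fst (\<epsilon> i (x, \<zero>\<^bsub>?FP\<^esub>)) \<oplus>\<^bsub>regular_module A\<^esub> fst (\<epsilon> i (y, \<zero>\<^bsub>?FP\<^esub>))"
          if "x \<in> carrier P" "y \<in> carrier P" for x y
          using linD(2)[OF l that]
          by (cases "\<epsilon> i (x, \<zero>\<^bsub>?FP\<^esub>)", cases "\<epsilon> i (y, \<zero>\<^bsub>?FP\<^esub>)") simp
        show "fst (\<epsilon> i (a \<odot>\<^bsub>P\<^esub> x, \<zero>\<^bsub>?FP\<^esub>)) = a \<odot>\<^bsub>regular_module A\<^esub> fst (\<epsilon> i (x, \<zero>\<^bsub>?FP\<^esub>))"
          if "a \<in> carrier A" "x \<in> carrier P" for a x
          using linD(3)[OF l that] by (cases "\<epsilon> i (x, \<zero>\<^bsub>?FP\<^esub>)") simp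
      qed
    next
      fix p assume p: "p \<in> carrier P"
      let ?g = "\<lambda>i. \<epsilon> i (p, \<zero>\<^bsub>?FP\<^esub>) \<odot>\<^bsub>?TP\<^esub> e i"
      \<comment> \<open>In a product over the trivial extension the first component involves neither
        \<open>m\<close> nor \<open>w\<close>, which is why reduction commutes with the
        expansion.\<close>
      have g: "?g i \<in> carrier ?TP \<and> fst (?g i) = fst (\<epsilon> i (p, \<zero>\<^bsub>?FP\<^esub>)) \<odot>\<^bsub>P\<^esub> fst (e i)" if "i < n" for i
      proof -
        obtain a m x w where *: "\<epsilon> i (p, \<zero>\<^bsub>?FP\<^esub>) = (a, m)" "e i = (x, w)"
          "a \<in> carrier A" "m \<in> carrier M" "x \<in> carrier P" "w \<in> carrier ?FP"
          using \<epsilon>c[OF \<open>i < n\<close> p] e[OF \<open>i < n\<close>] by blast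
        then show ?thesis using P pure_tensor_closed[OF P] by simp
      qed
      have "p = fst (finsum ?TP ?g {..<n})"
        using b T_inclusion(5)[OF P p] by (simp add: dual_basis_def)
      also have "\<dots> = finsum P (\<lambda>i. fst (?g i)) {..<n}"
        by (rule additive_finsum[where h = fst, OF TP.M.abelian_group_axioms P.M.abelian_group_axioms])
          (use g P in auto)
      also have "\<dots> = finsum P (\<lambda>i. fst (\<epsilon> i (p, \<zero>\<^bsub>?FP\<^esub>)) \<odot>\<^bsub>P\<^esub> fst (e i)) {..<n}"
        using g e \<epsilon>c[OF _ p] by (intro P.M.finsum_cong') (auto simp: mem_Times_iff)
      finally show "finsum P (\<lambda>i. fst (\<epsilon> i (p, \<zero>\<^bsub>?FP\<^esub>)) \<odot>\<^bsub>P\<^esub> fst (e i)) {..<n} = p" by simp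
    qed
    then show "fg_projective A P" using P by (auto simp: fg_projective_iff_dual_basis) }
  { assume "fg_projective A P"
    then obtain n e \<epsilon> where b: "dual_basis A P n e \<epsilon>" by (auto simp: fg_projective_iff_dual_basis)
    then have e: "e i \<in> carrier P" and \<epsilon>: "lin A P (regular_module A) (\<epsilon> i)" if "i < n" for i
      using that by (auto simp: dual_basis_def)
    have "\<exists>h. i < n \<longrightarrow> lin \<Lambda> ?TP ?L h \<and> (\<forall>p\<in>carrier P. h (p, \<zero>\<^bsub>?FP\<^esub>) = (\<epsilon> i p, \<zero>\<^bsub>M\<^esub>))" for i
    proof (cases "i < n")
      case True
      have "lin A P (restrict_scalars M ?L) (\<lambda>p. (\<epsilon> i p, \<zero>\<^bsub>M\<^esub>))"
        using linD[OF \<epsilon>[OF True]] by (intro linI) (auto simp: rsmult_zero)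
      then show ?thesis using T_extend[OF regular_trivial_extension P] by blast
    qed simp
    then obtain h where h: "\<And>i. i < n \<Longrightarrow> lin \<Lambda> ?TP ?L (h i)"
      "\<And>i p. i < n \<Longrightarrow> p \<in> carrier P \<Longrightarrow> h i (p, \<zero>\<^bsub>?FP\<^esub>) = (\<epsilon> i p, \<zero>\<^bsub>M\<^esub>)" by metis
    let ?e = "\<lambda>i. (e i, \<zero>\<^bsub>?FP\<^esub>)"
    have ec: "?e i \<in> carrier ?TP" if "i < n" for i using T_inclusion(5)[OF P e[OF that]] .
    have "finsum ?TP (\<lambda>i. h i z \<odot>\<^bsub>?TP\<^esub> ?e i) {..<n} = z" if z: "z \<in> carrier ?TP" for z
    proof (rule T_lin_ext[OF TPm P _ lin_id _ z])
      show "lin \<Lambda> ?TP ?TP (\<lambda>z. finsum ?TP (\<lambda>i. h i z \<odot>\<^bsub>?TP\<^esub> ?e i) {..<n})"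
        by (rule lin_finsum_smult[OF TPm TPm h(1) ec])
      fix p assume p: "p \<in> carrier P"
      have \<epsilon>p: "\<epsilon> i p \<in> carrier A" if "i < n" for i using linD(1)[OF \<epsilon>[OF that] p] by simp
      have "finsum ?TP (\<lambda>i. h i (p, \<zero>\<^bsub>?FP\<^esub>) \<odot>\<^bsub>?TP\<^esub> ?e i) {..<n} =
          finsum ?TP (\<lambda>i. (\<epsilon> i p \<odot>\<^bsub>P\<^esub> e i, \<zero>\<^bsub>?FP\<^esub>)) {..<n}"
        using h(2)[OF _ p] \<epsilon>p e T_inclusion(2,5)[OF P] by (intro TP.M.finsum_cong') auto
      also have "\<dots> = (finsum P (\<lambda>i. \<epsilon> i p \<odot>\<^bsub>P\<^esub> e i) {..<n}, \<zero>\<^bsub>?FP\<^esub>)"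
        by (rule additive_finsum[where h = "\<lambda>x. (x, \<zero>\<^bsub>?FP\<^esub>)", symmetric,
              OF P.M.abelian_group_axioms TP.M.abelian_group_axioms])
          (use \<epsilon>p e T_inclusion(1,5)[OF P] in auto)
      also have "\<dots> = (p, \<zero>\<^bsub>?FP\<^esub>)" using b p by (simp add: dual_basis_def)
      finally show "finsum ?TP (\<lambda>i. h i (p, \<zero>\<^bsub>?FP\<^esub>) \<odot>\<^bsub>?TP\<^esub> ?e i) {..<n} = (p, \<zero>\<^bsub>?FP\<^esub>)" .
    qed
    then have "dual_basis \<Lambda> ?TP n ?e h" using h(1) ec by (simp add: dual_basis_def)
    then show "fg_projective \<Lambda> ?TP" using TPm by (auto simp: fg_projective_iff_dual_basis) }
qed

text \<open>The submodule form of generation by the first summand: multiplying by \<open>M\<close>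
  produces all pure tensors.\<close>

lemma T_submodule_full:
  assumes X: "left_module A X" and N: "submodule N \<Lambda> (T_functor A M X)"
    and "\<And>x. x \<in> carrier X \<Longrightarrow> (x, \<zero>\<^bsub>tensor A M X\<^esub>) \<in> N"
  shows "N = carrier (T_functor A M X)"
proof -
  let ?FX = "tensor A M X" and ?TX = "T_functor A M X"
  interpret X: left_module A X by (rule X)
  interpret FX: left_module A ?FX by (rule left_module_tensor[OF X])
  interpret TX: left_module \<Lambda> ?TX by (rule left_module_T[OF X])
  note n = TX.submoduleD[OF N]
  have "{w \<in> carrier ?FX. (\<zero>\<^bsub>X\<^esub>, w) \<in> N} = carrier ?FX"
  proof (rule tensor_submodule[OF X])
    show "submodule {w \<in> carrier ?FX. (\<zero>\<^bsub>X\<^esub>, w) \<in> N} A ?FX"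
    proof (rule FX.submoduleI)
      show "v \<oplus>\<^bsub>?FX\<^esub> w \<in> {w \<in> carrier ?FX. (\<zero>\<^bsub>X\<^esub>, w) \<in> N}"
        if "v \<in> {w \<in> carrier ?FX. (\<zero>\<^bsub>X\<^esub>, w) \<in> N}" "w \<in> {w \<in> carrier ?FX. (\<zero>\<^bsub>X\<^esub>, w) \<in> N}" for v w
        using that n(3)[of "(\<zero>\<^bsub>X\<^esub>, v)" "(\<zero>\<^bsub>X\<^esub>, w)"] X by simp
      show "a \<odot>\<^bsub>?FX\<^esub> w \<in> {w \<in> carrier ?FX. (\<zero>\<^bsub>X\<^esub>, w) \<in> N}"
        if "a \<in> carrier A" "w \<in> {w \<in> carrier ?FX. (\<zero>\<^bsub>X\<^esub>, w) \<in> N}" for a w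
        using that n(4)[of "(a, \<zero>\<^bsub>M\<^esub>)" "(\<zero>\<^bsub>X\<^esub>, w)"] T_inclusion(4)[OF X] by simp
    qed (use n(2) X in auto)
    show "pure_tensor A M X m x \<in> {w \<in> carrier ?FX. (\<zero>\<^bsub>X\<^esub>, w) \<in> N}"
      if "m \<in> carrier M" "x \<in> carrier X" for m x
      using n(4)[OF _ assms(3)[OF that(2)], of "(\<zero>\<^bsub>A\<^esub>, m)"] T_inclusion(3)[OF X that FX.M.zero_closed]
        pure_tensor_closed[OF X] that by simp
  qed
  then have F: "(\<zero>\<^bsub>X\<^esub>, w) \<in> N" if "w \<in> carrier ?FX" for w using that by blast
  have "(x, w) \<in> N" if "x \<in> carrier X" "w \<in> carrier ?FX" for x w
    using n(3)[OF assms(3)[OF that(1)] F[OF that(2)]] that X by simp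
  then show ?thesis using n(1) X by auto
qed

lemma fg_module_T:
  assumes "fg_module A X" shows "fg_module \<Lambda> (T_functor A M X)"
proof -
  have X: "left_module A X" using assms by (simp add: fg_module_def)
  let ?FX = "tensor A M X" and ?TX = "T_functor A M X"
  interpret X: left_module A X by (rule X)
  interpret FX: left_module A ?FX by (rule left_module_tensor[OF X])
  interpret TX: left_module \<Lambda> ?TX by (rule left_module_T[OF X])
  have "\<exists>S. finite S \<and> S \<subseteq> carrier X \<and> (\<forall>N. submodule N A X \<and> S \<subseteq> N \<longrightarrow> N = carrier X)"
    using assms by (simp add: fg_module_def fin_gen_def)
  then obtain S where "finite S \<and> S \<subseteq> carrier X \<and> (\<forall>N. submodule N A X \<and> S \<subseteq> N \<longrightarrow> N = carrier X)" by (rule exE)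
  then have S: "finite S" "S \<subseteq> carrier X" "\<And>N. submodule N A X \<Longrightarrow> S \<subseteq> N \<Longrightarrow> N = carrier X" by simp_all
  have "N = carrier ?TX" if N: "submodule N \<Lambda> ?TX" and SN: "(\<lambda>x. (x, \<zero>\<^bsub>?FX\<^esub>)) ` S \<subseteq> N" for N
  proof (rule T_submodule_full[OF X N])
    note n = TX.submoduleD[OF N]
    let ?N = "{x \<in> carrier X. (x, \<zero>\<^bsub>?FX\<^esub>) \<in> N}"
    have "submodule ?N A X"
    proof (rule X.submoduleI)
      show "\<zero>\<^bsub>X\<^esub> \<in> ?N" using n(2) X by simp
      show "x \<oplus>\<^bsub>X\<^esub> y \<in> ?N" if "x \<in> ?N" "y \<in> ?N" for x y
        using that n(3)[of "(x, \<zero>\<^bsub>?FX\<^esub>)" "(y, \<zero>\<^bsub>?FX\<^esub>)"] X by simp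
      show "a \<odot>\<^bsub>X\<^esub> x \<in> ?N" if "a \<in> carrier A" "x \<in> ?N" for a x
        using that n(4)[of "(a, \<zero>\<^bsub>M\<^esub>)" "(x, \<zero>\<^bsub>?FX\<^esub>)"] T_inclusion(2)[OF X] by simp
    qed auto
    then have "?N = carrier X" using S(2) SN by (intro S(3)) auto
    then show "(x, \<zero>\<^bsub>?FX\<^esub>) \<in> N" if "x \<in> carrier X" for x using that by blast
  qed
  moreover have "(\<lambda>x. (x, \<zero>\<^bsub>?FX\<^esub>)) ` S \<subseteq> carrier ?TX" using S(2) T_inclusion(5)[OF X] by blast
  ultimately have "fin_gen \<Lambda> ?TX" unfolding fin_gen_def
    using S(1) by (intro exI[of _ "(\<lambda>x. (x, \<zero>\<^bsub>?FX\<^esub>)) ` S"]) simp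
  then show ?thesis by (simp add: fg_module_def TX.left_module_axioms)
qed

lemma submodule_Z_iff:
  assumes X: "left_module A X" shows "submodule N \<Lambda> (Z_functor A M X) \<longleftrightarrow> submodule N A X"
proof -
  interpret X: left_module A X by (rule X)
  interpret ZX: left_module \<Lambda> "Z_functor A M X" by (rule left_module_Z[OF X])
  show ?thesis
  proof
    assume N: "submodule N \<Lambda> (Z_functor A M X)"
    note n = ZX.submoduleD[OF N]
    show "submodule N A X"
    proof (rule X.submoduleI)
      show "a \<odot>\<^bsub>X\<^esub> x \<in> N" if "a \<in> carrier A" "x \<in> N" for a x
        using n(1) n(4)[of "(a, \<zero>\<^bsub>M\<^esub>)" x] that X by (auto simp: subset_eq)
    qed (use n X in auto)
  next
    assume N: "submodule N A X"
    note n = X.submoduleD[OF N]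
    show "submodule N \<Lambda> (Z_functor A M X)"
      by (rule ZX.submoduleI) (use n X in \<open>auto simp: subset_eq\<close>)
  qed
qed

lemma fg_module_Z: "fg_module A X \<Longrightarrow> fg_module \<Lambda> (Z_functor A M X)"
  by (auto simp: fg_module_def fin_gen_def submodule_Z_iff left_module_Z)

lemma lin_Z_restrict:
  assumes X: "left_module A X"
  shows "lin A P (restrict_scalars M (Z_functor A M X)) u \<longleftrightarrow> lin A P X u"
  using Z_smult[OF X] by (auto simp: lin_def Z_simps[OF X])

text \<open>Over \<open>A\<close> the module \<open>T X\<close> is just the direct sum of
  \<open>X\<close> and \<open>M \<otimes> X\<close>. The conditions on \<open>M \<otimes> X\<close>
  in the first equivalence originate here.\<close>

lemma lin_T_restrict:
  assumes X: "left_module A X" and P: "left_module A P"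
  shows "lin A P (restrict_scalars M (T_functor A M X)) u \<longleftrightarrow>
    lin A P X (\<lambda>p. fst (u p)) \<and> lin A P (tensor A M X) (\<lambda>p. snd (u p))"
proof -
  let ?TX = "T_functor A M X" and ?FX = "tensor A M X"
  interpret X: left_module A X by (rule X)
  interpret P: left_module A P by (rule P)
  interpret FX: left_module A ?FX by (rule left_module_tensor[OF X])
  have add: "x \<oplus>\<^bsub>?TX\<^esub> y = (fst x \<oplus>\<^bsub>X\<^esub> fst y, snd x \<oplus>\<^bsub>?FX\<^esub> snd y)" for x y
    using T_simps(3)[OF X, of "fst x" "snd x" "fst y" "snd y"] by simp
  have sm: "(a, \<zero>\<^bsub>M\<^esub>) \<odot>\<^bsub>?TX\<^esub> x = (a \<odot>\<^bsub>X\<^esub> fst x, a \<odot>\<^bsub>?FX\<^esub> snd x)"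
    if "a \<in> carrier A" "fst x \<in> carrier X" "snd x \<in> carrier ?FX" for a x
    using T_smult[OF X that(1) M.zero_closed that(2,3)] that pure_tensor_zero[OF X] by simp
  have c: "x \<in> carrier ?TX \<longleftrightarrow> fst x \<in> carrier X \<and> snd x \<in> carrier ?FX" for x
    by (simp add: T_simps(1)[OF X] mem_Times_iff)
  show ?thesis
    unfolding lin_def restrict_scalars_simps c add by (auto simp: sm prod_eq_iff)
qed

lemma hom_zero_T_T:
  assumes X: "left_module A X" and P: "left_module A P"
  shows "hom_zero \<Lambda> (T_functor A M P) (T_functor A M X) \<longleftrightarrow> hom_zero A P X \<and> hom_zero A P (tensor A M X)"
proof -
  let ?FX = "tensor A M X"
  interpret X: left_module A X by (rule X)
  interpret P: left_module A P by (rule P)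
  interpret FX: left_module A ?FX by (rule left_module_tensor[OF X])
  have z: "lin A P X (\<lambda>_. \<zero>\<^bsub>X\<^esub>)" "lin A P ?FX (\<lambda>_. \<zero>\<^bsub>?FX\<^esub>)" by (auto intro!: linI)
  show ?thesis
    unfolding hom_zero_T_iff[OF left_module_T[OF X] P] hom_zero_iff[OF P] lin_T_restrict[OF X P]
      restrict_scalars_simps T_simps[OF X]
  proof (intro iffI conjI allI impI ballI)
    assume *: "\<forall>h. lin A P X (\<lambda>p. fst (h p)) \<and> lin A P ?FX (\<lambda>p. snd (h p)) \<longrightarrow>
      (\<forall>x\<in>carrier P. h x = (\<zero>\<^bsub>X\<^esub>, \<zero>\<^bsub>?FX\<^esub>))"
    show "h x = \<zero>\<^bsub>X\<^esub>" if "lin A P X h" "x \<in> carrier P" for h x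
      using *[rule_format, of "\<lambda>p. (h p, \<zero>\<^bsub>?FX\<^esub>)" x] that z by simp
    show "h x = \<zero>\<^bsub>?FX\<^esub>" if "lin A P ?FX h" "x \<in> carrier P" for h x
      using *[rule_format, of "\<lambda>p. (\<zero>\<^bsub>X\<^esub>, h p)" x] that z by simp
  next
    fix h x
    assume "(\<forall>h. lin A P X h \<longrightarrow> (\<forall>x\<in>carrier P. h x = \<zero>\<^bsub>X\<^esub>)) \<and>
        (\<forall>h. lin A P ?FX h \<longrightarrow> (\<forall>x\<in>carrier P. h x = \<zero>\<^bsub>?FX\<^esub>))"
      "lin A P X (\<lambda>p. fst (h p)) \<and> lin A P ?FX (\<lambda>p. snd (h p))" "x \<in> carrier P"
    then have "fst (h x) = \<zero>\<^bsub>X\<^esub>" "snd (h x) = \<zero>\<^bsub>?FX\<^esub>" by blast+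
    then show "h x = (\<zero>\<^bsub>X\<^esub>, \<zero>\<^bsub>?FX\<^esub>)" by (simp add: prod_eq_iff)
  qed
qed

lemma hom_zero_T_Z:
  assumes X: "left_module A X" and P: "left_module A P"
  shows "hom_zero \<Lambda> (T_functor A M P) (Z_functor A M X) \<longleftrightarrow> hom_zero A P X"
  unfolding hom_zero_T_iff[OF left_module_Z[OF X] P] hom_zero_iff[OF P] lin_Z_restrict[OF X]
    restrict_scalars_simps Z_simps[OF X] ..

text \<open>Extension problems into a direct sum are solved componentwise; conversely a problem in
  one summand is padded with zero in the other.\<close>

lemma hom_surj_restrict_T:
  assumes X: "left_module A X" and P: "left_module A P" and Q: "left_module A Q"
  shows "hom_surj A P f Q (restrict_scalars M (T_functor A M X)) \<longleftrightarrow>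
    hom_surj A P f Q X \<and> hom_surj A P f Q (tensor A M X)"
proof -
  let ?FX = "tensor A M X"
  interpret X: left_module A X by (rule X)
  interpret FX: left_module A ?FX by (rule left_module_tensor[OF X])
  have z: "lin A P X (\<lambda>_. \<zero>\<^bsub>X\<^esub>)" "lin A P ?FX (\<lambda>_. \<zero>\<^bsub>?FX\<^esub>)" by (auto intro!: linI)
  show ?thesis
    unfolding hom_surj_def lin_T_restrict[OF X P] lin_T_restrict[OF X Q]
  proof (intro iffI conjI allI impI)
    assume *: "\<forall>\<psi>. lin A P X (\<lambda>p. fst (\<psi> p)) \<and> lin A P ?FX (\<lambda>p. snd (\<psi> p)) \<longrightarrow>
      (\<exists>\<phi>. (lin A Q X (\<lambda>p. fst (\<phi> p)) \<and> lin A Q ?FX (\<lambda>p. snd (\<phi> p))) \<and> (\<forall>x\<in>carrier P. \<psi> x = \<phi> (f x)))"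
    show "\<exists>\<phi>. lin A Q X \<phi> \<and> (\<forall>x\<in>carrier P. \<psi> x = \<phi> (f x))" if \<psi>: "lin A P X \<psi>" for \<psi>
    proof -
      obtain \<phi> where "lin A Q X (\<lambda>p. fst (\<phi> p))" "\<forall>x\<in>carrier P. (\<psi> x, \<zero>\<^bsub>?FX\<^esub>) = \<phi> (f x)"
        using *[rule_format, of "\<lambda>p. (\<psi> p, \<zero>\<^bsub>?FX\<^esub>)"] \<psi> z by auto
      then show ?thesis by (intro exI[of _ "\<lambda>p. fst (\<phi> p)"]) (metis fst_conv)
    qed
    show "\<exists>\<phi>. lin A Q ?FX \<phi> \<and> (\<forall>x\<in>carrier P. \<psi> x = \<phi> (f x))" if \<psi>: "lin A P ?FX \<psi>" for \<psi>
    proof -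
      obtain \<phi> where "lin A Q ?FX (\<lambda>p. snd (\<phi> p))" "\<forall>x\<in>carrier P. (\<zero>\<^bsub>X\<^esub>, \<psi> x) = \<phi> (f x)"
        using *[rule_format, of "\<lambda>p. (\<zero>\<^bsub>X\<^esub>, \<psi> p)"] \<psi> z by auto
      then show ?thesis by (intro exI[of _ "\<lambda>p. snd (\<phi> p)"]) (metis snd_conv)
    qed
  next
    fix \<psi>
    assume *: "(\<forall>\<psi>. lin A P X \<psi> \<longrightarrow> (\<exists>\<phi>. lin A Q X \<phi> \<and> (\<forall>x\<in>carrier P. \<psi> x = \<phi> (f x)))) \<and>
        (\<forall>\<psi>. lin A P ?FX \<psi> \<longrightarrow> (\<exists>\<phi>. lin A Q ?FX \<phi> \<and> (\<forall>x\<in>carrier P. \<psi> x = \<phi> (f x))))"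
      and \<psi>: "lin A P X (\<lambda>p. fst (\<psi> p)) \<and> lin A P ?FX (\<lambda>p. snd (\<psi> p))"
    obtain \<phi>1 where "lin A Q X \<phi>1" "\<forall>x\<in>carrier P. fst (\<psi> x) = \<phi>1 (f x)"
      using mp[OF spec[OF conjunct1[OF *]] conjunct1[OF \<psi>]] by blast
    moreover obtain \<phi>2 where "lin A Q ?FX \<phi>2" "\<forall>x\<in>carrier P. snd (\<psi> x) = \<phi>2 (f x)"
      using mp[OF spec[OF conjunct2[OF *]] conjunct2[OF \<psi>]] by blast
    ultimately show "\<exists>\<phi>. (lin A Q X (\<lambda>p. fst (\<phi> p)) \<and> lin A Q ?FX (\<lambda>p. snd (\<phi> p))) \<and> (\<forall>x\<in>carrier P. \<psi> x = \<phi> (f x))"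
      by (intro exI[of _ "\<lambda>q. (\<phi>1 q, \<phi>2 q)"]) (auto simp: prod_eq_iff)
  qed
qed

lemma T_map:
  assumes P: "left_module A P" and X: "left_module A X" and g: "lin A P X g"
  obtains Fg where "lin A (tensor A M P) (tensor A M X) Fg"
    "\<And>m p. m \<in> carrier M \<Longrightarrow> p \<in> carrier P \<Longrightarrow> Fg (pure_tensor A M P m p) = pure_tensor A M X m (g p)"
    "lin \<Lambda> (T_functor A M P) (T_functor A M X) (\<lambda>(p, w). (g p, Fg w))"
proof -
  let ?FP = "tensor A M P" and ?FX = "tensor A M X"
  interpret X: left_module A X by (rule X)
  interpret P: left_module A P by (rule P)
  interpret FX: left_module A ?FX by (rule left_module_tensor[OF X])
  interpret FP: left_module A ?FP by (rule left_module_tensor[OF P])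
  note g' = linD[OF g]
  have "\<exists>h. lin A ?FP ?FX h \<and> (\<forall>m\<in>carrier M. \<forall>p\<in>carrier P. h (pure_tensor A M P m p) = pure_tensor A M X m (g p))"
    by (rule tensor_lin[OF P FX.left_module_axioms])
      (use g' in \<open>auto simp: pure_tensor_closed[OF X] pure_tensor_add_left[OF X] pure_tensor_add_right[OF X]
        pure_tensor_balanced[OF X] tensor_smult_pure[OF X]\<close>)
  then obtain Fg where Fg: "lin A ?FP ?FX Fg"
    "\<And>m p. m \<in> carrier M \<Longrightarrow> p \<in> carrier P \<Longrightarrow> Fg (pure_tensor A M P m p) = pure_tensor A M X m (g p)" by blast
  note F' = linD[OF Fg(1)]
  have "lin \<Lambda> (T_functor A M P) (T_functor A M X) (\<lambda>(p, w). (g p, Fg w))"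
    by (rule linI) (use g' F' X P Fg(2) in \<open>auto simp: pure_tensor_closed[OF P]\<close>)
  then show thesis using that Fg by blast
qed

lemma T_map_surj:
  assumes P: "left_module A P" and X: "left_module A X" and g: "g ` carrier P = carrier X"
    and Fg: "lin A (tensor A M P) (tensor A M X) Fg"
      "\<And>m p. m \<in> carrier M \<Longrightarrow> p \<in> carrier P \<Longrightarrow> Fg (pure_tensor A M P m p) = pure_tensor A M X m (g p)"
  shows "Fg ` carrier (tensor A M P) = carrier (tensor A M X)"
proof (rule tensor_submodule[OF X])
  interpret FP: left_module A "tensor A M P" by (rule left_module_tensor[OF P])
  show "submodule (Fg ` carrier (tensor A M P)) A (tensor A M X)"
    using submodule_image[OF FP.left_module_axioms left_module_tensor[OF X] Fg(1) FP.submodule_carrier] .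
  fix m x assume m: "m \<in> carrier M" and "x \<in> carrier X"
  then have "x \<in> g ` carrier P" using g by simp
  then obtain p where "p \<in> carrier P" "x = g p" by auto
  then show "pure_tensor A M X m x \<in> Fg ` carrier (tensor A M P)"
    using Fg(2)[OF m, of p] pure_tensor_closed[OF P m, of p] by (metis image_eqI)
qed

end

section \<open>Minimal presentations of T X and Z X\<close>

context bimodule
begin

lemma T_minus:
  assumes X: "left_module A X" and "x \<in> carrier X" "w \<in> carrier (tensor A M X)" "x' \<in> carrier X" "w' \<in> carrier (tensor A M X)"
  shows "(x, w) \<ominus>\<^bsub>T_functor A M X\<^esub> (x', w') = (x \<ominus>\<^bsub>X\<^esub> x', w \<ominus>\<^bsub>tensor A M X\<^esub> w')"
proof -
  interpret X: left_module A X by (rule X)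
  interpret FX: left_module A "tensor A M X" by (rule left_module_tensor[OF X])
  interpret TX: left_module \<Lambda> "T_functor A M X" by (rule left_module_T[OF X])
  have "(x, w) = (x \<ominus>\<^bsub>X\<^esub> x', w \<ominus>\<^bsub>tensor A M X\<^esub> w') \<oplus>\<^bsub>T_functor A M X\<^esub> (x', w')"
    using assms by (simp add: X.M.diff_add_cancel FX.M.diff_add_cancel)
  then show ?thesis
    using TX.M.diff_add_cancel(3)[of "(x \<ominus>\<^bsub>X\<^esub> x', w \<ominus>\<^bsub>tensor A M X\<^esub> w')" "(x', w')"] assms by simp
qed

text \<open>For \<open>Y = T X\<close> the submodule \<open>MY\<close> is exactly the second
  summand, so modulo it the map is \<open>g\<close> and essentiality is inherited.\<close>

lemma essential_epi_T:
  assumes P: "left_module A P" and X: "left_module A X" and g: "essential_epi A P g X"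
    and h: "lin \<Lambda> (T_functor A M P) (T_functor A M X) (\<lambda>(p, w). (g p, Fg w))"
    and Fg: "lin A (tensor A M P) (tensor A M X) Fg"
  shows "essential_epi \<Lambda> (T_functor A M P) (\<lambda>(p, w). (g p, Fg w)) (T_functor A M X)"
proof -
  let ?FX = "tensor A M X" and ?FP = "tensor A M P" and ?TX = "T_functor A M X"
  let ?R = "restrict_scalars M ?TX"
  let ?MY = "span A ?R {m_act ?TX m y | m y. m \<in> carrier M \<and> y \<in> carrier ?TX}"
  interpret X: left_module A X by (rule X)
  interpret FX: left_module A ?FX by (rule left_module_tensor[OF X])
  interpret FP: left_module A ?FP by (rule left_module_tensor[OF P])
  interpret P: left_module A P by (rule P)
  interpret TX: left_module \<Lambda> ?TX by (rule left_module_T[OF X])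
  interpret R: left_module A ?R by (rule left_module_restrict_scalars[OF TX.left_module_axioms])
  note e = essential_epiD[OF g]
  note my = R.submoduleD[OF R.submodule_span]
  have gens: "{m_act ?TX m y | m y. m \<in> carrier M \<and> y \<in> carrier ?TX} \<subseteq> carrier ?R" by auto
  have "{w \<in> carrier ?FX. (\<zero>\<^bsub>X\<^esub>, w) \<in> ?MY} = carrier ?FX"
  proof (rule tensor_submodule[OF X])
    have "lin A ?FX ?R (\<lambda>w. (\<zero>\<^bsub>X\<^esub>, w))"
      using T_decompose(4)[OF TX.left_module_axioms X lin_id] .
    then show "submodule {w \<in> carrier ?FX. (\<zero>\<^bsub>X\<^esub>, w) \<in> ?MY} A ?FX"
      by (rule submodule_vimage[OF FX.left_module_axioms R.left_module_axioms _ R.submodule_span])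
    fix m x assume m: "m \<in> carrier M" and x: "x \<in> carrier X"
    have "m_act ?TX m (x, \<zero>\<^bsub>?FX\<^esub>) \<in> ?MY"
      using R.span_superset[OF gens] m T_inclusion(5)[OF X x] by blast
    then show "pure_tensor A M X m x \<in> {w \<in> carrier ?FX. (\<zero>\<^bsub>X\<^esub>, w) \<in> ?MY}"
      using T_inclusion(3)[OF X m x FX.M.zero_closed] pure_tensor_closed[OF X m x] by simp
  qed
  then have sup: "(\<zero>\<^bsub>X\<^esub>, w) \<in> ?MY" if "w \<in> carrier ?FX" for w using that by blast
  have "?MY \<subseteq> {z \<in> carrier ?TX. fst z = \<zero>\<^bsub>X\<^esub>}"
  proof (rule R.span_minimal)
    have "lin A ?R X fst"
      using lin_T_restrict[OF X R.left_module_axioms, of "\<lambda>z. z"] lin_id by blast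
    then show "submodule {z \<in> carrier ?TX. fst z = \<zero>\<^bsub>X\<^esub>} A ?R"
      using submodule_kernel[OF R.left_module_axioms X] by simp
    show "{m_act ?TX m y | m y. m \<in> carrier M \<and> y \<in> carrier ?TX} \<subseteq> {z \<in> carrier ?TX. fst z = \<zero>\<^bsub>X\<^esub>}"
      using X T_inclusion(3)[OF X] pure_tensor_closed[OF X] by auto
  qed
  then have sub: "fst z = \<zero>\<^bsub>X\<^esub>" if "z \<in> ?MY" for z using that by blast
  show ?thesis
  proof (rule T_essential_epi[OF TX.left_module_axioms P h, where u = "\<lambda>p. (g p, \<zero>\<^bsub>?FX\<^esub>)"])
    show "(case (p, \<zero>\<^bsub>?FP\<^esub>) of (p, w) \<Rightarrow> (g p, Fg w)) = (g p, \<zero>\<^bsub>?FX\<^esub>)" for p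
      using lin_zero[OF FP.left_module_axioms FX.left_module_axioms Fg] by simp
    have minus: "(x, w) \<ominus>\<^bsub>?TX\<^esub> (g p, \<zero>\<^bsub>?FX\<^esub>) = (x \<ominus>\<^bsub>X\<^esub> g p, w)"
      if "x \<in> carrier X" "w \<in> carrier ?FX" "p \<in> carrier P" for x w p
      using T_minus[OF X that(1,2) linD(1)[OF e(1) that(3)] FX.M.zero_closed] that(2) by simp
    { fix y assume "y \<in> carrier ?TX"
      then obtain x w where y: "y = (x, w)" "x \<in> carrier X" "w \<in> carrier ?FX" using X by (cases y) auto
      then have "x \<in> g ` carrier P" using e(2) by simp
      then obtain p where p: "p \<in> carrier P" "x = g p" by auto
      have "y \<ominus>\<^bsub>?TX\<^esub> (g p, \<zero>\<^bsub>?FX\<^esub>) = (\<zero>\<^bsub>X\<^esub>, w)"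
        using minus[OF y(2,3) p(1)] y p by (simp add: X.diff_zero_iff)
      then show "\<exists>p\<in>carrier P. y \<ominus>\<^bsub>?TX\<^esub> (g p, \<zero>\<^bsub>?FX\<^esub>) \<in> ?MY" using sup[OF y(3)] p(1) by (intro bexI[of _ p]) (simp_all only:) }
    fix L assume L: "submodule L A P"
      and ex: "\<And>y. y \<in> carrier ?TX \<Longrightarrow> \<exists>p\<in>L. y \<ominus>\<^bsub>?TX\<^esub> (g p, \<zero>\<^bsub>?FX\<^esub>) \<in> ?MY"
    note l = P.submoduleD(1)[OF L]
    have "g ` L = carrier X"
    proof
      show "g ` L \<subseteq> carrier X" using l linD(1)[OF e(1)] by auto
      show "carrier X \<subseteq> g ` L"
      proof
        fix x assume x: "x \<in> carrier X"
        obtain p where p: "p \<in> L" "(x, \<zero>\<^bsub>?FX\<^esub>) \<ominus>\<^bsub>?TX\<^esub> (g p, \<zero>\<^bsub>?FX\<^esub>) \<in> ?MY"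
          using ex[OF T_inclusion(5)[OF X x]] by blast
        then have pc: "p \<in> carrier P" using l by blast
        have "x \<ominus>\<^bsub>X\<^esub> g p = \<zero>\<^bsub>X\<^esub>" using sub[OF p(2)] minus[OF x FX.M.zero_closed pc] by simp
        then have "x = g p" using X.diff_zero_iff[OF x linD(1)[OF e(1) pc]] by simp
        then show "x \<in> g ` L" using p(1) by simp
      qed
    qed
    then show "L = carrier P" using e(3)[OF L] by simp
  qed
qed

text \<open>\<open>M\<close> acts on \<open>Z X\<close> as zero, so there \<open>MY\<close> is zero
  and the criterion asks for \<open>g\<close> itself to be essential.\<close>

lemma essential_epi_Z:
  assumes P: "left_module A P" and X: "left_module A X" and g: "essential_epi A P g X"
  shows "essential_epi \<Lambda> (T_functor A M P) (\<lambda>(p, w). g p) (Z_functor A M X)"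
proof -
  let ?ZX = "Z_functor A M X"
  let ?R = "restrict_scalars M ?ZX"
  let ?MY = "span A ?R {m_act ?ZX m y | m y. m \<in> carrier M \<and> y \<in> carrier ?ZX}"
  interpret X: left_module A X by (rule X)
  interpret P: left_module A P by (rule P)
  interpret ZX: left_module \<Lambda> ?ZX by (rule left_module_Z[OF X])
  interpret R: left_module A ?R by (rule left_module_restrict_scalars[OF ZX.left_module_axioms])
  note e = essential_epiD[OF g] and g' = linD[OF essential_epiD(1)[OF g]]
  have "?MY \<subseteq> {\<zero>\<^bsub>?R\<^esub>}"
    by (rule R.span_minimal[OF R.submodule_zero]) (auto simp: Z_simps[OF X] Z_smult[OF X])
  then have MY: "?MY = {\<zero>\<^bsub>X\<^esub>}" using R.submoduleD(2)[OF R.submodule_span] X by force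
  have h: "lin \<Lambda> (T_functor A M P) ?ZX (\<lambda>(p, w). g p)"
    by (rule linI) (use g' X P in auto)
  have minus: "x \<ominus>\<^bsub>?ZX\<^esub> y = x \<ominus>\<^bsub>X\<^esub> y" for x y
    by (simp add: a_minus_def a_inv_def m_inv_def Z_simps[OF X])
  show ?thesis
  proof (rule T_essential_epi[OF ZX.left_module_axioms P h, where u = g])
    { fix y assume "y \<in> carrier ?ZX"
      then have y: "y \<in> carrier X" using X by simp
      then have "y \<in> g ` carrier P" using e(2) by simp
      then obtain p where "p \<in> carrier P" "y = g p" by auto
      then show "\<exists>p\<in>carrier P. y \<ominus>\<^bsub>?ZX\<^esub> g p \<in> ?MY" using y
        unfolding MY minus by (intro bexI[of _ p]) (auto simp: X.diff_zero_iff) }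
    fix L assume L: "submodule L A P"
      and ex: "\<And>y. y \<in> carrier ?ZX \<Longrightarrow> \<exists>p\<in>L. y \<ominus>\<^bsub>?ZX\<^esub> g p \<in> ?MY"
    note l = P.submoduleD(1)[OF L]
    have "x \<in> g ` L" if x: "x \<in> carrier X" for x
    proof -
      have "x \<in> carrier ?ZX" using x X by simp
      then obtain p where p: "p \<in> L" "x \<ominus>\<^bsub>X\<^esub> g p = \<zero>\<^bsub>X\<^esub>" using ex unfolding MY minus by blast
      then show ?thesis using X.diff_zero_iff[OF x, of "g p"] g'(1) l by auto
    qed
    then have "g ` L = carrier X" using l g'(1) by auto
    then show "L = carrier P" using e(3)[OF L] by simp
  qed simp
qed

text \<open>
  The kernels of \<open>TP \<rightarrow> TX\<close> and of \<open>TP \<rightarrow> ZX\<close> have the form \<open>Y = N \<oplus> C\<close> with \<open>N = ker g\<close> and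
  \<open>M \<cdot> Y = U\<close>, the image of \<open>M \<otimes> N\<close> in \<open>M \<otimes> P\<close>.
\<close>

lemma kernel_essential_epi:
  fixes P :: "('a, 'p, 'f) module_scheme" and R :: "('a, 'r, 'g) module_scheme"
  defines "S \<equiv> \<lambda>N. {pure_tensor A M P m p | m p. m \<in> carrier M \<and> p \<in> N}"
  defines "U \<equiv> \<lambda>N. span A (tensor A M P) (S N)"
  assumes P: "left_module A P" and R: "left_module A R"
    and N: "submodule N A P" and C: "submodule C A (tensor A M P)" and NC: "S N \<subseteq> C"
    and Y: "submodule (N \<times> C) \<Lambda> (T_functor A M P)"
    and u1: "lin A R P u1" "\<And>r. r \<in> carrier R \<Longrightarrow> u1 r \<in> N"
    and u2: "lin A R (tensor A M P) u2" "\<And>r. r \<in> carrier R \<Longrightarrow> u2 r \<in> C"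
    and surj: "\<And>p w. p \<in> N \<Longrightarrow> w \<in> C \<Longrightarrow>
      \<exists>r\<in>carrier R. u1 r = p \<and> w \<ominus>\<^bsub>tensor A M P\<^esub> u2 r \<in> U N"
    and ess: "\<And>L. submodule L A R \<Longrightarrow> (\<And>p w. p \<in> N \<Longrightarrow> w \<in> C \<Longrightarrow>
      \<exists>r\<in>L. u1 r = p \<and> w \<ominus>\<^bsub>tensor A M P\<^esub> u2 r \<in> U N) \<Longrightarrow> L = carrier R"
  shows "\<exists>h. essential_epi \<Lambda> (T_functor A M R) h ((T_functor A M P)\<lparr>carrier := N \<times> C\<rparr>) \<and>
    (\<forall>r\<in>carrier R. h (r, \<zero>\<^bsub>tensor A M R\<^esub>) = (u1 r, u2 r))"
proof -
  let ?FP = "tensor A M P" and ?TP = "T_functor A M P"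
  let ?Y = "?TP\<lparr>carrier := N \<times> C\<rparr>"
  let ?R = "restrict_scalars M ?Y"
  let ?MY = "span A ?R {m_act ?Y m y | m y. m \<in> carrier M \<and> y \<in> carrier ?Y}"
  interpret P: left_module A P by (rule P)
  interpret R: left_module A R by (rule R)
  interpret FP: left_module A ?FP by (rule left_module_tensor[OF P])
  interpret TP: left_module \<Lambda> ?TP by (rule left_module_T[OF P])
  interpret Y: left_module \<Lambda> ?Y by (rule TP.left_module_submodule[OF Y])
  interpret RY: left_module A ?R by (rule left_module_restrict_scalars[OF Y.left_module_axioms])
  note n = P.submoduleD[OF N] and c = FP.submoduleD[OF C]
  have SN: "S N \<subseteq> carrier ?FP" using NC c(1) by blast
  have "submodule (U N) A ?FP" unfolding U_def by (rule FP.submodule_span)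
  note u = FP.submoduleD[OF this]
  have UC: "U N \<subseteq> C" unfolding U_def using FP.span_minimal[OF C NC] .
  have NP: "p \<in> carrier P" if "p \<in> N" for p using that n(1) by blast
  have CP: "w \<in> carrier ?FP" if "w \<in> C" for w using that c(1) by blast
  have sm: "(a, \<zero>\<^bsub>M\<^esub>) \<odot>\<^bsub>?TP\<^esub> (p, w) = (a \<odot>\<^bsub>P\<^esub> p, a \<odot>\<^bsub>?FP\<^esub> w)"
    if "a \<in> carrier A" "p \<in> N" "w \<in> C" for a p w
    using that NP CP pure_tensor_zero[OF P] P by simp
  have add: "(p, w) \<oplus>\<^bsub>?TP\<^esub> (p', w') = (p \<oplus>\<^bsub>P\<^esub> p', w \<oplus>\<^bsub>?FP\<^esub> w')" for p w p' w' by (rule T_simps(3)[OF P])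
  note zero = T_simps(2)[OF P]
  have act: "m_act ?TP m (p, w) = (\<zero>\<^bsub>P\<^esub>, pure_tensor A M P m p)" if "m \<in> carrier M" "p \<in> N" "w \<in> C" for m p w
    using T_inclusion(3)[OF P] that NP CP by blast
  have pC: "pure_tensor A M P m p \<in> C" if "m \<in> carrier M" "p \<in> N" for m p
    using NC that by (auto simp: S_def)
  have gens: "{m_act ?Y m y | m y. m \<in> carrier M \<and> y \<in> carrier ?Y} \<subseteq> carrier ?R"
    using n(2) pC by (auto simp: act)
  have pU: "pure_tensor A M P m p \<in> U N" if "m \<in> carrier M" "p \<in> N" for m p
  proof -
    have "pure_tensor A M P m p \<in> S N" using that by (auto simp: S_def)
    then show ?thesis using FP.span_superset[OF SN] unfolding U_def by blast
  qed
  have my: "submodule ?MY A ?R" by (rule RY.submodule_span)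
  note my' = RY.submoduleD[OF my]
  \<comment> \<open>Together with \<open>MY2\<close> this identifies \<open>M\<close> times the
    kernel with \<open>U N\<close> in the second component: \<open>M\<close> kills that component
    and sends the first one to pure tensors.\<close>
  have MY1: "?MY \<subseteq> {\<zero>\<^bsub>P\<^esub>} \<times> U N"
  proof (rule RY.span_minimal)
    show "submodule ({\<zero>\<^bsub>P\<^esub>} \<times> U N) A ?R"
      by (rule RY.submoduleI) (use n(2) u UC in \<open>auto simp: zero add sm subset_eq\<close>)
    show "{m_act ?Y m y | m y. m \<in> carrier M \<and> y \<in> carrier ?Y} \<subseteq> {\<zero>\<^bsub>P\<^esub>} \<times> U N"
      using pU by (auto simp: act)
  qed
  have MY2: "(\<zero>\<^bsub>P\<^esub>, w) \<in> ?MY" if "w \<in> U N" for w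
  proof -
    have "U N \<subseteq> {w \<in> C. (\<zero>\<^bsub>P\<^esub>, w) \<in> ?MY}" unfolding U_def
    proof (rule FP.span_minimal)
      show "submodule {w \<in> C. (\<zero>\<^bsub>P\<^esub>, w) \<in> ?MY} A ?FP"
      proof (rule FP.submoduleI)
        show "v \<oplus>\<^bsub>?FP\<^esub> w \<in> {w \<in> C. (\<zero>\<^bsub>P\<^esub>, w) \<in> ?MY}"
          if "v \<in> {w \<in> C. (\<zero>\<^bsub>P\<^esub>, w) \<in> ?MY}" "w \<in> {w \<in> C. (\<zero>\<^bsub>P\<^esub>, w) \<in> ?MY}" for v w
          using that my'(3)[of "(\<zero>\<^bsub>P\<^esub>, v)" "(\<zero>\<^bsub>P\<^esub>, w)"] c(3) by (simp add: add)
        show "a \<odot>\<^bsub>?FP\<^esub> w \<in> {w \<in> C. (\<zero>\<^bsub>P\<^esub>, w) \<in> ?MY}"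
          if "a \<in> carrier A" "w \<in> {w \<in> C. (\<zero>\<^bsub>P\<^esub>, w) \<in> ?MY}" for a w
          using that my'(4)[of a "(\<zero>\<^bsub>P\<^esub>, w)"] c(4) n(2) by (simp add: sm)
      qed (use c(1,2) my'(2) in \<open>auto simp: zero\<close>)
      show "S N \<subseteq> {w \<in> C. (\<zero>\<^bsub>P\<^esub>, w) \<in> ?MY}"
      proof
        fix w assume w: "w \<in> S N"
        then obtain m p where mp: "w = pure_tensor A M P m p" "m \<in> carrier M" "p \<in> N" by (auto simp: S_def)
        have "m_act ?Y m (p, \<zero>\<^bsub>?FP\<^esub>) \<in> ?MY"
          by (rule subsetD[OF RY.span_superset[OF gens]], rule CollectI,
              intro exI[of _ m] exI[of _ "(p, \<zero>\<^bsub>?FP\<^esub>)"] conjI refl) (use mp c(2) in auto)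
        then show "w \<in> {w \<in> C. (\<zero>\<^bsub>P\<^esub>, w) \<in> ?MY}" using mp act[OF mp(2,3) c(2)] w NC by auto
      qed
    qed
    then show ?thesis using that by blast
  qed
  have minus: "(p, w) \<ominus>\<^bsub>?Y\<^esub> (p', w') = (p \<ominus>\<^bsub>P\<^esub> p', w \<ominus>\<^bsub>?FP\<^esub> w')"
    if "p \<in> N" "w \<in> C" "p' \<in> N" "w' \<in> C" for p w p' w'
  proof -
    have "(p, w) = (p \<ominus>\<^bsub>P\<^esub> p', w \<ominus>\<^bsub>?FP\<^esub> w') \<oplus>\<^bsub>?Y\<^esub> (p', w')"
      using that NP CP by (simp add: add P.M.diff_add_cancel FP.M.diff_add_cancel)
    then show ?thesis
      using Y.M.diff_add_cancel(3)[of "(p \<ominus>\<^bsub>P\<^esub> p', w \<ominus>\<^bsub>?FP\<^esub> w')" "(p', w')"] that n(6) c(6) by simp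
  qed
  \<comment> \<open>Congruence modulo \<open>MY\<close> is equality in the first component and
    congruence modulo \<open>U N\<close> in the second, which is the form of the hypotheses
    \<open>surj\<close> and \<open>ess\<close>.\<close>
  have MY: "(p, w) \<ominus>\<^bsub>?Y\<^esub> (u1 r, u2 r) \<in> ?MY \<longleftrightarrow> u1 r = p \<and> w \<ominus>\<^bsub>?FP\<^esub> u2 r \<in> U N"
    if "p \<in> N" "w \<in> C" "r \<in> carrier R" for p w r
  proof -
    have "p \<ominus>\<^bsub>P\<^esub> u1 r = \<zero>\<^bsub>P\<^esub> \<longleftrightarrow> u1 r = p"
      using P.diff_zero_iff NP[OF that(1)] NP[OF u1(2)[OF that(3)]] by auto
    then show ?thesis using minus[OF that(1,2) u1(2)[OF that(3)] u2(2)[OF that(3)]] MY1 MY2 by auto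
  qed
  have "lin A R ?R (\<lambda>r. (u1 r, u2 r))"
    using linD[OF u1(1)] linD[OF u2(1)] u1(2) u2(2) by (intro linI) (auto simp: add sm)
  then obtain h where h: "lin \<Lambda> (T_functor A M R) ?Y h" "\<forall>r\<in>carrier R. h (r, \<zero>\<^bsub>tensor A M R\<^esub>) = (u1 r, u2 r)"
    using T_extend[OF Y.left_module_axioms R] by blast
  have "essential_epi \<Lambda> (T_functor A M R) h ?Y"
  proof (rule T_essential_epi[OF Y.left_module_axioms R h(1), where u = "\<lambda>r. (u1 r, u2 r)"])
    show "h (r, \<zero>\<^bsub>tensor A M R\<^esub>) = (u1 r, u2 r)" if "r \<in> carrier R" for r using h(2) that by blast
    show "\<exists>r\<in>carrier R. y \<ominus>\<^bsub>?Y\<^esub> (u1 r, u2 r) \<in> ?MY" if y: "y \<in> carrier ?Y" for y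
    proof -
      obtain p w where pw: "y = (p, w)" "p \<in> N" "w \<in> C" using y by auto
      then show ?thesis using surj[OF pw(2,3)] MY[OF pw(2,3)] by blast
    qed
    fix L assume L: "submodule L A R" and ex: "\<And>y. y \<in> carrier ?Y \<Longrightarrow> \<exists>r\<in>L. y \<ominus>\<^bsub>?Y\<^esub> (u1 r, u2 r) \<in> ?MY"
    show "L = carrier R"
    proof (rule ess[OF L])
      fix p w assume pw: "p \<in> N" "w \<in> C"
      then have "(p, w) \<in> carrier ?Y" by simp
      then obtain r where r: "r \<in> L" "(p, w) \<ominus>\<^bsub>?Y\<^esub> (u1 r, u2 r) \<in> ?MY" using ex by blast
      then have "r \<in> carrier R" using R.submoduleD(1)[OF L] by blast
      then show "\<exists>r\<in>L. u1 r = p \<and> w \<ominus>\<^bsub>?FP\<^esub> u2 r \<in> U N" using MY[OF pw] r by blast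
    qed
  qed
  then show ?thesis using h(2) by blast
qed

text \<open>The kernel of \<open>T P0\<close> to \<open>T X\<close> has as second component the
  kernel of \<open>Fg\<close>. Right exactness identifies it with \<open>U\<close>, so modulo
  \<open>M\<close> only the kernel of \<open>g\<close> remains and \<open>P1\<close> covers it; the
  map to the second component can be taken to be zero.\<close>

lemma min_pres_T:
  assumes X: "left_module A X" and p: "min_pres A P1 f P0 g X"
  shows "\<exists>f' g'. min_pres \<Lambda> (T_functor A M P1) f' (T_functor A M P0) g' (T_functor A M X) \<and>
    (\<forall>r\<in>carrier P1. f' (r, \<zero>\<^bsub>tensor A M P1\<^esub>) = (f r, \<zero>\<^bsub>tensor A M P0\<^esub>))"
proof -
  have proj: "fg_projective A P0" "fg_projective A P1" and g: "essential_epi A P0 g X"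
    and f: "essential_epi A P1 f (P0\<lparr>carrier := {x \<in> carrier P0. g x = \<zero>\<^bsub>X\<^esub>}\<rparr>)"
    using p by (simp_all add: min_pres_def)
  note P0 = fg_projective_left_module[OF proj(1)] and P1 = fg_projective_left_module[OF proj(2)]
  let ?FX = "tensor A M X" and ?FP = "tensor A M P0" and ?TP = "T_functor A M P0" and ?TX = "T_functor A M X"
  interpret P0: left_module A P0 by (rule P0)
  interpret P1: left_module A P1 by (rule P1)
  interpret FP: left_module A ?FP by (rule left_module_tensor[OF P0])
  interpret FX: left_module A ?FX by (rule left_module_tensor[OF X])
  note e = essential_epiD[OF g] and e1 = essential_epiD[OF f]
  obtain Fg where Fg: "lin A ?FP ?FX Fg"
    "\<And>m p. m \<in> carrier M \<Longrightarrow> p \<in> carrier P0 \<Longrightarrow> Fg (pure_tensor A M P0 m p) = pure_tensor A M X m (g p)"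
    and g': "lin \<Lambda> ?TP ?TX (\<lambda>(p, w). (g p, Fg w))"
    using T_map[OF P0 X e(1)] by metis
  let ?g = "\<lambda>(p, w). (g p, Fg w)"
  let ?N = "{x \<in> carrier P0. g x = \<zero>\<^bsub>X\<^esub>}" and ?C = "{w \<in> carrier ?FP. Fg w = \<zero>\<^bsub>?FX\<^esub>}"
  have ker: "{z \<in> carrier ?TP. ?g z = \<zero>\<^bsub>?TX\<^esub>} = ?N \<times> ?C" using X P0 by auto
  have f1: "lin A P1 P0 f" "\<And>r. r \<in> carrier P1 \<Longrightarrow> f r \<in> ?N" using e1(1) by (auto simp: lin_def)
  have ker_span: "w \<in> span A ?FP {pure_tensor A M P0 m p | m p. m \<in> carrier M \<and> p \<in> ?N}" if "w \<in> ?C" for w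
    using tensor_kernel[OF P0 X e(1,2) Fg, of w] that by simp
  have "\<exists>h. essential_epi \<Lambda> (T_functor A M P1) h (?TP\<lparr>carrier := ?N \<times> ?C\<rparr>) \<and>
    (\<forall>r\<in>carrier P1. h (r, \<zero>\<^bsub>tensor A M P1\<^esub>) = (f r, \<zero>\<^bsub>?FP\<^esub>))"
  proof (rule kernel_essential_epi[OF P0 P1])
    show "submodule ?N A P0" by (rule submodule_kernel[OF P0 X e(1)])
    show "submodule ?C A ?FP" by (rule submodule_kernel[OF FP.left_module_axioms FX.left_module_axioms Fg(1)])
    show "{pure_tensor A M P0 m p | m p. m \<in> carrier M \<and> p \<in> ?N} \<subseteq> ?C"
      using Fg(2) pure_tensor_zero[OF X] pure_tensor_closed[OF P0] by auto
    show "submodule (?N \<times> ?C) \<Lambda> ?TP"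
      using submodule_kernel[OF left_module_T[OF P0] left_module_T[OF X] g'] ker by simp
    show "lin A P1 ?FP (\<lambda>_. \<zero>\<^bsub>?FP\<^esub>)" by (rule linI) auto
    show "\<zero>\<^bsub>?FP\<^esub> \<in> ?C" using lin_zero[OF FP.left_module_axioms FX.left_module_axioms Fg(1)] by simp
    { fix p w assume "p \<in> ?N" and w: "w \<in> ?C"
      then have "p \<in> f ` carrier P1" using e1(2) by simp
      then obtain r where "r \<in> carrier P1" "f r = p" by auto
      then show "\<exists>r\<in>carrier P1. f r = p \<and> w \<ominus>\<^bsub>?FP\<^esub> \<zero>\<^bsub>?FP\<^esub> \<in>
          span A ?FP {pure_tensor A M P0 m p | m p. m \<in> carrier M \<and> p \<in> ?N}"
        using ker_span[OF w] w by auto }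
    fix L assume L: "submodule L A P1" and ex: "\<And>p w. p \<in> ?N \<Longrightarrow> w \<in> ?C \<Longrightarrow>
      \<exists>r\<in>L. f r = p \<and> w \<ominus>\<^bsub>?FP\<^esub> \<zero>\<^bsub>?FP\<^esub> \<in> span A ?FP {pure_tensor A M P0 m p | m p. m \<in> carrier M \<and> p \<in> ?N}"
    have z: "\<zero>\<^bsub>?FP\<^esub> \<in> ?C" using lin_zero[OF FP.left_module_axioms FX.left_module_axioms Fg(1)] by simp
    have "f ` L = ?N" using ex[OF _ z] f1(2) P1.submoduleD(1)[OF L] by (auto simp: image_iff; blast)
    then show "L = carrier P1" using e1(3)[OF L] by simp
  qed (use f1 in auto)
  then obtain f' where f': "essential_epi \<Lambda> (T_functor A M P1) f' (?TP\<lparr>carrier := ?N \<times> ?C\<rparr>)"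
    "\<forall>r\<in>carrier P1. f' (r, \<zero>\<^bsub>tensor A M P1\<^esub>) = (f r, \<zero>\<^bsub>?FP\<^esub>)" by blast
  have "min_pres \<Lambda> (T_functor A M P1) f' ?TP ?g ?TX"
    unfolding min_pres_def ker fg_projective_T_iff[OF P0] fg_projective_T_iff[OF P1]
    using proj f'(1) essential_epi_T[OF P0 X g g' Fg(1)] by simp
  then show ?thesis using f'(2) by blast
qed

text \<open>A sum of two covers is essential. The members of \<open>L\<close> whose second
  coordinate is killed by \<open>\<pi>\<close> have first coordinates that \<open>f\<close> maps
  onto \<open>N\<close>, so these fill \<open>P\<close>. Subtracting such members leaves elements of
  \<open>L\<close> in \<open>Q\<close> that \<open>\<pi>\<close> maps onto \<open>N'\<close>, so
  \<open>L\<close> contains \<open>Q\<close> as well.\<close>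

lemma essential_epi_dsum:
  assumes P: "left_module A P" and Q: "left_module A Q"
    and f: "essential_epi A P f N" and \<pi>: "essential_epi A Q \<pi> N'"
    and N: "left_module A N" and N': "left_module A N'"
    and L: "submodule L A (dsum_module P Q)"
    and ex: "\<And>x y. x \<in> carrier N \<Longrightarrow> y \<in> carrier N' \<Longrightarrow> \<exists>r\<in>L. f (fst r) = x \<and> \<pi> (snd r) = y"
  shows "L = carrier (dsum_module P Q)"
proof -
  interpret P: left_module A P by (rule P)
  interpret Q: left_module A Q by (rule Q)
  interpret N: left_module A N by (rule N)
  interpret N': left_module A N' by (rule N')
  interpret D: left_module A "dsum_module P Q" by (rule left_module_dsum[OF P Q])
  note l = D.submoduleD[OF L] and e = essential_epiD[OF f] and e' = essential_epiD[OF \<pi>]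
  note f' = linD[OF e(1)] and p' = linD[OF e'(1)]
  have lc: "fst r \<in> carrier P" "snd r \<in> carrier Q" if "r \<in> L" for r using l(1) that by auto
  have minus: "r \<ominus>\<^bsub>dsum_module P Q\<^esub> s = (fst r \<ominus>\<^bsub>P\<^esub> fst s, snd r \<ominus>\<^bsub>Q\<^esub> snd s)" if "r \<in> L" "s \<in> L" for r s
    using dsum_minus[OF P Q lc[OF that(1)] lc[OF that(2)]] by simp
  let ?L1 = "fst ` (L \<inter> {r \<in> carrier (dsum_module P Q). \<pi> (snd r) = \<zero>\<^bsub>N'\<^esub>})"
  have fst_lin: "lin A (dsum_module P Q) P fst" and snd_lin: "lin A (dsum_module P Q) Q snd"
    by (auto intro!: linI)
  have "submodule ?L1 A P"
    by (intro submodule_image[OF D.left_module_axioms P fst_lin] D.submodule_Int[OF L]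
        submodule_kernel[OF D.left_module_axioms N' lin_comp[OF snd_lin e'(1)]])
  moreover have "f ` ?L1 = carrier N"
  proof
    show "f ` ?L1 \<subseteq> carrier N" using f'(1) by auto
    show "carrier N \<subseteq> f ` ?L1"
    proof
      fix x assume "x \<in> carrier N"
      then obtain r where "r \<in> L" "f (fst r) = x" "\<pi> (snd r) = \<zero>\<^bsub>N'\<^esub>" using ex by blast
      then show "x \<in> f ` ?L1" using l(1) by (intro image_eqI[of _ f "fst r"] imageI) auto
    qed
  qed
  ultimately have L1: "?L1 = carrier P" by (rule e(3))
  have L1E: "\<exists>r\<in>L. fst r = p \<and> \<pi> (snd r) = \<zero>\<^bsub>N'\<^esub>" if "p \<in> carrier P" for p
  proof -
    have "p \<in> ?L1" using L1 that by simp
    then show ?thesis by auto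
  qed
  let ?L2 = "{q \<in> carrier Q. (\<zero>\<^bsub>P\<^esub>, q) \<in> L}"
  have "lin A Q (dsum_module P Q) (\<lambda>q. (\<zero>\<^bsub>P\<^esub>, q))" by (rule linI) auto
  then have "submodule ?L2 A Q" by (rule submodule_vimage[OF Q D.left_module_axioms _ L])
  moreover have "\<pi> ` ?L2 = carrier N'"
  proof
    show "\<pi> ` ?L2 \<subseteq> carrier N'" using p'(1) by auto
    show "carrier N' \<subseteq> \<pi> ` ?L2"
    proof
      fix y assume y: "y \<in> carrier N'"
      obtain r where r: "r \<in> L" "\<pi> (snd r) = y" using ex[OF N.M.zero_closed y] by blast
      \<comment> \<open>\<open>s\<close> cancels the first coordinate of \<open>r\<close> without
        changing the image of the second under \<open>\<pi>\<close>.\<close>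
      obtain s where s: "s \<in> L" "fst s = fst r" "\<pi> (snd s) = \<zero>\<^bsub>N'\<^esub>" using L1E[OF lc(1)[OF r(1)]] by blast
      have "r \<ominus>\<^bsub>dsum_module P Q\<^esub> s = (\<zero>\<^bsub>P\<^esub>, snd r \<ominus>\<^bsub>Q\<^esub> snd s)"
        using minus[OF r(1) s(1)] s(2) lc[OF r(1)] by (simp add: P.diff_zero_iff)
      then have "(\<zero>\<^bsub>P\<^esub>, snd r \<ominus>\<^bsub>Q\<^esub> snd s) \<in> L" using l(6)[OF r(1) s(1)] by simp
      moreover have "\<pi> (snd r \<ominus>\<^bsub>Q\<^esub> snd s) = y"
        using lin_diff[OF Q N' e'(1) lc(2)[OF r(1)] lc(2)[OF s(1)]] r(2) s(3) y by simp
      ultimately show "y \<in> \<pi> ` ?L2" using lc[OF r(1)] lc[OF s(1)] by (intro image_eqI[of _ \<pi> "snd r \<ominus>\<^bsub>Q\<^esub> snd s"]) auto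
    qed
  qed
  ultimately have L2: "?L2 = carrier Q" by (rule e'(3))
  have "(p, q) \<in> L" if p: "p \<in> carrier P" and q: "q \<in> carrier Q" for p q
  proof -
    obtain r where r: "r \<in> L" "fst r = p" using L1E[OF p] by blast
    have "q \<ominus>\<^bsub>Q\<^esub> snd r \<in> ?L2" using L2 q lc[OF r(1)] by simp
    then have "r \<oplus>\<^bsub>dsum_module P Q\<^esub> (\<zero>\<^bsub>P\<^esub>, q \<ominus>\<^bsub>Q\<^esub> snd r) \<in> L" using l(3) r(1) by blast
    moreover have "r \<oplus>\<^bsub>dsum_module P Q\<^esub> (\<zero>\<^bsub>P\<^esub>, q \<ominus>\<^bsub>Q\<^esub> snd r) = (p, q)"
      using r(2) lc[OF r(1)] p q by (cases r) (simp add: Q.M.diff_add_cancel)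
    ultimately show ?thesis by simp
  qed
  then show ?thesis using l(1) by auto
qed

text \<open>Here the kernel is the kernel of \<open>g\<close> times the whole of
  \<open>M \<otimes> P0\<close>. Modulo \<open>U\<close> the second factor is
  \<open>M \<otimes> X\<close> by right exactness, so the cover acquires the additional summand
  \<open>Q\<close>.\<close>

lemma min_pres_Z:
  assumes X: "left_module A X" and p: "min_pres A P1 f P0 g X"
    and Q: "fg_projective A Q" and \<pi>: "essential_epi A Q \<pi> (tensor A M X)"
  shows "\<exists>f' g'. min_pres \<Lambda> (T_functor A M (dsum_module P1 Q)) f' (T_functor A M P0) g' (Z_functor A M X) \<and>
    (\<forall>r\<in>carrier P1. \<forall>q\<in>carrier Q. \<exists>w\<in>carrier (tensor A M P0).
      f' ((r, q), \<zero>\<^bsub>tensor A M (dsum_module P1 Q)\<^esub>) = (f r, w))"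
proof -
  have proj: "fg_projective A P0" "fg_projective A P1" and g: "essential_epi A P0 g X"
    and f: "essential_epi A P1 f (P0\<lparr>carrier := {x \<in> carrier P0. g x = \<zero>\<^bsub>X\<^esub>}\<rparr>)"
    using p by (simp_all add: min_pres_def)
  note P0 = fg_projective_left_module[OF proj(1)] and P1 = fg_projective_left_module[OF proj(2)]
    and Qm = fg_projective_left_module[OF Q]
  let ?FX = "tensor A M X" and ?FP = "tensor A M P0" and ?TP = "T_functor A M P0" and ?ZX = "Z_functor A M X"
  let ?D = "dsum_module P1 Q"
  interpret P0: left_module A P0 by (rule P0)
  interpret P1: left_module A P1 by (rule P1)
  interpret Q: left_module A Q by (rule Qm)
  interpret FP: left_module A ?FP by (rule left_module_tensor[OF P0])
  interpret FX: left_module A ?FX by (rule left_module_tensor[OF X])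
  note D = left_module_dsum[OF P1 Qm]
  interpret D: left_module A ?D by (rule D)
  note e = essential_epiD[OF g] and e1 = essential_epiD[OF f] and e2 = essential_epiD[OF \<pi>]
  obtain Fg where Fg: "lin A ?FP ?FX Fg"
    "\<And>m p. m \<in> carrier M \<Longrightarrow> p \<in> carrier P0 \<Longrightarrow> Fg (pure_tensor A M P0 m p) = pure_tensor A M X m (g p)"
    using T_map[OF P0 X e(1)] by metis
  have Fs: "Fg ` carrier ?FP = carrier ?FX" using T_map_surj[OF P0 X e(2) Fg] .
  have "\<pi> q \<in> Fg ` carrier ?FP" if "q \<in> carrier Q" for q using Fs linD(1)[OF e2(1) that] by simp
  \<comment> \<open>A lift of \<open>\<pi>\<close> along the surjection \<open>Fg\<close> gives
    \<open>Q\<close> a map into the actual second component of the kernel.\<close>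
  then obtain \<sigma> where \<sigma>: "lin A Q ?FP \<sigma>" "\<And>q. q \<in> carrier Q \<Longrightarrow> Fg (\<sigma> q) = \<pi> q"
    using projective_lift[OF Q FP.left_module_axioms FX.left_module_axioms e2(1) Fg(1)] by metis
  let ?g = "\<lambda>(p, w). g p"
  let ?N = "{x \<in> carrier P0. g x = \<zero>\<^bsub>X\<^esub>}"
  let ?U = "span A ?FP {pure_tensor A M P0 m p | m p. m \<in> carrier M \<and> p \<in> ?N}"
  have ker: "{z \<in> carrier ?TP. ?g z = \<zero>\<^bsub>?ZX\<^esub>} = ?N \<times> carrier ?FP" using X P0 by auto
  have f1: "lin A P1 P0 f" "\<And>r. r \<in> carrier P1 \<Longrightarrow> f r \<in> ?N" using e1(1) by (auto simp: lin_def)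
  have Nsub: "submodule ?N A P0" by (rule submodule_kernel[OF P0 X e(1)])
  have NX: "left_module A (P0\<lparr>carrier := ?N\<rparr>)" by (rule P0.left_module_submodule[OF Nsub])
  have U1: "?U \<subseteq> {w \<in> carrier ?FP. Fg w = \<zero>\<^bsub>?FX\<^esub>}"
    by (rule FP.span_minimal[OF submodule_kernel[OF FP.left_module_axioms FX.left_module_axioms Fg(1)]])
      (use Fg(2) pure_tensor_zero[OF X] pure_tensor_closed[OF P0] in auto)
  \<comment> \<open>The kernel of \<open>Fg\<close> is \<open>U\<close>, so congruence modulo
    \<open>U\<close> in \<open>M \<otimes> P0\<close> can be tested in
    \<open>M \<otimes> X\<close>.\<close>
  have U: "w \<ominus>\<^bsub>?FP\<^esub> \<sigma> q \<in> ?U \<longleftrightarrow> \<pi> q = Fg w" if "w \<in> carrier ?FP" "q \<in> carrier Q" for w q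
  proof -
    note \<sigma>q = linD(1)[OF \<sigma>(1) that(2)]
    have "Fg (w \<ominus>\<^bsub>?FP\<^esub> \<sigma> q) = Fg w \<ominus>\<^bsub>?FX\<^esub> \<pi> q"
      using lin_diff[OF FP.left_module_axioms FX.left_module_axioms Fg(1) that(1) \<sigma>q] \<sigma>(2)[OF that(2)] by simp
    then have "Fg (w \<ominus>\<^bsub>?FP\<^esub> \<sigma> q) = \<zero>\<^bsub>?FX\<^esub> \<longleftrightarrow> \<pi> q = Fg w"
      using FX.diff_zero_iff[OF linD(1)[OF Fg(1) that(1)] linD(1)[OF e2(1) that(2)]] by auto
    moreover have "w \<ominus>\<^bsub>?FP\<^esub> \<sigma> q \<in> ?U" if "Fg (w \<ominus>\<^bsub>?FP\<^esub> \<sigma> q) = \<zero>\<^bsub>?FX\<^esub>"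
      using tensor_kernel[OF P0 X e(1,2) Fg FP.M.minus_closed that] \<open>w \<in> carrier ?FP\<close> \<sigma>q by simp
    ultimately show ?thesis using U1 by blast
  qed
  let ?u1 = "\<lambda>r. f (fst r)" and ?u2 = "\<lambda>r. \<sigma> (snd r)"
  have fst_lin: "lin A ?D P1 fst" and snd_lin: "lin A ?D Q snd" by (auto intro!: linI)
  have "\<exists>h. essential_epi \<Lambda> (T_functor A M ?D) h (?TP\<lparr>carrier := ?N \<times> carrier ?FP\<rparr>) \<and>
    (\<forall>r\<in>carrier ?D. h (r, \<zero>\<^bsub>tensor A M ?D\<^esub>) = (?u1 r, ?u2 r))"
  proof (rule kernel_essential_epi[OF P0 D Nsub FP.submodule_carrier])
    show "{pure_tensor A M P0 m p | m p. m \<in> carrier M \<and> p \<in> ?N} \<subseteq> carrier ?FP"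
      using pure_tensor_closed[OF P0] by auto
    show "submodule (?N \<times> carrier ?FP) \<Lambda> ?TP"
      using submodule_kernel[OF left_module_T[OF P0] left_module_Z[OF X] essential_epiD(1)[OF essential_epi_Z[OF P0 X g]]] ker
      by simp
    show "lin A ?D P0 ?u1" by (rule lin_comp[OF fst_lin f1(1)])
    show "lin A ?D ?FP ?u2" by (rule lin_comp[OF snd_lin \<sigma>(1)])
    show "?u1 r \<in> ?N" if "r \<in> carrier ?D" for r using that f1(2) by auto
    show "?u2 r \<in> carrier ?FP" if "r \<in> carrier ?D" for r using that linD(1)[OF \<sigma>(1)] by auto
    { fix p w assume "p \<in> ?N" and w: "w \<in> carrier ?FP"
      then have "p \<in> f ` carrier P1" using e1(2) by simp
      then obtain r where r: "r \<in> carrier P1" "f r = p" by auto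
      have "Fg w \<in> \<pi> ` carrier Q" using e2(2) linD(1)[OF Fg(1) w] by simp
      then obtain q where q: "q \<in> carrier Q" "\<pi> q = Fg w" by auto
      show "\<exists>r\<in>carrier ?D. ?u1 r = p \<and> w \<ominus>\<^bsub>?FP\<^esub> ?u2 r \<in> ?U"
        using r q U[OF w q(1)] by (intro bexI[of _ "(r, q)"]) auto }
    fix L assume L: "submodule L A ?D"
      and ex: "\<And>p w. p \<in> ?N \<Longrightarrow> w \<in> carrier ?FP \<Longrightarrow> \<exists>r\<in>L. ?u1 r = p \<and> w \<ominus>\<^bsub>?FP\<^esub> ?u2 r \<in> ?U"
    show "L = carrier ?D"
    proof (rule essential_epi_dsum[OF P1 Qm f \<pi> NX FX.left_module_axioms L])
      fix x y assume x: "x \<in> carrier (P0\<lparr>carrier := ?N\<rparr>)" and y: "y \<in> carrier ?FX"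
      have "y \<in> Fg ` carrier ?FP" using Fs y by simp
      then obtain w where w: "w \<in> carrier ?FP" "y = Fg w" by auto
      have "x \<in> ?N" using x by simp
      then obtain r where r: "r \<in> L" "f (fst r) = x" "w \<ominus>\<^bsub>?FP\<^esub> \<sigma> (snd r) \<in> ?U" using ex[OF _ w(1)] by blast
      have "snd r \<in> carrier Q" using D.submoduleD(1)[OF L] r(1) by auto
      then show "\<exists>r\<in>L. f (fst r) = x \<and> \<pi> (snd r) = y" using r U[OF w(1)] w(2) by blast
    qed
  qed
  then obtain f' where f': "essential_epi \<Lambda> (T_functor A M ?D) f' (?TP\<lparr>carrier := ?N \<times> carrier ?FP\<rparr>)"
    "\<forall>r\<in>carrier ?D. f' (r, \<zero>\<^bsub>tensor A M ?D\<^esub>) = (?u1 r, ?u2 r)" by blast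
  have "min_pres \<Lambda> (T_functor A M ?D) f' ?TP ?g ?ZX"
    unfolding min_pres_def ker fg_projective_T_iff[OF P0] fg_projective_T_iff[OF D]
    using proj f'(1) essential_epi_Z[OF P0 X g] fg_projective_dsum[OF proj(2) Q] by simp
  moreover have "\<exists>w\<in>carrier ?FP. f' ((r, q), \<zero>\<^bsub>tensor A M ?D\<^esub>) = (f r, w)" if "r \<in> carrier P1" "q \<in> carrier Q" for r q
    using f'(2)[rule_format, of "(r, q)"] that linD(1)[OF \<sigma>(1)] by auto
  ultimately show ?thesis by blast
qed

text \<open>The criterion over the trivial extension, the adjunction, and the splitting of
  \<open>T X\<close> over \<open>A\<close> leave the two surjectivity conditions that the criterion
  over \<open>A\<close> translates back.\<close>

lemma tau_zero_T:
  assumes "fg_module A X"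
  shows "hom_zero \<Lambda> (T_functor A M X) (AR_translate K \<Lambda> (T_functor A M X)) \<longleftrightarrow>
    hom_zero A X (AR_translate K A X) \<and> hom_zero A (tensor A M X) (AR_translate K A X)"
proof -
  have X: "left_module A X" using assms by (simp add: fg_module_def)
  obtain P1 :: "('a, nat \<Rightarrow> 'a) module" and f and P0 :: "('a, nat \<Rightarrow> 'a) module" and g
    where p: "min_pres A P1 f P0 g X" by (rule min_pres_exists[OF assms])
  have P1: "left_module A P1" and P0: "left_module A P0"
    and f: "essential_epi A P1 f (P0\<lparr>carrier := {x \<in> carrier P0. g x = \<zero>\<^bsub>X\<^esub>}\<rparr>)"
    using p fg_projective_left_module by (auto simp: min_pres_def)
  obtain f' g' where p': "min_pres \<Lambda> (T_functor A M P1) f' (T_functor A M P0) g' (T_functor A M X)"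
    and f': "\<And>r. r \<in> carrier P1 \<Longrightarrow> f' (r, \<zero>\<^bsub>tensor A M P1\<^esub>) = (f r, \<zero>\<^bsub>tensor A M P0\<^esub>)"
    using min_pres_T[OF X p] by blast
  have l: "lin \<Lambda> (T_functor A M P1) (T_functor A M P0) f'"
    using p' essential_epiD(1)[of \<Lambda> "T_functor A M P1" f'] unfolding min_pres_def by (fastforce simp: lin_def)
  have fc: "f r \<in> carrier P0" if "r \<in> carrier P1" for r using linD(1)[OF essential_epiD(1)[OF f] that] by simp
  have "hom_zero \<Lambda> (T_functor A M X) (AR_translate K \<Lambda> (T_functor A M X)) \<longleftrightarrow>
      hom_surj \<Lambda> (T_functor A M P1) f' (T_functor A M P0) (T_functor A M X)"
    by (rule central_field.hom_zero_AR_translate_iff[OF central_field_trivial_extension left_module_T[OF X] p' left_module_T[OF X]])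
  also have "\<dots> \<longleftrightarrow> hom_surj A P1 f P0 (restrict_scalars M (T_functor A M X))"
    by (rule hom_surj_T_iff[OF left_module_T[OF X] P1 P0 l fc]) (simp_all add: f')
  also have "\<dots> \<longleftrightarrow> hom_surj A P1 f P0 X \<and> hom_surj A P1 f P0 (tensor A M X)"
    by (rule hom_surj_restrict_T[OF X P1 P0])
  finally show ?thesis
    using central_field.hom_zero_AR_translate_iff[OF central_field X p X]
      central_field.hom_zero_AR_translate_iff[OF central_field X p left_module_tensor[OF X]] by simp
qed

text \<open>For maps into \<open>Z X\<close> the differential of the presentation is
  \<open>f\<close> on \<open>P1\<close> and zero on \<open>Q\<close>. A map on
  \<open>P1 \<oplus> Q\<close> then extends over it only if it vanishes on \<open>Q\<close>, so the
  criterion asks for the one for \<open>X\<close> and for \<open>Hom(Q, X) = 0\<close>.\<close>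

lemma tau_zero_Z:
  assumes "fg_module A X" and Q: "fg_projective A Q" and \<pi>: "essential_epi A Q \<pi> (tensor A M X)"
  shows "hom_zero \<Lambda> (Z_functor A M X) (AR_translate K \<Lambda> (Z_functor A M X)) \<longleftrightarrow>
    hom_zero A X (AR_translate K A X) \<and> hom_zero A Q X"
proof -
  have X: "left_module A X" using assms(1) by (simp add: fg_module_def)
  interpret X: left_module A X by (rule X)
  obtain P1 :: "('a, nat \<Rightarrow> 'a) module" and f and P0 :: "('a, nat \<Rightarrow> 'a) module" and g
    where p: "min_pres A P1 f P0 g X" by (rule min_pres_exists[OF assms(1)])
  have P1: "left_module A P1" and P0: "left_module A P0" and Qm: "left_module A Q"
    and f: "essential_epi A P1 f (P0\<lparr>carrier := {x \<in> carrier P0. g x = \<zero>\<^bsub>X\<^esub>}\<rparr>)"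
    using p Q fg_projective_left_module by (auto simp: min_pres_def)
  interpret P1: left_module A P1 by (rule P1)
  interpret P0: left_module A P0 by (rule P0)
  interpret Q: left_module A Q by (rule Qm)
  let ?D = "dsum_module P1 Q" and ?ZX = "Z_functor A M X"
  note D = left_module_dsum[OF P1 Qm]
  obtain f' g' where p': "min_pres \<Lambda> (T_functor A M ?D) f' (T_functor A M P0) g' ?ZX"
    and f': "\<And>r q. r \<in> carrier P1 \<Longrightarrow> q \<in> carrier Q \<Longrightarrow>
      \<exists>w\<in>carrier (tensor A M P0). f' ((r, q), \<zero>\<^bsub>tensor A M ?D\<^esub>) = (f r, w)"
    using min_pres_Z[OF X p Q \<pi>] by blast
  have l: "lin \<Lambda> (T_functor A M ?D) (T_functor A M P0) f'"
    using p' essential_epiD(1)[of \<Lambda> "T_functor A M ?D" f'] unfolding min_pres_def by (fastforce simp: lin_def)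
  have fl: "lin A P1 P0 f" using essential_epiD(1)[OF f] by (auto simp: lin_def)
  note fc = linD(1)[OF fl]
  have "hom_zero \<Lambda> ?ZX (AR_translate K \<Lambda> ?ZX) \<longleftrightarrow> hom_surj \<Lambda> (T_functor A M ?D) f' (T_functor A M P0) ?ZX"
    by (rule central_field.hom_zero_AR_translate_iff[OF central_field_trivial_extension left_module_Z[OF X] p' left_module_Z[OF X]])
  also have "\<dots> \<longleftrightarrow> hom_surj A ?D (\<lambda>r. f (fst r)) P0 (restrict_scalars M ?ZX)"
  proof (rule hom_surj_T_iff[OF left_module_Z[OF X] D P0 l])
    show "f (fst r) \<in> carrier P0" if "r \<in> carrier ?D" for r using that fc by auto
    fix \<phi> r assume \<phi>: "lin \<Lambda> (T_functor A M P0) ?ZX \<phi>" and "r \<in> carrier ?D"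
    then obtain s q where r: "r = (s, q)" "s \<in> carrier P1" "q \<in> carrier Q" by (cases r) auto
    obtain w where w: "w \<in> carrier (tensor A M P0)" "f' (r, \<zero>\<^bsub>tensor A M ?D\<^esub>) = (f s, w)"
      using f'[OF r(2,3)] r(1) by blast
    \<comment> \<open>Since \<open>M\<close> acts on \<open>Z X\<close> as zero,
      \<open>\<phi>\<close> kills the second summand of \<open>T P0\<close>, so the component
      \<open>w\<close> of \<open>f'\<close> leaves no trace.\<close>
    note d = T_decompose[OF left_module_Z[OF X] P0 \<phi>]
    interpret FP: left_module A "tensor A M P0" by (rule left_module_tensor[OF P0])
    have "lin A (tensor A M P0) (restrict_scalars M ?ZX) (\<lambda>_. \<zero>\<^bsub>X\<^esub>)"
      by (rule linI) (auto simp: Z_simps[OF X] Z_smult[OF X])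
    moreover have "\<phi> (\<zero>\<^bsub>P0\<^esub>, pure_tensor A M P0 m p) = \<zero>\<^bsub>X\<^esub>" if "m \<in> carrier M" "p \<in> carrier P0" for m p
      using d(2)[OF that] linD(1)[OF d(3) that(2)] by (simp add: Z_simps[OF X] Z_smult[OF X])
    ultimately have "\<phi> (\<zero>\<^bsub>P0\<^esub>, w) = \<zero>\<^bsub>X\<^esub>"
      using tensor_lin_ext[OF P0 left_module_restrict_scalars[OF left_module_Z[OF X]] d(4) _ _ w(1)] by blast
    then show "\<phi> (f' (r, \<zero>\<^bsub>tensor A M ?D\<^esub>)) = \<phi> (f (fst r), \<zero>\<^bsub>tensor A M P0\<^esub>)"
      using w(2) d(1)[OF fc[OF r(2)] w(1)] linD(1)[OF d(3) fc[OF r(2)]] r(1) by (simp add: Z_simps[OF X])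
  qed
  also have "\<dots> \<longleftrightarrow> hom_surj A ?D (\<lambda>r. f (fst r)) P0 X"
    unfolding hom_surj_def lin_Z_restrict[OF X] ..
  also have "\<dots> \<longleftrightarrow> hom_surj A P1 f P0 X \<and> hom_zero A Q X"
  proof (intro iffI conjI; (elim conjE)?)
    assume s: "hom_surj A ?D (\<lambda>r. f (fst r)) P0 X"
    have lift: "\<exists>\<phi>. lin A P0 X \<phi> \<and> (\<forall>r\<in>carrier P1. \<forall>q\<in>carrier Q. \<psi> (r, q) = \<phi> (f r))" if "lin A ?D X \<psi>" for \<psi>
      using s that unfolding hom_surj_def by fastforce
    show "hom_surj A P1 f P0 X" unfolding hom_surj_def
    proof (intro allI impI)
      fix \<psi> assume "lin A P1 X \<psi>"
      then have "lin A ?D X (\<lambda>r. \<psi> (fst r))" by (auto simp: lin_def)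
      from lift[OF this] show "\<exists>\<phi>. lin A P0 X \<phi> \<and> (\<forall>x\<in>carrier P1. \<psi> x = \<phi> (f x))"
        using Q.M.zero_closed by fastforce
    qed
    show "hom_zero A Q X" unfolding hom_zero_iff[OF Qm]
    proof (intro allI impI ballI)
      fix h q assume h: "lin A Q X h" and q: "q \<in> carrier Q"
      then have "lin A ?D X (\<lambda>r. h (snd r))" by (auto simp: lin_def)
      from lift[OF this] obtain \<phi> where \<phi>: "lin A P0 X \<phi>" "\<forall>r\<in>carrier P1. \<forall>q\<in>carrier Q. h q = \<phi> (f r)" by auto
      \<comment> \<open>The extension of \<open>h\<close> depends only on the coordinate in
        \<open>P1\<close>, so it may be evaluated there at zero.\<close>
      have "h q = \<phi> (f \<zero>\<^bsub>P1\<^esub>)" using \<phi>(2) P1.M.zero_closed q by blast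
      then show "h q = \<zero>\<^bsub>X\<^esub>" using lin_zero[OF P1 P0 fl] lin_zero[OF P0 X \<phi>(1)] by simp
    qed
  next
    assume s: "hom_surj A P1 f P0 X" and z: "hom_zero A Q X"
    show "hom_surj A ?D (\<lambda>r. f (fst r)) P0 X" unfolding hom_surj_def
    proof (intro allI impI)
      fix \<psi> assume \<psi>: "lin A ?D X \<psi>"
      have i1: "lin A P1 ?D (\<lambda>r. (r, \<zero>\<^bsub>Q\<^esub>))" and i2: "lin A Q ?D (\<lambda>q. (\<zero>\<^bsub>P1\<^esub>, q))" by (auto intro!: linI)
      obtain \<phi> where \<phi>: "lin A P0 X \<phi>" "\<forall>r\<in>carrier P1. \<psi> (r, \<zero>\<^bsub>Q\<^esub>) = \<phi> (f r)"
        using s lin_comp[OF i1 \<psi>] unfolding hom_surj_def by blast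
      have "\<psi> (\<zero>\<^bsub>P1\<^esub>, q) = \<zero>\<^bsub>X\<^esub>" if "q \<in> carrier Q" for q
        using z lin_comp[OF i2 \<psi>] that unfolding hom_zero_iff[OF Qm] by blast
      then have "\<psi> r = \<phi> (f (fst r))" if "r \<in> carrier ?D" for r
        using that linD(2)[OF \<psi>, of "(fst r, \<zero>\<^bsub>Q\<^esub>)" "(\<zero>\<^bsub>P1\<^esub>, snd r)"] \<phi>(2) linD(1)[OF \<phi>(1)] fc by auto
      then show "\<exists>\<phi>. lin A P0 X \<phi> \<and> (\<forall>r\<in>carrier ?D. \<psi> r = \<phi> (f (fst r)))" using \<phi>(1) by blast
    qed
  qed
  finally show ?thesis using central_field.hom_zero_AR_translate_iff[OF central_field X p X] by blast
qed

end

section \<open>Counting indecomposable summands\<close>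

text \<open>Surjectivity is demanded only up to \<open>s\<close>, because a summand of
  \<open>T X\<close> is reached only up to isomorphism.\<close>

lemma card_quotient_eq:
  assumes r: "equiv A r" and s: "equiv B s" and \<Phi>: "\<And>x. x \<in> A \<Longrightarrow> \<Phi> x \<in> B"
    and iff: "\<And>x y. x \<in> A \<Longrightarrow> y \<in> A \<Longrightarrow> (x, y) \<in> r \<longleftrightarrow> (\<Phi> x, \<Phi> y) \<in> s"
    and surj: "\<And>b. b \<in> B \<Longrightarrow> \<exists>a\<in>A. (\<Phi> a, b) \<in> s"
  shows "card (A // r) = card (B // s)"
proof (rule bij_betw_same_card)
  let ?F = "\<lambda>C. s `` (\<Phi> ` C)"
  have F: "?F (r `` {x}) = s `` {\<Phi> x}" if x: "x \<in> A" for x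
  proof
    show "s `` {\<Phi> x} \<subseteq> ?F (r `` {x})" using equiv_class_self[OF r x] by blast
    show "?F (r `` {x}) \<subseteq> s `` {\<Phi> x}"
    proof
      fix b assume "b \<in> ?F (r `` {x})"
      then obtain y where y: "(x, y) \<in> r" "(\<Phi> y, b) \<in> s" by blast
      have "y \<in> A" using y(1) r by (auto simp: equiv_def refl_on_def)
      then have "(\<Phi> x, \<Phi> y) \<in> s" using iff[OF x] y(1) by blast
      then have "(\<Phi> x, b) \<in> s" using y(2) s by (meson equivE transE)
      then show "b \<in> s `` {\<Phi> x}" by blast
    qed
  qed
  show "bij_betw ?F (A // r) (B // s)"
    unfolding bij_betw_def
  proof
    show "inj_on ?F (A // r)"
    proof (rule inj_onI)
      fix C D assume "C \<in> A // r" "D \<in> A // r" and eq: "?F C = ?F D"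
      then obtain x y where x: "x \<in> A" "C = r `` {x}" and y: "y \<in> A" "D = r `` {y}" by (auto elim!: quotientE)
      have "s `` {\<Phi> x} = s `` {\<Phi> y}" using eq F x y by simp
      then have "(\<Phi> x, \<Phi> y) \<in> s" using eq_equiv_class[OF _ s] \<Phi> y(1) by blast
      then have "(x, y) \<in> r" using iff[OF x(1) y(1)] by blast
      then show "C = D" using x y equiv_class_eq[OF r] by blast
    qed
    show "?F ` (A // r) = B // s"
    proof
      show "?F ` (A // r) \<subseteq> B // s"
      proof
        fix E assume "E \<in> ?F ` (A // r)"
        then obtain x where "x \<in> A" "E = ?F (r `` {x})" by (auto elim!: quotientE)
        then show "E \<in> B // s" using F \<Phi> by (simp add: quotientI)
      qed
      show "B // s \<subseteq> ?F ` (A // r)"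
      proof
        fix E assume "E \<in> B // s"
        then obtain b where b: "b \<in> B" "E = s `` {b}" by (auto elim!: quotientE)
        obtain a where a: "a \<in> A" "(\<Phi> a, b) \<in> s" using surj[OF b(1)] by blast
        then have "E = ?F (r `` {a})" using F[OF a(1)] b(2) equiv_class_eq[OF s a(2)] by simp
        then show "E \<in> ?F ` (A // r)" using a(1) by (simp add: quotientI)
      qed
    qed
  qed
qed

text \<open>An idempotent encodes a decomposition by its image and kernel. Unlike a pair of
  submodules it can be carried along a functor or an isomorphism.\<close>

definition idem :: "('r, 'b) ring_scheme \<Rightarrow> ('r, 'm, 'd) module_scheme \<Rightarrow> ('m \<Rightarrow> 'm) \<Rightarrow> bool" where
  "idem R M e \<longleftrightarrow> lin R M M e \<and> (\<forall>x\<in>carrier M. e (e x) = e x)"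

section \<open>Direct summands as images of idempotents\<close>

context left_module
begin

lemma decomposition_imp_idem:
  assumes "direct_decomposition R M S S'"
  shows "\<exists>e. idem R M e \<and> e ` carrier M = S \<and> {x \<in> carrier M. e x = \<zero>\<^bsub>M\<^esub>} = S'"
proof -
  have S: "submodule S R M" "submodule S' R M" "S \<inter> S' = {\<zero>\<^bsub>M\<^esub>}" "S <+>\<^bsub>M\<^esub> S' = carrier M"
    using assms by (simp_all add: direct_decomposition_def)
  note s = submoduleD[OF S(1)] and s' = submoduleD[OF S(2)]
  have dec: "\<exists>i\<in>S. x \<ominus>\<^bsub>M\<^esub> i \<in> S'" if "x \<in> carrier M" for x
  proof -
    have "x \<in> S <+>\<^bsub>M\<^esub> S'" using S(4) that by simp
    then obtain i j where "i \<in> S" "j \<in> S'" "x = i \<oplus>\<^bsub>M\<^esub> j" by (auto simp: mem_set_add)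
    then show ?thesis using s(1) s'(1) by (intro bexI[of _ i]) (auto simp: M.diff_add_cancel subset_eq)
  qed
  then obtain e where e: "lin R M M e" "\<forall>x\<in>carrier M. e x \<in> S" "\<forall>x\<in>carrier M. x \<ominus>\<^bsub>M\<^esub> e x \<in> S'"
    "\<forall>x\<in>S. e x = x" "\<forall>x\<in>S'. e x = \<zero>\<^bsub>M\<^esub>"
    using projection_exists[OF S(1-3)] by blast
  have "idem R M e" using e by (simp add: idem_def)
  moreover have "e ` carrier M = S"
  proof
    show "e ` carrier M \<subseteq> S" using e(2) by blast
    show "S \<subseteq> e ` carrier M"
    proof
      fix x assume "x \<in> S"
      then have "x = e x" "x \<in> carrier M" using e(4) s(1) by auto
      then show "x \<in> e ` carrier M" by (rule image_eqI)
    qed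
  qed
  moreover have "x \<in> S'" if "x \<in> carrier M" "e x = \<zero>\<^bsub>M\<^esub>" for x
    using e(3) that by force
  then have "{x \<in> carrier M. e x = \<zero>\<^bsub>M\<^esub>} = S'" using e(5) s'(1) by blast
  ultimately show ?thesis by blast
qed

lemma idem_imp_decomposition:
  assumes "idem R M e"
  shows "direct_decomposition R M (e ` carrier M) {x \<in> carrier M. e x = \<zero>\<^bsub>M\<^esub>}"
proof -
  have e: "lin R M M e" "\<And>x. x \<in> carrier M \<Longrightarrow> e (e x) = e x" using assms by (auto simp: idem_def)
  note L = left_module_axioms and e' = linD[OF e(1)]
  let ?I = "e ` carrier M" and ?K = "{x \<in> carrier M. e x = \<zero>\<^bsub>M\<^esub>}"
  have s: "submodule ?I R M" "submodule ?K R M"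
    using submodule_image[OF L L e(1) submodule_carrier] submodule_kernel[OF L L e(1)] by auto
  moreover have "?I \<inter> ?K = {\<zero>\<^bsub>M\<^esub>}" using e(2) submoduleD(2)[OF s(1)] submoduleD(2)[OF s(2)] by auto
  moreover have "?I <+>\<^bsub>M\<^esub> ?K = carrier M"
  proof
    show "?I <+>\<^bsub>M\<^esub> ?K \<subseteq> carrier M" using submoduleD(1)[OF submodule_sum[OF s]] .
    show "carrier M \<subseteq> ?I <+>\<^bsub>M\<^esub> ?K"
    proof
      fix x assume x: "x \<in> carrier M"
      have "x \<ominus>\<^bsub>M\<^esub> e x \<in> ?K" using x e' e(2) by (simp add: lin_diff[OF L L e(1)] M.diff_zero_iff)
      moreover have "x = e x \<oplus>\<^bsub>M\<^esub> (x \<ominus>\<^bsub>M\<^esub> e x)" using x e'(1) by (simp add: M.diff_add_cancel)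
      ultimately show "x \<in> ?I <+>\<^bsub>M\<^esub> ?K" using x unfolding mem_set_add by blast
    qed
  qed
  ultimately show ?thesis by (simp add: direct_decomposition_def)
qed

lemma summand_iff_idem:
  "(\<exists>S'. direct_decomposition R M S S') \<longleftrightarrow> (\<exists>e. idem R M e \<and> e ` carrier M = S)"
  using decomposition_imp_idem idem_imp_decomposition by blast

lemma indecomposable_iff_idem:
  "indecomposable R M \<longleftrightarrow> carrier M \<noteq> {\<zero>\<^bsub>M\<^esub>} \<and>
    (\<forall>e. idem R M e \<longrightarrow> (\<forall>x\<in>carrier M. e x = \<zero>\<^bsub>M\<^esub>) \<or> (\<forall>x\<in>carrier M. e x = x))"
proof -
  note L = left_module_axioms
  have I: "e ` carrier M = {\<zero>\<^bsub>M\<^esub>} \<longleftrightarrow> (\<forall>x\<in>carrier M. e x = \<zero>\<^bsub>M\<^esub>)" for e :: "'m \<Rightarrow> 'm"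
  proof
    assume *: "\<forall>x\<in>carrier M. e x = \<zero>\<^bsub>M\<^esub>"
    then have "e ` carrier M = (\<lambda>_. \<zero>\<^bsub>M\<^esub>) ` carrier M" by (intro image_cong) auto
    then show "e ` carrier M = {\<zero>\<^bsub>M\<^esub>}" using M.zero_closed by auto
  qed blast
  have K: "{x \<in> carrier M. e x = \<zero>\<^bsub>M\<^esub>} = {\<zero>\<^bsub>M\<^esub>} \<longleftrightarrow> (\<forall>x\<in>carrier M. e x = x)" if "idem R M e" for e
  proof -
    have e: "lin R M M e" "\<And>x. x \<in> carrier M \<Longrightarrow> e (e x) = e x" using that by (auto simp: idem_def)
    have "e (x \<ominus>\<^bsub>M\<^esub> e x) = \<zero>\<^bsub>M\<^esub>" if "x \<in> carrier M" for x
      using that linD(1)[OF e(1)] e(2) by (simp add: lin_diff[OF L L e(1)] M.diff_zero_iff)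
    then have "e x = x" if "{x \<in> carrier M. e x = \<zero>\<^bsub>M\<^esub>} = {\<zero>\<^bsub>M\<^esub>}" "x \<in> carrier M" for x
    proof -
      have "x \<ominus>\<^bsub>M\<^esub> e x \<in> {x \<in> carrier M. e x = \<zero>\<^bsub>M\<^esub>}"
        using that(2) linD(1)[OF e(1)] \<open>\<And>x. x \<in> carrier M \<Longrightarrow> e (x \<ominus>\<^bsub>M\<^esub> e x) = \<zero>\<^bsub>M\<^esub>\<close> by simp
      then show ?thesis using that linD(1)[OF e(1) that(2)] by (simp add: M.diff_zero_iff)
    qed
    then show ?thesis using lin_zero[OF L L e(1)] by auto
  qed
  show ?thesis
  proof (intro iffI conjI allI impI)
    assume "indecomposable R M"
    then have ind: "\<And>S S'. direct_decomposition R M S S' \<Longrightarrow> S = {\<zero>\<^bsub>M\<^esub>} \<or> S' = {\<zero>\<^bsub>M\<^esub>}"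
      and "carrier M \<noteq> {\<zero>\<^bsub>M\<^esub>}" by (auto simp: indecomposable_def)
    then show "carrier M \<noteq> {\<zero>\<^bsub>M\<^esub>}" by simp
    show "(\<forall>x\<in>carrier M. e x = \<zero>\<^bsub>M\<^esub>) \<or> (\<forall>x\<in>carrier M. e x = x)" if "idem R M e" for e
      using ind[OF idem_imp_decomposition[OF that]] unfolding I K[OF that] .
  next
    assume *: "carrier M \<noteq> {\<zero>\<^bsub>M\<^esub>} \<and>
      (\<forall>e. idem R M e \<longrightarrow> (\<forall>x\<in>carrier M. e x = \<zero>\<^bsub>M\<^esub>) \<or> (\<forall>x\<in>carrier M. e x = x))"
    have "S = {\<zero>\<^bsub>M\<^esub>} \<or> S' = {\<zero>\<^bsub>M\<^esub>}" if dd: "direct_decomposition R M S S'" for S S'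
    proof -
      obtain e where e: "idem R M e" "e ` carrier M = S" "{x \<in> carrier M. e x = \<zero>\<^bsub>M\<^esub>} = S'"
        using decomposition_imp_idem[OF dd] by blast
      have "(\<forall>x\<in>carrier M. e x = \<zero>\<^bsub>M\<^esub>) \<or> (\<forall>x\<in>carrier M. e x = x)" using * e(1) by blast
      then show ?thesis unfolding I[symmetric] K[OF e(1), symmetric] e(2,3) .
    qed
    then show "indecomposable R M" using * by (simp add: indecomposable_def)
  qed
qed

text \<open>The composite \<open>i p\<close> is idempotent with the image of \<open>i\<close>, and
  \<open>i\<close> is injective because \<open>p\<close> inverts it.\<close>

lemma retract_summand:
  assumes V: "left_module R V" and i: "lin R V M i" and p: "lin R M V p"
    and pi: "\<And>x. x \<in> carrier V \<Longrightarrow> p (i x) = x"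
  shows "\<exists>e. idem R M e \<and> e ` carrier M = i ` carrier V"
    and "module_iso R V (M\<lparr>carrier := i ` carrier V\<rparr>)"
proof -
  have "idem R M (\<lambda>x. i (p x))" using lin_comp[OF p i] pi linD(1)[OF p] by (simp add: idem_def)
  moreover have "(\<lambda>x. i (p x)) ` carrier M = i ` carrier V"
  proof
    show "(\<lambda>x. i (p x)) ` carrier M \<subseteq> i ` carrier V" using linD(1)[OF p] by blast
    show "i ` carrier V \<subseteq> (\<lambda>x. i (p x)) ` carrier M"
    proof
      fix y assume "y \<in> i ` carrier V"
      then obtain x where "x \<in> carrier V" "y = i x" by auto
      then have "y = i (p (i x))" "i x \<in> carrier M" using pi linD(1)[OF i] by auto
      then show "y \<in> (\<lambda>x. i (p x)) ` carrier M" by (rule image_eqI)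
    qed
  qed
  ultimately show "\<exists>e. idem R M e \<and> e ` carrier M = i ` carrier V" by blast
  have "lin R V (M\<lparr>carrier := i ` carrier V\<rparr>) i" using i by (auto simp: lin_def)
  moreover have "bij_betw i (carrier V) (i ` carrier V)"
    using pi by (intro inj_on_imp_bij_betw inj_on_inverseI[of _ p]) auto
  ultimately show "module_iso R V (M\<lparr>carrier := i ` carrier V\<rparr>)" using V by (auto simp: module_iso_iff)
qed

lemma idem_submodule: "idem R M e \<Longrightarrow> submodule (e ` carrier M) R M"
  using submodule_image[OF left_module_axioms left_module_axioms _ submodule_carrier] by (simp add: idem_def)

lemma indec_summands_iff:
  "S \<in> indec_summands R M \<longleftrightarrow> (\<exists>e. idem R M e \<and> e ` carrier M = S) \<and> indecomposable R (M\<lparr>carrier := S\<rparr>)"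
  unfolding indec_summands_def summand_iff_idem by blast

lemma indec_summands_left_module:
  assumes "S \<in> indec_summands R M" shows "submodule S R M" "left_module R (M\<lparr>carrier := S\<rparr>)"
proof -
  show "submodule S R M" using assms idem_submodule unfolding indec_summands_iff by blast
  then show "left_module R (M\<lparr>carrier := S\<rparr>)" by (rule left_module_submodule)
qed

lemma equiv_indec_summands:
  "equiv (indec_summands R M) {(S, S'). S \<in> indec_summands R M \<and> S' \<in> indec_summands R M \<and>
    module_iso R (M\<lparr>carrier := S\<rparr>) (M\<lparr>carrier := S'\<rparr>)}"
  using indec_summands_left_module(2) module_iso_refl module_iso_sym module_iso_trans
  by (intro equivI refl_onI symI transI) (fastforce, blast+)

end

lemma num_indec_summands_eq:
  assumes M: "left_module R M" and N: "left_module R' N"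
    and \<Phi>: "\<And>S. S \<in> indec_summands R M \<Longrightarrow> \<Phi> S \<in> indec_summands R' N"
    and iso: "\<And>S S'. S \<in> indec_summands R M \<Longrightarrow> S' \<in> indec_summands R M \<Longrightarrow>
      module_iso R (M\<lparr>carrier := S\<rparr>) (M\<lparr>carrier := S'\<rparr>) \<longleftrightarrow>
      module_iso R' (N\<lparr>carrier := \<Phi> S\<rparr>) (N\<lparr>carrier := \<Phi> S'\<rparr>)"
    and surj: "\<And>T. T \<in> indec_summands R' N \<Longrightarrow>
      \<exists>S\<in>indec_summands R M. module_iso R' (N\<lparr>carrier := \<Phi> S\<rparr>) (N\<lparr>carrier := T\<rparr>)"
  shows "num_indec_summands R M = num_indec_summands R' N"
  unfolding num_indec_summands_def
proof (rule card_quotient_eq[OF left_module.equiv_indec_summands[OF M] left_module.equiv_indec_summands[OF N], of \<Phi>])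
  show "\<exists>S\<in>indec_summands R M. (\<Phi> S, T) \<in> {(S, S'). S \<in> indec_summands R' N \<and> S' \<in> indec_summands R' N \<and>
      module_iso R' (N\<lparr>carrier := S\<rparr>) (N\<lparr>carrier := S'\<rparr>)}" if "T \<in> indec_summands R' N" for T
    using surj[OF that] \<Phi> that by auto
qed (use \<Phi> iso in auto)

text \<open>Conjugation by the isomorphism carries idempotents to idempotents and preserves being
  zero or the identity.\<close>

lemma indecomposable_iso:
  assumes M: "left_module R M" and N: "left_module R N" and iso: "module_iso R M N" and ind: "indecomposable R M"
  shows "indecomposable R N"
proof -
  interpret M: left_module R M by (rule M)
  interpret N: left_module R N by (rule N)
  obtain h where h: "lin R M N h" "bij_betw h (carrier M) (carrier N)" using iso by (auto simp: module_iso_iff[OF M])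
  let ?k = "inv_into (carrier M) h"
  note k = lin_inv_into[OF M N h]
  have kh: "?k (h x) = x" if "x \<in> carrier M" for x using h(2) that by (simp add: bij_betw_inv_into_left)
  have hk: "h (?k y) = y" if "y \<in> carrier N" for y using h(2) that by (simp add: bij_betw_inv_into_right)
  have ind': "carrier M \<noteq> {\<zero>\<^bsub>M\<^esub>}"
    "\<And>e. idem R M e \<Longrightarrow> (\<forall>x\<in>carrier M. e x = \<zero>\<^bsub>M\<^esub>) \<or> (\<forall>x\<in>carrier M. e x = x)"
    using ind by (auto simp: M.indecomposable_iff_idem)
  show ?thesis unfolding N.indecomposable_iff_idem
  proof (intro conjI allI impI)
    show "carrier N \<noteq> {\<zero>\<^bsub>N\<^esub>}"
    proof
      assume *: "carrier N = {\<zero>\<^bsub>N\<^esub>}"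
      have "x = \<zero>\<^bsub>M\<^esub>" if "x \<in> carrier M" for x
        using kh[OF that] linD(1)[OF h(1) that] lin_zero[OF N M k] * by simp
      then show False using ind'(1) M.M.zero_closed by blast
    qed
    fix e assume e: "idem R N e"
    then have el: "lin R N N e" and ee: "\<And>y. y \<in> carrier N \<Longrightarrow> e (e y) = e y" by (auto simp: idem_def)
    have "idem R M (\<lambda>x. ?k (e (h x)))"
      using lin_comp[OF lin_comp[OF h(1) el] k] linD(1)[OF h(1)] linD(1)[OF el] ee
      by (simp add: idem_def hk)
    from ind'(2)[OF this]
    show "(\<forall>y\<in>carrier N. e y = \<zero>\<^bsub>N\<^esub>) \<or> (\<forall>y\<in>carrier N. e y = y)"
    proof
      assume *: "\<forall>x\<in>carrier M. ?k (e (h x)) = \<zero>\<^bsub>M\<^esub>"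
      have "e y = \<zero>\<^bsub>N\<^esub>" if y: "y \<in> carrier N" for y
        using *[rule_format, OF linD(1)[OF k y]] hk[OF y] hk[OF linD(1)[OF el y]] lin_zero[OF M N h(1)] by simp
      then show ?thesis by blast
    next
      assume *: "\<forall>x\<in>carrier M. ?k (e (h x)) = x"
      have "e y = y" if y: "y \<in> carrier N" for y
        using *[rule_format, OF linD(1)[OF k y]] hk[OF y] hk[OF linD(1)[OF el y]] by simp
      then show ?thesis by blast
    qed
  qed
qed

text \<open>Summands correspond under direct and inverse images. This serves for the regular module
  of the trivial extension, which is isomorphic but not equal to \<open>T\<close> of the regular
  module of \<open>A\<close>.\<close>

lemma num_indec_summands_iso:
  assumes M: "left_module R M" and N: "left_module R N" and iso: "module_iso R M N"
  shows "num_indec_summands R M = num_indec_summands R N"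
proof -
  interpret M: left_module R M by (rule M)
  interpret N: left_module R N by (rule N)
  obtain h where h: "lin R M N h" "bij_betw h (carrier M) (carrier N)" using iso by (auto simp: module_iso_iff[OF M])
  let ?k = "inv_into (carrier M) h"
  note k = lin_inv_into[OF M N h]
  have kh: "?k (h x) = x" if "x \<in> carrier M" for x using h(2) that by (simp add: bij_betw_inv_into_left)
  have hk: "h (?k y) = y" if "y \<in> carrier N" for y using h(2) that by (simp add: bij_betw_inv_into_right)
  have sub_iso: "module_iso R (M\<lparr>carrier := S\<rparr>) (N\<lparr>carrier := h ` S\<rparr>)" if S: "submodule S R M" for S
  proof -
    note s = M.submoduleD(1)[OF S]
    have "lin R (M\<lparr>carrier := S\<rparr>) (N\<lparr>carrier := h ` S\<rparr>) h" using lin_restrict_carrier(1)[OF h(1) s order_refl] .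
    moreover have "bij_betw h S (h ` S)" using h(2) s by (meson bij_betw_def inj_on_subset)
    ultimately show ?thesis unfolding module_iso_iff[OF M.left_module_submodule[OF S]] by auto
  qed
  have hs: "submodule (h ` S) R N" if "submodule S R M" for S using submodule_image[OF M N h(1) that] .
  have trans_iff: "module_iso R (M\<lparr>carrier := S\<rparr>) (M\<lparr>carrier := S'\<rparr>) \<longleftrightarrow>
      module_iso R (N\<lparr>carrier := h ` S\<rparr>) (N\<lparr>carrier := h ` S'\<rparr>)" if S: "submodule S R M" "submodule S' R M" for S S'
  proof -
    note m = M.left_module_submodule[OF S(1)] M.left_module_submodule[OF S(2)]
    note n = N.left_module_submodule[OF hs[OF S(1)]] N.left_module_submodule[OF hs[OF S(2)]]
    note i = sub_iso[OF S(1)] sub_iso[OF S(2)]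
    show ?thesis
      using module_iso_trans[OF m(1) n(1) i(1)] module_iso_trans[OF n(1) m(1) module_iso_sym[OF m(1) n(1) i(1)]]
        module_iso_trans[OF m(1,2) _ i(2)] module_iso_trans[OF m(1) n(2) _ module_iso_sym[OF m(2) n(2) i(2)]] by metis
  qed
  have idem_h: "\<exists>e'. idem R N e' \<and> e' ` carrier N = h ` S" if "idem R M e" "e ` carrier M = S" for e S
  proof -
    have e: "lin R M M e" "\<And>x. x \<in> carrier M \<Longrightarrow> e (e x) = e x" using that by (auto simp: idem_def)
    have "idem R N (\<lambda>y. h (e (?k y)))"
      using lin_comp[OF lin_comp[OF k e(1)] h(1)] linD(1)[OF k] linD(1)[OF e(1)] e(2) by (simp add: idem_def kh)
    moreover have "(\<lambda>y. h (e (?k y))) ` carrier N = h ` S"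
    proof -
      have "?k ` carrier N = carrier M" using bij_betw_inv_into[OF h(2)] by (simp add: bij_betw_def)
      then show ?thesis using that(2) by (metis image_image)
    qed
    ultimately show ?thesis by blast
  qed
  have k': "bij_betw ?k (carrier N) (carrier M)" by (rule bij_betw_inv_into[OF h(2)])
  show ?thesis
  proof (rule num_indec_summands_eq[OF M N, of "\<lambda>S. h ` S"])
    fix S assume S: "S \<in> indec_summands R M"
    note s = M.indec_summands_left_module[OF S]
    show "h ` S \<in> indec_summands R N"
      using S idem_h indecomposable_iso[OF s(2) N.left_module_submodule[OF hs[OF s(1)]] sub_iso[OF s(1)]]
      unfolding M.indec_summands_iff N.indec_summands_iff by blast
  next
    show "module_iso R (M\<lparr>carrier := S\<rparr>) (M\<lparr>carrier := S'\<rparr>) \<longleftrightarrow>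
      module_iso R (N\<lparr>carrier := h ` S\<rparr>) (N\<lparr>carrier := h ` S'\<rparr>)"
      if "S \<in> indec_summands R M" "S' \<in> indec_summands R M" for S S'
      using trans_iff M.indec_summands_left_module(1) that by blast
  next
    fix T assume T: "T \<in> indec_summands R N"
    note t = N.indec_summands_left_module[OF T]
    let ?S = "{x \<in> carrier M. h x \<in> T}"
    have S: "submodule ?S R M" by (rule submodule_vimage[OF M N h(1) t(1)])
    have hS: "h ` ?S = T"
    proof
      show "T \<subseteq> h ` ?S"
      proof
        fix y assume y: "y \<in> T"
        then have "y \<in> carrier N" using N.submoduleD(1)[OF t(1)] by blast
        then show "y \<in> h ` ?S" using hk y linD(1)[OF k] by (intro image_eqI[of _ h "?k y"]) auto
      qed
    qed auto
    obtain e where e: "idem R N e" "e ` carrier N = T" using T unfolding N.indec_summands_iff by blast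
    have el: "lin R N N e" and ee: "\<And>y. y \<in> carrier N \<Longrightarrow> e (e y) = e y" using e(1) by (auto simp: idem_def)
    have "idem R M (\<lambda>x. ?k (e (h x)))"
      using lin_comp[OF lin_comp[OF h(1) el] k] linD(1)[OF h(1)] linD(1)[OF el] ee by (simp add: idem_def hk)
    moreover have "(\<lambda>x. ?k (e (h x))) ` carrier M = ?S"
    proof
      show "(\<lambda>x. ?k (e (h x))) ` carrier M \<subseteq> ?S"
        using e(2) linD(1)[OF h(1)] linD(1)[OF el] linD(1)[OF k] hk by auto
      show "?S \<subseteq> (\<lambda>x. ?k (e (h x))) ` carrier M"
      proof
        fix x assume x: "x \<in> ?S"
        then obtain y where y: "y \<in> carrier N" "h x = e y" using e(2) by auto
        then have "?k (e (h x)) = ?k (h x)" using ee by simp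
        then have "x = ?k (e (h x))" using x kh[of x] by simp
        then show "x \<in> (\<lambda>x. ?k (e (h x))) ` carrier M" using x by blast
      qed
    qed
    moreover have "indecomposable R (M\<lparr>carrier := ?S\<rparr>)"
    proof (rule indecomposable_iso[OF t(2) M.left_module_submodule[OF S]])
      show "module_iso R (N\<lparr>carrier := T\<rparr>) (M\<lparr>carrier := ?S\<rparr>)"
        using module_iso_sym[OF M.left_module_submodule[OF S] _ sub_iso[OF S]] t(2) hS by simp
      show "indecomposable R (N\<lparr>carrier := T\<rparr>)" using T unfolding N.indec_summands_iff by blast
    qed
    ultimately have "?S \<in> indec_summands R M" unfolding M.indec_summands_iff by blast
    then show "\<exists>S\<in>indec_summands R M. module_iso R (N\<lparr>carrier := h ` S\<rparr>) (N\<lparr>carrier := T\<rparr>)"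
      using module_iso_refl[OF t(2)] hS by metis
  qed
qed

section \<open>Summands of T X and Z X\<close>

context bimodule
begin

text \<open>The second summand of \<open>T V\<close> consists of multiples by \<open>M\<close>, so
  it is mapped into the second summand of \<open>T W\<close>. Taking first components therefore
  gives the map induced modulo \<open>M\<close>, and on pure tensors \<open>H\<close> is determined
  by that map.\<close>

lemma T_fst:
  assumes V: "left_module A V" and W: "left_module A W" and H: "lin \<Lambda> (T_functor A M V) (T_functor A M W) H"
  shows "x \<in> carrier V \<Longrightarrow> w \<in> carrier (tensor A M V) \<Longrightarrow> fst (H (x, w)) = fst (H (x, \<zero>\<^bsub>tensor A M V\<^esub>))"
    and "lin A V W (\<lambda>x. fst (H (x, \<zero>\<^bsub>tensor A M V\<^esub>)))"
    and "m \<in> carrier M \<Longrightarrow> x \<in> carrier V \<Longrightarrow> H (\<zero>\<^bsub>V\<^esub>, pure_tensor A M V m x) =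
      (\<zero>\<^bsub>W\<^esub>, pure_tensor A M W m (fst (H (x, \<zero>\<^bsub>tensor A M V\<^esub>))))"
    and "z \<in> carrier (T_functor A M V) \<Longrightarrow> fst (H z) \<in> carrier W \<and> snd (H z) \<in> carrier (tensor A M W)"
    and "w \<in> carrier (tensor A M V) \<Longrightarrow> fst (H (\<zero>\<^bsub>V\<^esub>, w)) = \<zero>\<^bsub>W\<^esub>"
proof -
  let ?FV = "tensor A M V" and ?FW = "tensor A M W" and ?TW = "T_functor A M W"
  interpret V: left_module A V by (rule V)
  interpret W: left_module A W by (rule W)
  interpret FV: left_module A ?FV by (rule left_module_tensor[OF V])
  note TW = left_module_T[OF W] and d = T_decompose[OF left_module_T[OF W] V H]
  show c: "fst (H z) \<in> carrier W \<and> snd (H z) \<in> carrier ?FW" if "z \<in> carrier (T_functor A M V)" for z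
    using linD(1)[OF H that] W by (auto simp: mem_Times_iff)
  have add: "fst (y \<oplus>\<^bsub>?TW\<^esub> z) = fst y \<oplus>\<^bsub>W\<^esub> fst z" for y z
    using T_simps(3)[OF W, of "fst y" "snd y" "fst z" "snd z"] by simp
  have RW: "left_module A (restrict_scalars M ?TW)" by (rule left_module_restrict_scalars[OF TW])
  have fl: "lin A (restrict_scalars M ?TW) W fst"
    using lin_T_restrict[OF W RW, of "\<lambda>z. z"] lin_id by blast
  show "lin A V W (\<lambda>x. fst (H (x, \<zero>\<^bsub>?FV\<^esub>)))" using lin_comp[OF d(3) fl] .
  show pure: "H (\<zero>\<^bsub>V\<^esub>, pure_tensor A M V m x) = (\<zero>\<^bsub>W\<^esub>, pure_tensor A M W m (fst (H (x, \<zero>\<^bsub>?FV\<^esub>))))"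
    if "m \<in> carrier M" "x \<in> carrier V" for m x
    using d(2)[OF that] T_inclusion(3)[OF W that(1), of "fst (H (x, \<zero>\<^bsub>?FV\<^esub>))" "snd (H (x, \<zero>\<^bsub>?FV\<^esub>))"]
      c[OF T_inclusion(5)[OF V that(2)]] by simp
  have z: "lin A ?FV W (\<lambda>_. \<zero>\<^bsub>W\<^esub>)" by (auto intro!: linI)
  show f0: "fst (H (\<zero>\<^bsub>V\<^esub>, w)) = \<zero>\<^bsub>W\<^esub>" if "w \<in> carrier ?FV" for w
    using tensor_lin_ext[OF V W lin_comp[OF d(4) fl] z _ that] pure by simp
  show "fst (H (x, w)) = fst (H (x, \<zero>\<^bsub>?FV\<^esub>))" if "x \<in> carrier V" "w \<in> carrier ?FV"
    using d(1)[OF that] add f0[OF that(2)] c[OF T_inclusion(5)[OF V that(1)]] by simp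
qed

lemma T_zero_iff:
  assumes V: "left_module A V"
  shows "carrier (T_functor A M V) = {\<zero>\<^bsub>T_functor A M V\<^esub>} \<longleftrightarrow> carrier V = {\<zero>\<^bsub>V\<^esub>}"
proof
  interpret V: left_module A V by (rule V)
  interpret TV: left_module \<Lambda> "T_functor A M V" by (rule left_module_T[OF V])
  { assume *: "carrier (T_functor A M V) = {\<zero>\<^bsub>T_functor A M V\<^esub>}"
    have "x = \<zero>\<^bsub>V\<^esub>" if "x \<in> carrier V" for x using T_inclusion(5)[OF V that] * V by simp
    then show "carrier V = {\<zero>\<^bsub>V\<^esub>}" using V.M.zero_closed by blast }
  assume "carrier V = {\<zero>\<^bsub>V\<^esub>}"
  then show "carrier (T_functor A M V) = {\<zero>\<^bsub>T_functor A M V\<^esub>}"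
    by (intro T_submodule_full[OF V TV.submodule_zero, symmetric]) (simp add: T_simps(2)[OF V])
qed

text \<open>The equation \<open>k g = id\<close> holds on the generating first summand and spreads
  to all of \<open>T V\<close>. So \<open>T\<close> preserves retractions, and a summand of
  \<open>X\<close> gives a retract of \<open>T X\<close>.\<close>

lemma T_map_idem:
  assumes V: "left_module A V" and W: "left_module A W" and g: "lin A V W g" and k: "lin A W V k"
    and kg: "\<And>x. x \<in> carrier V \<Longrightarrow> k (g x) = x"
  obtains Tg Tk where "lin \<Lambda> (T_functor A M V) (T_functor A M W) Tg" "lin \<Lambda> (T_functor A M W) (T_functor A M V) Tk"
    "\<And>x. x \<in> carrier V \<Longrightarrow> Tg (x, \<zero>\<^bsub>tensor A M V\<^esub>) = (g x, \<zero>\<^bsub>tensor A M W\<^esub>)"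
    "\<And>x. x \<in> carrier W \<Longrightarrow> Tk (x, \<zero>\<^bsub>tensor A M W\<^esub>) = (k x, \<zero>\<^bsub>tensor A M V\<^esub>)"
    "\<And>z. z \<in> carrier (T_functor A M V) \<Longrightarrow> Tk (Tg z) = z"
proof -
  interpret FV: left_module A "tensor A M V" by (rule left_module_tensor[OF V])
  interpret FW: left_module A "tensor A M W" by (rule left_module_tensor[OF W])
  obtain Fg where Fg: "lin A (tensor A M V) (tensor A M W) Fg" "lin \<Lambda> (T_functor A M V) (T_functor A M W) (\<lambda>(x, w). (g x, Fg w))"
    using T_map[OF V W g] by metis
  obtain Fk where Fk: "lin A (tensor A M W) (tensor A M V) Fk" "lin \<Lambda> (T_functor A M W) (T_functor A M V) (\<lambda>(x, w). (k x, Fk w))"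
    using T_map[OF W V k] by metis
  let ?g = "\<lambda>(x, w). (g x, Fg w)" and ?k = "\<lambda>(x, w). (k x, Fk w)"
  have g0: "?g (x, \<zero>\<^bsub>tensor A M V\<^esub>) = (g x, \<zero>\<^bsub>tensor A M W\<^esub>)" for x
    using lin_zero[OF FV.left_module_axioms FW.left_module_axioms Fg(1)] by simp
  have k0: "?k (x, \<zero>\<^bsub>tensor A M W\<^esub>) = (k x, \<zero>\<^bsub>tensor A M V\<^esub>)" for x
    using lin_zero[OF FW.left_module_axioms FV.left_module_axioms Fk(1)] by simp
  have "?k (?g z) = z" if "z \<in> carrier (T_functor A M V)" for z
    by (rule T_lin_ext[OF left_module_T[OF V] V lin_comp[OF Fg(2) Fk(2)] lin_id _ that])
      (simp only: g0 k0 kg)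
  then show thesis using that Fg(2) Fk(2) g0 k0 by blast
qed

text \<open>One direction applies \<open>T\<close> to both inverse maps. For the other, maps induced
  modulo \<open>M\<close> compose as the original ones do, so the reductions of an isomorphism and
  its inverse are again inverse.\<close>

lemma module_iso_T_iff:
  assumes V: "left_module A V" and W: "left_module A W"
  shows "module_iso \<Lambda> (T_functor A M V) (T_functor A M W) \<longleftrightarrow> module_iso A V W"
proof
  assume "module_iso A V W"
  then obtain g where g: "lin A V W g" "bij_betw g (carrier V) (carrier W)" by (auto simp: module_iso_iff[OF V])
  let ?k = "inv_into (carrier V) g"
  note k = lin_inv_into[OF V W g]
  have kg: "\<And>x. x \<in> carrier V \<Longrightarrow> ?k (g x) = x" and gk: "\<And>y. y \<in> carrier W \<Longrightarrow> g (?k y) = y"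
    using g(2) by (simp_all add: bij_betw_inv_into_left bij_betw_inv_into_right)
  obtain Tg Tk where T: "lin \<Lambda> (T_functor A M V) (T_functor A M W) Tg" "lin \<Lambda> (T_functor A M W) (T_functor A M V) Tk"
    "\<And>x. x \<in> carrier V \<Longrightarrow> Tg (x, \<zero>\<^bsub>tensor A M V\<^esub>) = (g x, \<zero>\<^bsub>tensor A M W\<^esub>)"
    "\<And>x. x \<in> carrier W \<Longrightarrow> Tk (x, \<zero>\<^bsub>tensor A M W\<^esub>) = (?k x, \<zero>\<^bsub>tensor A M V\<^esub>)"
    "\<And>z. z \<in> carrier (T_functor A M V) \<Longrightarrow> Tk (Tg z) = z"
    using T_map_idem[OF V W g(1) k kg] by blast
  have "Tg (Tk z) = z" if "z \<in> carrier (T_functor A M W)" for z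
    by (rule T_lin_ext[OF left_module_T[OF W] W lin_comp[OF T(2,1)] lin_id _ that])
      (simp add: T(3,4) gk linD(1)[OF k])
  then have "bij_betw Tg (carrier (T_functor A M V)) (carrier (T_functor A M W))"
    using T(5) linD(1)[OF T(1)] linD(1)[OF T(2)] by (intro bij_betw_byWitness[of _ Tk]) blast+
  then show "module_iso \<Lambda> (T_functor A M V) (T_functor A M W)"
    using T(1) module_iso_iff[OF left_module_T[OF V]] by blast
next
  assume "module_iso \<Lambda> (T_functor A M V) (T_functor A M W)"
  then obtain H where H: "lin \<Lambda> (T_functor A M V) (T_functor A M W) H"
    "bij_betw H (carrier (T_functor A M V)) (carrier (T_functor A M W))"
    by (auto simp: module_iso_iff[OF left_module_T[OF V]])
  let ?G = "inv_into (carrier (T_functor A M V)) H"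
  note G = lin_inv_into[OF left_module_T[OF V] left_module_T[OF W] H]
  note fH = T_fst[OF V W H(1)] and fG = T_fst[OF W V G]
  let ?h = "\<lambda>x. fst (H (x, \<zero>\<^bsub>tensor A M V\<^esub>))" and ?g = "\<lambda>x. fst (?G (x, \<zero>\<^bsub>tensor A M W\<^esub>))"
  \<comment> \<open>The second component of \<open>H\<close> at \<open>x\<close> is invisible to the
    first component of \<open>?G\<close>, so it may be replaced by zero.\<close>
  have 1: "?g (?h x) = x" if "x \<in> carrier V" for x
  proof -
    note xc = T_inclusion(5)[OF V that]
    have "fst (?G (H (x, \<zero>\<^bsub>tensor A M V\<^esub>))) = ?g (?h x)"
      using fG(1)[of "?h x" "snd (H (x, \<zero>\<^bsub>tensor A M V\<^esub>))"] fH(4)[OF xc] by simp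
    then show ?thesis using bij_betw_inv_into_left[OF H(2) xc] by simp
  qed
  have 2: "?h (?g y) = y" if "y \<in> carrier W" for y
  proof -
    note yc = T_inclusion(5)[OF W that]
    have "fst (H (?G (y, \<zero>\<^bsub>tensor A M W\<^esub>))) = ?h (?g y)"
      using fH(1)[of "?g y" "snd (?G (y, \<zero>\<^bsub>tensor A M W\<^esub>))"] fG(4)[OF yc] by simp
    then show ?thesis using bij_betw_inv_into_right[OF H(2) yc] by simp
  qed
  have "bij_betw ?h (carrier V) (carrier W)"
    using 1 2 linD(1)[OF fH(2)] linD(1)[OF fG(2)] by (intro bij_betw_byWitness[of _ ?g]) blast+
  then show "module_iso A V W" using fH(2) module_iso_iff[OF V] by blast
qed

lemma T_idem:
  assumes V: "left_module A V" and E: "idem \<Lambda> (T_functor A M V) E"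
  shows "idem A V (\<lambda>x. fst (E (x, \<zero>\<^bsub>tensor A M V\<^esub>)))"
proof -
  have E': "lin \<Lambda> (T_functor A M V) (T_functor A M V) E"
    "\<And>z. z \<in> carrier (T_functor A M V) \<Longrightarrow> E (E z) = E z" using E by (auto simp: idem_def)
  note f = T_fst[OF V V E'(1)]
  have "fst (E (fst (E (x, \<zero>\<^bsub>tensor A M V\<^esub>)), \<zero>\<^bsub>tensor A M V\<^esub>)) = fst (E (x, \<zero>\<^bsub>tensor A M V\<^esub>))"
    if "x \<in> carrier V" for x
    using f(1)[of "fst (E (x, \<zero>\<^bsub>tensor A M V\<^esub>))" "snd (E (x, \<zero>\<^bsub>tensor A M V\<^esub>))"] f(4)[OF T_inclusion(5)[OF V that]]
      E'(2)[OF T_inclusion(5)[OF V that]] by simp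
  then show ?thesis using f(2) by (simp add: idem_def)
qed

text \<open>An idempotent of \<open>V\<close> lifts by \<open>T\<close>. Conversely the idempotent
  that \<open>E\<close> induces on \<open>V\<close> is zero or the identity; on the second summand
  \<open>E\<close> is then zero or the identity too, and idempotence removes the remaining
  off-diagonal part.\<close>

lemma indecomposable_T_iff:
  assumes V: "left_module A V"
  shows "indecomposable \<Lambda> (T_functor A M V) \<longleftrightarrow> indecomposable A V"
proof -
  let ?FV = "tensor A M V" and ?TV = "T_functor A M V"
  interpret V: left_module A V by (rule V)
  interpret FV: left_module A ?FV by (rule left_module_tensor[OF V])
  interpret TV: left_module \<Lambda> ?TV by (rule left_module_T[OF V])
  show ?thesis
    unfolding V.indecomposable_iff_idem TV.indecomposable_iff_idem T_zero_iff[OF V]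
  proof (intro conj_cong refl iffI allI impI)
    fix e assume *: "\<forall>E. idem \<Lambda> ?TV E \<longrightarrow> (\<forall>z\<in>carrier ?TV. E z = \<zero>\<^bsub>?TV\<^esub>) \<or> (\<forall>z\<in>carrier ?TV. E z = z)"
      and "idem A V e"
    then have e: "lin A V V e" "\<And>x. x \<in> carrier V \<Longrightarrow> e (e x) = e x" by (auto simp: idem_def)
    obtain E where E: "lin \<Lambda> ?TV ?TV E" "\<And>x. x \<in> carrier V \<Longrightarrow> E (x, \<zero>\<^bsub>?FV\<^esub>) = (e x, \<zero>\<^bsub>?FV\<^esub>)"
    proof -
      obtain Fe where Fe: "lin A ?FV ?FV Fe" "lin \<Lambda> ?TV ?TV (\<lambda>(x, w). (e x, Fe w))"
        using T_map[OF V V e(1)] by metis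
      then show thesis using that lin_zero[OF FV.left_module_axioms FV.left_module_axioms Fe(1)] by fastforce
    qed
    have "E (E z) = E z" if "z \<in> carrier ?TV" for z
      by (rule T_lin_ext[OF TV.left_module_axioms V lin_comp[OF E(1) E(1)] E(1) _ that])
        (simp add: E(2) e(2) linD(1)[OF e(1)])
    then have "idem \<Lambda> ?TV E" using E(1) by (simp add: idem_def)
    then have "(\<forall>z\<in>carrier ?TV. E z = \<zero>\<^bsub>?TV\<^esub>) \<or> (\<forall>z\<in>carrier ?TV. E z = z)" using * by blast
    then show "(\<forall>x\<in>carrier V. e x = \<zero>\<^bsub>V\<^esub>) \<or> (\<forall>x\<in>carrier V. e x = x)"
    proof
      assume z: "\<forall>z\<in>carrier ?TV. E z = \<zero>\<^bsub>?TV\<^esub>"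
      have "e x = \<zero>\<^bsub>V\<^esub>" if "x \<in> carrier V" for x
        using z[rule_format, OF T_inclusion(5)[OF V that]] E(2)[OF that] V by simp
      then show ?thesis by blast
    next
      assume z: "\<forall>z\<in>carrier ?TV. E z = z"
      have "e x = x" if "x \<in> carrier V" for x
        using z[rule_format, OF T_inclusion(5)[OF V that]] E(2)[OF that] by simp
      then show ?thesis by blast
    qed
  next
    fix E assume *: "\<forall>e. idem A V e \<longrightarrow> (\<forall>x\<in>carrier V. e x = \<zero>\<^bsub>V\<^esub>) \<or> (\<forall>x\<in>carrier V. e x = x)"
      and E: "idem \<Lambda> ?TV E"
    have El: "lin \<Lambda> ?TV ?TV E" and EE: "\<And>z. z \<in> carrier ?TV \<Longrightarrow> E (E z) = E z" using E by (auto simp: idem_def)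
    note f = T_fst[OF V V El] and d = T_decompose[OF TV.left_module_axioms V El]
    note RV = left_module_restrict_scalars[OF TV.left_module_axioms]
    let ?e = "\<lambda>x. fst (E (x, \<zero>\<^bsub>?FV\<^esub>))" and ?r = "\<lambda>x. snd (E (x, \<zero>\<^bsub>?FV\<^esub>))"
    have Ex: "E (x, \<zero>\<^bsub>?FV\<^esub>) = (?e x, ?r x)" for x by simp
    note ec = f(4)[OF T_inclusion(5)[OF V]]
    have il: "lin A ?FV (restrict_scalars M ?TV) (\<lambda>w. (\<zero>\<^bsub>V\<^esub>, w))"
      using T_decompose(4)[OF TV.left_module_axioms V lin_id] .
    have zl: "lin A ?FV (restrict_scalars M ?TV) (\<lambda>w. \<zero>\<^bsub>?TV\<^esub>)"
      using lin_comp[OF _ il, of ?FV "\<lambda>_. \<zero>\<^bsub>?FV\<^esub>"] V by (auto simp: lin_def)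
    have "(\<forall>x\<in>carrier V. ?e x = \<zero>\<^bsub>V\<^esub>) \<or> (\<forall>x\<in>carrier V. ?e x = x)" using * T_idem[OF V E] by blast
    then show "(\<forall>z\<in>carrier ?TV. E z = \<zero>\<^bsub>?TV\<^esub>) \<or> (\<forall>z\<in>carrier ?TV. E z = z)"
    proof
      assume e: "\<forall>x\<in>carrier V. ?e x = \<zero>\<^bsub>V\<^esub>"
      have E0: "E (\<zero>\<^bsub>V\<^esub>, w) = \<zero>\<^bsub>?TV\<^esub>" if "w \<in> carrier ?FV" for w
        by (rule tensor_lin_ext[OF V RV d(4) zl _ that]) (simp add: f(3) e pure_tensor_zero[OF V] T_simps(2)[OF V])
      have z: "lin \<Lambda> ?TV ?TV (\<lambda>_. \<zero>\<^bsub>?TV\<^esub>)" by (rule linI) auto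
      have "E z = \<zero>\<^bsub>?TV\<^esub>" if "z \<in> carrier ?TV" for z
      proof (rule T_lin_ext[OF TV.left_module_axioms V El z _ that])
        fix x assume x: "x \<in> carrier V"
        \<comment> \<open>Applying \<open>E\<close> twice moves the value into the second summand
          and then kills it.\<close>
        have "E (x, \<zero>\<^bsub>?FV\<^esub>) = E (\<zero>\<^bsub>V\<^esub>, ?r x)"
          using EE[OF T_inclusion(5)[OF V x]] Ex[of x] e x by simp
        then show "E (x, \<zero>\<^bsub>?FV\<^esub>) = \<zero>\<^bsub>?TV\<^esub>" using E0 ec[OF x] by simp
      qed
      then show ?thesis by blast
    next
      assume e: "\<forall>x\<in>carrier V. ?e x = x"
      have E0: "E (\<zero>\<^bsub>V\<^esub>, w) = (\<zero>\<^bsub>V\<^esub>, w)" if "w \<in> carrier ?FV" for w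
        by (rule tensor_lin_ext[OF V RV d(4) il _ that]) (simp add: f(3) e)
      have "E z = z" if "z \<in> carrier ?TV" for z
      proof (rule T_lin_ext[OF TV.left_module_axioms V El lin_id _ that])
        fix x assume x: "x \<in> carrier V"
        have r: "?r x \<in> carrier ?FV" using ec[OF x] by simp
        have Ex': "E (x, \<zero>\<^bsub>?FV\<^esub>) = (x, ?r x)" using Ex[of x] e x by simp
        \<comment> \<open>Idempotence also gives \<open>E (x, ?r x) = (x, ?r x)\<close>; comparing
          the two shows that \<open>?r x\<close> equals its double, hence is zero.\<close>
        have "E (x, ?r x) = (x, ?r x) \<oplus>\<^bsub>?TV\<^esub> (\<zero>\<^bsub>V\<^esub>, ?r x)"
          using d(1)[OF x r] Ex' E0[OF r] by simp
        moreover have "E (x, ?r x) = (x, ?r x)" using EE[OF T_inclusion(5)[OF V x]] Ex' by simp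
        ultimately have "?r x \<oplus>\<^bsub>?FV\<^esub> ?r x = ?r x" using V by simp
        then have "?r x = \<zero>\<^bsub>?FV\<^esub>" using r FV.M.add.r_cancel_one' by metis
        then show "E (x, \<zero>\<^bsub>?FV\<^esub>) = (x, \<zero>\<^bsub>?FV\<^esub>)" using Ex' by simp
      qed
      then show ?thesis by blast
    qed
  qed
qed

text \<open>
  The summand of \<open>TX\<close> belonging to an idempotent \<open>E\<close> is isomorphic to \<open>T\<close> of the summand of \<open>X\<close>
  belonging to the idempotent that \<open>E\<close> induces on \<open>X = TX / M \<cdot> TX\<close>.
\<close>

lemma T_summand:
  assumes X: "left_module A X" and E: "idem \<Lambda> (T_functor A M X) E"
    and S: "S = (\<lambda>x. fst (E (x, \<zero>\<^bsub>tensor A M X\<^esub>))) ` carrier X"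
  shows "module_iso \<Lambda> (T_functor A M (X\<lparr>carrier := S\<rparr>)) ((T_functor A M X)\<lparr>carrier := E ` carrier (T_functor A M X)\<rparr>)"
proof -
  let ?FX = "tensor A M X" and ?TX = "T_functor A M X" and ?V = "X\<lparr>carrier := S\<rparr>"
  let ?FV = "tensor A M ?V" and ?TV = "T_functor A M ?V"
  let ?e = "\<lambda>x. fst (E (x, \<zero>\<^bsub>?FX\<^esub>))" and ?N = "E ` carrier ?TX"
  interpret X: left_module A X by (rule X)
  interpret FX: left_module A ?FX by (rule left_module_tensor[OF X])
  interpret TX: left_module \<Lambda> ?TX by (rule left_module_T[OF X])
  have El: "lin \<Lambda> ?TX ?TX E" and EE: "\<And>z. z \<in> carrier ?TX \<Longrightarrow> E (E z) = E z" using E by (auto simp: idem_def)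
  note f = T_fst[OF X X El] and d = T_decompose[OF TX.left_module_axioms X El]
  have e: "lin A X X ?e" "\<And>x. x \<in> carrier X \<Longrightarrow> ?e (?e x) = ?e x" using T_idem[OF X E] by (auto simp: idem_def)
  have Ssub: "submodule S A X" using X.idem_submodule[OF T_idem[OF X E]] S by simp
  have V: "left_module A ?V" by (rule X.left_module_submodule[OF Ssub])
  interpret V: left_module A ?V by (rule V)
  interpret FV: left_module A ?FV by (rule left_module_tensor[OF V])
  interpret TV: left_module \<Lambda> ?TV by (rule left_module_T[OF V])
  have SX: "x \<in> carrier X" if "x \<in> S" for x using X.submoduleD(1)[OF Ssub] that by blast
  have eS: "?e x = x" if x: "x \<in> S" for x
  proof -
    obtain y where "y \<in> carrier X" "x = ?e y" using x S by auto
    then show ?thesis using e(2) by simp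
  qed
  have eV: "?e x \<in> S" if "x \<in> carrier X" for x using S that by blast
  have inc: "lin A ?V X (\<lambda>x. x)" using SX by (auto simp: lin_def)
  have prj: "lin A X ?V ?e" using e(1) eV by (auto simp: lin_def)
  obtain i p where i: "lin \<Lambda> ?TV ?TX i" "\<And>x. x \<in> carrier ?V \<Longrightarrow> i (x, \<zero>\<^bsub>?FV\<^esub>) = (x, \<zero>\<^bsub>?FX\<^esub>)"
    and p: "lin \<Lambda> ?TX ?TV p" "\<And>z. z \<in> carrier ?TV \<Longrightarrow> p (i z) = z"
  proof -
    have "?e x = x" if "x \<in> carrier ?V" for x using that eS by simp
    then show thesis
    proof (rule T_map_idem[OF V X inc prj])
      fix i p assume "lin \<Lambda> ?TV ?TX i" "lin \<Lambda> ?TX ?TV p"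
        "\<And>x. x \<in> carrier ?V \<Longrightarrow> i (x, \<zero>\<^bsub>?FV\<^esub>) = (x, \<zero>\<^bsub>?FX\<^esub>)"
        "\<And>z. z \<in> carrier ?TV \<Longrightarrow> p (i z) = z"
      then show thesis using that by blast
    qed
  qed
  note fi = T_fst[OF V X i(1)] and di = T_decompose[OF TX.left_module_axioms V i(1)]
  have i_pure: "i (\<zero>\<^bsub>?V\<^esub>, pure_tensor A M ?V m x) = (\<zero>\<^bsub>X\<^esub>, pure_tensor A M X m x)" if "m \<in> carrier M" "x \<in> S" for m x
    using fi(3)[OF that(1), of x] i(2)[of x] that(2) by simp
  \<comment> \<open>The isomorphism is the inclusion of \<open>T\<close> of the summand followed by
    \<open>E\<close>. The inclusion itself need not land in the image of \<open>E\<close>, as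
    \<open>E\<close> can differ from \<open>T\<close> of the induced idempotent.\<close>
  let ?\<alpha> = "\<lambda>z. E (i z)"
  have \<alpha>: "lin \<Lambda> ?TV ?TX ?\<alpha>" by (rule lin_comp[OF i(1) El])
  note d\<alpha> = T_decompose[OF TX.left_module_axioms V \<alpha>]
  have \<alpha>N: "lin \<Lambda> ?TV (?TX\<lparr>carrier := ?N\<rparr>) ?\<alpha>" using \<alpha> linD(1)[OF i(1)] by (auto simp: lin_def)
  note RX = left_module_restrict_scalars[OF TX.left_module_axioms]
  \<comment> \<open>On the second summand \<open>E\<close> acts through the induced idempotent,
    which is the identity on \<open>S\<close>. Hence \<open>?\<alpha>\<close> agrees there with the
    injective \<open>i\<close>.\<close>
  have \<alpha>0: "?\<alpha> (\<zero>\<^bsub>?V\<^esub>, w) = i (\<zero>\<^bsub>?V\<^esub>, w)" if "w \<in> carrier ?FV" for w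
  proof (rule tensor_lin_ext[OF V RX d\<alpha>(4) di(4) _ that])
    fix m x assume m: "m \<in> carrier M" and "x \<in> carrier ?V"
    then have x: "x \<in> S" by simp
    show "?\<alpha> (\<zero>\<^bsub>?V\<^esub>, pure_tensor A M ?V m x) = i (\<zero>\<^bsub>?V\<^esub>, pure_tensor A M ?V m x)"
      using i_pure[OF m x] f(3)[OF m SX[OF x]] eS[OF x] by simp
  qed
  have "inj_on ?\<alpha> (carrier ?TV)"
    unfolding lin_inj_on[OF TV.left_module_axioms TX.left_module_axioms \<alpha>]
  proof (intro ballI impI)
    fix z assume z: "z \<in> carrier ?TV" and 0: "?\<alpha> z = \<zero>\<^bsub>?TX\<^esub>"
    obtain x w where xw: "z = (x, w)" "x \<in> S" "w \<in> carrier ?FV" using z V by (cases z) auto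
    have "fst (?\<alpha> z) = x"
      using T_fst(1)[OF V X \<alpha>, of x w] xw i(2)[of x] eS by simp
    then have x0: "x = \<zero>\<^bsub>?V\<^esub>" using 0 X by simp
    then have "i z = \<zero>\<^bsub>?TX\<^esub>" using \<alpha>0[OF xw(3)] 0 xw(1) by simp
    then show "z = \<zero>\<^bsub>?TV\<^esub>" using p(2)[OF z] lin_zero[OF TX.left_module_axioms TV.left_module_axioms p(1)] by simp
  qed
  moreover have "?\<alpha> ` carrier ?TV = ?N"
  proof
    show "?\<alpha> ` carrier ?TV \<subseteq> ?N" using linD(1)[OF i(1)] by blast
    have im: "submodule (?\<alpha> ` carrier ?TV) \<Lambda> ?TX"
      by (rule submodule_image[OF TV.left_module_axioms TX.left_module_axioms \<alpha> TV.submodule_carrier])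
    note im' = TX.submoduleD[OF im]
    have "submodule {z \<in> carrier ?TX. E z \<in> ?\<alpha> ` carrier ?TV} \<Lambda> ?TX"
      by (rule submodule_vimage[OF TX.left_module_axioms TX.left_module_axioms El im])
    then have sub: "submodule {z \<in> carrier ?TX. E z \<in> ?\<alpha> ` carrier ?TV} \<Lambda> ?TX" .
    note sub' = TX.submoduleD[OF sub]
    \<comment> \<open>At the pure tensor of \<open>m\<close> and \<open>x\<close> the value of
      \<open>E\<close> is the pure tensor of \<open>m\<close> and \<open>?e x\<close>, which comes
      from the summand.\<close>
    have F: "E (\<zero>\<^bsub>X\<^esub>, w) \<in> ?\<alpha> ` carrier ?TV" if w: "w \<in> carrier ?FX" for w
    proof -
      interpret RX: left_module A "restrict_scalars M ?TX" by (rule RX)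
      have "submodule (?\<alpha> ` carrier ?TV) A (restrict_scalars M ?TX)"
        by (rule RX.submoduleI) (use im' in auto)
      then have "submodule {w \<in> carrier ?FX. E (\<zero>\<^bsub>X\<^esub>, w) \<in> ?\<alpha> ` carrier ?TV} A ?FX"
        by (rule submodule_vimage[OF FX.left_module_axioms RX d(4)])
      moreover have "pure_tensor A M X m x \<in> {w \<in> carrier ?FX. E (\<zero>\<^bsub>X\<^esub>, w) \<in> ?\<alpha> ` carrier ?TV}"
        if "m \<in> carrier M" "x \<in> carrier X" for m x
      proof -
        have ex: "?e x \<in> S" by (rule eV[OF that(2)])
        have z: "(\<zero>\<^bsub>?V\<^esub>, pure_tensor A M ?V m (?e x)) \<in> carrier ?TV"
          using pure_tensor_closed[OF V that(1)] ex by (intro T_inclusion(6)[OF V]) simp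
        have "E (\<zero>\<^bsub>X\<^esub>, pure_tensor A M X m x) = ?\<alpha> (\<zero>\<^bsub>?V\<^esub>, pure_tensor A M ?V m (?e x))"
          using f(3)[OF that] f(3)[OF that(1) SX[OF ex]] i_pure[OF that(1) ex] eS[OF ex] by simp
        then show ?thesis using z pure_tensor_closed[OF X that] by blast
      qed
      ultimately have "{w \<in> carrier ?FX. E (\<zero>\<^bsub>X\<^esub>, w) \<in> ?\<alpha> ` carrier ?TV} = carrier ?FX"
        by (rule tensor_submodule[OF X])
      then show ?thesis using w by blast
    qed
    show "?N \<subseteq> ?\<alpha> ` carrier ?TV"
    proof
      fix n assume "n \<in> ?N"
      then obtain y where y: "y \<in> carrier ?TX" "n = E y" by auto
      obtain x w where xw: "n = (x, w)" by (cases n)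
      have xc: "x \<in> carrier X" "w \<in> carrier ?FX" using f(4)[OF y(1)] y(2) xw by (metis fst_conv snd_conv)+
      have En: "E (x, w) = (x, w)" using EE[OF y(1)] y(2) xw by simp
      then have "?e x = x" using f(1)[OF xc] by simp
      \<comment> \<open>An element fixed by \<open>E\<close> has its first component fixed by the
        induced idempotent. So both parts of its decomposition lie in the image of
        \<open>?\<alpha>\<close>.\<close>
      then have xS: "x \<in> S" using eV[OF xc(1)] by simp
      have "E (x, \<zero>\<^bsub>?FX\<^esub>) = ?\<alpha> (x, \<zero>\<^bsub>?FV\<^esub>)" using i(2) xS by simp
      moreover have "(x, \<zero>\<^bsub>?FV\<^esub>) \<in> carrier ?TV" using T_inclusion(5)[OF V] xS by simp
      ultimately have "E (x, \<zero>\<^bsub>?FX\<^esub>) \<in> ?\<alpha> ` carrier ?TV" by (metis image_eqI)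
      then have "E (x, \<zero>\<^bsub>?FX\<^esub>) \<oplus>\<^bsub>?TX\<^esub> E (\<zero>\<^bsub>X\<^esub>, w) \<in> ?\<alpha> ` carrier ?TV" using im'(3) F[OF xc(2)] by blast
      then show "n \<in> ?\<alpha> ` carrier ?TV" using d(1)[OF xc] En xw by simp
    qed
  qed
  ultimately have "bij_betw ?\<alpha> (carrier ?TV) ?N" by (simp add: bij_betw_def)
  then show ?thesis unfolding module_iso_iff[OF TV.left_module_axioms] using \<alpha>N by auto
qed

text \<open>A summand \<open>S\<close> of \<open>X\<close> is matched with a submodule of
  \<open>T X\<close> isomorphic to \<open>T\<close> of \<open>S\<close>. Indecomposability and
  isomorphism transfer in both directions, and \<open>T_summand\<close> shows that every class of
  summands of \<open>T X\<close> is reached.\<close>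

lemma num_indec_summands_T:
  assumes X: "left_module A X"
  shows "num_indec_summands \<Lambda> (T_functor A M X) = num_indec_summands A X"
proof -
  let ?FX = "tensor A M X" and ?TX = "T_functor A M X"
  interpret X: left_module A X by (rule X)
  interpret TX: left_module \<Lambda> ?TX by (rule left_module_T[OF X])
  have ex: "\<exists>N. (\<exists>E. idem \<Lambda> ?TX E \<and> E ` carrier ?TX = N) \<and>
      module_iso \<Lambda> (T_functor A M (X\<lparr>carrier := S\<rparr>)) (?TX\<lparr>carrier := N\<rparr>)"
    if S: "S \<in> indec_summands A X" for S
  proof -
    let ?V = "X\<lparr>carrier := S\<rparr>"
    obtain e where "idem A X e" "e ` carrier X = S" using S unfolding X.indec_summands_iff by blast
    then have e: "lin A X X e" "\<And>x. x \<in> carrier X \<Longrightarrow> e (e x) = e x" and eS: "e ` carrier X = S"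
      by (auto simp: idem_def)
    note V = X.indec_summands_left_module(2)[OF S]
    have inc: "lin A ?V X (\<lambda>x. x)" using X.submoduleD(1)[OF X.indec_summands_left_module(1)[OF S]] by (auto simp: lin_def)
    have prj: "lin A X ?V e" using e(1) eS by (auto simp: lin_def)
    have "e x = x" if "x \<in> carrier ?V" for x using that eS e(2) by auto
    then obtain i p where "lin \<Lambda> (T_functor A M ?V) ?TX i" "lin \<Lambda> ?TX (T_functor A M ?V) p"
      "\<And>z. z \<in> carrier (T_functor A M ?V) \<Longrightarrow> p (i z) = z"
      using T_map_idem[OF V X inc prj] by metis
    then show ?thesis using TX.retract_summand[OF left_module_T[OF V], of i p] by blast
  qed
  \<comment> \<open>\<open>T\<close> of \<open>S\<close> lives on another carrier type than
    \<open>T X\<close>, so a summand of \<open>T X\<close> isomorphic to it is chosen.\<close>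
  define \<Phi> where "\<Phi> S = (SOME N. (\<exists>E. idem \<Lambda> ?TX E \<and> E ` carrier ?TX = N) \<and>
      module_iso \<Lambda> (T_functor A M (X\<lparr>carrier := S\<rparr>)) (?TX\<lparr>carrier := N\<rparr>))" for S
  have \<Phi>: "\<exists>E. idem \<Lambda> ?TX E \<and> E ` carrier ?TX = \<Phi> S"
    "module_iso \<Lambda> (T_functor A M (X\<lparr>carrier := S\<rparr>)) (?TX\<lparr>carrier := \<Phi> S\<rparr>)"
    if "S \<in> indec_summands A X" for S
    using someI_ex[OF ex[OF that]] unfolding \<Phi>_def by blast+
  have \<Phi>m: "left_module \<Lambda> (?TX\<lparr>carrier := \<Phi> S\<rparr>)" if S: "S \<in> indec_summands A X" for S
  proof -
    obtain E where "idem \<Lambda> ?TX E" "E ` carrier ?TX = \<Phi> S" using \<Phi>(1)[OF S] by blast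
    then show ?thesis using TX.left_module_submodule[OF TX.idem_submodule, of E] by simp
  qed
  show ?thesis
  proof (rule num_indec_summands_eq[OF X TX.left_module_axioms, symmetric, of \<Phi>])
    fix S assume S: "S \<in> indec_summands A X"
    note V = X.indec_summands_left_module(2)[OF S]
    have "indecomposable A (X\<lparr>carrier := S\<rparr>)" using S unfolding X.indec_summands_iff by blast
    then have "indecomposable \<Lambda> (?TX\<lparr>carrier := \<Phi> S\<rparr>)"
      using indecomposable_iso[OF left_module_T[OF V] \<Phi>m[OF S] \<Phi>(2)[OF S]] indecomposable_T_iff[OF V] by blast
    then show "\<Phi> S \<in> indec_summands \<Lambda> ?TX" using \<Phi>(1)[OF S] unfolding TX.indec_summands_iff by blast
    fix S' assume S': "S' \<in> indec_summands A X"
    note V' = X.indec_summands_left_module(2)[OF S']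
    note T = left_module_T[OF V] left_module_T[OF V'] and n = \<Phi>m[OF S] \<Phi>m[OF S'] and i = \<Phi>(2)[OF S] \<Phi>(2)[OF S']
    have "module_iso \<Lambda> (T_functor A M (X\<lparr>carrier := S\<rparr>)) (T_functor A M (X\<lparr>carrier := S'\<rparr>)) \<longleftrightarrow>
        module_iso \<Lambda> (?TX\<lparr>carrier := \<Phi> S\<rparr>) (?TX\<lparr>carrier := \<Phi> S'\<rparr>)"
    proof
      assume "module_iso \<Lambda> (T_functor A M (X\<lparr>carrier := S\<rparr>)) (T_functor A M (X\<lparr>carrier := S'\<rparr>))"
      from module_iso_trans[OF T this i(2)]
      show "module_iso \<Lambda> (?TX\<lparr>carrier := \<Phi> S\<rparr>) (?TX\<lparr>carrier := \<Phi> S'\<rparr>)"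
        by (rule module_iso_trans[OF n(1) T(1) module_iso_sym[OF T(1) n(1) i(1)]])
    next
      assume "module_iso \<Lambda> (?TX\<lparr>carrier := \<Phi> S\<rparr>) (?TX\<lparr>carrier := \<Phi> S'\<rparr>)"
      from module_iso_trans[OF n this module_iso_sym[OF T(2) n(2) i(2)]]
      show "module_iso \<Lambda> (T_functor A M (X\<lparr>carrier := S\<rparr>)) (T_functor A M (X\<lparr>carrier := S'\<rparr>))"
        by (rule module_iso_trans[OF T(1) n(1) i(1)])
    qed
    then show "module_iso A (X\<lparr>carrier := S\<rparr>) (X\<lparr>carrier := S'\<rparr>) \<longleftrightarrow>
        module_iso \<Lambda> (?TX\<lparr>carrier := \<Phi> S\<rparr>) (?TX\<lparr>carrier := \<Phi> S'\<rparr>)"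
      using module_iso_T_iff[OF V V'] by simp
  next
    fix N assume N: "N \<in> indec_summands \<Lambda> ?TX"
    note Nm = TX.indec_summands_left_module[OF N]
    obtain E where E: "idem \<Lambda> ?TX E" "E ` carrier ?TX = N" and ind: "indecomposable \<Lambda> (?TX\<lparr>carrier := N\<rparr>)"
      using N unfolding TX.indec_summands_iff by blast
    let ?e = "\<lambda>x. fst (E (x, \<zero>\<^bsub>?FX\<^esub>))"
    let ?S = "?e ` carrier X"
    have e: "idem A X ?e" by (rule T_idem[OF X E(1)])
    have V: "left_module A (X\<lparr>carrier := ?S\<rparr>)" by (rule X.left_module_submodule[OF X.idem_submodule[OF e]])
    have iso: "module_iso \<Lambda> (T_functor A M (X\<lparr>carrier := ?S\<rparr>)) (?TX\<lparr>carrier := N\<rparr>)"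
      using T_summand[OF X E(1) refl] E(2) by simp
    have "indecomposable A (X\<lparr>carrier := ?S\<rparr>)"
      using indecomposable_iso[OF Nm(2) left_module_T[OF V] module_iso_sym[OF left_module_T[OF V] Nm(2) iso] ind]
        indecomposable_T_iff[OF V] by blast
    then have S: "?S \<in> indec_summands A X" using e unfolding X.indec_summands_iff by blast
    have "module_iso \<Lambda> (?TX\<lparr>carrier := \<Phi> ?S\<rparr>) (?TX\<lparr>carrier := N\<rparr>)"
      by (rule module_iso_trans[OF \<Phi>m[OF S] left_module_T[OF V]
            module_iso_sym[OF left_module_T[OF V] \<Phi>m[OF S] \<Phi>(2)[OF S]] iso])
    then show "\<exists>S\<in>indec_summands A X. module_iso \<Lambda> (?TX\<lparr>carrier := \<Phi> S\<rparr>) (?TX\<lparr>carrier := N\<rparr>)" using S by blast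
  qed
qed

text \<open>\<open>M \<otimes> A\<close> is \<open>M\<close>, by tensoring with 1. The map
  \<open>h\<close> comes from the adjunction, and \<open>?k\<close> is written down as its
  inverse.\<close>

lemma regular_iso_T: "module_iso \<Lambda> (T_functor A M (regular_module A)) (regular_module \<Lambda>)"
proof -
  let ?R = "regular_module A" and ?L = "regular_module \<Lambda>"
  let ?FR = "tensor A M ?R" and ?TR = "T_functor A M ?R"
  have R: "left_module A ?R" by (rule left_module_regular[OF A.ring_axioms])
  interpret R: left_module A ?R by (rule R)
  interpret FR: left_module A ?FR by (rule left_module_tensor[OF R])
  interpret TR: left_module \<Lambda> ?TR by (rule left_module_T[OF R])
  interpret L: left_module \<Lambda> ?L by (rule regular_trivial_extension)
  have "lin A ?R (restrict_scalars M ?L) (\<lambda>a. (a, \<zero>\<^bsub>M\<^esub>))" by (rule linI) (auto simp: rsmult_zero)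
  then obtain h where h: "lin \<Lambda> ?TR ?L h" "\<forall>a\<in>carrier ?R. h (a, \<zero>\<^bsub>?FR\<^esub>) = (a, \<zero>\<^bsub>M\<^esub>)"
    using T_extend[OF regular_trivial_extension R] by blast
  note d = T_decompose[OF regular_trivial_extension R h(1)]
  let ?k = "\<lambda>(a, m). (a, pure_tensor A M ?R m \<one>\<^bsub>A\<^esub>)"
  have p1: "pure_tensor A M ?R m \<one>\<^bsub>A\<^esub> \<in> carrier ?FR" if "m \<in> carrier M" for m
    using pure_tensor_closed[OF R that, of "\<one>\<^bsub>A\<^esub>"] by simp
  have bal: "pure_tensor A M ?R (rsmult M n a) \<one>\<^bsub>A\<^esub> = pure_tensor A M ?R n a" if "n \<in> carrier M" "a \<in> carrier A" for n a
    using pure_tensor_balanced[OF R that(1,2), of "\<one>\<^bsub>A\<^esub>"] that by simp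
  have k: "lin \<Lambda> ?L ?TR ?k"
  proof (rule linI)
    show "?k x \<in> carrier ?TR" if "x \<in> carrier ?L" for x using that p1 R by auto
    show "?k (x \<oplus>\<^bsub>?L\<^esub> y) = ?k x \<oplus>\<^bsub>?TR\<^esub> ?k y" if "x \<in> carrier ?L" "y \<in> carrier ?L" for x y
      using that R pure_tensor_add_left[OF R, of _ _ "\<one>\<^bsub>A\<^esub>"] by auto
    show "?k (b \<odot>\<^bsub>?L\<^esub> x) = b \<odot>\<^bsub>?TR\<^esub> ?k x" if "b \<in> carrier \<Lambda>" "x \<in> carrier ?L" for b x
      using that R pure_tensor_add_left[OF R, of _ _ "\<one>\<^bsub>A\<^esub>"] tensor_smult_pure[OF R, of _ _ "\<one>\<^bsub>A\<^esub>"] p1 bal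
      by (auto simp: rsmult_closed)
  qed
  have "?k (h z) = z" if "z \<in> carrier ?TR" for z
  proof (rule T_lin_ext[OF TR.left_module_axioms R lin_comp[OF h(1) k] lin_id _ that])
    show "?k (h (a, \<zero>\<^bsub>?FR\<^esub>)) = (a, \<zero>\<^bsub>?FR\<^esub>)" if "a \<in> carrier ?R" for a
      using h(2) that pure_tensor_zero(2)[OF R, of "\<one>\<^bsub>A\<^esub>"] by simp
  qed
  moreover have "h (?k x) = x" if xL: "x \<in> carrier ?L" for x
  proof -
    obtain a m where x: "x = (a, m)" "a \<in> carrier A" "m \<in> carrier M" using xL by (cases x) auto
    have "h (\<zero>\<^bsub>?R\<^esub>, pure_tensor A M ?R m \<one>\<^bsub>A\<^esub>) = (\<zero>\<^bsub>A\<^esub>, m)"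
      using d(2)[OF x(3), of "\<one>\<^bsub>A\<^esub>"] h(2) x(3) by (simp add: rsmult_one)
    then show ?thesis using d(1)[of a "pure_tensor A M ?R m \<one>\<^bsub>A\<^esub>"] h(2) p1 x by simp
  qed
  ultimately have "bij_betw h (carrier ?TR) (carrier ?L)"
    using linD(1)[OF h(1)] linD(1)[OF k] by (intro bij_betw_byWitness[of _ ?k]) blast+
  then show ?thesis using h(1) module_iso_iff[OF TR.left_module_axioms] by blast
qed

lemma num_indec_summands_regular:
  "num_indec_summands \<Lambda> (regular_module \<Lambda>) = num_indec_summands A (regular_module A)"
  using num_indec_summands_iso[OF left_module_T regular_trivial_extension regular_iso_T]
    num_indec_summands_T left_module_regular[OF A.ring_axioms] by metis

text \<open>Submodules, decompositions and isomorphisms of \<open>Z X\<close> are those of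
  \<open>X\<close>, so the sets of summands and the relations on them coincide outright.\<close>

lemma num_indec_summands_Z:
  fixes X :: "('a, 'y, 'z) module_scheme"
  assumes X: "left_module A X"
  shows "num_indec_summands \<Lambda> (Z_functor A M X) = num_indec_summands A X"
proof -
  interpret X: left_module A X by (rule X)
  \<comment> \<open>\<open>Z\<close> commutes with replacing the carrier, so a submodule of
    \<open>Z X\<close> is \<open>Z\<close> of a submodule of \<open>X\<close> as a record.\<close>
  have sub: "(Z_functor A M X)\<lparr>carrier := S\<rparr> = Z_functor A M (X\<lparr>carrier := S\<rparr>)" for S
    by (simp add: Z_functor_def pair_module_def mk_module_def)
  have dd: "direct_decomposition \<Lambda> (Z_functor A M V) S S' \<longleftrightarrow> direct_decomposition A V S S'"
    if "left_module A V" for V :: "('a, 'y, 'z) module_scheme" and S S'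
    using submodule_Z_iff[OF that] Z_simps[OF that] by (simp add: direct_decomposition_def set_add_def')
  have ind: "indecomposable \<Lambda> (Z_functor A M V) \<longleftrightarrow> indecomposable A V"
    if "left_module A V" for V :: "('a, 'y, 'z) module_scheme"
    using Z_simps[OF that] by (simp add: indecomposable_def dd[OF that])
  have iso: "module_iso \<Lambda> (Z_functor A M V) (Z_functor A M W) \<longleftrightarrow> module_iso A V W"
    if V: "left_module A V" and W: "left_module A W" for V W :: "('a, 'y, 'z) module_scheme"
  proof -
    have "lin \<Lambda> (Z_functor A M V) (Z_functor A M W) h \<longleftrightarrow> lin A V W h" for h
      using Z_simps[OF V] Z_simps[OF W] Z_smult[OF V] Z_smult[OF W] M.zero_closed
      by (fastforce simp: lin_def)
    then show ?thesis using Z_simps[OF V] Z_simps[OF W]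
      by (simp add: module_iso_iff[OF V] module_iso_iff[OF left_module_Z[OF V]])
  qed
  have eq: "indec_summands \<Lambda> (Z_functor A M X) = indec_summands A X"
    unfolding indec_summands_def sub dd[OF X]
    using ind X.left_module_submodule by (auto simp: direct_decomposition_def)
  have "{(S, S'). S \<in> indec_summands A X \<and> S' \<in> indec_summands A X \<and>
      module_iso \<Lambda> (Z_functor A M (X\<lparr>carrier := S\<rparr>)) (Z_functor A M (X\<lparr>carrier := S'\<rparr>))} =
    {(S, S'). S \<in> indec_summands A X \<and> S' \<in> indec_summands A X \<and>
      module_iso A (X\<lparr>carrier := S\<rparr>) (X\<lparr>carrier := S'\<rparr>)}"
    using iso X.indec_summands_left_module(2) by blast
  then show ?thesis unfolding num_indec_summands_def eq sub by simp
qed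

end

theorem theorem1p1:
  fixes K :: "'k ring"
    and A :: "('k, 'a) module"
    and M :: "('a, 'm) bimodule"
    and X :: "('a, 'x) module"
    and P :: "('a, 'p) module"
  assumes "fd_algebra K A"
    and "fg_bimodule K A M"
    and "fg_module A X"
    and "fg_module A P"
  shows "(support_tau_tilting_pair K (trivial_extension A M) (T_functor A M X) (T_functor A M P) \<longleftrightarrow>
            support_tau_tilting_pair K A X P \<and>
            hom_zero A P (tensor A M X) \<and>
            hom_zero A (tensor A M X) (AR_translate K A X)) \<and>
         (\<forall>(Q :: ('a, 'q) module) \<pi>. projective_cover A Q \<pi> (tensor A M X) \<longrightarrow>
            (support_tau_tilting_pair K (trivial_extension A M) (Z_functor A M X) (T_functor A M P) \<longleftrightarrow>
              support_tau_tilting_pair K A X P \<and> hom_zero A Q X))"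
proof -
  interpret bimodule K A M using assms(2) by (simp add: fg_bimodule_def)
  have X: "left_module A X" and P: "left_module A P" using assms(3,4) by (simp_all add: fg_module_def)
  note num = num_indec_summands_T[OF X] num_indec_summands_T[OF P] num_indec_summands_Z[OF X]
    num_indec_summands_regular
  note defs = support_tau_tilting_pair_def tau_rigid_pair_def tau_rigid_def
  show ?thesis
  proof (intro conjI allI impI)
    show "support_tau_tilting_pair K \<Lambda> (T_functor A M X) (T_functor A M P) \<longleftrightarrow>
      support_tau_tilting_pair K A X P \<and> hom_zero A P (tensor A M X) \<and>
      hom_zero A (tensor A M X) (AR_translate K A X)"
      unfolding defs num fg_projective_T_iff[OF P] hom_zero_T_T[OF X P] tau_zero_T[OF assms(3)]
      using fg_module_T[OF assms(3)] assms(3) by blast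
    fix Q :: "('a, 'q) module" and \<pi>
    assume "projective_cover A Q \<pi> (tensor A M X)"
    \<comment> \<open>Only the essential epimorphism is kept of the cover; this is the form in which
      it enters the presentation of \<open>Z X\<close>.\<close>
    then have Q: "fg_projective A Q" "essential_epi A Q \<pi> (tensor A M X)"
      by (simp_all add: projective_cover_iff[OF left_module_tensor[OF X]])
    show "support_tau_tilting_pair K \<Lambda> (Z_functor A M X) (T_functor A M P) \<longleftrightarrow>
      support_tau_tilting_pair K A X P \<and> hom_zero A Q X"
      unfolding defs num fg_projective_T_iff[OF P] hom_zero_T_Z[OF X P] tau_zero_Z[OF assms(3) Q]
      using fg_module_Z[OF assms(3)] assms(3) by blast
  qed
qed

end
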